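(* Let $\mu\in\mathbb R$, $\phi:\mathbb R_+\to\mathbb R$ and $h:\mathbb R\to\mathbb R_+$ satisfy: 1. $\phi$ is locally bounded, $\|\phi\|_1:=\int_0^\infty|\phi(t)|dt<+\infty$ and $m:=\int_0^\infty t|\phi(t)|dt<\infty$; 2. $h$ is positive and $\alpha$-Lipschitz, with $\alpha\|\phi\|_1<1$. Let $\lambda$ be the intensity of the non-linear Hawkes process $H$ with empty history and $\lambda^\infty$ the intensity of the stationary Hawkes process, both with parameters $(\mu,h,\phi)$. Set $$F^T:=\frac{H_T-\int_0^T\lambda_udu}{\sqrt T},\qquad T>0,$$ and let $G\sim\mathcal N(0,\sigma^2)$ with $\sigma^2=\mathbb E[\lambda^\infty_0]$. Then there exists $C>0$ such that for any $T>0$, $$d_W(F^T,G)\le\frac{C}{\sqrt T}.$$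
   Context: $\mathbb R_+=[0,\infty)$. $N$ is a Poisson random measure on $\mathbb R\times\mathbb R_+$ with intensity the Lebesgue measure $dt\,d\theta$, and $\mathbb F^N$ its natural filtration, $\mathcal F^N_t=\sigma(N(\mathcal T\times B):\mathcal T\in\mathcal B((-\infty,t]),B\in\mathcal B(\mathbb R_+))$. Hawkes process with empty history: $\lambda$ is the unique $\mathbb F^N$-predictable solution of $$\lambda_t=h\Big(\mu+\iint_{(0,t)\times\mathbb R_+}\phi(t-s)\mathbf 1_{\{\theta\le\lambda_s\}}N(ds,d\theta)\Big),\ t\ge0,\qquad H_t=\iint_{(0,t]\times\mathbb R_+}\mathbf 1_{\{\theta\le\lambda_s\}}N(ds,d\theta).$$ Stationary Hawkes process: $\lambda^\infty$ is the unique (stationary, finite mean) $\mathbb F^N$-predictable solution of $$\lambda^\infty_t=h\Big(\mu+\iint_{(-\infty,t)\times\mathbb R_+}\phi(t-s)\mathbf 1_{\{\theta\le\lambda^\infty_s\}}N(ds,d\theta)\Big),\ t\in\mathbb R.$$ (Existence and uniqueness hold under the stated assumptions on $\phi,h$, by Brémaud–Massoulié.) Wasserstein distance: $d_W(F,G)=\sup_u|\mathbb E[u(F)]-\mathbb E[u(G)]|$ over $1$-Lipschitz $u:\mathbb R\to\mathbb R$. *)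

theory Defs
  imports "HOL-Probability.Probability"
begin

text \<open>
  Poisson random measures, as locally finite random point measures. The law of \<open>N(A)\<close> is
  spelled out instead of using \<open>poisson_pmf\<close>, which excludes the rate \<open>0\<close>.
\<close>

definition poisson_random_measure ::
  "'w measure \<Rightarrow> ('x::metric_space) measure \<Rightarrow> ('w \<Rightarrow> 'x measure) \<Rightarrow> bool" where
  "poisson_random_measure M \<Lambda> N \<longleftrightarrow>
     (\<forall>\<omega>\<in>space M. sets (N \<omega>) = sets \<Lambda>) \<and>
     (\<forall>\<omega>\<in>space M. \<forall>A\<in>sets \<Lambda>. emeasure (N \<omega>) A \<in> range ennreal_of_enat) \<and>
     (\<forall>\<omega>\<in>space M. \<forall>A\<in>sets \<Lambda>. bounded A \<longrightarrow> emeasure (N \<omega>) A < \<infinity>) \<and>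
     (\<forall>A\<in>sets \<Lambda>. (\<lambda>\<omega>. emeasure (N \<omega>) A) \<in> borel_measurable M) \<and>
     (\<forall>A\<in>sets \<Lambda>. emeasure \<Lambda> A < \<infinity> \<longrightarrow>
        (\<forall>k::nat. measure M {\<omega>\<in>space M. emeasure (N \<omega>) A = of_nat k} =
           measure \<Lambda> A ^ k / fact k * exp (- measure \<Lambda> A))) \<and>
     (\<forall>A\<in>sets \<Lambda>. emeasure \<Lambda> A = \<infinity> \<longrightarrow> (AE \<omega> in M. emeasure (N \<omega>) A = \<infinity>)) \<and>
     (\<forall>(I::nat set) A. finite I \<longrightarrow> A ` I \<subseteq> sets \<Lambda> \<longrightarrow> disjoint_family_on A I \<longrightarrow>
        prob_space.indep_vars M (\<lambda>_. borel) (\<lambda>i \<omega>. emeasure (N \<omega>) (A i)) I)"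

definition half_plane_lebesgue :: "(real \<times> real) measure" where
  "half_plane_lebesgue = restrict_space lborel (UNIV \<times> {0..})"

definition natural_filtration ::
  "'w measure \<Rightarrow> ('w \<Rightarrow> (real \<times> real) measure) \<Rightarrow> real \<Rightarrow> 'w measure" where
  "natural_filtration M N t = sigma (space M)
     {(\<lambda>\<omega>. emeasure (N \<omega>) (S \<times> B)) -` D \<inter> space M | S B D.
        S \<in> sets borel \<and> S \<subseteq> {..t} \<and> B \<in> sets borel \<and> B \<subseteq> {0..} \<and> D \<in> sets borel}"

text \<open>
  The predictable sigma-algebra on \<open>I \<times> \<Omega>\<close>, for a time interval \<open>I\<close>. The second family of
  generators is only there when \<open>I\<close> has a least element, e.g. \<open>I = {0..}\<close>.
\<close>

definition predictable_sigma ::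
  "real set \<Rightarrow> 'w set \<Rightarrow> (real \<Rightarrow> 'w measure) \<Rightarrow> (real \<times> 'w) measure" where
  "predictable_sigma I \<Omega> F = sigma (I \<times> \<Omega>)
     ({({s<..t} \<inter> I) \<times> A | s t A. s \<in> I \<and> t \<in> I \<and> s \<le> t \<and> A \<in> sets (F s)} \<union>
      {{s} \<times> A | s A. s \<in> I \<and> (\<forall>t\<in>I. s \<le> t) \<and> A \<in> sets (F s)})"

definition predictable_on ::
  "real set \<Rightarrow> 'w measure \<Rightarrow> ('w \<Rightarrow> (real \<times> real) measure) \<Rightarrow> (real \<Rightarrow> 'w \<Rightarrow> real) \<Rightarrow> bool" where
  "predictable_on I M N X \<longleftrightarrow>
     (\<lambda>(t, \<omega>). X t \<omega>) \<in> borel_measurable (predictable_sigma I (space M) (natural_filtration M N))"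

text \<open>The integral of \<open>f(s) 1{\<theta> \<le> lam(s)}\<close> against \<open>N(ds, d\<theta>)\<close> over \<open>S \<times> {0..}\<close>.\<close>

definition thinned_integral ::
  "('w \<Rightarrow> (real \<times> real) measure) \<Rightarrow> (real \<Rightarrow> 'w \<Rightarrow> real) \<Rightarrow> real set \<Rightarrow> (real \<Rightarrow> real) \<Rightarrow> 'w \<Rightarrow> real"
  where
  "thinned_integral N lam S f \<omega> =
     (LINT (s, \<theta>)|N \<omega>. indicator S s * (f s * indicator {..lam s \<omega>} \<theta>))"

text \<open>
  The equations below hold almost surely for each fixed \<open>t\<close>. In the empty-history case, almost
  sure local integrability of \<open>lam\<close> (non-explosion of the counting process) is part of being a
  solution; in the stationary case the finite mean plays that role. In both cases, if \<open>\<phi>\<close> is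
  locally bounded and integrable, the integrals against \<open>N\<close> exist almost surely.
\<close>

definition empty_history_hawkes_intensity ::
  "'w measure \<Rightarrow> ('w \<Rightarrow> (real \<times> real) measure) \<Rightarrow> real \<Rightarrow> (real \<Rightarrow> real) \<Rightarrow> (real \<Rightarrow> real) \<Rightarrow>
     (real \<Rightarrow> 'w \<Rightarrow> real) \<Rightarrow> bool" where
  "empty_history_hawkes_intensity M N \<mu> h \<phi> lam \<longleftrightarrow>
     predictable_on {0..} M N lam \<and>
     (\<forall>T\<ge>0. AE \<omega> in M. set_integrable lborel {0..T} (\<lambda>u. lam u \<omega>)) \<and>
     (\<forall>t\<ge>0. AE \<omega> in M.
        lam t \<omega> = h (\<mu> + thinned_integral N lam {0<..<t} (\<lambda>s. \<phi> (t - s)) \<omega>))"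

definition hawkes_process ::
  "('w \<Rightarrow> (real \<times> real) measure) \<Rightarrow> (real \<Rightarrow> 'w \<Rightarrow> real) \<Rightarrow> real \<Rightarrow> 'w \<Rightarrow> real" where
  "hawkes_process N lam t \<omega> = thinned_integral N lam {0<..t} (\<lambda>_. 1) \<omega>"

definition strictly_stationary :: "'w measure \<Rightarrow> (real \<Rightarrow> 'w \<Rightarrow> real) \<Rightarrow> bool" where
  "strictly_stationary M X \<longleftrightarrow>
     (\<forall>J u. finite J \<longrightarrow>
        distr M (Pi\<^sub>M J (\<lambda>_. borel)) (\<lambda>\<omega>. \<lambda>t\<in>J. X (t + u) \<omega>) =
        distr M (Pi\<^sub>M J (\<lambda>_. borel)) (\<lambda>\<omega>. \<lambda>t\<in>J. X t \<omega>))"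

definition stationary_hawkes_intensity ::
  "'w measure \<Rightarrow> ('w \<Rightarrow> (real \<times> real) measure) \<Rightarrow> real \<Rightarrow> (real \<Rightarrow> real) \<Rightarrow> (real \<Rightarrow> real) \<Rightarrow>
     (real \<Rightarrow> 'w \<Rightarrow> real) \<Rightarrow> bool" where
  "stationary_hawkes_intensity M N \<mu> h \<phi> lam \<longleftrightarrow>
     predictable_on UNIV M N lam \<and>
     strictly_stationary M lam \<and>
     (\<forall>t. integrable M (lam t)) \<and>
     (\<forall>t. AE \<omega> in M.
        lam t \<omega> = h (\<mu> + thinned_integral N lam {..<t} (\<lambda>s. \<phi> (t - s)) \<omega>))"

definition normalized_martingale ::
  "('w \<Rightarrow> (real \<times> real) measure) \<Rightarrow> (real \<Rightarrow> 'w \<Rightarrow> real) \<Rightarrow> real \<Rightarrow> 'w \<Rightarrow> real" where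
  "normalized_martingale N lam T \<omega> =
     (hawkes_process N lam T \<omega> - (LINT u:{0..T}|lborel. lam u \<omega>)) / sqrt T"

text \<open>The normal law with mean \<open>m\<close> and variance \<open>v \<ge> 0\<close>, a point mass if \<open>v = 0\<close>.\<close>

definition normal_law :: "real \<Rightarrow> real \<Rightarrow> real measure" where
  "normal_law m v =
     (if v = 0 then return borel m else density lborel (normal_density m (sqrt v)))"

text \<open>
  The convention that the integral of a non-integrable function is \<open>0\<close> is harmless here: if only
  one of the two variables is integrable, the functions \<open>u(x) = x + c\<close> make the supremum infinite.
\<close>

definition wasserstein_dist ::
  "'a measure \<Rightarrow> ('a \<Rightarrow> real) \<Rightarrow> 'b measure \<Rightarrow> ('b \<Rightarrow> real) \<Rightarrow> ennreal" where
  "wasserstein_dist M X P Y =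
     (SUP u\<in>{u :: real \<Rightarrow> real. 1-lipschitz_on UNIV u}.
        ennreal \<bar>(LINT \<omega>|M. u (X \<omega>)) - (LINT \<omega>|P. u (Y \<omega>))\<bar>)"

end

(*
  Read on the space of point configurations, the intensity is a functional that a point added at
  time s changes only after s.  For a field Y of this kind, Mecke's formula gives
  E[k R] = E[integral of Y(x) (k(. + x) - k) dx], where R is the compensated integral of Y.
  Applied to k = f(F) and the accepted points, with a Taylor expansion of f, this replaces
  E[F f(F)] by E[f'(F) A / T], A being the integrated intensity on [0, T].  The error is
  O(1 / sqrt T) because, as alpha |phi|_1 < 1, an additional point has a total expected influence
  on later intensities that is bounded, even conditionally on its past; the remaining cross term
  is treated by a second application of the same formula.  A Poincare inequality gives
  Var A = O(T), and the first moment of phi bounds E|A - integral of the stationary intensity|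
  uniformly in T, so A / T may be replaced by sigma^2 in Stein's equation.

  To have bounded fields throughout, the argument runs on Picard iterates capped at a level b,
  with constants that depend neither on b nor on the number of iterations; these iterates
  approximate the intensity in L^1.
*)

theory Submission
  imports Defs
begin

section \<open>Point configurations\<close>

text \<open>The given probability space carries no operation of adding a point. The argument is
  therefore transported to the law of the Poisson measure on configurations, and predictability
  becomes a property that can be stated there: invariance under points added at or after the present
  time. Even the isometry of compensated integrals then comes out of Mecke's formula.

  The obstacle is the first-order Taylor term. A point at \<open>x\<close> moves \<open>F\<close> by
  its own jump and by the compensated effect of the later points that it creates or destroys. Both
  parts have the same order, so an absolute bound of the second one, summed over order T accepted
  points, leaves an error that does not vanish. It is however centred given the past of
  \<open>x\<close>: the covariance formula, applied to it once more, replaces f'(F) by an increment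
  of f'(F) and so gains the missing factor 1 / sqrt T.

  First moments of the influence control its second moments because acceptance is a 0-1 variable:
  squares of acceptance indicators and of their differences are again first-order quantities.
  Approximation of the intensity in \<open>L^1\<close> is enough because the test functions are
  Lipschitz.\<close>

definition configs :: "('a::euclidean_space) measure set" where
  "configs = {nu. sets nu = sets borel \<and>
     (\<forall>A\<in>sets borel. bounded A \<longrightarrow> (\<exists>k::nat. emeasure nu A = of_nat k))}"

text \<open>A configuration is an integer-valued measure rather than a set of points, so a place may
  be occupied twice and a point can be added without a case distinction. The counts of bounded sets
  have countably many values, which is why the events of one fixed count suffice as
  generators.\<close>

definition confs :: "('a::euclidean_space) measure measure" where
  "confs = sigma configs
     {{nu\<in>configs. emeasure nu A = of_nat k} | A (k::nat). A \<in> sets borel \<and> bounded A}"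

lemma space_confs [simp]: "space confs = configs"
  unfolding confs_def by (rule space_measure_of) auto

lemma sets_configs [simp]: "nu \<in> configs \<Longrightarrow> sets nu = sets borel"
  by (simp add: configs_def)

lemma space_configs [simp]: "nu \<in> configs \<Longrightarrow> space nu = UNIV"
  using sets_eq_imp_space_eq[of nu borel] by simp

lemma configs_count:
  assumes "nu \<in> configs" "A \<in> sets borel" "bounded A"
  obtains k :: nat where "emeasure nu A = of_nat k"
  using assms unfolding configs_def by blast

lemma configs_finite: "nu \<in> configs \<Longrightarrow> A \<in> sets borel \<Longrightarrow> bounded A \<Longrightarrow> emeasure nu A < \<infinity>"
  by (erule configs_count[of nu A]) (auto simp: of_nat_less_top)

lemma measurable_cball [measurable]: "cball (a::'a::metric_space) r \<in> sets borel"
  by simp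

lemma UN_cball_nat: "(\<Union>n. cball (0::'a::real_normed_vector) (real n)) = UNIV"
proof -
  have "\<exists>n. norm x \<le> real n" for x :: 'a
    by (rule real_arch_simple)
  then show ?thesis by auto
qed

lemma incseq_cball_nat: "incseq (\<lambda>n. cball (0::'a::real_normed_vector) (real n))"
  by (auto simp: incseq_def)

lemma emeasure_SUP_cball:
  fixes nu :: "('a::euclidean_space) measure"
  assumes "sets nu = sets borel" "A \<in> sets borel"
  shows "emeasure nu A = (SUP n. emeasure nu (A \<inter> cball 0 (real n)))"
proof -
  have "(SUP n. emeasure nu (A \<inter> cball 0 (real n))) = emeasure nu (\<Union>n. A \<inter> cball 0 (real n))"
  proof (rule SUP_emeasure_incseq)
    show "range (\<lambda>n. A \<inter> cball 0 (real n)) \<subseteq> sets nu"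
      using assms by (intro image_subsetI) simp
    show "incseq (\<lambda>n. A \<inter> cball 0 (real n))"
      using incseq_cball_nat by (fastforce simp: incseq_def)
  qed
  also have "(\<Union>n. A \<inter> cball 0 (real n)) = A"
    using UN_cball_nat by blast
  finally show ?thesis ..
qed

lemma measurable_count_bounded:
  assumes "A \<in> sets borel" "bounded A"
  shows "(\<lambda>nu. emeasure nu A) \<in> borel_measurable confs"
proof (rule measurableI)
  fix D :: "ennreal set" assume "D \<in> sets borel"
  have "(\<lambda>nu. emeasure nu A) -` D \<inter> space confs
      = (\<Union>k\<in>{k::nat. of_nat k \<in> D}. {nu\<in>configs. emeasure nu A = of_nat k})"
  proof (intro set_eqI iffI)
    fix nu assume "nu \<in> (\<lambda>nu. emeasure nu A) -` D \<inter> space confs"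
    then have nu: "nu \<in> configs" "emeasure nu A \<in> D" by auto
    obtain k :: nat where "emeasure nu A = of_nat k"
      using configs_count[OF nu(1) assms] by blast
    with nu show "nu \<in> (\<Union>k\<in>{k::nat. of_nat k \<in> D}. {nu\<in>configs. emeasure nu A = of_nat k})" by auto
  qed auto
  also have "... \<in> sets confs"
    unfolding confs_def by (rule sets.countable_UN'') (use assms in \<open>auto intro!: sigma_sets.Basic\<close>)
  finally show "(\<lambda>nu. emeasure nu A) -` D \<inter> space confs \<in> sets confs" .
qed simp

lemma measurable_count [measurable]:
  assumes [measurable]: "A \<in> sets borel"
  shows "(\<lambda>nu. emeasure nu A) \<in> borel_measurable confs"
proof -
  have "(\<lambda>nu. SUP n. emeasure nu (A \<inter> cball 0 (real n))) \<in> borel_measurable confs"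
    by (intro borel_measurable_SUP measurable_count_bounded) auto
  then show ?thesis
    by (rule measurable_cong[THEN iffD1, rotated]) (auto simp: emeasure_SUP_cball[of _ A])
qed

lemma measurable_confsI:
  fixes f :: "'z \<Rightarrow> ('a::euclidean_space) measure"
  assumes "\<And>z. z \<in> space Z \<Longrightarrow> f z \<in> configs"
    and "\<And>A. A \<in> sets borel \<Longrightarrow> bounded A \<Longrightarrow> (\<lambda>z. emeasure (f z) A) \<in> borel_measurable Z"
  shows "f \<in> measurable Z confs"
  unfolding confs_def
proof (rule measurable_measure_of)
  show "f \<in> space Z \<rightarrow> configs" using assms(1) by auto
  fix y :: "'a measure set"
  assume "y \<in> {{nu\<in>configs. emeasure nu A = of_nat k} | A (k::nat). A \<in> sets borel \<and> bounded A}"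
  then obtain A and k :: nat where y: "y = {nu\<in>configs. emeasure nu A = of_nat k}"
    and A: "A \<in> sets borel" "bounded A" by auto
  have "f -` y \<inter> space Z = (\<lambda>z. emeasure (f z) A) -` {of_nat k} \<inter> space Z"
    using assms(1) by (auto simp: y)
  also have "... \<in> sets Z"
    using assms(2)[OF A] by (rule measurable_sets) auto
  finally show "f -` y \<inter> space Z \<in> sets Z" .
qed auto

section \<open>Measurability of integrals against a random configuration\<close>

lemma nn_integral_SUP_cball:
  fixes nu :: "('a::euclidean_space) measure"
  assumes "sets nu = sets borel" "g \<in> borel_measurable borel"
  shows "(\<integral>\<^sup>+x. g x \<partial>nu) = (SUP n. \<integral>\<^sup>+x. g x * indicator (cball 0 (real n)) x \<partial>nu)"
proof -
  have [measurable_cong]: "sets nu = sets borel" by fact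
  have [measurable]: "g \<in> borel_measurable borel" by fact
  have "(SUP n. \<integral>\<^sup>+x. g x * indicator (cball 0 (real n)) x \<partial>nu)
      = (\<integral>\<^sup>+x. (SUP n. g x * indicator (cball 0 (real n)) x) \<partial>nu)"
  proof (intro nn_integral_monotone_convergence_SUP[symmetric])
    show "incseq (\<lambda>n x. g x * indicator (cball 0 (real n)) x)"
      by (auto simp: incseq_def le_fun_def split: split_indicator)
  qed measurable
  moreover have "(SUP n. g x * indicator (cball 0 (real n)) x) = g x" for x
  proof (rule antisym)
    show "(SUP n. g x * indicator (cball 0 (real n)) x) \<le> g x"
      by (auto intro!: SUP_least split: split_indicator)
    obtain n :: nat where "norm x \<le> real n" using real_arch_simple by auto
    then show "g x \<le> (SUP n. g x * indicator (cball 0 (real n)) x)"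
      by (intro SUP_upper2[of n]) auto
  qed
  ultimately show ?thesis by simp
qed

text \<open>A Dynkin argument over measurable rectangles. The ball serves the complement step, which
  subtracts two integrals and therefore needs finite total mass;
  \<open>nn_integral_SUP_cball\<close> removes it afterwards.\<close>

lemma nn_integral_confs_indicator:
  fixes Z :: "'z measure" and f :: "'z \<Rightarrow> ('a::euclidean_space) measure"
  assumes [measurable]: "f \<in> measurable Z confs" and "X \<in> sets (Z \<Otimes>\<^sub>M (borel :: 'a measure))"
  shows "(\<lambda>z. \<integral>\<^sup>+x. indicator X (z, x) * indicator (cball 0 r) x \<partial>(f z)) \<in> borel_measurable Z"
proof -
  have conf: "f z \<in> configs" if "z \<in> space Z" for z
    using measurable_space[OF assms(1) that] by simp
  have cong: "sets (f z) = sets borel" if "z \<in> space Z" for z using conf[OF that] by simp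
  have fin: "emeasure (f z) (cball 0 r) < \<infinity>" if "z \<in> space Z" for z
    using configs_finite[OF conf[OF that]] by auto
  have [measurable]: "(\<lambda>z. emeasure (f z) B) \<in> borel_measurable Z" if "B \<in> sets borel" for B
    using measurable_compose[OF assms(1) measurable_count[OF that]] by simp
  have cut: "Y \<in> sets (Z \<Otimes>\<^sub>M borel) \<Longrightarrow> z \<in> space Z \<Longrightarrow>
     (\<lambda>x. indicator Y (z, x) * indicator (cball 0 r) x :: ennreal) \<in> borel_measurable (f z)" for Y z
  proof -
    assume Y: "Y \<in> sets (Z \<Otimes>\<^sub>M borel)" and z: "z \<in> space Z"
    have [measurable]: "(\<lambda>x. indicator Y (z, x) :: ennreal) \<in> borel_measurable borel"
      using measurable_compose[OF measurable_Pair1'[OF z] borel_measurable_indicator[OF Y]] .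
    show ?thesis unfolding measurable_cong_sets[OF cong[OF z] refl] by measurable
  qed
  have "X \<in> sigma_sets (space Z \<times> space borel) {a \<times> b |a b. a \<in> sets Z \<and> b \<in> sets (borel::'a measure)}"
    using assms(2) by (simp only: sets_pair_measure)
  from Int_stable_pair_measure_generator[of Z "borel::'a measure"] pair_measure_closed[of Z "borel::'a measure"] this
  show ?thesis
  proof (induction rule: sigma_sets_induct_disjoint)
    case (basic A)
    then obtain a b where A: "A = a \<times> b" and [measurable]: "a \<in> sets Z" "b \<in> sets borel" by auto
    have "(\<integral>\<^sup>+x. indicator A (z, x) * indicator (cball 0 r) x \<partial>(f z))
       = indicator a z * emeasure (f z) (b \<inter> cball 0 r)" if z: "z \<in> space Z" for z
    proof -
      have "(\<integral>\<^sup>+x. indicator A (z, x) * indicator (cball 0 r) x \<partial>(f z))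
        = (\<integral>\<^sup>+x. indicator a z * indicator (b \<inter> cball 0 r) x \<partial>(f z))"
        by (intro nn_integral_cong) (auto simp: A split: split_indicator)
      also have "... = indicator a z * emeasure (f z) (b \<inter> cball 0 r)"
        by (subst nn_integral_cmult) (auto simp: cong[OF z] measurable_cong_sets[OF cong[OF z] refl])
      finally show ?thesis .
    qed
    then show ?case by (subst measurable_cong[where g="\<lambda>z. indicator a z * emeasure (f z) (b \<inter> cball 0 r)"]) auto
  next
    case empty then show ?case by simp
  next
    case (compl A)
    then have A: "A \<in> sets (Z \<Otimes>\<^sub>M borel)" by (simp only: sets_pair_measure)
    have "(\<integral>\<^sup>+x. indicator (space Z \<times> space borel - A) (z, x) * indicator (cball 0 r) x \<partial>(f z))
      = emeasure (f z) (cball 0 r) - (\<integral>\<^sup>+x. indicator A (z, x) * indicator (cball 0 r) x \<partial>(f z))"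
      if z: "z \<in> space Z" for z
    proof -
      have [measurable_cong]: "sets (f z) = sets borel" by (rule cong[OF z])
      have "(\<integral>\<^sup>+x. indicator A (z, x) * indicator (cball 0 r) x \<partial>(f z)) \<le> (\<integral>\<^sup>+x. indicator (cball 0 r) x \<partial>(f z))"
        by (intro nn_integral_mono) (auto split: split_indicator)
      also have "... < \<infinity>" using fin[OF z] by simp
      finally have *: "(\<integral>\<^sup>+x. indicator A (z, x) * indicator (cball 0 r) x \<partial>(f z)) \<noteq> \<infinity>" by simp
      have "(\<integral>\<^sup>+x. indicator (space Z \<times> space borel - A) (z, x) * indicator (cball 0 r) x \<partial>(f z))
        = (\<integral>\<^sup>+x. indicator (cball 0 r) x - indicator A (z, x) * indicator (cball 0 r) x \<partial>(f z))"
        using z by (intro nn_integral_cong) (auto split: split_indicator)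
      also have "... = (\<integral>\<^sup>+x. indicator (cball 0 r) x \<partial>(f z)) - (\<integral>\<^sup>+x. indicator A (z, x) * indicator (cball 0 r) x \<partial>(f z))"
        using * cut[OF A z] by (intro nn_integral_diff) (auto split: split_indicator)
      finally show ?thesis by simp
    qed
    moreover have "(\<lambda>z. emeasure (f z) (cball 0 r) - (\<integral>\<^sup>+x. indicator A (z, x) * indicator (cball 0 r) x \<partial>(f z))) \<in> borel_measurable Z"
      using compl.IH by simp
    ultimately show ?case by (rule measurable_cong[THEN iffD2])
  next
    case (union A)
    then have A: "A i \<in> sets (Z \<Otimes>\<^sub>M borel)" for i by (auto simp only: sets_pair_measure)
    have "(\<integral>\<^sup>+x. indicator (\<Union> (range A)) (z, x) * indicator (cball 0 r) x \<partial>(f z))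
      = (\<Sum>i. \<integral>\<^sup>+x. indicator (A i) (z, x) * indicator (cball 0 r) x \<partial>(f z))" if z: "z \<in> space Z" for z
    proof -
      have "(\<integral>\<^sup>+x. indicator (\<Union> (range A)) (z, x) * indicator (cball 0 r) x \<partial>(f z))
        = (\<integral>\<^sup>+x. (\<Sum>i. indicator (A i) (z, x) * indicator (cball 0 r) x) \<partial>(f z))"
        by (intro nn_integral_cong) (simp add: suminf_indicator[OF union(1), symmetric])
      also have "... = (\<Sum>i. \<integral>\<^sup>+x. indicator (A i) (z, x) * indicator (cball 0 r) x \<partial>(f z))"
        using cut[OF A z] by (intro nn_integral_suminf) auto
      finally show ?thesis .
    qed
    then show ?case using union.IH by (subst measurable_cong) auto
  qed
qed

text \<open>Configurations are infinite measures that vary with the parameter, so neither the rule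
  for one fixed sigma-finite measure nor a rule for probability kernels applies. Indicators come
  from the localized statement, general integrands from monotone limits.\<close>

lemma borel_measurable_nn_integral_confs [measurable (raw)]:
  fixes f :: "'z \<Rightarrow> ('a::euclidean_space) measure" and g :: "'z \<Rightarrow> 'a \<Rightarrow> ennreal"
  assumes g: "case_prod g \<in> borel_measurable (Z \<Otimes>\<^sub>M borel)" and f [measurable]: "f \<in> measurable Z confs"
  shows "(\<lambda>z. \<integral>\<^sup>+x. g z x \<partial>(f z)) \<in> borel_measurable Z"
proof -
  have cong: "sets (f z) = sets borel" if "z \<in> space Z" for z
    using measurable_space[OF f that] by simp
  have cut: "(\<lambda>x. h (z, x)) \<in> borel_measurable (f z)"
    if "h \<in> borel_measurable (Z \<Otimes>\<^sub>M borel)" "z \<in> space Z" for h :: "_ \<Rightarrow> ennreal" and z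
    using measurable_compose[OF measurable_Pair1'[OF that(2)] that(1)]
    unfolding measurable_cong_sets[OF cong[OF that(2)] refl] .
  have *: "(\<lambda>z. \<integral>\<^sup>+x. h (z, x) \<partial>(f z)) \<in> borel_measurable Z"
    if "h \<in> borel_measurable (Z \<Otimes>\<^sub>M (borel :: 'a measure))" for h :: "'z \<times> 'a \<Rightarrow> ennreal"
    using that
  proof (induction rule: borel_measurable_induct)
    case (cong h k)
    have "(\<integral>\<^sup>+x. h (z, x) \<partial>(f z)) = (\<integral>\<^sup>+x. k (z, x) \<partial>(f z))" if "z \<in> space Z" for z
      using cong(3)[of "(z, _)"] that by (intro nn_integral_cong) (auto simp: space_pair_measure)
    then show ?case using cong(4) by (simp cong: measurable_cong)
  next
    case (set A)
    have "(\<integral>\<^sup>+x. indicator A (z, x) \<partial>(f z)) = (SUP n. \<integral>\<^sup>+x. indicator A (z, x) * indicator (cball 0 (real n)) x \<partial>(f z))"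
      if z: "z \<in> space Z" for z
      using z set measurable_space[OF f z] by (intro nn_integral_SUP_cball) auto
    then show ?case
      using nn_integral_confs_indicator[OF f set] by (subst measurable_cong) auto
  next
    case (mult u c)
    have "(\<integral>\<^sup>+x. c * u (z, x) \<partial>(f z)) = c * (\<integral>\<^sup>+x. u (z, x) \<partial>(f z))" if "z \<in> space Z" for z
      using cut[OF mult(2) that] by (rule nn_integral_cmult)
    from mult have "(\<lambda>z. c * (\<integral>\<^sup>+x. u (z, x) \<partial>(f z))) \<in> borel_measurable Z" by simp
    then show ?case by (rule measurable_cong[THEN iffD2, rotated]) fact
  next
    case (add u v)
    have "(\<integral>\<^sup>+x. v (z, x) + u (z, x) \<partial>(f z)) = (\<integral>\<^sup>+x. v (z, x) \<partial>(f z)) + (\<integral>\<^sup>+x. u (z, x) \<partial>(f z))" if "z \<in> space Z" for z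
      using cut[OF add(1) that] cut[OF add(3) that] by (intro nn_integral_add)
    from add have "(\<lambda>z. (\<integral>\<^sup>+x. v (z, x) \<partial>(f z)) + (\<integral>\<^sup>+x. u (z, x) \<partial>(f z))) \<in> borel_measurable Z" by simp
    then show ?case by (rule measurable_cong[THEN iffD2, rotated]) fact
  next
    case (seq U)
    have "(\<integral>\<^sup>+x. (SUP i. U i) (z, x) \<partial>(f z)) = (SUP i. \<integral>\<^sup>+x. U i (z, x) \<partial>(f z))" if "z \<in> space Z" for z
      unfolding SUP_apply image_image
    proof (rule nn_integral_monotone_convergence_SUP)
      show "incseq (\<lambda>i x. U i (z, x))"
        using seq(3) by (simp add: incseq_def le_fun_def)
      show "\<And>i. (\<lambda>x. U i (z, x)) \<in> borel_measurable (f z)"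
        using cut[OF seq(1) that] .
    qed
    have "(\<lambda>z. SUP i. \<integral>\<^sup>+x. U i (z, x) \<partial>(f z)) \<in> borel_measurable Z"
      using seq by (intro borel_measurable_SUP) auto
    then show ?case by (rule measurable_cong[THEN iffD2, rotated]) fact
  qed
  show ?thesis using *[OF g] by simp
qed

lemma borel_measurable_integral_confs [measurable (raw)]:
  fixes f :: "'z \<Rightarrow> ('a::euclidean_space) measure" and g :: "'z \<Rightarrow> 'a \<Rightarrow> real"
  assumes g [measurable]: "case_prod g \<in> borel_measurable (Z \<Otimes>\<^sub>M borel)" and f [measurable]: "f \<in> measurable Z confs"
  shows "(\<lambda>z. LINT x|f z. g z x) \<in> borel_measurable Z"
proof -
  have cong: "sets (f z) = sets borel" if "z \<in> space Z" for z
    using measurable_space[OF f that] by simp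
  \<comment> \<open>A divergent Bochner integral has the value 0. The parameters where this default
    applies form a measurable set by the nonnegative case, so the case distinction itself is
    measurable.\<close>
  have "(LINT x|f z. g z x) = (if (\<integral>\<^sup>+x. ennreal (norm (g z x)) \<partial>(f z)) < \<infinity>
     then enn2real (\<integral>\<^sup>+x. ennreal (g z x) \<partial>(f z)) - enn2real (\<integral>\<^sup>+x. ennreal (- g z x) \<partial>(f z)) else 0)"
    if z: "z \<in> space Z" for z
  proof -
    have "g z \<in> borel_measurable (f z)"
      using z unfolding measurable_cong_sets[OF cong[OF z] refl] by measurable
    then have "integrable (f z) (g z) \<longleftrightarrow> (\<integral>\<^sup>+x. ennreal (norm (g z x)) \<partial>(f z)) < \<infinity>"
      by (auto simp: integrable_iff_bounded)
    then show ?thesis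
      by (auto simp: real_lebesgue_integral_def not_integrable_integral_eq)
  qed
  then show ?thesis by (subst measurable_cong) auto
qed

subsection \<open>Superposition, restriction and addition of a point\<close>

definition superpose :: "('a::euclidean_space) measure \<Rightarrow> 'a measure \<Rightarrow> 'a measure" where
  "superpose nu nu' = measure_of UNIV (sets borel) (\<lambda>A. emeasure nu A + emeasure nu' A)"

lemma sets_superpose [simp, measurable_cong]: "sets (superpose nu nu') = sets borel"
  unfolding superpose_def by (simp add: sets.sigma_sets_eq[of borel, simplified])

lemma space_superpose [simp]: "space (superpose nu nu') = UNIV"
  using sets_eq_imp_space_eq[OF sets_superpose] by simp

lemma emeasure_superpose:
  assumes "sets nu = sets borel" "sets nu' = sets borel" "A \<in> sets borel"
  shows "emeasure (superpose nu nu') A = emeasure nu A + emeasure nu' A"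
proof (rule emeasure_measure_of[OF superpose_def])
  show "countably_additive (sets (superpose nu nu')) (\<lambda>A. emeasure nu A + emeasure nu' A)"
    unfolding countably_additive_def
  proof safe
    fix B :: "nat \<Rightarrow> 'a set" assume B: "range B \<subseteq> sets (superpose nu nu')" "disjoint_family B"
    have "(\<Sum>i. emeasure nu (B i) + emeasure nu' (B i)) = (\<Sum>i. emeasure nu (B i)) + (\<Sum>i. emeasure nu' (B i))"
      by (intro suminf_add[symmetric]) auto
    then show "(\<Sum>i. emeasure nu (B i) + emeasure nu' (B i)) = emeasure nu (\<Union> (range B)) + emeasure nu' (\<Union> (range B))"
      using B assms by (simp add: suminf_emeasure)
  qed
qed (use assms in \<open>auto simp: positive_def\<close>)

lemma nn_integral_superpose:
  fixes g :: "'a::euclidean_space \<Rightarrow> ennreal"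
  assumes s: "sets nu = sets borel" "sets nu' = sets borel" and "g \<in> borel_measurable borel"
  shows "(\<integral>\<^sup>+x. g x \<partial>superpose nu nu') = (\<integral>\<^sup>+x. g x \<partial>nu) + (\<integral>\<^sup>+x. g x \<partial>nu')"
  using assms(3)
proof (induction rule: borel_measurable_induct)
  case (cong f g)
  moreover have "f = g" using cong by (auto simp: fun_eq_iff)
  ultimately show ?case by simp
next
  case (set A) then show ?case using s by (simp add: emeasure_superpose)
next
  case (mult u c)
  have [measurable_cong]: "sets nu = sets borel" "sets nu' = sets borel" by fact+
  show ?case using mult by (simp add: nn_integral_cmult distrib_left)
next
  case (add u v)
  have [measurable_cong]: "sets nu = sets borel" "sets nu' = sets borel" by fact+
  show ?case using add by (simp add: nn_integral_add ac_simps)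
next
  case (seq U)
  have [measurable_cong]: "sets nu = sets borel" "sets nu' = sets borel" by fact+
  have SUP: "(\<integral>\<^sup>+x. (SUP i. U i) x \<partial>\<rho>) = (SUP i. \<integral>\<^sup>+x. U i x \<partial>\<rho>)" if "sets \<rho> = sets borel" for \<rho>
    unfolding SUP_apply using seq that measurable_cong_sets[OF that refl, of borel]
    by (intro nn_integral_monotone_convergence_SUP) auto
  have inc: "incseq (\<lambda>i. \<integral>\<^sup>+x. U i x \<partial>\<rho>)" for \<rho>
    using seq by (auto simp: incseq_def le_fun_def intro!: nn_integral_mono)
  show ?case
    using seq unfolding SUP[OF s(1)] SUP[OF s(2)] SUP[OF sets_superpose]
    by (simp add: ennreal_SUP_add[OF inc inc])
qed

text \<open>Restriction by a density keeps the whole space as carrier, so the result is again an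
  element of \<open>configs\<close>.\<close>

abbreviation restr :: "('a::euclidean_space) set \<Rightarrow> 'a measure \<Rightarrow> 'a measure" where
  "restr C nu \<equiv> density nu (indicator C)"

definition add_point :: "'a::euclidean_space \<Rightarrow> 'a measure \<Rightarrow> 'a measure" where
  "add_point x nu = superpose nu (return borel x)"

lemma sets_add_point [simp, measurable_cong]: "sets (add_point x nu) = sets borel"
  by (simp add: add_point_def)

lemma emeasure_add_point:
  "nu \<in> configs \<Longrightarrow> A \<in> sets borel \<Longrightarrow> emeasure (add_point x nu) A = emeasure nu A + indicator A x"
  by (simp add: add_point_def emeasure_superpose)

lemma nn_integral_add_point:
  "nu \<in> configs \<Longrightarrow> g \<in> borel_measurable borel \<Longrightarrow>
    (\<integral>\<^sup>+y. g y \<partial>add_point x nu) = (\<integral>\<^sup>+y. g y \<partial>nu) + g x"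
  by (simp add: add_point_def nn_integral_superpose nn_integral_return)

lemma emeasure_restr:
  "nu \<in> configs \<Longrightarrow> C \<in> sets borel \<Longrightarrow> A \<in> sets borel \<Longrightarrow> emeasure (restr C nu) A = emeasure nu (C \<inter> A)"
  by (subst emeasure_density)
     (auto simp: indicator_inter_arith[symmetric] measurable_cong_sets[OF sets_configs refl])

lemma superpose_in_configs: "nu \<in> configs \<Longrightarrow> nu' \<in> configs \<Longrightarrow> superpose nu nu' \<in> configs"
proof -
  assume c: "nu \<in> configs" "nu' \<in> configs"
  have "\<exists>k::nat. emeasure (superpose nu nu') A = of_nat k" if A: "A \<in> sets borel" "bounded A" for A
  proof -
    obtain k l :: nat where "emeasure nu A = of_nat k" "emeasure nu' A = of_nat l"
      using configs_count[OF c(1) A] configs_count[OF c(2) A] by metis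
    then have "emeasure (superpose nu nu') A = of_nat (k + l)"
      using c A by (simp add: emeasure_superpose)
    then show ?thesis ..
  qed
  then show ?thesis unfolding configs_def by simp
qed

lemma return_in_configs: "return borel x \<in> configs"
proof -
  have "\<exists>k::nat. emeasure (return borel x) A = of_nat k" if "A \<in> sets borel" for A
    using that by (cases "x \<in> A") (auto intro: exI[of _ 1] exI[of _ 0])
  then show ?thesis unfolding configs_def by simp
qed

lemma add_point_in_configs [simp]: "nu \<in> configs \<Longrightarrow> add_point x nu \<in> configs"
  unfolding add_point_def by (intro superpose_in_configs return_in_configs)

lemma restr_in_configs [simp]: "nu \<in> configs \<Longrightarrow> C \<in> sets borel \<Longrightarrow> restr C nu \<in> configs"
proof -
  assume c: "nu \<in> configs" "C \<in> sets borel"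
  have "\<exists>k::nat. emeasure (restr C nu) A = of_nat k" if "A \<in> sets borel" "bounded A" for A
    using configs_count[OF c(1), of "C \<inter> A"] c that by (metis bounded_Int emeasure_restr sets.Int)
  then show ?thesis using c unfolding configs_def by simp
qed

lemma measurable_superpose [measurable (raw)]:
  fixes f :: "'z \<Rightarrow> ('a::euclidean_space) measure"
  assumes [measurable]: "f \<in> measurable Z confs" "g \<in> measurable Z confs"
  shows "(\<lambda>z. superpose (f z) (g z)) \<in> measurable Z confs"
proof (rule measurable_confsI)
  fix z assume "z \<in> space Z"
  then show "superpose (f z) (g z) \<in> configs"
    using measurable_space[OF assms(1)] measurable_space[OF assms(2)] by (intro superpose_in_configs) auto
next
  fix A :: "'a set" assume [measurable]: "A \<in> sets borel"
  have "emeasure (superpose (f z) (g z)) A = emeasure (f z) A + emeasure (g z) A" if "z \<in> space Z" for z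
    using that measurable_space[OF assms(1)] measurable_space[OF assms(2)] by (intro emeasure_superpose) auto
  moreover have "(\<lambda>z. emeasure (f z) A) \<in> borel_measurable Z" "(\<lambda>z. emeasure (g z) A) \<in> borel_measurable Z"
    using measurable_compose[OF assms(1) measurable_count] measurable_compose[OF assms(2) measurable_count] by auto
  ultimately show "(\<lambda>z. emeasure (superpose (f z) (g z)) A) \<in> borel_measurable Z"
    by (subst measurable_cong) auto
qed

lemma measurable_return_confs [measurable (raw)]:
  assumes [measurable]: "f \<in> measurable Z borel"
  shows "(\<lambda>z. return borel (f z)) \<in> measurable Z confs"
  by (rule measurable_confsI) (auto simp: return_in_configs)

lemma measurable_add_point [measurable (raw)]:
  assumes [measurable]: "f \<in> measurable Z borel" "g \<in> measurable Z confs"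
  shows "(\<lambda>z. add_point (f z) (g z)) \<in> measurable Z confs"
  unfolding add_point_def by measurable

lemma measurable_restr [measurable (raw)]:
  fixes g :: "'z \<Rightarrow> ('a::euclidean_space) measure"
  assumes [measurable]: "C \<in> sets borel" "g \<in> measurable Z confs"
  shows "(\<lambda>z. restr C (g z)) \<in> measurable Z confs"
proof (rule measurable_confsI)
  show "z \<in> space Z \<Longrightarrow> restr C (g z) \<in> configs" for z
    using measurable_space[OF assms(2)] by auto
  fix A :: "'a set" assume [measurable]: "A \<in> sets borel"
  have "emeasure (restr C (g z)) A = emeasure (g z) (C \<inter> A)" if "z \<in> space Z" for z
    using that measurable_space[OF assms(2)] by (intro emeasure_restr) auto
  moreover have "(\<lambda>z. emeasure (g z) (C \<inter> A)) \<in> borel_measurable Z"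
    using measurable_compose[OF assms(2) measurable_count[of "C \<inter> A"]] by auto
  ultimately show "(\<lambda>z. emeasure (restr C (g z)) A) \<in> borel_measurable Z"
    by (subst measurable_cong) auto
qed

lemma configs_eqI:
  "nu \<in> configs \<Longrightarrow> nu' \<in> configs \<Longrightarrow> (\<And>A. A \<in> sets borel \<Longrightarrow> emeasure nu A = emeasure nu' A) \<Longrightarrow> nu = nu'"
  by (rule measure_eqI) auto

lemma add_point_commute: "nu \<in> configs \<Longrightarrow> add_point x (add_point y nu) = add_point y (add_point x nu)"
  by (rule configs_eqI) (auto simp: emeasure_add_point ac_simps)

text \<open>The formula for superpositions concerns nonnegative functions. Positive and negative
  parts are treated separately, and the new point contributes \<open>max 0 (g x)\<close> to one and
  \<open>max 0 (- g x)\<close> to the other.\<close>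

lemma integrable_add_point:
  fixes g :: "'a::euclidean_space \<Rightarrow> real"
  assumes [simp]: "nu \<in> configs" and g [measurable]: "g \<in> borel_measurable borel" and i: "integrable nu g"
  shows "integrable (add_point x nu) g" "(LINT y|add_point x nu. g y) = (LINT y|nu. g y) + g x"
proof -
  have [measurable_cong]: "sets nu = sets borel" by simp
  have fin: "(\<integral>\<^sup>+y. ennreal (g y) \<partial>nu) < \<infinity>" "(\<integral>\<^sup>+y. ennreal (- g y) \<partial>nu) < \<infinity>" "(\<integral>\<^sup>+y. ennreal (norm (g y)) \<partial>nu) < \<infinity>"
    using i by (simp_all add: real_integrable_def top.not_eq_extremum)
       (use i in \<open>simp add: integrable_iff_bounded\<close>)
  show 1: "integrable (add_point x nu) g"
    unfolding integrable_iff_bounded using fin(3) by (simp add: nn_integral_add_point)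
  have "enn2real (\<integral>\<^sup>+y. ennreal (g y) \<partial>add_point x nu) = enn2real (\<integral>\<^sup>+y. ennreal (g y) \<partial>nu) + max 0 (g x)"
    using fin(1) by (simp add: nn_integral_add_point enn2real_plus max_def ennreal_neg)
  moreover have "enn2real (\<integral>\<^sup>+y. ennreal (- g y) \<partial>add_point x nu) = enn2real (\<integral>\<^sup>+y. ennreal (- g y) \<partial>nu) + max 0 (- g x)"
    using fin(2) by (simp add: nn_integral_add_point enn2real_plus max_def ennreal_neg)
  ultimately show "(LINT y|add_point x nu. g y) = (LINT y|nu. g y) + g x"
    using i 1 by (simp add: real_lebesgue_integral_def)
qed

section \<open>Poisson laws on configurations\<close>

text \<open>For disjoint bounded cells these are the events whose Poisson probabilities are explicit
  products; all identities between laws are reduced to them.\<close>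

definition cylinder :: "('a::euclidean_space) set set \<Rightarrow> ('a set \<Rightarrow> nat) \<Rightarrow> 'a measure set" where
  "cylinder \<C> k = {nu\<in>configs. \<forall>C\<in>\<C>. emeasure nu C = of_nat (k C)}"

definition bounded_borel :: "('a::euclidean_space) set set" where
  "bounded_borel = {A. A \<in> sets borel \<and> bounded A}"

lemma bounded_borelD: "A \<in> bounded_borel \<Longrightarrow> A \<in> sets borel" "A \<in> bounded_borel \<Longrightarrow> bounded A"
  by (auto simp: bounded_borel_def)

lemma sets_cylinder:
  assumes "finite \<C>" "\<C> \<subseteq> bounded_borel"
  shows "cylinder \<C> k \<in> sets confs"
proof -
  have "{nu\<in>space confs. emeasure nu C = of_nat (k C)} \<in> sets confs" if "C \<in> \<C>" for C
  proof -
    have [measurable]: "C \<in> sets borel" using that assms by (auto simp: bounded_borel_def)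
    show ?thesis by measurable
  qed
  from sets.sets_Collect_finite_All[OF this assms(1)] show ?thesis
    by (simp add: cylinder_def)
qed

lemma disjoint_refinement:
  assumes "finite \<A>" "\<A> \<subseteq> bounded_borel"
  obtains \<C> where "finite \<C>" "disjoint \<C>" "\<C> \<subseteq> bounded_borel"
    "\<And>A. A \<in> \<A> \<Longrightarrow> A = \<Union>{C\<in>\<C>. C \<subseteq> A}"
proof
  \<comment> \<open>The points that lie in all members of \<open>J\<close> and in no other member of
    the family. Only nonempty \<open>J\<close> are used, which keeps the atoms bounded.\<close>
  let ?atom = "\<lambda>J. \<Inter>J - \<Union>(\<A> - J)"
  let ?C = "?atom ` (Pow \<A> - {{}})"
  show "finite ?C" using assms by auto
  show "disjoint ?C"
  proof (rule disjointI)
    fix a b assume "a \<in> ?C" "b \<in> ?C" and ne: "a \<noteq> b"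
    then obtain J K where J: "J \<subseteq> \<A>" "a = ?atom J" and K: "K \<subseteq> \<A>" "b = ?atom K" by auto
    with ne have "J \<noteq> K" by auto
    then show "a \<inter> b = {}" using J K by blast
  qed
  show "?C \<subseteq> bounded_borel"
  proof
    fix a assume "a \<in> ?C"
    then obtain J where J: "J \<subseteq> \<A>" "J \<noteq> {}" "a = ?atom J" by auto
    have fin: "finite J" "finite (\<A> - J)" using J assms finite_subset by auto
    have "(\<Inter>B\<in>J. B) \<in> sets borel" using fin(1) J assms(2) bounded_borelD(1)
      by (intro sets.finite_INT) auto
    then have "\<Inter>J \<in> sets borel" by simp
    moreover have "\<Union>(\<A> - J) \<in> sets borel" using fin assms bounded_borelD(1)
      by (intro sets.finite_Union) auto
    moreover have "bounded a"
    proof -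
      obtain B where "B \<in> J" using J by auto
      then have "bounded B" "a \<subseteq> B" using J assms bounded_borelD(2) by auto
      then show ?thesis using bounded_subset by blast
    qed
    ultimately show "a \<in> bounded_borel" using J by (simp add: bounded_borel_def)
  qed
  fix A assume A: "A \<in> \<A>"
  show "A = \<Union>{C\<in>?C. C \<subseteq> A}"
  proof
    show "A \<subseteq> \<Union>{C\<in>?C. C \<subseteq> A}"
    proof
      fix x assume x: "x \<in> A"
      let ?J = "{B\<in>\<A>. x \<in> B}"
      have "x \<in> ?atom ?J" "?atom ?J \<subseteq> A" "?J \<in> Pow \<A> - {{}}" using x A by auto
      then show "x \<in> \<Union>{C\<in>?C. C \<subseteq> A}" by (intro UnionI[of "?atom ?J"]) auto
    qed
  qed auto
qed

lemma emeasure_refinement: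
  assumes "nu \<in> configs" "finite \<C>" "disjoint \<C>" "\<C> \<subseteq> bounded_borel" "A = \<Union>{C\<in>\<C>. C \<subseteq> A}"
  shows "emeasure nu A = (\<Sum>C\<in>{C\<in>\<C>. C \<subseteq> A}. emeasure nu C)"
proof -
  have "(\<Sum>C\<in>{C\<in>\<C>. C \<subseteq> A}. emeasure nu (id C)) = emeasure nu (\<Union>C\<in>{C\<in>\<C>. C \<subseteq> A}. id C)"
  proof (rule sum_emeasure)
    show "id ` {C \<in> \<C>. C \<subseteq> A} \<subseteq> sets nu"
      using assms(1,4) bounded_borelD(1) by auto
    show "disjoint_family_on id {C \<in> \<C>. C \<subseteq> A}"
      using assms(3) by (auto simp: disjoint_family_on_def disjoint_def)
  qed (use assms in simp)
  also have "(\<Union>C\<in>{C\<in>\<C>. C \<subseteq> A}. id C) = A" using assms(5) by simp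
  finally show ?thesis by simp
qed

text \<open>Counts of unions are sums of counts of cells, so the coarse event splits according to
  the counts of the cells. The split is finite because each cell lies in some member of the family,
  whose prescribed count bounds that of the cell.\<close>

lemma cylinder_refinement:
  assumes C: "finite \<C>" "disjoint \<C>" "\<C> \<subseteq> bounded_borel"
    and A: "finite \<A>" "\<And>A. A \<in> \<A> \<Longrightarrow> A = \<Union>{C\<in>\<C>. C \<subseteq> A}"
    and cov: "\<And>C. C \<in> \<C> \<Longrightarrow> \<exists>A\<in>\<A>. C \<subseteq> A"
  obtains S where "finite S" "cylinder \<A> k = (\<Union>m\<in>S. cylinder \<C> m)"
    "disjoint_family_on (cylinder \<C>) S"
proof
  \<comment> \<open>Extensional functions: otherwise the arbitrary values off the cells would list
    each cylinder infinitely often.\<close>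
  let ?S = "{m \<in> \<C> \<rightarrow>\<^sub>E {.. (\<Sum>A\<in>\<A>. k A)}. \<forall>A\<in>\<A>. (\<Sum>C\<in>{C\<in>\<C>. C \<subseteq> A}. m C) = k A}"
  have "finite (\<C> \<rightarrow>\<^sub>E {.. (\<Sum>A\<in>\<A>. k A)})" using C(1) by (intro finite_PiE) auto
  then show "finite ?S" by (rule finite_subset[rotated]) auto
  show "disjoint_family_on (cylinder \<C>) ?S"
    unfolding disjoint_family_on_def
  proof (intro ballI impI)
    fix m n assume m: "m \<in> ?S" "n \<in> ?S" "m \<noteq> n"
    have "m = n" if "nu \<in> cylinder \<C> m" "nu \<in> cylinder \<C> n" for nu
    proof (rule PiE_ext[of m \<C> "\<lambda>_. {.. (\<Sum>A\<in>\<A>. k A)}" n])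
      fix C assume "C \<in> \<C>"
      then have "(of_nat (m C) :: ennreal) = of_nat (n C)" using that unfolding cylinder_def by force
      then show "m C = n C" by simp
    qed (use m in auto)
    then show "cylinder \<C> m \<inter> cylinder \<C> n = {}" using m(3) by auto
  qed
  show "cylinder \<A> k = (\<Union>m\<in>?S. cylinder \<C> m)"
  proof (intro set_eqI iffI)
    fix nu assume "nu \<in> cylinder \<A> k"
    then have nu: "nu \<in> configs" and k: "\<And>A. A \<in> \<A> \<Longrightarrow> emeasure nu A = of_nat (k A)"
      by (auto simp: cylinder_def)
    have "\<forall>C\<in>\<C>. \<exists>j::nat. emeasure nu C = of_nat j"
      using configs_count[OF nu] C(3) bounded_borelD by (metis subsetD)
    then obtain m where m: "\<And>C. C \<in> \<C> \<Longrightarrow> emeasure nu C = of_nat (m C)" by metis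
    have sum: "(\<Sum>C\<in>{C\<in>\<C>. C \<subseteq> A}. m C) = k A" if "A \<in> \<A>" for A
    proof -
      have "(of_nat (k A) :: ennreal) = (\<Sum>C\<in>{C\<in>\<C>. C \<subseteq> A}. emeasure nu C)"
        using emeasure_refinement[OF nu C A(2)[OF that]] k[OF that] by simp
      also have "... = of_nat (\<Sum>C\<in>{C\<in>\<C>. C \<subseteq> A}. m C)" by (simp add: m)
      finally show ?thesis by (metis of_nat_eq_iff)
    qed
    have le: "m C \<le> (\<Sum>A\<in>\<A>. k A)" if "C \<in> \<C>" for C
    proof -
      obtain B where B: "B \<in> \<A>" "C \<subseteq> B" using cov[OF \<open>C \<in> \<C>\<close>] by auto
      have "m C \<le> (\<Sum>C\<in>{C\<in>\<C>. C \<subseteq> B}. m C)"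
        using that B C(1) by (intro member_le_sum) auto
      also have "... = k B" using sum[OF B(1)] .
      also have "... \<le> (\<Sum>A\<in>\<A>. k A)" using B A(1) by (intro member_le_sum) auto
      finally show ?thesis .
    qed
    have "restrict m \<C> \<in> ?S" using le sum by (auto intro!: sum.cong)
    moreover have "nu \<in> cylinder \<C> (restrict m \<C>)" using nu m by (auto simp: cylinder_def)
    ultimately show "nu \<in> (\<Union>m\<in>?S. cylinder \<C> m)" by blast
  next
    fix nu assume "nu \<in> (\<Union>m\<in>?S. cylinder \<C> m)"
    then obtain m where m: "m \<in> ?S" and "nu \<in> cylinder \<C> m" by blast
    then have nu: "nu \<in> configs" and e: "\<And>C. C \<in> \<C> \<Longrightarrow> emeasure nu C = of_nat (m C)"
      by (auto simp: cylinder_def)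
    have "emeasure nu B = of_nat (k B)" if "B \<in> \<A>" for B
    proof -
      have "emeasure nu B = (\<Sum>C\<in>{C\<in>\<C>. C \<subseteq> B}. of_nat (m C))"
        using emeasure_refinement[OF nu C A(2)[OF that]] e by simp
      also have "... = of_nat (\<Sum>C\<in>{C\<in>\<C>. C \<subseteq> B}. m C)" by simp
      also have "... = of_nat (k B)" using m that by simp
      finally show ?thesis .
    qed
    then show "nu \<in> cylinder \<A> k" using nu by (simp add: cylinder_def)
  qed
qed

text \<open>Cylinders whose family contains the fixed set \<open>R\<close> are stable under
  intersection and still generate. Including \<open>R\<close> provides an exhaustion of the space by
  the events that \<open>R\<close> has count \<open>j\<close>, so finiteness has to be known on
  these events only. Refinement into atoms reduces the comparison to disjoint cells.\<close>

lemma configs_measure_eqI: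
  fixes R :: "('a::euclidean_space) set"
  assumes sets: "sets P = sets confs" "sets P' = sets confs" and R: "R \<in> bounded_borel"
    and eq: "\<And>\<C> k. finite \<C> \<Longrightarrow> disjoint \<C> \<Longrightarrow> \<C> \<subseteq> bounded_borel \<Longrightarrow> R = \<Union>{C\<in>\<C>. C \<subseteq> R} \<Longrightarrow>
        emeasure P (cylinder \<C> k) = emeasure P' (cylinder \<C> k)"
    and fin: "\<And>k. emeasure P (cylinder {R} k) \<noteq> \<infinity>"
  shows "P = P'"
proof -
  let ?E = "{cylinder \<A> k | \<A> k. finite \<A> \<and> \<A> \<subseteq> bounded_borel \<and> R \<in> \<A>}"
  have stable: "Int_stable ?E"
  proof (rule Int_stableI)
    fix a b assume "a \<in> ?E" "b \<in> ?E"
    then obtain \<A> k \<B> l where a: "a = cylinder \<A> k" "finite \<A>" "\<A> \<subseteq> bounded_borel" "R \<in> \<A>"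
      and b: "b = cylinder \<B> l" "finite \<B>" "\<B> \<subseteq> bounded_borel" "R \<in> \<B>" by blast
    show "a \<inter> b \<in> ?E"
    proof (cases "\<forall>A\<in>\<A> \<inter> \<B>. k A = l A")
      case True
      then have "a \<inter> b = cylinder (\<A> \<union> \<B>) (\<lambda>A. if A \<in> \<A> then k A else l A)"
        unfolding a b cylinder_def by auto
      then show ?thesis using a b by blast
    next
      case False
      then obtain A where A: "A \<in> \<A>" "A \<in> \<B>" "k A \<noteq> l A" by blast
      have "False" if "nu \<in> a \<inter> b" for nu
      proof -
        have "(of_nat (k A) :: ennreal) = of_nat (l A)"
          using that A unfolding a b cylinder_def by force
        then show False using A by simp
      qed
      then have "a \<inter> b = {}" by blast
      \<comment> \<open>The empty event must be a cylinder as well; the empty set never contains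
        exactly one point.\<close>
      also have "... = cylinder {R, {}} (\<lambda>_. 1)" by (auto simp: cylinder_def)
      finally have "a \<inter> b = cylinder {R, {}} (\<lambda>_. 1)" .
      moreover have "finite {R, {}}" "{R, {}} \<subseteq> bounded_borel" using R by (auto simp: bounded_borel_def)
      ultimately show ?thesis by blast
    qed
  qed
  have sub: "?E \<subseteq> Pow configs" by (auto simp: cylinder_def)
  have UN: "(\<Union>j. cylinder {R} (\<lambda>_. j)) = configs"
  proof (intro equalityI subsetI)
    fix nu :: "'a measure" assume "nu \<in> configs"
    moreover then obtain j :: nat where "emeasure nu R = of_nat j"
      using configs_count[OF _ bounded_borelD[OF R]] by blast
    ultimately show "nu \<in> (\<Union>j. cylinder {R} (\<lambda>_. j))" by (auto simp: cylinder_def)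
  qed (auto simp: cylinder_def)
  have gen: "sets confs = sigma_sets configs ?E"
  proof
    show "sigma_sets configs ?E \<subseteq> sets confs"
      using sets.sigma_sets_subset[of ?E confs] sets_cylinder by auto
    have "sigma_sets configs {{nu\<in>configs. emeasure nu A = of_nat k} | A (k::nat). A \<in> sets borel \<and> bounded A}
      \<subseteq> sigma_sets configs ?E"
    proof (rule sigma_sets_mono, safe)
      fix A :: "'a set" and k :: nat assume A: "A \<in> sets borel" "bounded A"
      \<comment> \<open>A split according to the count of \<open>R\<close> brings \<open>R\<close>
        into the family. The conditional also covers the case that \<open>A\<close> equals
        \<open>R\<close>.\<close>
      have "{nu\<in>configs. emeasure nu A = of_nat k} = (\<Union>j. cylinder {A, R} (\<lambda>B. if B = A then k else j))"
      proof (intro set_eqI iffI)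
        fix nu assume "nu \<in> {nu\<in>configs. emeasure nu A = of_nat k}"
        moreover then obtain j :: nat where "emeasure nu R = of_nat j"
          using configs_count[OF _ bounded_borelD[OF R]] by blast
        ultimately have "nu \<in> cylinder {A, R} (\<lambda>B. if B = A then k else j)"
          by (auto simp: cylinder_def)
        then show "nu \<in> (\<Union>j. cylinder {A, R} (\<lambda>B. if B = A then k else j))" by blast
      qed (auto simp: cylinder_def)
      also have "... \<in> sigma_sets configs ?E"
      proof (rule sigma_sets.Union, rule sigma_sets.Basic)
        fix j
        have "finite {A, R}" "{A, R} \<subseteq> bounded_borel" "R \<in> {A, R}"
          using A R by (auto simp: bounded_borel_def)
        then show "cylinder {A, R} (\<lambda>B. if B = A then k else j) \<in> ?E" by blast
      qed
      finally show "{nu\<in>configs. emeasure nu A = of_nat k} \<in> sigma_sets configs ?E" .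
    qed
    then show "sets confs \<subseteq> sigma_sets configs ?E"
      unfolding confs_def by (subst sets_measure_of) auto
  qed
  show ?thesis
  proof (rule measure_eqI_generator_eq[OF stable sub])
    fix X assume "X \<in> ?E"
    then obtain \<A> k where X: "X = cylinder \<A> k" "finite \<A>" "\<A> \<subseteq> bounded_borel" "R \<in> \<A>" by blast
    obtain \<C> where C: "finite \<C>" "disjoint \<C>" "\<C> \<subseteq> bounded_borel"
      "\<And>A. A \<in> \<A> \<Longrightarrow> A = \<Union>{C\<in>\<C>. C \<subseteq> A}"
      using disjoint_refinement[OF X(2,3)] by blast
    \<comment> \<open>Cells outside all members of the family are dropped: their counts are
      unconstrained and would make the split infinite.\<close>
    let ?C = "{C\<in>\<C>. \<exists>A\<in>\<A>. C \<subseteq> A}"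
    have sel: "{C\<in>?C. C \<subseteq> A} = {C\<in>\<C>. C \<subseteq> A}" if "A \<in> \<A>" for A using that by auto
    have C': "finite ?C" "disjoint ?C" "?C \<subseteq> bounded_borel"
      using C by (auto simp: disjoint_def)
    have C4: "A = \<Union>{C\<in>?C. C \<subseteq> A}" if "A \<in> \<A>" for A
      using C(4)[OF that] by (simp only: sel[OF that])
    have cov: "\<exists>A\<in>\<A>. B \<subseteq> A" if "B \<in> ?C" for B using that by blast
    obtain S where S: "finite S" "cylinder \<A> k = (\<Union>m\<in>S. cylinder ?C m)"
      "disjoint_family_on (cylinder ?C) S"
      by (rule cylinder_refinement[OF C' X(2) C4 cov, of k])
    have img: "cylinder ?C ` S \<subseteq> sets confs"
      using sets_cylinder[OF C'(1,3)] by (intro image_subsetI)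
    have "emeasure P X = (\<Sum>m\<in>S. emeasure P (cylinder ?C m))"
      unfolding X(1) S(2) by (rule sum_emeasure[symmetric]) (simp_all only: sets img S)
    also have "... = (\<Sum>m\<in>S. emeasure P' (cylinder ?C m))"
      by (intro sum.cong refl eq[OF C' C4[OF X(4)]])
    also have "... = emeasure P' X"
      unfolding X(1) S(2) by (rule sum_emeasure) (simp_all only: sets img S)
    finally show "emeasure P X = emeasure P' X" .
  next
    show "range (\<lambda>j. cylinder {R} (\<lambda>_. j)) \<subseteq> ?E" using R by blast
    show "(\<Union>j. cylinder {R} (\<lambda>_. j)) = configs" by (rule UN)
    show "emeasure P (cylinder {R} (\<lambda>_. j)) \<noteq> \<infinity>" for j by (rule fin)
  qed (simp_all only: sets gen)
qed

section \<open>Poisson laws: Mecke's formula and invariance under resampling\<close>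

definition merge :: "('a::euclidean_space) set \<Rightarrow> 'a measure \<Rightarrow> 'a measure \<Rightarrow> 'a measure" where
  "merge C nu' nu = superpose (restr C nu') (restr (- C) nu)"

lemma merge_in_configs [simp]:
  "nu' \<in> configs \<Longrightarrow> nu \<in> configs \<Longrightarrow> C \<in> sets borel \<Longrightarrow> merge C nu' nu \<in> configs"
  unfolding merge_def by (intro superpose_in_configs restr_in_configs) auto

lemma measurable_merge [measurable (raw)]:
  "C \<in> sets borel \<Longrightarrow> f \<in> measurable Z confs \<Longrightarrow> g \<in> measurable Z confs \<Longrightarrow>
    (\<lambda>z. merge C (f z) (g z)) \<in> measurable Z confs"
  unfolding merge_def by (intro measurable_superpose measurable_restr) auto

lemma emeasure_merge:
  "nu' \<in> configs \<Longrightarrow> nu \<in> configs \<Longrightarrow> C \<in> sets borel \<Longrightarrow> A \<in> sets borel \<Longrightarrow>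
    emeasure (merge C nu' nu) A = emeasure nu' (C \<inter> A) + emeasure nu (- C \<inter> A)"
  unfolding merge_def by (subst emeasure_superpose) (auto simp: emeasure_restr)

text \<open>The product over disjoint cells encodes the Poisson marginals and their independence at
  once, and it determines the law by \<open>configs_measure_eqI\<close>. A cell of measure zero
  enters with \<open>0 ^ 0 = 1\<close>, so it carries no point almost surely.\<close>

locale poisson_law = Q: prob_space Q for Q :: "('a::euclidean_space) measure measure" +
  fixes \<Lambda> :: "'a measure"
  assumes sets_Q [simp, measurable_cong]: "sets Q = sets confs"
    and sets_\<Lambda> [simp, measurable_cong]: "sets \<Lambda> = sets borel"
    and \<Lambda>_finite: "A \<in> bounded_borel \<Longrightarrow> emeasure \<Lambda> A < \<infinity>"
    and Q_cylinder: "finite \<C> \<Longrightarrow> disjoint \<C> \<Longrightarrow> \<C> \<subseteq> bounded_borel \<Longrightarrow>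
      measure Q (cylinder \<C> k) =
        (\<Prod>C\<in>\<C>. measure \<Lambda> C ^ k C / fact (k C) * exp (- measure \<Lambda> C))"
begin

lemma space_Q [simp]: "space Q = configs"
  using sets_eq_imp_space_eq[OF sets_Q] by simp

lemma space_\<Lambda> [simp]: "space \<Lambda> = UNIV"
  using sets_eq_imp_space_eq[OF sets_\<Lambda>] by simp

lemma emeasure_Q_configs [simp]: "emeasure Q configs = 1"
  using Q.emeasure_space_1 by simp

lemma sigma_finite_\<Lambda>: "sigma_finite_measure \<Lambda>"
proof
  show "\<exists>A::'a set set. countable A \<and> A \<subseteq> sets \<Lambda> \<and> \<Union>A = space \<Lambda> \<and> (\<forall>a\<in>A. emeasure \<Lambda> a \<noteq> \<infinity>)"
  proof (intro exI conjI ballI)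
    show "countable (range (\<lambda>n. cball (0::'a) (real n)))" by simp
    show "\<Union>(range (\<lambda>n. cball (0::'a) (real n))) = space \<Lambda>" using UN_cball_nat by simp
    fix a assume "a \<in> range (\<lambda>n. cball (0::'a) (real n))"
    then have "a \<in> bounded_borel" by (auto simp: bounded_borel_def)
    then show "emeasure \<Lambda> a \<noteq> \<infinity>" using \<Lambda>_finite by (metis less_irrefl)
  qed auto
qed

sublocale \<Lambda>: sigma_finite_measure \<Lambda>
  by (rule sigma_finite_\<Lambda>)

sublocale \<Lambda>Q: pair_sigma_finite \<Lambda> Q ..

lemma emeasure_\<Lambda>: "A \<in> bounded_borel \<Longrightarrow> emeasure \<Lambda> A = ennreal (measure \<Lambda> A)"
  using \<Lambda>_finite[of A] by (intro emeasure_eq_ennreal_measure) auto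

lemma emeasure_cylinder:
  assumes "finite \<C>" "disjoint \<C>" "\<C> \<subseteq> bounded_borel"
  shows "emeasure Q (cylinder \<C> k) =
    ennreal (\<Prod>C\<in>\<C>. measure \<Lambda> C ^ k C / fact (k C) * exp (- measure \<Lambda> C))"
  using Q_cylinder[OF assms] by (simp add: Q.emeasure_eq_measure)

text \<open>
  Mecke's formula on cylinders: the Poisson weights satisfy
  \<open>n * (l ^ n / fact n) = l * (l ^ (n - 1) / fact (n - 1))\<close>.
\<close>

lemma cylinder_shift:
  assumes C: "finite \<C>" "disjoint \<C>" "\<C> \<subseteq> bounded_borel" "D \<in> \<C>"
  shows "(\<integral>\<^sup>+x. (\<integral>\<^sup>+nu. indicator (cylinder \<C> k) (add_point x nu) \<partial>Q) * indicator D x \<partial>\<Lambda>)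
    = of_nat (k D) * emeasure Q (cylinder \<C> k)"
proof -
  have D: "D \<in> bounded_borel" and [measurable]: "D \<in> sets borel"
    using C by (auto simp: bounded_borel_def)
  \<comment> \<open>Subtraction is truncated at 0. If \<open>k D\<close> is 0, the event cannot hold
    once a point of \<open>D\<close> has been added, and \<open>?q\<close> records this
    case.\<close>
  let ?k = "k(D := k D - 1)"
  let ?q = "if k D = 0 then 0 else emeasure Q (cylinder \<C> ?k)"
  have "(\<integral>\<^sup>+nu. indicator (cylinder \<C> k) (add_point x nu) \<partial>Q) = ?q" if x: "x \<in> D" for x
  proof -
    have mem: "add_point x nu \<in> cylinder \<C> k \<longleftrightarrow> k D \<noteq> 0 \<and> nu \<in> cylinder \<C> ?k" if nu: "nu \<in> configs" for nu
    proof -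
      \<comment> \<open>By disjointness a point of \<open>D\<close> lies in no other cell and raises
        the count of \<open>D\<close> alone.\<close>
      have e: "emeasure (add_point x nu) B = emeasure nu B + (if B = D then 1 else 0)" if "B \<in> \<C>" for B
      proof -
        have "x \<in> B \<longleftrightarrow> B = D" using C(2,4) that x by (auto simp: disjoint_def)
        then show ?thesis
          using C(3) that bounded_borelD(1) by (subst emeasure_add_point[OF nu]) auto
      qed
      obtain j :: nat where j: "emeasure nu D = of_nat j"
        using configs_count[OF nu bounded_borelD[OF D]] by blast
      have "emeasure nu D + 1 = of_nat (k D) \<longleftrightarrow> k D \<noteq> 0 \<and> emeasure nu D = of_nat (k D - 1)"
      proof -
        have "(of_nat j + 1 :: ennreal) = of_nat (Suc j)" by (simp add: add.commute)
        then have "(of_nat j + 1 :: ennreal) = of_nat (k D) \<longleftrightarrow> Suc j = k D"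
          by (metis of_nat_eq_iff)
        moreover have "(of_nat j :: ennreal) = of_nat (k D - 1) \<longleftrightarrow> j = k D - 1"
          by (metis of_nat_eq_iff)
        ultimately show ?thesis unfolding j by (cases "k D") auto
      qed
      then show ?thesis
        unfolding cylinder_def using e nu C(4) by (auto split: if_splits)
    qed
    have "(\<integral>\<^sup>+nu. indicator (cylinder \<C> k) (add_point x nu) \<partial>Q)
      = (\<integral>\<^sup>+nu. (if k D = 0 then 0 else indicator (cylinder \<C> ?k) nu) \<partial>Q)"
      using mem by (intro nn_integral_cong) (auto split: split_indicator)
    also have "... = ?q"
      using sets_cylinder[OF C(1,3)] by (cases "k D = 0") auto
    finally show ?thesis .
  qed
  then have "(\<integral>\<^sup>+x. (\<integral>\<^sup>+nu. indicator (cylinder \<C> k) (add_point x nu) \<partial>Q) * indicator D x \<partial>\<Lambda>)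
    = (\<integral>\<^sup>+x. ?q * indicator D x \<partial>\<Lambda>)"
    by (intro nn_integral_cong) (auto split: split_indicator)
  also have "... = ?q * ennreal (measure \<Lambda> D)"
    using D by (simp add: nn_integral_cmult emeasure_\<Lambda>)
  also have "... = of_nat (k D) * emeasure Q (cylinder \<C> k)"
  proof (cases "k D")
    case (Suc n)
    define p where "p = (\<Prod>C\<in>\<C>-{D}. measure \<Lambda> C ^ k C / fact (k C) * exp (- measure \<Lambda> C))"
    have p: "p \<ge> 0" unfolding p_def by (intro prod_nonneg) auto
    define a where "a = measure \<Lambda> D"
    have a: "a \<ge> 0" by (simp add: a_def)
    have 1: "emeasure Q (cylinder \<C> k) = ennreal (a ^ Suc n / fact (Suc n) * exp (- a) * p)"
      unfolding emeasure_cylinder[OF C(1-3)] p_def a_def prod.remove[OF C(1,4)] by (simp add: Suc)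
    have "(\<Prod>C\<in>\<C>-{D}. measure \<Lambda> C ^ ?k C / fact (?k C) * exp (- measure \<Lambda> C)) = p"
      unfolding p_def by (intro prod.cong) auto
    then have 2: "emeasure Q (cylinder \<C> ?k) = ennreal (a ^ n / fact n * exp (- a) * p)"
      unfolding emeasure_cylinder[OF C(1-3)] a_def prod.remove[OF C(1,4)] by (simp add: Suc)
    have "ennreal (a ^ n / fact n * exp (- a) * p) * ennreal a
      = ennreal (real (Suc n)) * ennreal (a ^ Suc n / fact (Suc n) * exp (- a) * p)"
      using p a by (simp add: ennreal_mult[symmetric] field_simps del: of_nat_Suc)
    then show ?thesis using 2 unfolding 1 Suc a_def[symmetric]
      by (simp add: ennreal_of_nat_eq_real_of_nat del: of_nat_Suc)
  qed simp
  finally show ?thesis .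
qed

text \<open>Mecke's formula as an equality of two measures: weighting a configuration by its number
  of points in \<open>A\<close> has the same effect as planting a point distributed according to
  \<Lambda> on \<open>A\<close>. In this form it can be checked on cylinders, where
  \<open>cylinder_shift\<close> is summed over the cells that make up \<open>A\<close>.\<close>

lemma mecke_bounded:
  assumes A: "A \<in> bounded_borel"
  shows "density Q (\<lambda>nu. emeasure nu A) = distr (restr A \<Lambda> \<Otimes>\<^sub>M Q) confs (\<lambda>(x, nu). add_point x nu)"
proof (rule configs_measure_eqI[OF _ _ A])
  have [measurable]: "A \<in> sets borel" using A by (rule bounded_borelD)
  show "sets (density Q (\<lambda>nu. emeasure nu A)) = sets confs" by simp
  show "sets (distr (restr A \<Lambda> \<Otimes>\<^sub>M Q) confs (\<lambda>(x, nu). add_point x nu)) = sets confs" by simp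
  have dens: "emeasure (density Q (\<lambda>nu. emeasure nu A)) (cylinder \<C> k)
      = (\<Sum>C\<in>{C\<in>\<C>. C \<subseteq> A}. of_nat (k C) * emeasure Q (cylinder \<C> k))"
    if C: "finite \<C>" "disjoint \<C>" "\<C> \<subseteq> bounded_borel" "A = \<Union>{C\<in>\<C>. C \<subseteq> A}" for \<C> k
  proof -
    note [measurable] = sets_cylinder[OF C(1,3)]
    have "emeasure (density Q (\<lambda>nu. emeasure nu A)) (cylinder \<C> k)
      = (\<integral>\<^sup>+nu. emeasure nu A * indicator (cylinder \<C> k) nu \<partial>Q)"
      by (intro emeasure_density) auto
    also have "... = (\<integral>\<^sup>+nu. (\<Sum>C\<in>{C\<in>\<C>. C \<subseteq> A}. of_nat (k C)) * indicator (cylinder \<C> k) nu \<partial>Q)"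
    proof (intro nn_integral_cong)
      fix nu assume "nu \<in> space Q"
      then have nu: "nu \<in> configs" by simp
      have "emeasure nu A = (\<Sum>C\<in>{C\<in>\<C>. C \<subseteq> A}. of_nat (k C))" if "nu \<in> cylinder \<C> k"
        unfolding emeasure_refinement[OF nu C] using that by (intro sum.cong) (auto simp: cylinder_def)
      then show "emeasure nu A * indicator (cylinder \<C> k) nu
         = (\<Sum>C\<in>{C\<in>\<C>. C \<subseteq> A}. of_nat (k C)) * indicator (cylinder \<C> k) nu"
        by (auto split: split_indicator)
    qed
    also have "... = (\<Sum>C\<in>{C\<in>\<C>. C \<subseteq> A}. of_nat (k C)) * emeasure Q (cylinder \<C> k)"
      by (subst nn_integral_cmult) auto
    finally show ?thesis by (simp add: sum_distrib_right)
  qed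
  {
    fix \<C> and k :: "'a set \<Rightarrow> nat"
    assume C: "finite \<C>" "disjoint \<C>" "\<C> \<subseteq> bounded_borel" "A = \<Union>{C\<in>\<C>. C \<subseteq> A}"
    note [measurable] = sets_cylinder[OF C(1,3)]
    let ?D = "{C\<in>\<C>. C \<subseteq> A}"
    have Dsets: "C \<in> ?D \<Longrightarrow> C \<in> sets borel" for C using C(3) bounded_borelD(1) by auto
    have ind: "indicator A x = (\<Sum>C\<in>?D. indicator C x :: ennreal)" for x
    proof -
      have "indicator (\<Union>C\<in>?D. id C) x = (\<Sum>C\<in>?D. indicator (id C) x :: ennreal)"
        using C(1,2) by (intro indicator_UN_disjoint) (auto simp: disjoint_family_on_def disjoint_def)
      then show ?thesis using C(4) by simp
    qed
    have "emeasure (distr (restr A \<Lambda> \<Otimes>\<^sub>M Q) confs (\<lambda>(x, nu). add_point x nu)) (cylinder \<C> k)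
      = (\<integral>\<^sup>+nu. indicator (cylinder \<C> k) nu \<partial>distr (restr A \<Lambda> \<Otimes>\<^sub>M Q) confs (\<lambda>(x, nu). add_point x nu))"
      by simp
    also have "... = (\<integral>\<^sup>+p. indicator (cylinder \<C> k) (add_point (fst p) (snd p)) \<partial>(restr A \<Lambda> \<Otimes>\<^sub>M Q))"
      by (subst nn_integral_distr) (auto simp: case_prod_beta)
    also have "... = (\<integral>\<^sup>+x. \<integral>\<^sup>+nu. indicator (cylinder \<C> k) (add_point x nu) \<partial>Q \<partial>restr A \<Lambda>)"
      by (subst Q.nn_integral_fst[symmetric]) auto
    also have "... = (\<integral>\<^sup>+x. indicator A x * (\<integral>\<^sup>+nu. indicator (cylinder \<C> k) (add_point x nu) \<partial>Q) \<partial>\<Lambda>)"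
      by (subst nn_integral_density) auto
    also have "... = (\<integral>\<^sup>+x. (\<Sum>C\<in>?D. (\<integral>\<^sup>+nu. indicator (cylinder \<C> k) (add_point x nu) \<partial>Q) * indicator C x) \<partial>\<Lambda>)"
      by (intro nn_integral_cong) (simp add: ind sum_distrib_left mult.commute)
    also have "... = (\<Sum>C\<in>?D. \<integral>\<^sup>+x. (\<integral>\<^sup>+nu. indicator (cylinder \<C> k) (add_point x nu) \<partial>Q) * indicator C x \<partial>\<Lambda>)"
    proof (rule nn_integral_sum)
      fix C assume "C \<in> ?D"
      then have [measurable]: "C \<in> sets borel" by (rule Dsets)
      show "(\<lambda>x. (\<integral>\<^sup>+nu. indicator (cylinder \<C> k) (add_point x nu) \<partial>Q) * indicator C x) \<in> borel_measurable \<Lambda>"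
        by measurable
    qed
    also have "... = (\<Sum>C\<in>?D. of_nat (k C) * emeasure Q (cylinder \<C> k))"
      using cylinder_shift[OF C(1-3)] by (intro sum.cong) auto
    also have "... = emeasure (density Q (\<lambda>nu. emeasure nu A)) (cylinder \<C> k)"
      using dens[OF C] by simp
    finally show "emeasure (density Q (\<lambda>nu. emeasure nu A)) (cylinder \<C> k)
      = emeasure (distr (restr A \<Lambda> \<Otimes>\<^sub>M Q) confs (\<lambda>(x, nu). add_point x nu)) (cylinder \<C> k)" by simp
  }
  fix k
  have "emeasure (density Q (\<lambda>nu. emeasure nu A)) (cylinder {A} k)
      = (\<Sum>C\<in>{C\<in>{A}. C \<subseteq> A}. of_nat (k C) * emeasure Q (cylinder {A} k))"
    using A by (intro dens) (auto simp: disjoint_def)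
  also have "{C\<in>{A}. C \<subseteq> A} = {A}" by auto
  finally show "emeasure (density Q (\<lambda>nu. emeasure nu A)) (cylinder {A} k) \<noteq> \<infinity>"
    by (simp add: ennreal_mult_eq_top_iff Q.emeasure_eq_measure of_nat_less_top less_top[symmetric])
qed

text \<open>Complete independence in a form that can be applied to functionals. On cylinders that
  refine \<open>C\<close> the probability of the merged configuration factors into the cells inside
  \<open>C\<close> and the cells outside.\<close>

lemma resample:
  assumes C: "C \<in> bounded_borel"
  shows "distr (Q \<Otimes>\<^sub>M Q) confs (\<lambda>(nu', nu). merge C nu' nu) = Q"
proof (rule configs_measure_eqI[OF _ _ C])
  have [measurable]: "C \<in> sets borel" using C by (rule bounded_borelD)
  show "emeasure (distr (Q \<Otimes>\<^sub>M Q) confs (\<lambda>(nu', nu). merge C nu' nu)) (cylinder {C} k) \<noteq> \<infinity>" for k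
  proof -
    have "prob_space (distr (Q \<Otimes>\<^sub>M Q) confs (\<lambda>(nu', nu). merge C nu' nu))"
    proof (rule prob_space.prob_space_distr)
      interpret QQ: pair_prob_space Q Q ..
      show "prob_space (Q \<Otimes>\<^sub>M Q)" by (rule QQ.prob_space_axioms)
    qed measurable
    then interpret D: prob_space "distr (Q \<Otimes>\<^sub>M Q) confs (\<lambda>(nu', nu). merge C nu' nu)" .
    show ?thesis by (simp add: D.emeasure_eq_measure)
  qed
  fix \<C> and k :: "'a set \<Rightarrow> nat"
  assume F: "finite \<C>" "disjoint \<C>" "\<C> \<subseteq> bounded_borel" "C = \<Union>{B\<in>\<C>. B \<subseteq> C}"
  note [measurable] = sets_cylinder[OF F(1,3)]
  let ?D = "{B\<in>\<C>. B \<subseteq> C}"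
  have D: "finite ?D" "disjoint ?D" "?D \<subseteq> bounded_borel" and D': "finite (\<C>-?D)" "disjoint (\<C>-?D)" "\<C>-?D \<subseteq> bounded_borel"
    using F(1-3) by (auto simp: disjoint_def)
  have out: "B \<inter> C = {}" if "B \<in> \<C> - ?D" for B
  proof (rule ccontr)
    assume "B \<inter> C \<noteq> {}"
    then obtain x where x: "x \<in> B" "x \<in> C" by auto
    then obtain B' where "B' \<in> ?D" "x \<in> B'" using F(4) by blast
    then have "B = B'" using x that F(2) by (auto simp: disjoint_def)
    then show False using that \<open>B' \<in> ?D\<close> by simp
  qed
  have mem: "merge C nu' nu \<in> cylinder \<C> k \<longleftrightarrow> nu' \<in> cylinder ?D k \<and> nu \<in> cylinder (\<C> - ?D) k"
    if c: "nu' \<in> configs" "nu \<in> configs" for nu' nu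
  proof -
    have "emeasure (merge C nu' nu) B = (if B \<in> ?D then emeasure nu' B else emeasure nu B)" if "B \<in> \<C>" for B
    proof (cases "B \<in> ?D")
      case True
      then have "C \<inter> B = B" "- C \<inter> B = {}" by auto
      then show ?thesis using True bounded_borelD(1)[OF subsetD[OF F(3) that]] by (subst emeasure_merge[OF c]) auto
    next
      case False
      then have "C \<inter> B = {}" "- C \<inter> B = B" using out[of B] that by auto
      then show ?thesis using False bounded_borelD(1)[OF subsetD[OF F(3) that]] by (subst emeasure_merge[OF c]) auto
    qed
    then show ?thesis using c by (auto simp: cylinder_def)
  qed
  have "emeasure (distr (Q \<Otimes>\<^sub>M Q) confs (\<lambda>(nu', nu). merge C nu' nu)) (cylinder \<C> k)
    = emeasure (Q \<Otimes>\<^sub>M Q) ((\<lambda>(nu', nu). merge C nu' nu) -` cylinder \<C> k \<inter> space (Q \<Otimes>\<^sub>M Q))"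
    by (intro emeasure_distr) auto
  also have "(\<lambda>(nu', nu). merge C nu' nu) -` cylinder \<C> k \<inter> space (Q \<Otimes>\<^sub>M Q) = cylinder ?D k \<times> cylinder (\<C> - ?D) k"
    using mem by (auto simp: space_pair_measure) (auto simp: cylinder_def)
  also have "emeasure (Q \<Otimes>\<^sub>M Q) (cylinder ?D k \<times> cylinder (\<C> - ?D) k)
    = emeasure Q (cylinder ?D k) * emeasure Q (cylinder (\<C> - ?D) k)"
    using sets_cylinder[OF D(1,3)] sets_cylinder[OF D'(1,3)] by (intro Q.emeasure_pair_measure_Times) auto
  also have "... = emeasure Q (cylinder \<C> k)"
    unfolding emeasure_cylinder[OF D] emeasure_cylinder[OF D'] emeasure_cylinder[OF F(1-3)]
    by (subst prod.subset_diff[of ?D \<C>]) (use F in \<open>auto simp: ennreal_mult[symmetric] prod_nonneg mult.commute\<close>)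
  finally show "emeasure (distr (Q \<Otimes>\<^sub>M Q) confs (\<lambda>(nu', nu). merge C nu' nu)) (cylinder \<C> k) = emeasure Q (cylinder \<C> k)" .
qed (use sets_Q in auto)

text \<open>A monotone class argument from rectangles, where \<open>mecke_bounded\<close> applies.
  It is localized to balls, since the complement step cancels a common term and this is possible for
  finite values only.\<close>

theorem mecke:
  assumes "g \<in> borel_measurable (borel \<Otimes>\<^sub>M confs)"
  shows "(\<integral>\<^sup>+nu. \<integral>\<^sup>+x. g (x, nu) \<partial>nu \<partial>Q) = (\<integral>\<^sup>+x. \<integral>\<^sup>+nu. g (x, add_point x nu) \<partial>Q \<partial>\<Lambda>)"
proof -
  define L where "L g = (\<integral>\<^sup>+nu. \<integral>\<^sup>+x. g (x, nu) \<partial>nu \<partial>Q)" for g :: "'a \<times> 'a measure \<Rightarrow> ennreal"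
  define R where "R g = (\<integral>\<^sup>+x. \<integral>\<^sup>+nu. g (x, add_point x nu) \<partial>Q \<partial>\<Lambda>)" for g :: "'a \<times> 'a measure \<Rightarrow> ennreal"
  let ?B = "borel \<Otimes>\<^sub>M confs :: ('a \<times> 'a measure) measure"
  have cut: "(\<lambda>x. g (x, nu)) \<in> borel_measurable nu" if "g \<in> borel_measurable ?B" "nu \<in> configs"
    for g :: "_ \<Rightarrow> ennreal" and nu
  proof -
    have "(\<lambda>x. g (x, nu)) \<in> borel_measurable borel"
      using measurable_compose[OF measurable_Pair2'[of nu confs borel] that(1)] that(2) by simp
    then show ?thesis using measurable_cong_sets[OF sets_configs[OF that(2)] refl] by blast
  qed
  have L_cmult: "L (\<lambda>p. c * g p) = c * L g" if [measurable]: "g \<in> borel_measurable ?B" for g c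
  proof -
    have "L (\<lambda>p. c * g p) = (\<integral>\<^sup>+nu. c * (\<integral>\<^sup>+x. g (x, nu) \<partial>nu) \<partial>Q)"
      unfolding L_def by (intro nn_integral_cong nn_integral_cmult cut) auto
    also have "... = c * L g" unfolding L_def by (intro nn_integral_cmult) measurable
    finally show ?thesis .
  qed
  have R_cmult: "R (\<lambda>p. c * g p) = c * R g" if [measurable]: "g \<in> borel_measurable ?B" for g c
    unfolding R_def by (simp add: nn_integral_cmult)
  have L_add: "L (\<lambda>p. f p + g p) = L f + L g"
    if [measurable]: "f \<in> borel_measurable ?B" "g \<in> borel_measurable ?B" for f g
  proof -
    have "L (\<lambda>p. f p + g p) = (\<integral>\<^sup>+nu. (\<integral>\<^sup>+x. f (x, nu) \<partial>nu) + (\<integral>\<^sup>+x. g (x, nu) \<partial>nu) \<partial>Q)"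
      unfolding L_def by (intro nn_integral_cong nn_integral_add cut) auto
    also have "... = L f + L g" unfolding L_def by (intro nn_integral_add) measurable
    finally show ?thesis .
  qed
  have R_add: "R (\<lambda>p. f p + g p) = R f + R g"
    if [measurable]: "f \<in> borel_measurable ?B" "g \<in> borel_measurable ?B" for f g
    unfolding R_def by (simp add: nn_integral_add)
  have L_SUP: "L (\<lambda>p. SUP i. U i p) = (SUP i. L (U i))"
    if U [measurable]: "\<And>i::nat. U i \<in> borel_measurable ?B" and inc: "\<And>p. incseq (\<lambda>i. U i p)" for U
  proof -
    have "L (\<lambda>p. SUP i. U i p) = (\<integral>\<^sup>+nu. (SUP i. \<integral>\<^sup>+x. U i (x, nu) \<partial>nu) \<partial>Q)"
      unfolding L_def
      by (intro nn_integral_cong nn_integral_monotone_convergence_SUP cut[OF U])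
         (use inc in \<open>auto simp: incseq_def le_fun_def\<close>)
    also have "... = (SUP i. L (U i))" unfolding L_def
      by (intro nn_integral_monotone_convergence_SUP)
         (use inc in \<open>auto simp: incseq_def le_fun_def intro!: nn_integral_mono\<close>)
    finally show ?thesis .
  qed
  have R_SUP: "R (\<lambda>p. SUP i. U i p) = (SUP i. R (U i))"
    if U [measurable]: "\<And>i::nat. U i \<in> borel_measurable ?B" and inc: "\<And>p. incseq (\<lambda>i. U i p)" for U
  proof -
    have "R (\<lambda>p. SUP i. U i p) = (\<integral>\<^sup>+x. (SUP i. \<integral>\<^sup>+nu. U i (x, add_point x nu) \<partial>Q) \<partial>\<Lambda>)"
      unfolding R_def
      by (intro nn_integral_cong nn_integral_monotone_convergence_SUP)
         (use inc in \<open>auto simp: incseq_def le_fun_def\<close>)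
    also have "... = (SUP i. R (U i))" unfolding R_def
      by (intro nn_integral_monotone_convergence_SUP)
         (use inc in \<open>auto simp: incseq_def le_fun_def intro!: nn_integral_mono\<close>)
    finally show ?thesis .
  qed
  have L_suminf: "L (\<lambda>p. \<Sum>i. U i p) = (\<Sum>i. L (U i))" if U [measurable]: "\<And>i::nat. U i \<in> borel_measurable ?B" for U
  proof -
    have "L (\<lambda>p. \<Sum>i. U i p) = (\<integral>\<^sup>+nu. (\<Sum>i. \<integral>\<^sup>+x. U i (x, nu) \<partial>nu) \<partial>Q)"
      unfolding L_def by (intro nn_integral_cong nn_integral_suminf cut) auto
    also have "... = (\<Sum>i. L (U i))" unfolding L_def by (intro nn_integral_suminf) measurable
    finally show ?thesis .
  qed
  have R_suminf: "R (\<lambda>p. \<Sum>i. U i p) = (\<Sum>i. R (U i))" if U [measurable]: "\<And>i::nat. U i \<in> borel_measurable ?B" for U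
    unfolding R_def by (simp add: nn_integral_suminf)
  have rect: "L (\<lambda>p. indicator (a \<times> b) p * indicator (cball 0 r) (fst p)) = R (\<lambda>p. indicator (a \<times> b) p * indicator (cball 0 r) (fst p))
      \<and> L (\<lambda>p. indicator (a \<times> b) p * indicator (cball 0 r) (fst p)) < \<infinity>"
    if [measurable]: "a \<in> sets borel" "b \<in> sets confs" for a :: "'a set" and b r
  proof -
    have ab: "a \<inter> cball 0 r \<in> bounded_borel" by (auto simp: bounded_borel_def)
    have "L (\<lambda>p. indicator (a \<times> b) p * indicator (cball 0 r) (fst p)) = (\<integral>\<^sup>+nu. emeasure nu (a \<inter> cball 0 r) * indicator b nu \<partial>Q)"
      unfolding L_def
    proof (intro nn_integral_cong)
      fix nu assume "nu \<in> space Q"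
      then have nu: "nu \<in> configs" by simp
      have "(\<integral>\<^sup>+x. indicator (a \<times> b) (x, nu) * indicator (cball 0 r) (fst (x, nu)) \<partial>nu) = (\<integral>\<^sup>+x. indicator (a \<inter> cball 0 r) x * indicator b nu \<partial>nu)"
        by (intro nn_integral_cong) (auto split: split_indicator)
      also have "... = emeasure nu (a \<inter> cball 0 r) * indicator b nu"
        using nu by (subst nn_integral_multc) (auto simp: measurable_cong_sets[OF sets_configs refl])
      finally show "(\<integral>\<^sup>+x. indicator (a \<times> b) (x, nu) * indicator (cball 0 r) (fst (x, nu)) \<partial>nu) = emeasure nu (a \<inter> cball 0 r) * indicator b nu" .
    qed
    also have "... = emeasure (density Q (\<lambda>nu. emeasure nu (a \<inter> cball 0 r))) b"
      by (subst emeasure_density) auto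
    finally have 1: "L (\<lambda>p. indicator (a \<times> b) p * indicator (cball 0 r) (fst p)) = emeasure (density Q (\<lambda>nu. emeasure nu (a \<inter> cball 0 r))) b" .
    have 2: "emeasure (distr (restr (a \<inter> cball 0 r) \<Lambda> \<Otimes>\<^sub>M Q) confs (\<lambda>(x, nu). add_point x nu)) b = (\<integral>\<^sup>+x. indicator (a \<inter> cball 0 r) x * (\<integral>\<^sup>+nu. indicator b (add_point x nu) \<partial>Q) \<partial>\<Lambda>)"
    proof -
      have "emeasure (distr (restr (a \<inter> cball 0 r) \<Lambda> \<Otimes>\<^sub>M Q) confs (\<lambda>(x, nu). add_point x nu)) b
        = (\<integral>\<^sup>+nu. indicator b nu \<partial>distr (restr (a \<inter> cball 0 r) \<Lambda> \<Otimes>\<^sub>M Q) confs (\<lambda>(x, nu). add_point x nu))"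
        by simp
      also have "... = (\<integral>\<^sup>+p. indicator b (add_point (fst p) (snd p)) \<partial>(restr (a \<inter> cball 0 r) \<Lambda> \<Otimes>\<^sub>M Q))"
        by (subst nn_integral_distr) (auto simp: case_prod_beta)
      also have "... = (\<integral>\<^sup>+x. \<integral>\<^sup>+nu. indicator b (add_point x nu) \<partial>Q \<partial>restr (a \<inter> cball 0 r) \<Lambda>)"
        by (subst Q.nn_integral_fst[symmetric]) auto
      finally show ?thesis by (simp add: nn_integral_density)
    qed
    have "... = R (\<lambda>p. indicator (a \<times> b) p * indicator (cball 0 r) (fst p))"
      unfolding R_def
      by (intro nn_integral_cong, subst nn_integral_cmult[symmetric]) (auto intro!: nn_integral_cong split: split_indicator)
    moreover have "(\<integral>\<^sup>+x. indicator (a \<inter> cball 0 r) x * (\<integral>\<^sup>+nu. indicator b (add_point x nu) \<partial>Q) \<partial>\<Lambda>) < \<infinity>"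
    proof -
      have "(\<integral>\<^sup>+nu. indicator b (add_point x nu) \<partial>Q) \<le> (\<integral>\<^sup>+nu. 1 \<partial>Q)" for x
        by (intro nn_integral_mono) (auto split: split_indicator)
      then have "(\<integral>\<^sup>+x. indicator (a \<inter> cball 0 r) x * (\<integral>\<^sup>+nu. indicator b (add_point x nu) \<partial>Q) \<partial>\<Lambda>) \<le> (\<integral>\<^sup>+x. indicator (a \<inter> cball 0 r) x \<partial>\<Lambda>)"
        by (intro nn_integral_mono) (auto split: split_indicator)
      also have "... < \<infinity>" using \<Lambda>_finite[OF ab] by simp
      finally show ?thesis .
    qed
    ultimately show ?thesis using 1 2 mecke_bounded[OF ab] by simp
  qed
  have set_r: "L (\<lambda>p. indicator X p * indicator (cball 0 r) (fst p)) = R (\<lambda>p. indicator X p * indicator (cball 0 r) (fst p))"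
    if "X \<in> sets ?B" for X r
  proof -
    have "X \<in> sigma_sets (space borel \<times> space confs) {a \<times> b |a b. a \<in> sets (borel::'a measure) \<and> b \<in> sets confs}"
      using that by (simp only: sets_pair_measure)
    from Int_stable_pair_measure_generator pair_measure_closed this show ?thesis
    proof (induction rule: sigma_sets_induct_disjoint)
      case (basic A) then show ?case using rect by auto
    next
      case empty then show ?case by (simp add: L_def R_def)
    next
      case (compl A)
      then have [measurable]: "A \<in> sets ?B" by (simp only: sets_pair_measure)
      let ?i = "\<lambda>X p. indicator X p * indicator (cball 0 r) (fst p) :: ennreal"
      let ?S = "space borel \<times> space confs :: ('a \<times> 'a measure) set"
      have [measurable]: "?S \<in> sets ?B" by (metis space_pair_measure sets.top)
      have "?i ?S p = ?i A p + ?i (?S - A) p" if "p \<in> ?S" for p using that by (auto split: split_indicator)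
      then have "L (?i ?S) = L (\<lambda>p. ?i A p + ?i (?S - A) p)" "R (?i ?S) = R (\<lambda>p. ?i A p + ?i (?S - A) p)"
        unfolding L_def R_def by (auto intro!: nn_integral_cong)
      moreover have "L (?i ?S) = R (?i ?S) \<and> L (?i ?S) < \<infinity>"
        using rect[of UNIV configs r] sets.top[of confs] by simp
      moreover have "L (\<lambda>p. ?i A p + ?i (?S - A) p) = L (?i A) + L (?i (?S - A))"
        "R (\<lambda>p. ?i A p + ?i (?S - A) p) = R (?i A) + R (?i (?S - A))"
        by (intro L_add R_add; measurable)+
      moreover define a l r where "a = L (?i A)" and "l = L (?i (?S - A))" and "r = R (?i (?S - A))"
      moreover have "R (?i A) = a" using compl.IH by (simp only: a_def)
      ultimately have "a + l = a + r" "a + l < \<infinity>" by metis+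
      \<comment> \<open>Extended nonnegative reals cancel on the left only if the cancelled term is
        finite.\<close>
      then have "l = r" by (auto simp: ennreal_add_left_cancel)
      then show ?case by (simp only: l_def r_def)
    next
      case (union A)
      then have [measurable]: "A i \<in> sets ?B" for i by (auto simp only: sets_pair_measure)
      have "indicator (\<Union>(range A)) p * indicator (cball 0 r) (fst p) = (\<Sum>i. indicator (A i) p * indicator (cball 0 r) (fst p) :: ennreal)" for p
        by (simp add: suminf_indicator[OF union(1), symmetric])
      moreover have "L (\<lambda>p. \<Sum>i. indicator (A i) p * indicator (cball 0 r) (fst p))
        = R (\<lambda>p. \<Sum>i. indicator (A i) p * indicator (cball 0 r) (fst p))"
        using union.IH by (subst L_suminf R_suminf, measurable)+
      ultimately show ?case by (simp only:)
    qed
  qed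
  have indic: "L (indicator X) = R (indicator X)" if [measurable]: "X \<in> sets ?B" for X
  proof -
    have *: "indicator X p = (SUP n. indicator X p * indicator (cball 0 (real n)) (fst p) :: ennreal)" for p
    proof (rule antisym)
      obtain n :: nat where "norm (fst p) \<le> real n" using real_arch_simple by auto
      then show "indicator X p \<le> (SUP n. indicator X p * indicator (cball 0 (real n)) (fst p) :: ennreal)"
        by (intro SUP_upper2[of n]) auto
    qed (auto intro!: SUP_least split: split_indicator)
    have inc: "incseq (\<lambda>n. indicator X p * indicator (cball 0 (real n)) (fst p) :: ennreal)" for p
      by (auto simp: incseq_def split: split_indicator)
    have "L (indicator X) = L (\<lambda>p. SUP n. indicator X p * indicator (cball 0 (real n)) (fst p))"
      by (subst *[abs_def]) (rule refl)
    also have "... = (SUP n. L (\<lambda>p. indicator X p * indicator (cball 0 (real n)) (fst p)))"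
      by (intro L_SUP inc) measurable
    also have "... = (SUP n. R (\<lambda>p. indicator X p * indicator (cball 0 (real n)) (fst p)))"
      by (simp add: set_r[OF that])
    also have "... = R (\<lambda>p. SUP n. indicator X p * indicator (cball 0 (real n)) (fst p))"
      by (intro R_SUP[symmetric] inc) measurable
    also have "... = R (indicator X)"
      by (subst (2) *[abs_def]) (rule refl)
    finally show ?thesis .
  qed
  have "L g = R g" using assms
  proof (induction rule: borel_measurable_induct)
    case (cong f g)
    have eq: "f (x, nu) = g (x, nu)" if "nu \<in> configs" for x nu
      using cong(3)[of "(x, nu)"] that by (simp add: space_pair_measure)
    have "L f = L g" unfolding L_def by (intro nn_integral_cong) (simp add: eq)
    moreover have "R f = R g" unfolding R_def by (intro nn_integral_cong) (simp add: eq)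
    ultimately show ?case using cong(4) by simp
  next
    case (set A) then show ?case by (rule indic)
  next
    case (mult u c) then show ?case by (simp add: L_cmult R_cmult)
  next
    case (add u v) then show ?case by (simp add: L_add R_add)
  next
    case (seq U)
    have "\<And>p. incseq (\<lambda>i. U i p)" using seq(3) by (auto simp: incseq_def le_fun_def)
    then have "L (\<lambda>p. SUP i. U i p) = R (\<lambda>p. SUP i. U i p)"
      using seq by (simp add: L_SUP R_SUP)
    then show ?case by (simp add: SUP_apply[abs_def] image_image)
  qed
  then show ?thesis by (simp add: L_def R_def)
qed

end

section \<open>The Poincare inequality\<close>

definition depends :: "('a::euclidean_space) set \<Rightarrow> ('a measure \<Rightarrow> 'b) \<Rightarrow> bool" where
  "depends A X \<longleftrightarrow> (\<forall>nu\<in>configs. X (restr A nu) = X nu)"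

lemma restr_restr:
  "nu \<in> configs \<Longrightarrow> A \<in> sets borel \<Longrightarrow> B \<in> sets borel \<Longrightarrow> restr A (restr B nu) = restr (A \<inter> B) nu"
  by (rule configs_eqI) (auto simp: emeasure_restr Int_ac)

lemma depends_Int:
  assumes "depends A X" "depends B X" "A \<in> sets borel" "B \<in> sets borel"
  shows "depends (A \<inter> B) X"
  unfolding depends_def
proof
  fix nu :: "'a measure" assume nu: "nu \<in> configs"
  have "X (restr (A \<inter> B) nu) = X (restr A (restr B nu))" using assms nu by (simp add: restr_restr)
  also have "... = X (restr B nu)" using assms(1,4) nu by (simp add: depends_def)
  also have "... = X nu" using assms(2) nu by (simp add: depends_def)
  finally show "X (restr (A \<inter> B) nu) = X nu" .
qed

lemma merge_restr_same:
  "nu' \<in> configs \<Longrightarrow> nu \<in> configs \<Longrightarrow> C \<in> sets borel \<Longrightarrow> merge C nu' (restr (- C) nu) = merge C nu' nu"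
  by (rule configs_eqI) (auto simp: emeasure_merge emeasure_restr Int_ac)

lemma restr_merge_same:
  "nu' \<in> configs \<Longrightarrow> nu \<in> configs \<Longrightarrow> C \<in> sets borel \<Longrightarrow> restr (- C) (merge C nu' nu) = restr (- C) nu"
  by (rule configs_eqI) (auto simp: emeasure_merge emeasure_restr Int_ac Int_assoc[symmetric])

lemma merge_restr_subset:
  assumes "nu' \<in> configs" "nu \<in> configs" "D \<in> sets borel" "A \<in> sets borel" "D \<subseteq> A"
  shows "merge D nu' (restr A nu) = restr A (merge D nu' nu)"
proof (rule configs_eqI)
  fix B :: "'a set" assume "B \<in> sets borel"
  moreover have "D \<inter> (A \<inter> B) = D \<inter> B" "A \<inter> (- D \<inter> B) = - D \<inter> (A \<inter> B)" using assms by auto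
  ultimately show "emeasure (merge D nu' (restr A nu)) B = emeasure (restr A (merge D nu' nu)) B"
    using assms by (simp add: emeasure_merge emeasure_restr)
qed (use assms in auto)

lemma restr_add_point_outside:
  "nu \<in> configs \<Longrightarrow> A \<in> sets borel \<Longrightarrow> x \<notin> A \<Longrightarrow> restr A (add_point x nu) = restr A nu"
  by (rule configs_eqI) (auto simp: emeasure_restr emeasure_add_point)

lemma restr_null:
  assumes "nu \<in> configs" "C \<in> sets borel" "emeasure nu C = 0"
  shows "restr (- C) nu = nu"
proof (rule configs_eqI)
  fix A :: "'a set" assume A: "A \<in> sets borel"
  have "emeasure nu (C \<inter> A) \<le> emeasure nu C" using assms by (intro emeasure_mono) auto
  then have "emeasure nu (C \<inter> A) = 0" using assms by simp
  moreover have "emeasure nu A = emeasure nu (C \<inter> A) + emeasure nu (- C \<inter> A)"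
    using assms A by (subst plus_emeasure) (auto intro!: arg_cong[where f="emeasure nu"])
  ultimately show "emeasure (restr (- C) nu) A = emeasure nu A"
    using assms A by (simp add: emeasure_restr)
qed (use assms in auto)

context poisson_law begin

lemma prob_configs [simp]: "measure Q configs = 1"
  using Q.prob_space by simp

text \<open>
  By independence over disjoint sets this is the conditional expectation of \<open>X\<close> given the
  configuration outside \<open>C\<close>.
\<close>

definition resampled :: "'a set \<Rightarrow> ('a measure \<Rightarrow> real) \<Rightarrow> 'a measure \<Rightarrow> real" where
  "resampled C X nu = (LINT nu'|Q. X (merge C nu' nu))"

text \<open>The bound holds at every configuration and not just almost everywhere, because the
  functional is evaluated at merged, thinned and augmented configurations.\<close>

definition bfun :: "real \<Rightarrow> ('a measure \<Rightarrow> real) \<Rightarrow> bool" where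
  "bfun c X \<longleftrightarrow> X \<in> borel_measurable confs \<and> (\<forall>nu\<in>configs. \<bar>X nu\<bar> \<le> c)"

lemma bfun_measurable: "bfun c X \<Longrightarrow> X \<in> borel_measurable confs"
  by (simp add: bfun_def)

lemma bfun_integrable: "bfun c X \<Longrightarrow> integrable Q X"
  by (rule Q.integrable_const_bound[of _ c]) (auto simp: bfun_def)

lemma bfun_mult:
  assumes "bfun c X" "bfun d Y" shows "bfun (c * d) (\<lambda>nu. X nu * Y nu)"
proof -
  have "\<bar>X nu * Y nu\<bar> \<le> c * d" if "nu \<in> configs" for nu
  proof -
    have "\<bar>X nu\<bar> \<le> c" "\<bar>Y nu\<bar> \<le> d" using assms that by (auto simp: bfun_def)
    then show ?thesis unfolding abs_mult by (intro mult_mono) auto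
  qed
  then show ?thesis using assms by (auto simp: bfun_def)
qed

lemma bfun_diff: "bfun c X \<Longrightarrow> bfun d Y \<Longrightarrow> bfun (c + d) (\<lambda>nu. X nu - Y nu)"
  by (auto simp: bfun_def intro!: order_trans[OF abs_triangle_ineq4] add_mono)

lemma bfun_square_integrable: "bfun c X \<Longrightarrow> integrable Q (\<lambda>nu. (X nu)\<^sup>2)"
  using bfun_integrable[OF bfun_mult] by (simp add: power2_eq_square)

lemma bfun_resampled:
  assumes C: "C \<in> sets borel" and X: "bfun c X"
  shows "bfun c (resampled C X)"
proof -
  note [measurable] = bfun_measurable[OF X] C
  have "\<bar>resampled C X nu\<bar> \<le> c" if "nu \<in> configs" for nu
  proof -
    have "\<bar>resampled C X nu\<bar> \<le> (LINT nu'|Q. c)"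
      unfolding resampled_def
      using X that C by (intro Bochner_Integration.integral_abs_bound[THEN order_trans] integral_mono'
        ) (auto simp: bfun_def)
    then show ?thesis by simp
  qed
  moreover have "resampled C X \<in> borel_measurable confs"
    unfolding resampled_def by measurable
  ultimately show ?thesis by (simp add: bfun_def)
qed

lemma bfun_restr: "A \<in> sets borel \<Longrightarrow> bfun c X \<Longrightarrow> bfun c (\<lambda>nu. X (restr A nu))"
  by (auto simp: bfun_def intro!: measurable_compose[OF measurable_restr, of A "\<lambda>nu. nu"])

lemma integral_resampled:
  assumes C: "C \<in> bounded_borel" and X: "bfun c X"
  shows "(LINT nu|Q. resampled C X nu) = (LINT nu|Q. X nu)"
proof -
  note [measurable] = bfun_measurable[OF X] bounded_borelD(1)[OF C]
  interpret QQ: pair_prob_space Q Q ..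
  have int: "integrable (Q \<Otimes>\<^sub>M Q) (\<lambda>(nu', nu). X (merge C nu' nu))"
  proof (rule QQ.P.integrable_const_bound[of _ c])
    show "AE p in Q \<Otimes>\<^sub>M Q. norm (case p of (nu', nu) \<Rightarrow> X (merge C nu' nu)) \<le> c"
      using X bounded_borelD(1)[OF C] by (intro AE_I2) (auto simp: bfun_def space_pair_measure)
  qed measurable
  have "(LINT nu|Q. X nu) = (LINT nu|distr (Q \<Otimes>\<^sub>M Q) confs (\<lambda>(nu', nu). merge C nu' nu). X nu)"
    by (simp add: resample[OF C])
  also have "... = (LINT p|(Q \<Otimes>\<^sub>M Q). X (case p of (nu', nu) \<Rightarrow> merge C nu' nu))"
    by (subst integral_distr) auto
  also have "... = (LINT p|(Q \<Otimes>\<^sub>M Q). (case p of (nu', nu) \<Rightarrow> X (merge C nu' nu)))"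
    by (intro Bochner_Integration.integral_cong) auto
  also have "... = (LINT nu|Q. LINT nu'|Q. X (merge C nu' nu))"
    using QQ.integral_snd[OF int] by simp
  finally show ?thesis by (simp add: resampled_def)
qed

text \<open>The pull-out property of conditional expectations: \<open>Y\<close> does not change when
  \<open>C\<close> is resampled, so it leaves the inner integral.\<close>

lemma integral_resampled_mult:
  assumes C: "C \<in> bounded_borel" and X: "bfun c X" and Y: "bfun d Y" "depends (- C) Y"
  shows "(LINT nu|Q. X nu * Y nu) = (LINT nu|Q. resampled C X nu * Y nu)"
proof -
  have Cb: "C \<in> sets borel" using C by (rule bounded_borelD)
  have "(LINT nu|Q. X nu * Y nu) = (LINT nu|Q. resampled C (\<lambda>nu. X nu * Y nu) nu)"
    by (rule integral_resampled[OF C bfun_mult[OF X Y(1)], symmetric])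
  also have "... = (LINT nu|Q. resampled C X nu * Y nu)"
  proof (intro Bochner_Integration.integral_cong refl)
    fix nu assume "nu \<in> space Q"
    then have nu: "nu \<in> configs" by simp
    have "Y (merge C nu' nu) = Y nu" if "nu' \<in> configs" for nu'
      using Y(2) that nu Cb restr_merge_same[OF that nu Cb] unfolding depends_def
      by (metis merge_in_configs)
    then have "resampled C (\<lambda>nu. X nu * Y nu) nu = (LINT nu'|Q. X (merge C nu' nu) * Y nu)"
      unfolding resampled_def by (intro Bochner_Integration.integral_cong) auto
    then show "resampled C (\<lambda>nu. X nu * Y nu) nu = resampled C X nu * Y nu"
      by (simp add: resampled_def)
  qed
  finally show ?thesis .
qed

lemma depends_resampled_same:
  assumes "C \<in> sets borel" shows "depends (- C) (resampled C X)"
  unfolding depends_def resampled_def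
  using assms by (auto intro!: Bochner_Integration.integral_cong simp: merge_restr_same)

lemma depends_resampled:
  fixes X :: "'a measure \<Rightarrow> real"
  assumes "D \<in> sets borel" "A \<in> sets borel" "D \<subseteq> A" "depends A X"
  shows "depends A (resampled D X)"
  unfolding depends_def resampled_def
proof (intro ballI Bochner_Integration.integral_cong refl)
  fix nu nu' :: "'a measure" assume "nu \<in> configs" "nu' \<in> space Q"
  then show "X (merge D nu' (restr A nu)) = X (merge D nu' nu)"
    using assms by (simp add: merge_restr_subset depends_def)
qed

lemma resampled_square:
  assumes C: "C \<in> bounded_borel" and X: "bfun c X"
  shows "(LINT nu|Q. (X nu)\<^sup>2) - (LINT nu|Q. (resampled C X nu)\<^sup>2) = (LINT nu|Q. (X nu - resampled C X nu)\<^sup>2)"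
proof -
  have Cb: "C \<in> sets borel" using C by (rule bounded_borelD)
  note R = bfun_resampled[OF Cb X]
  have "(LINT nu|Q. X nu * resampled C X nu) = (LINT nu|Q. (resampled C X nu)\<^sup>2)"
    using integral_resampled_mult[OF C X R depends_resampled_same[OF Cb]] by (simp add: power2_eq_square)
  then show ?thesis
    using bfun_square_integrable[OF X] bfun_square_integrable[OF R] bfun_integrable[OF bfun_mult[OF X R]]
    by (simp add: power2_diff mult.assoc)
qed

lemma resampled_contraction:
  assumes C: "C \<in> bounded_borel" and X: "bfun c X"
  shows "(LINT nu|Q. (resampled C X nu)\<^sup>2) \<le> (LINT nu|Q. (X nu)\<^sup>2)"
proof -
  have "0 \<le> (LINT nu|Q. (X nu - resampled C X nu)\<^sup>2)" by (intro integral_nonneg_AE) auto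
  then show ?thesis using resampled_square[OF C X] by linarith
qed

text \<open>Conditional expectation is the orthogonal projection onto the functionals that do not
  see \<open>C\<close>. Hence the conditional variance is at most the mean square distance to any
  such competitor \<open>Y\<close>.\<close>

lemma resampled_optimal:
  assumes C: "C \<in> bounded_borel" and X: "bfun c X" and Y: "bfun d Y" "depends (- C) Y"
  shows "(LINT nu|Q. (X nu)\<^sup>2) - (LINT nu|Q. (resampled C X nu)\<^sup>2) \<le> (LINT nu|Q. (X nu - Y nu)\<^sup>2)"
proof -
  have Cb: "C \<in> sets borel" using C by (rule bounded_borelD)
  note R = bfun_resampled[OF Cb X]
  have "0 \<le> (LINT nu|Q. (resampled C X nu - Y nu)\<^sup>2)" by (intro integral_nonneg_AE) auto
  moreover have "(LINT nu|Q. (resampled C X nu - Y nu)\<^sup>2)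
      = (LINT nu|Q. (resampled C X nu)\<^sup>2) + (LINT nu|Q. (Y nu)\<^sup>2) - 2 * (LINT nu|Q. resampled C X nu * Y nu)"
    using bfun_square_integrable[OF Y(1)] bfun_square_integrable[OF R] bfun_integrable[OF bfun_mult[OF R Y(1)]]
    by (simp add: power2_diff mult.assoc)
  moreover have "(LINT nu|Q. (X nu - Y nu)\<^sup>2) = (LINT nu|Q. (X nu)\<^sup>2) + (LINT nu|Q. (Y nu)\<^sup>2) - 2 * (LINT nu|Q. X nu * Y nu)"
    using bfun_square_integrable[OF Y(1)] bfun_square_integrable[OF X] bfun_integrable[OF bfun_mult[OF X Y(1)]]
    by (simp add: power2_diff mult.assoc)
  ultimately show ?thesis using integral_resampled_mult[OF C X Y] by linarith
qed

text \<open>Averaging over \<open>C\<close> commutes with emptying a disjoint cell. Together with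
  \<open>resampled_contraction\<close> this keeps the contributions of the remaining cells from
  growing after \<open>C\<close> has been integrated out.\<close>

lemma resampled_diff_restr:
  assumes C: "C \<in> sets borel" "D \<in> sets borel" "C \<inter> D = {}" and X: "bfun c X" and nu: "nu \<in> configs"
  shows "resampled C (\<lambda>nu. X nu - X (restr (- D) nu)) nu = resampled C X nu - resampled C X (restr (- D) nu)"
proof -
  have i: "integrable Q (\<lambda>nu'. X (merge C nu' nu))" "integrable Q (\<lambda>nu'. X (merge C nu' (restr (- D) nu)))"
    using X C nu by (auto intro!: bfun_integrable[of c] simp: bfun_def
       intro: measurable_compose[of "\<lambda>nu'. merge C nu' _" confs confs X] measurable_merge)
  have "C \<subseteq> - D" using C by auto
  then have "(LINT nu'|Q. X (restr (- D) (merge C nu' nu))) = (LINT nu'|Q. X (merge C nu' (restr (- D) nu)))"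
    using C nu by (intro Bochner_Integration.integral_cong) (auto simp: merge_restr_subset)
  moreover have "integrable Q (\<lambda>nu'. X (restr (- D) (merge C nu' nu)))"
    using i(2) by (rule Bochner_Integration.integrable_cong[THEN iffD1, OF refl, rotated])
       (use C nu \<open>C \<subseteq> - D\<close> in \<open>auto simp: merge_restr_subset\<close>)
  ultimately show ?thesis unfolding resampled_def using i by simp
qed

text \<open>
  The cells are integrated out one after the other. Each step loses a conditional variance, which
  is at most the mean square distance of \<open>X\<close> to its value with the cell emptied.
\<close>

lemma efron_stein_list:
  assumes "bfun c X" "distinct Cs" "disjoint (set Cs)" "set Cs \<subseteq> bounded_borel"
    and "U \<in> sets borel" "depends U X" "\<Union>(set Cs) \<subseteq> U"
  shows "\<exists>Z. bfun c Z \<and> depends (U - \<Union>(set Cs)) Z \<and> (LINT nu|Q. Z nu) = (LINT nu|Q. X nu) \<and>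
    (LINT nu|Q. (X nu)\<^sup>2) - (LINT nu|Q. (Z nu)\<^sup>2) \<le> (\<Sum>C\<leftarrow>Cs. LINT nu|Q. (X nu - X (restr (- C) nu))\<^sup>2)"
  using assms
proof (induction Cs arbitrary: X U)
  case Nil
  then show ?case by (intro exI[of _ X]) auto
next
  case (Cons C Cs)
  have C: "C \<in> bounded_borel" and Cb: "C \<in> sets borel"
    using Cons.prems bounded_borelD by auto
  let ?Y = "resampled C X" and ?V = "U - C"
  have Y: "bfun c ?Y" using Cons.prems Cb by (intro bfun_resampled)
  have disj: "C \<inter> D = {}" if "D \<in> set Cs" for D
    using Cons.prems that by (auto simp: disjoint_def)
  have "depends (U \<inter> - C) ?Y"
    using Cons.prems Cb by (intro depends_Int depends_resampled_same depends_resampled) auto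
  then have "depends ?V ?Y" by (simp add: Diff_eq)
  moreover have "\<Union>(set Cs) \<subseteq> ?V" using Cons.prems disj by auto
  ultimately obtain Z where Z: "bfun c Z" "depends (?V - \<Union>(set Cs)) Z" "(LINT nu|Q. Z nu) = (LINT nu|Q. ?Y nu)"
    "(LINT nu|Q. (?Y nu)\<^sup>2) - (LINT nu|Q. (Z nu)\<^sup>2) \<le> (\<Sum>D\<leftarrow>Cs. LINT nu|Q. (?Y nu - ?Y (restr (- D) nu))\<^sup>2)"
    using Cons.IH[of ?Y ?V] Cons.prems Y Cb by (auto simp: disjoint_def)
  have "(LINT nu|Q. (?Y nu - ?Y (restr (- D) nu))\<^sup>2) \<le> (LINT nu|Q. (X nu - X (restr (- D) nu))\<^sup>2)" if D: "D \<in> set Cs" for D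
  proof -
    have Db: "D \<in> sets borel" using D Cons.prems bounded_borelD(1) by auto
    have b: "bfun (c + c) (\<lambda>nu. X nu - X (restr (- D) nu))"
      using Cons.prems Db by (intro bfun_diff bfun_restr) auto
    have "(LINT nu|Q. (?Y nu - ?Y (restr (- D) nu))\<^sup>2) = (LINT nu|Q. (resampled C (\<lambda>nu. X nu - X (restr (- D) nu)) nu)\<^sup>2)"
      using resampled_diff_restr[OF Cb Db disj[OF D] Cons.prems(1)]
      by (intro Bochner_Integration.integral_cong) auto
    also have "... \<le> (LINT nu|Q. (X nu - X (restr (- D) nu))\<^sup>2)"
      by (rule resampled_contraction[OF C b])
    finally show ?thesis .
  qed
  then have "(\<Sum>D\<leftarrow>Cs. LINT nu|Q. (?Y nu - ?Y (restr (- D) nu))\<^sup>2) \<le> (\<Sum>D\<leftarrow>Cs. LINT nu|Q. (X nu - X (restr (- D) nu))\<^sup>2)"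
    by (intro sum_list_mono)
  moreover have "(LINT nu|Q. (X nu)\<^sup>2) - (LINT nu|Q. (?Y nu)\<^sup>2) \<le> (LINT nu|Q. (X nu - X (restr (- C) nu))\<^sup>2)"
    using Cons.prems(1) Cb
    by (intro resampled_optimal[OF C Cons.prems(1) bfun_restr])
       (auto simp: depends_def restr_restr)
  moreover have "(LINT nu|Q. ?Y nu) = (LINT nu|Q. X nu)" by (rule integral_resampled[OF C Cons.prems(1)])
  moreover have "?V - \<Union>(set Cs) = U - \<Union>(set (C # Cs))" by auto
  ultimately show ?case using Z by (intro exI[of _ Z]) auto
qed

lemma efron_stein:
  assumes X: "bfun c X" and C: "finite \<C>" "disjoint \<C>" "\<C> \<subseteq> bounded_borel" and dep: "depends (\<Union>\<C>) X"
  shows "(LINT nu|Q. (X nu)\<^sup>2) - (LINT nu|Q. X nu)\<^sup>2 \<le> (\<Sum>C\<in>\<C>. LINT nu|Q. (X nu - X (restr (- C) nu))\<^sup>2)"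
proof -
  obtain Cs where Cs: "set Cs = \<C>" "distinct Cs" using finite_distinct_list[OF C(1)] by blast
  have "\<Union>\<C> \<in> sets borel" using C bounded_borelD(1) by (intro sets.finite_Union) auto
  then obtain Z where Z: "bfun c Z" "depends (\<Union>\<C> - \<Union>\<C>) Z" "(LINT nu|Q. Z nu) = (LINT nu|Q. X nu)"
    "(LINT nu|Q. (X nu)\<^sup>2) - (LINT nu|Q. (Z nu)\<^sup>2) \<le> (\<Sum>C\<leftarrow>Cs. LINT nu|Q. (X nu - X (restr (- C) nu))\<^sup>2)"
    using efron_stein_list[OF X Cs(2), of "\<Union>\<C>"] C dep Cs(1) by auto
  obtain nu0 :: "'a measure" where nu0: "nu0 \<in> configs" using Q.not_empty by auto
  \<comment> \<open>What is left after all cells depends on no region at all. It is a constant and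
    thus equal to the mean, which turns its second moment into the squared mean.\<close>
  have "Z nu = Z (restr {} nu0)" if "nu \<in> configs" for nu
  proof -
    have "restr {} nu = restr {} nu0" using that nu0 by (intro configs_eqI) (auto simp: emeasure_restr)
    then show ?thesis using Z(2) that by (auto simp: depends_def)
  qed
  then have "(LINT nu|Q. Z nu) = (LINT nu|Q. Z (restr {} nu0))" "(LINT nu|Q. (Z nu)\<^sup>2) = (LINT nu|Q. (Z (restr {} nu0))\<^sup>2)"
    by (intro Bochner_Integration.integral_cong; simp)+
  then have "(LINT nu|Q. (Z nu)\<^sup>2) = (LINT nu|Q. X nu)\<^sup>2" using Z(3) by (simp add: Q.prob_space)
  moreover have "(\<Sum>C\<leftarrow>Cs. LINT nu|Q. (X nu - X (restr (- C) nu))\<^sup>2) = (\<Sum>C\<in>\<C>. LINT nu|Q. (X nu - X (restr (- C) nu))\<^sup>2)"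
    using Cs by (simp add: sum_list_distinct_conv_sum_set)
  ultimately show ?thesis using Z(4) by simp
qed

lemma mecke_event:
  assumes C: "C \<in> bounded_borel" and g [measurable]: "g \<in> borel_measurable confs"
  shows "(\<integral>\<^sup>+nu. emeasure nu C * g nu \<partial>Q) = (\<integral>\<^sup>+x. (\<integral>\<^sup>+nu. g (add_point x nu) \<partial>Q) * indicator C x \<partial>\<Lambda>)"
proof -
  have [measurable]: "C \<in> sets borel" using C by (rule bounded_borelD)
  have "(\<integral>\<^sup>+nu. emeasure nu C * g nu \<partial>Q) = (\<integral>\<^sup>+nu. \<integral>\<^sup>+x. g nu * indicator C x \<partial>nu \<partial>Q)"
    by (intro nn_integral_cong) (simp add: nn_integral_cmult_indicator mult.commute)
  also have "... = (\<integral>\<^sup>+x. (\<integral>\<^sup>+nu. g (add_point x nu) * indicator C x \<partial>Q) \<partial>\<Lambda>)"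
    using mecke[of "\<lambda>(x, nu). g nu * indicator C x"] by simp
  also have "... = (\<integral>\<^sup>+x. (\<integral>\<^sup>+nu. g (add_point x nu) \<partial>Q) * indicator C x \<partial>\<Lambda>)"
    by (intro nn_integral_cong nn_integral_multc) measurable
  finally show ?thesis .
qed

lemma expected_count: "C \<in> bounded_borel \<Longrightarrow> (\<integral>\<^sup>+nu. emeasure nu C \<partial>Q) = emeasure \<Lambda> C"
  using mecke_event[of C "\<lambda>_. 1"] by (simp add: bounded_borelD)

text \<open>
  Two or more points in \<open>C\<close> contribute only the term of order \<open>(measure \<Lambda> C)\<^sup>2\<close>, which vanishes along
  fine partitions.
\<close>

lemma cell_bound:
  assumes X: "bfun c X" and C: "C \<in> bounded_borel"
  shows "ennreal (LINT nu|Q. (X nu - X (restr (- C) nu))\<^sup>2)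
    \<le> (\<integral>\<^sup>+x. (\<integral>\<^sup>+nu. ennreal ((X (add_point x nu) - X nu)\<^sup>2) \<partial>Q) * indicator C x \<partial>\<Lambda>) + ennreal (4 * c\<^sup>2 * (measure \<Lambda> C)\<^sup>2)"
proof -
  note [measurable] = bfun_measurable[OF X] bounded_borelD(1)[OF C]
  have Cb: "C \<in> sets borel" using C by (rule bounded_borelD)
  let ?g = "\<lambda>nu. (X nu - X (restr (- C) nu))\<^sup>2"
  have bound: "?g nu \<le> 4 * c\<^sup>2" if "nu \<in> configs" for nu
  proof -
    have "\<bar>X nu - X (restr (- C) nu)\<bar> \<le> 2 * c"
      using bfun_diff[OF X bfun_restr[OF _ X]] that Cb by (auto simp: bfun_def)
    then have "\<bar>X nu - X (restr (- C) nu)\<bar>\<^sup>2 \<le> (2 * c)\<^sup>2" by (intro power_mono) auto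
    then show ?thesis by (simp add: power_mult_distrib)
  qed
  let ?one = "\<lambda>nu. if emeasure nu C = 1 then ennreal (?g nu) else 0"
  let ?two = "\<lambda>nu. if 2 \<le> emeasure nu C then 1 else 0 :: ennreal"
  \<comment> \<open>The factor \<open>emeasure nu C\<close> equals 1 in the first term and is at
    least 2 where the second one is nonzero. Inserting it costs nothing and gives both terms the
    shape to which Mecke's formula applies.\<close>
  have split: "ennreal (?g nu) \<le> emeasure nu C * ?one nu + ennreal (4 * c\<^sup>2) * (emeasure nu C * ?two nu)"
    if nu: "nu \<in> configs" for nu
  proof -
    obtain k :: nat where k: "emeasure nu C = of_nat k"
      using configs_count[OF nu bounded_borelD[OF C]] by blast
    consider "k = 0" | "k = 1" | "2 \<le> k" by linarith
    then show ?thesis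
    proof cases
      case 1
      then have "restr (- C) nu = nu" using restr_null[OF nu Cb] k by simp
      then show ?thesis by simp
    next
      case 2 then show ?thesis using k by simp
    next
      case 3
      then have two: "2 \<le> emeasure nu C"
        using of_nat_mono[OF 3, where 'a=ennreal] unfolding k by simp
      have "1 \<le> emeasure nu C" using two order_trans[of 1 2 "emeasure nu C"] by simp
      then have "ennreal (4 * c\<^sup>2) * 1 \<le> ennreal (4 * c\<^sup>2) * (emeasure nu C * ?two nu)"
        using two by (intro mult_left_mono) auto
      then have "ennreal (4 * c\<^sup>2) \<le> ennreal (4 * c\<^sup>2) * (emeasure nu C * ?two nu)" by simp
      moreover have "ennreal (?g nu) \<le> ennreal (4 * c\<^sup>2)" using bound[OF nu] by (intro ennreal_leI)
      ultimately show ?thesis by (meson add_increasing order_trans zero_le)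
    qed
  qed
  have "ennreal (LINT nu|Q. ?g nu) = (\<integral>\<^sup>+nu. ennreal (?g nu) \<partial>Q)"
  proof (rule nn_integral_eq_integral[symmetric])
    show "integrable Q ?g"
      by (rule bfun_square_integrable[OF bfun_diff[OF X bfun_restr[OF _ X]]]) (use Cb in auto)
  qed auto
  also have "... \<le> (\<integral>\<^sup>+nu. emeasure nu C * ?one nu + ennreal (4 * c\<^sup>2) * (emeasure nu C * ?two nu) \<partial>Q)"
    using split by (intro nn_integral_mono) simp
  also have "... = (\<integral>\<^sup>+nu. emeasure nu C * ?one nu \<partial>Q) + ennreal (4 * c\<^sup>2) * (\<integral>\<^sup>+nu. emeasure nu C * ?two nu \<partial>Q)"
    by (subst nn_integral_add) (auto simp: nn_integral_cmult)
  also have "(\<integral>\<^sup>+nu. emeasure nu C * ?one nu \<partial>Q) = (\<integral>\<^sup>+x. (\<integral>\<^sup>+nu. ?one (add_point x nu) \<partial>Q) * indicator C x \<partial>\<Lambda>)"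
    by (intro mecke_event C) measurable
  also have "... \<le> (\<integral>\<^sup>+x. (\<integral>\<^sup>+nu. ennreal ((X (add_point x nu) - X nu)\<^sup>2) \<partial>Q) * indicator C x \<partial>\<Lambda>)"
  proof (intro nn_integral_mono)
    fix x
    have "?one (add_point x nu) \<le> ennreal ((X (add_point x nu) - X nu)\<^sup>2)" if nu: "nu \<in> configs" and x: "x \<in> C" for nu
    proof (cases "emeasure (add_point x nu) C = 1")
      case True
      obtain k :: nat where k: "emeasure nu C = of_nat k"
        using configs_count[OF nu bounded_borelD[OF C]] by blast
      have "(of_nat (Suc k) :: ennreal) = of_nat 1"
        using True x k Cb nu by (simp add: emeasure_add_point add.commute)
      then have "k = 0" by (metis One_nat_def Suc_inject of_nat_eq_iff)
      then have "restr (- C) (add_point x nu) = nu"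
        using k x nu Cb restr_null[OF nu Cb] by (simp add: restr_add_point_outside)
      then show ?thesis by simp
    qed simp
    then show "(\<integral>\<^sup>+nu. ?one (add_point x nu) \<partial>Q) * indicator C x
      \<le> (\<integral>\<^sup>+nu. ennreal ((X (add_point x nu) - X nu)\<^sup>2) \<partial>Q) * indicator C x"
      by (auto intro!: nn_integral_mono split: split_indicator)
  qed
  also have "(\<integral>\<^sup>+nu. emeasure nu C * ?two nu \<partial>Q) = (\<integral>\<^sup>+x. (\<integral>\<^sup>+nu. ?two (add_point x nu) \<partial>Q) * indicator C x \<partial>\<Lambda>)"
    by (intro mecke_event C) measurable
  also have "... \<le> (\<integral>\<^sup>+x. emeasure \<Lambda> C * indicator C x \<partial>\<Lambda>)"
  proof (intro nn_integral_mono)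
    fix x
    \<comment> \<open>One of the two points is the added one, so another point of \<open>C\<close>
      was there before.\<close>
    have "?two (add_point x nu) \<le> emeasure nu C" if nu: "nu \<in> configs" and x: "x \<in> C" for nu
    proof -
      obtain k :: nat where k: "emeasure nu C = of_nat k"
        using configs_count[OF nu bounded_borelD[OF C]] by blast
      show ?thesis using k x Cb nu by (cases k) (auto simp: emeasure_add_point)
    qed
    then have "(\<integral>\<^sup>+nu. ?two (add_point x nu) \<partial>Q) \<le> (\<integral>\<^sup>+nu. emeasure nu C \<partial>Q)" if "x \<in> C"
      using that by (intro nn_integral_mono) auto
    then show "(\<integral>\<^sup>+nu. ?two (add_point x nu) \<partial>Q) * indicator C x \<le> emeasure \<Lambda> C * indicator C x"
      using expected_count[OF C] by (auto split: split_indicator)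
  qed
  also have "... = ennreal ((measure \<Lambda> C)\<^sup>2)"
    by (simp add: nn_integral_cmult emeasure_\<Lambda>[OF C] ennreal_mult[symmetric] power2_eq_square)
  finally show ?thesis
    by (auto simp: ennreal_mult[symmetric] mult.assoc add_mono mult_left_mono)
qed

text \<open>In the Efron-Stein bound the one-point parts of the cells add up to an integral over
  \<open>U\<close> that does not depend on the partition. The parts with several points are at most
  \<open>4 * c\<^sup>2\<close> times the sum of the squared cell masses, and this vanishes along
  fine partitions.\<close>

theorem poincare:
  assumes X: "bfun c X" and U: "U \<in> bounded_borel" "depends U X"
    and fine: "\<And>\<epsilon>. 0 < \<epsilon> \<Longrightarrow> \<exists>\<C>. finite \<C> \<and> disjoint \<C> \<and> \<C> \<subseteq> bounded_borel \<and> \<Union>\<C> = U \<and> (\<Sum>C\<in>\<C>. (measure \<Lambda> C)\<^sup>2) \<le> \<epsilon>"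
  shows "ennreal ((LINT nu|Q. (X nu)\<^sup>2) - (LINT nu|Q. X nu)\<^sup>2)
    \<le> (\<integral>\<^sup>+x. (\<integral>\<^sup>+nu. ennreal ((X (add_point x nu) - X nu)\<^sup>2) \<partial>Q) * indicator U x \<partial>\<Lambda>)"
proof (rule ennreal_le_epsilon)
  fix e :: real assume e: "0 < e"
  note [measurable] = bfun_measurable[OF X]
  \<comment> \<open>The summand 1 keeps the denominator positive also for c = 0.\<close>
  define \<epsilon> where "\<epsilon> = e / (4 * c\<^sup>2 + 1)"
  have \<epsilon>: "0 < \<epsilon>" "4 * c\<^sup>2 * \<epsilon> \<le> e"
    using e by (auto simp: \<epsilon>_def field_simps power2_eq_square add_pos_nonneg add_nonneg_pos)
  obtain \<C> where C: "finite \<C>" "disjoint \<C>" "\<C> \<subseteq> bounded_borel" "\<Union>\<C> = U" "(\<Sum>C\<in>\<C>. (measure \<Lambda> C)\<^sup>2) \<le> \<epsilon>"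
    using fine[OF \<epsilon>(1)] by blast
  let ?D = "\<lambda>x. \<integral>\<^sup>+nu. ennreal ((X (add_point x nu) - X nu)\<^sup>2) \<partial>Q"
  have ind: "(\<Sum>C\<in>\<C>. indicator C x :: ennreal) = indicator U x" for x
  proof -
    have "indicator (\<Union>C\<in>\<C>. id C) x = (\<Sum>C\<in>\<C>. indicator (id C) x :: ennreal)"
      using C(1,2) by (intro indicator_UN_disjoint) (auto simp: disjoint_family_on_def disjoint_def)
    then show ?thesis using C(4) by simp
  qed
  have "ennreal ((LINT nu|Q. (X nu)\<^sup>2) - (LINT nu|Q. X nu)\<^sup>2)
    \<le> ennreal (\<Sum>C\<in>\<C>. LINT nu|Q. (X nu - X (restr (- C) nu))\<^sup>2)"
    using C U by (intro ennreal_leI efron_stein[OF X]) auto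
  also have "... = (\<Sum>C\<in>\<C>. ennreal (LINT nu|Q. (X nu - X (restr (- C) nu))\<^sup>2))"
    by (intro sum_ennreal[symmetric]) auto
  also have "... \<le> (\<Sum>C\<in>\<C>. (\<integral>\<^sup>+x. ?D x * indicator C x \<partial>\<Lambda>) + ennreal (4 * c\<^sup>2 * (measure \<Lambda> C)\<^sup>2))"
    using C(3) by (intro sum_mono cell_bound[OF X]) auto
  also have "... = (\<Sum>C\<in>\<C>. \<integral>\<^sup>+x. ?D x * indicator C x \<partial>\<Lambda>) + ennreal (4 * c\<^sup>2 * (\<Sum>C\<in>\<C>. (measure \<Lambda> C)\<^sup>2))"
    by (simp add: sum.distrib sum_distrib_left)
  also have "(\<Sum>C\<in>\<C>. \<integral>\<^sup>+x. ?D x * indicator C x \<partial>\<Lambda>) = (\<integral>\<^sup>+x. (\<Sum>C\<in>\<C>. ?D x * indicator C x) \<partial>\<Lambda>)"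
  proof (rule nn_integral_sum[symmetric])
    fix C assume "C \<in> \<C>"
    then have [measurable]: "C \<in> sets borel" using C(3) bounded_borelD(1) by auto
    show "(\<lambda>x. ?D x * indicator C x) \<in> borel_measurable \<Lambda>" by measurable
  qed
  also have "... = (\<integral>\<^sup>+x. ?D x * indicator U x \<partial>\<Lambda>)"
    by (simp add: sum_distrib_left[symmetric] ind)
  also have "ennreal (4 * c\<^sup>2 * (\<Sum>C\<in>\<C>. (measure \<Lambda> C)\<^sup>2)) \<le> ennreal e"
    using C(5) \<epsilon> by (intro ennreal_leI) (meson mult_left_mono order_trans zero_le_mult_iff zero_le_numeral zero_le_power2)
  finally show "ennreal ((LINT nu|Q. (X nu)\<^sup>2) - (LINT nu|Q. X nu)\<^sup>2)
    \<le> (\<integral>\<^sup>+x. ?D x * indicator U x \<partial>\<Lambda>) + ennreal e" by (simp add: add_left_mono)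
qed

end

section \<open>Compensated integrals of causal fields\<close>

declare split_paired_All [simp del]

text \<open>Predictability in terms of configurations. The comparison of times is not strict, so
  \<open>Y x\<close> ignores a point added at \<open>x\<close> itself, which is exactly the
  invariance that Mecke's formula needs. Bound and support hold everywhere, so with bounded
  \<open>B\<close> all integrals exist at every configuration.\<close>

definition causal :: "real \<Rightarrow> (real \<times> real) set \<Rightarrow> (real \<times> real \<Rightarrow> (real \<times> real) measure \<Rightarrow> real) \<Rightarrow> bool" where
  "causal c B Y \<longleftrightarrow> (\<lambda>(x, nu). Y x nu) \<in> borel_measurable (borel \<Otimes>\<^sub>M confs) \<and> 0 \<le> c \<and>
     (\<forall>x. \<forall>nu\<in>configs. \<bar>Y x nu\<bar> \<le> c \<and> (x \<notin> B \<longrightarrow> Y x nu = 0) \<and>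
        (\<forall>y. fst x \<le> fst y \<longrightarrow> Y x (add_point y nu) = Y x nu))"

text \<open>The add-one-cost operator of Poisson calculus, applied to each member of a
  family.\<close>

definition point_diff :: "'a::euclidean_space \<Rightarrow> ('b \<Rightarrow> 'a measure \<Rightarrow> real) \<Rightarrow> 'b \<Rightarrow> 'a measure \<Rightarrow> real" where
  "point_diff x Y y nu = Y y (add_point x nu) - Y y nu"

lemma causal_measurable:
  "causal c B Y \<Longrightarrow> (\<lambda>(x, nu). Y x nu) \<in> borel_measurable (borel \<Otimes>\<^sub>M confs)"
  by (simp add: causal_def)

text \<open>Additions of points commute, so the difference field inherits causality. This closure is
  what permits a second application of the covariance formula.\<close>

lemma causal_point_diff:
  assumes Y: "causal c B Y"
  shows "causal (2 * c) B (point_diff x Y)"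
proof -
  note [measurable] = causal_measurable[OF Y]
  have "(\<lambda>(y, nu). point_diff x Y y nu) \<in> borel_measurable (borel \<Otimes>\<^sub>M confs)"
    unfolding point_diff_def by measurable
  moreover have "\<bar>point_diff x Y y nu\<bar> \<le> 2 * c" if "nu \<in> configs" for y nu
  proof -
    have "\<bar>Y y (add_point x nu)\<bar> \<le> c" "\<bar>Y y nu\<bar> \<le> c" using Y that by (auto simp: causal_def)
    then show ?thesis by (simp add: point_diff_def)
  qed
  ultimately show ?thesis
    using Y by (auto simp: causal_def point_diff_def add_point_commute[of _ x])
qed

lemma point_diff_before:
  "causal c B Y \<Longrightarrow> nu \<in> configs \<Longrightarrow> fst y \<le> fst x \<Longrightarrow> point_diff x Y y nu = 0"
  by (simp add: causal_def point_diff_def)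

text \<open>Up to time \<open>s\<close> the product vanishes with \<open>Y\<close>. After
  \<open>s\<close> a point at or beyond the time of \<open>y\<close> changes neither factor, as
  \<open>W\<close> is determined by the configuration before \<open>s\<close>.\<close>

lemma causal_past_mult:
  assumes Y: "causal c B Y" and W: "W \<in> borel_measurable confs" "\<And>nu. nu \<in> configs \<Longrightarrow> \<bar>W nu\<bar> \<le> 1"
    and past: "\<And>nu y. nu \<in> configs \<Longrightarrow> s \<le> fst y \<Longrightarrow> W (add_point y nu) = W nu"
    and zero: "\<And>nu y. nu \<in> configs \<Longrightarrow> fst y \<le> s \<Longrightarrow> Y y nu = 0"
  shows "causal c B (\<lambda>y nu. W nu * Y y nu)"
proof -
  note [measurable] = causal_measurable[OF Y] W(1)
  have "\<bar>W nu * Y y nu\<bar> \<le> c" if "nu \<in> configs" for y nu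
    using mult_mono[OF W(2)[OF that], of "\<bar>Y y nu\<bar>" c] Y that by (simp add: causal_def abs_mult)
  moreover have "W (add_point z nu) * Y y (add_point z nu) = W nu * Y y nu"
    if "nu \<in> configs" "fst y \<le> fst z" for y z nu
  proof (cases "fst y \<le> s")
    case True then show ?thesis using zero that by simp
  next
    case False
    then have "W (add_point z nu) = W nu" using past that by simp
    moreover have "Y y (add_point z nu) = Y y nu" using Y that by (simp add: causal_def)
    ultimately show ?thesis by simp
  qed
  ultimately show ?thesis using Y by (auto simp: causal_def)
qed

locale poisson_plane = poisson_law Q \<Lambda>
  for Q :: "(real \<times> real) measure measure" and \<Lambda> :: "(real \<times> real) measure" +
  assumes \<Lambda>_eq: "\<Lambda> = density lborel (indicator (UNIV \<times> {0..}))"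
begin

text \<open>For integrands that ignore their own point, the random measure may be replaced by its
  intensity in expectation.\<close>

lemma compensation:
  assumes G: "(\<lambda>(x, nu). G x nu) \<in> borel_measurable (borel \<Otimes>\<^sub>M confs)"
    and inv: "\<And>x nu. nu \<in> configs \<Longrightarrow> G x (add_point x nu) = G x nu"
  shows "(\<integral>\<^sup>+nu. \<integral>\<^sup>+x. G x nu \<partial>nu \<partial>Q) = (\<integral>\<^sup>+x. \<integral>\<^sup>+nu. G x nu \<partial>Q \<partial>\<Lambda>)"
proof -
  have "(\<integral>\<^sup>+nu. \<integral>\<^sup>+x. G x nu \<partial>nu \<partial>Q) = (\<integral>\<^sup>+x. \<integral>\<^sup>+nu. G x (add_point x nu) \<partial>Q \<partial>\<Lambda>)"
    using mecke[OF G] by simp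
  also have "... = (\<integral>\<^sup>+x. \<integral>\<^sup>+nu. G x nu \<partial>Q \<partial>\<Lambda>)"
    by (intro nn_integral_cong) (simp add: inv)
  finally show ?thesis .
qed

section \<open>Duality and isometry for compensated integrals\<close>

definition compensated :: "(real \<times> real \<Rightarrow> (real \<times> real) measure \<Rightarrow> real) \<Rightarrow> (real \<times> real) measure \<Rightarrow> real" where
  "compensated Y nu = (LINT x|nu. Y x nu) - (LINT x|\<Lambda>. Y x nu)"

text \<open>Compensated integrals are unbounded, but they grow at most linearly in the number of
  points of their support. Counts have finite second moments, so functionals of this class may be
  squared and multiplied.\<close>

definition growth :: "(real \<times> real) set \<Rightarrow> real \<Rightarrow> ((real \<times> real) measure \<Rightarrow> real) \<Rightarrow> bool" where
  "growth B C k \<longleftrightarrow> k \<in> borel_measurable confs \<and> 0 \<le> C \<and> (\<forall>nu\<in>configs. \<bar>k nu\<bar> \<le> C * (1 + measure nu B))"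

definition field_growth ::
  "(real \<times> real) set \<Rightarrow> real \<Rightarrow> (real \<times> real \<Rightarrow> (real \<times> real) measure \<Rightarrow> real) \<Rightarrow> bool" where
  "field_growth B C g \<longleftrightarrow> (\<lambda>(x, nu). g x nu) \<in> borel_measurable (borel \<Otimes>\<^sub>M confs) \<and> 0 \<le> C \<and>
     (\<forall>x. \<forall>nu\<in>configs. \<bar>g x nu\<bar> \<le> C * (1 + measure nu B) \<and> (x \<notin> B \<longrightarrow> g x nu = 0))"

lemma field_growthD:
  assumes "field_growth B C g" "nu \<in> configs"
  shows "\<bar>g x nu\<bar> \<le> C * (1 + measure nu B)" "x \<notin> B \<Longrightarrow> g x nu = 0"
  using assms by (simp_all add: field_growth_def)

lemma emeasure_conf: "nu \<in> configs \<Longrightarrow> B \<in> bounded_borel \<Longrightarrow> emeasure nu B = ennreal (measure nu B)"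
  using configs_finite[of nu B] by (intro emeasure_eq_ennreal_measure) (auto simp: bounded_borel_def)

lemma measurable_measure_conf [measurable (raw)]:
  assumes B: "B \<in> sets borel" and f: "f \<in> measurable Z confs"
  shows "(\<lambda>z. measure (f z) B) \<in> borel_measurable Z"
proof -
  have [measurable]: "(\<lambda>z. emeasure (f z) B) \<in> borel_measurable Z"
    using measurable_compose[OF f measurable_count[OF B]] by simp
  show ?thesis unfolding measure_def by measurable
qed

lemma field_section:
  assumes "(\<lambda>(x, nu). g x nu) \<in> borel_measurable (borel \<Otimes>\<^sub>M confs)" "nu \<in> configs" "sets \<rho> = sets borel"
  shows "(\<lambda>x. g x nu) \<in> borel_measurable \<rho>"
  using measurable_compose[OF measurable_Pair2'[of nu confs borel] assms(1)] assms(2)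
  unfolding measurable_cong_sets[OF assms(3) refl] by simp

lemma measure_add_point:
  assumes "nu \<in> configs" "B \<in> bounded_borel"
  shows "measure (add_point x nu) B = measure nu B + indicator B x"
proof -
  have "ennreal (measure (add_point x nu) B) = ennreal (measure nu B + indicator B x)"
    using emeasure_conf[OF assms] emeasure_conf[OF add_point_in_configs[OF assms(1)] assms(2), of x]
      emeasure_add_point[OF assms(1) bounded_borelD(1)[OF assms(2)], of x]
    by (cases "x \<in> B") auto
  then show ?thesis by (subst (asm) ennreal_inj) auto
qed

text \<open>Mecke's formula applied to the count itself: one factor becomes an integral over
  \<open>B\<close>, the other grows by the planted point.\<close>

lemma count_square_finite:
  assumes B: "B \<in> bounded_borel"
  shows "(\<integral>\<^sup>+nu. ennreal ((1 + measure nu B)\<^sup>2) \<partial>Q) < \<infinity>"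
proof -
  have [measurable]: "B \<in> sets borel" using B by (rule bounded_borelD)
  have Bfin: "emeasure \<Lambda> B < \<infinity>" using \<Lambda>_finite[OF B] .
  have "(\<integral>\<^sup>+nu. emeasure nu B * emeasure nu B \<partial>Q) = (\<integral>\<^sup>+x. (\<integral>\<^sup>+nu. emeasure (add_point x nu) B \<partial>Q) * indicator B x \<partial>\<Lambda>)"
    by (intro mecke_event B) measurable
  also have "... \<le> (\<integral>\<^sup>+x. (emeasure \<Lambda> B + 1) * indicator B x \<partial>\<Lambda>)"
  proof (intro nn_integral_mono mult_right_mono)
    fix x
    have "(\<integral>\<^sup>+nu. emeasure (add_point x nu) B \<partial>Q) \<le> (\<integral>\<^sup>+nu. emeasure nu B + 1 \<partial>Q)"
      by (intro nn_integral_mono) (auto simp: emeasure_add_point split: split_indicator)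
    also have "... = emeasure \<Lambda> B + 1"
      using expected_count[OF B] by (subst nn_integral_add) auto
    finally show "(\<integral>\<^sup>+nu. emeasure (add_point x nu) B \<partial>Q) \<le> emeasure \<Lambda> B + 1" .
  qed simp
  also have "... < \<infinity>" using Bfin by (simp add: nn_integral_cmult ennreal_mult_less_top)
  finally have 2: "(\<integral>\<^sup>+nu. emeasure nu B * emeasure nu B \<partial>Q) < \<infinity>" .
  have "(\<integral>\<^sup>+nu. ennreal ((1 + measure nu B)\<^sup>2) \<partial>Q) \<le> (\<integral>\<^sup>+nu. 2 + 2 * (emeasure nu B * emeasure nu B) \<partial>Q)"
  proof (intro nn_integral_mono)
    fix nu assume "nu \<in> space Q"
    then have e: "emeasure nu B = ennreal (measure nu B)" using emeasure_conf[OF _ B] by simp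
    have "0 \<le> (1 - measure nu B)\<^sup>2" by simp
    then have "(1 + measure nu B)\<^sup>2 \<le> 2 + 2 * (measure nu B * measure nu B)"
      by (simp add: power2_eq_square algebra_simps)
    then have "ennreal ((1 + measure nu B)\<^sup>2) \<le> ennreal (2 + 2 * (measure nu B * measure nu B))"
      by (intro ennreal_leI)
    also have "... = 2 + 2 * (emeasure nu B * emeasure nu B)"
      by (simp add: e ennreal_plus ennreal_mult)
    finally show "ennreal ((1 + measure nu B)\<^sup>2) \<le> 2 + 2 * (emeasure nu B * emeasure nu B)" .
  qed
  also have "... = 2 + 2 * (\<integral>\<^sup>+nu. emeasure nu B * emeasure nu B \<partial>Q)"
    by (subst nn_integral_add) (auto simp: nn_integral_cmult)
  also have "... < \<infinity>" using 2 by (simp add: ennreal_mult_less_top)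
  finally show ?thesis .
qed

lemma growth_square_integrable:
  assumes B: "B \<in> bounded_borel" and k: "growth B C k"
  shows "integrable Q (\<lambda>nu. (k nu)\<^sup>2)"
proof -
  have [measurable]: "k \<in> borel_measurable confs" using k by (simp add: growth_def)
  have [measurable]: "B \<in> sets borel" using B by (rule bounded_borelD)
  have "(\<integral>\<^sup>+nu. ennreal (norm ((k nu)\<^sup>2)) \<partial>Q) \<le> (\<integral>\<^sup>+nu. ennreal (C\<^sup>2) * ennreal ((1 + measure nu B)\<^sup>2) \<partial>Q)"
  proof (intro nn_integral_mono)
    fix nu assume "nu \<in> space Q"
    then have "\<bar>k nu\<bar> \<le> C * (1 + measure nu B)" using k by (simp add: growth_def)
    then have "\<bar>k nu\<bar>\<^sup>2 \<le> (C * (1 + measure nu B))\<^sup>2" by (intro power_mono) auto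
    then show "ennreal (norm ((k nu)\<^sup>2)) \<le> ennreal (C\<^sup>2) * ennreal ((1 + measure nu B)\<^sup>2)"
      by (simp add: ennreal_mult[symmetric] power_mult_distrib)
  qed
  also have "... < \<infinity>"
    using count_square_finite[OF B] by (simp add: nn_integral_cmult ennreal_mult_less_top)
  finally show ?thesis by (intro integrableI_bounded) auto
qed

lemma growth_integrable:
  assumes B: "B \<in> bounded_borel" and k: "growth B C k"
  shows "integrable Q k"
proof (rule Q.square_integrable_imp_integrable[OF _ growth_square_integrable[OF B k]])
  show "k \<in> borel_measurable Q"
    using k by (simp add: growth_def measurable_cong_sets[OF sets_Q refl])
qed

lemma growth_mult_integrable:
  assumes B: "B \<in> bounded_borel" and k: "growth B C k" "growth B D l"
  shows "integrable Q (\<lambda>nu. k nu * l nu)"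
proof (rule Bochner_Integration.integrable_bound)
  show "integrable Q (\<lambda>nu. (k nu)\<^sup>2 + (l nu)\<^sup>2)"
    using growth_square_integrable[OF B k(1)] growth_square_integrable[OF B k(2)] by simp
  show "(\<lambda>nu. k nu * l nu) \<in> borel_measurable Q" using k by (auto simp: growth_def)
  have "\<bar>a * b\<bar> \<le> a\<^sup>2 + b\<^sup>2" for a b :: real
  proof -
    have "0 \<le> (\<bar>a\<bar> - \<bar>b\<bar>)\<^sup>2" by simp
    then have "2 * (\<bar>a\<bar> * \<bar>b\<bar>) \<le> a\<^sup>2 + b\<^sup>2" by (simp add: power2_diff)
    moreover have "0 \<le> \<bar>a\<bar> * \<bar>b\<bar>" by simp
    ultimately show ?thesis unfolding abs_mult by linarith
  qed
  then show "AE nu in Q. norm (k nu * l nu) \<le> norm ((k nu)\<^sup>2 + (l nu)\<^sup>2)" by auto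
qed

lemma growth_bounded:
  "k \<in> borel_measurable confs \<Longrightarrow> 0 \<le> c \<Longrightarrow> (\<And>nu. nu \<in> configs \<Longrightarrow> \<bar>k nu\<bar> \<le> c) \<Longrightarrow> growth B c k"
proof -
  assume k: "k \<in> borel_measurable confs" and c: "0 \<le> c" and b: "\<And>nu. nu \<in> configs \<Longrightarrow> \<bar>k nu\<bar> \<le> c"
  have "c \<le> c * (1 + measure nu B)" for nu :: "(real \<times> real) measure"
    using mult_left_mono[of 1 "1 + measure nu B" c] c by simp
  then show ?thesis using k c b by (auto simp: growth_def intro: order_trans)
qed

lemma growth_cmult: "growth B C k \<Longrightarrow> growth B (\<bar>a\<bar> * C) (\<lambda>nu. a * k nu)"
  by (auto simp: growth_def abs_mult mult.assoc intro!: mult_left_mono)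

lemma growth_bounded_mult:
  assumes k: "growth B C k" and l: "l \<in> borel_measurable confs" "0 \<le> c" "\<And>nu. nu \<in> configs \<Longrightarrow> \<bar>l nu\<bar> \<le> c"
  shows "growth B (C * c) (\<lambda>nu. k nu * l nu)"
proof -
  have "\<bar>k nu * l nu\<bar> \<le> C * c * (1 + measure nu B)" if "nu \<in> configs" for nu
  proof -
    have "\<bar>k nu\<bar> * \<bar>l nu\<bar> \<le> (C * (1 + measure nu B)) * c"
      using k l that by (intro mult_mono) (auto simp: growth_def)
    then show ?thesis by (simp add: abs_mult ac_simps)
  qed
  then show ?thesis using k l by (auto simp: growth_def)
qed

lemma causal_integrable:
  assumes B: "B \<in> bounded_borel" and Y: "causal c B Y" and nu: "nu \<in> configs"
    and \<rho>: "sets \<rho> = sets borel" "emeasure \<rho> B < \<infinity>"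
  shows "integrable \<rho> (\<lambda>x. Y x nu)" "\<bar>LINT x|\<rho>. Y x nu\<bar> \<le> c * measure \<rho> B"
proof -
  note [measurable] = causal_measurable[OF Y] bounded_borelD(1)[OF B]
  have m: "(\<lambda>x. Y x nu) \<in> borel_measurable \<rho>"
    by (rule field_section[OF causal_measurable[OF Y] nu \<rho>(1)])
  show i: "integrable \<rho> (\<lambda>x. Y x nu)"
    by (rule integrableI_bounded_set[of B _ _ c])
       (use Y nu m \<rho> bounded_borelD(1)[OF B] in \<open>auto simp: causal_def\<close>)
  have iB: "integrable \<rho> (\<lambda>x. c * indicator B x :: real)"
    using \<rho> bounded_borelD(1)[OF B] by (intro integrable_mult_right integrable_real_indicator) auto
  have "\<bar>LINT x|\<rho>. Y x nu\<bar> \<le> (LINT x|\<rho>. \<bar>Y x nu\<bar>)" by (rule integral_abs_bound)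
  also have "... \<le> (LINT x|\<rho>. c * indicator B x)"
    using i iB Y nu by (intro integral_mono) (auto simp: causal_def split: split_indicator)
  also have "... = c * measure \<rho> B"
    using \<rho> bounded_borelD(1)[OF B] sets.sets_into_space[of B \<rho>] by (simp add: Int_absorb2)
  finally show "\<bar>LINT x|\<rho>. Y x nu\<bar> \<le> c * measure \<rho> B" .
qed

lemma growth_compensated:
  assumes B: "B \<in> bounded_borel" and Y: "causal c B Y"
  shows "growth B (c * (1 + measure \<Lambda> B)) (compensated Y)"
proof -
  note [measurable] = causal_measurable[OF Y]
  have c: "0 \<le> c" using Y by (simp add: causal_def)
  have "compensated Y \<in> borel_measurable confs" unfolding compensated_def by measurable
  moreover have "\<bar>compensated Y nu\<bar> \<le> c * (1 + measure \<Lambda> B) * (1 + measure nu B)" if nu: "nu \<in> configs" for nu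
  proof -
    have "\<bar>compensated Y nu\<bar> \<le> c * measure nu B + c * measure \<Lambda> B"
      unfolding compensated_def
      using causal_integrable(2)[OF B Y nu, of nu] causal_integrable(2)[OF B Y nu, of \<Lambda>]
        configs_finite[OF nu bounded_borelD[OF B]] \<Lambda>_finite[OF B] nu by auto
    also have "... = c * (measure nu B + measure \<Lambda> B)" by (simp add: algebra_simps)
    also have "... \<le> c * ((1 + measure \<Lambda> B) * (1 + measure nu B))"
      by (intro mult_left_mono c) (simp add: algebra_simps)
    finally show ?thesis by (simp add: mult.assoc)
  qed
  ultimately show ?thesis using c by (auto simp: growth_def)
qed

lemma field_growth_integrable:
  assumes B: "B \<in> bounded_borel" and g: "field_growth B C g"
  shows "integrable (\<Lambda> \<Otimes>\<^sub>M Q) (\<lambda>(x, nu). g x nu)" "integrable (\<Lambda> \<Otimes>\<^sub>M Q) (\<lambda>(x, nu). g x (add_point x nu))"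
proof -
  have g' [measurable]: "(\<lambda>(x, nu). g x nu) \<in> borel_measurable (borel \<Otimes>\<^sub>M confs)"
    using g by (simp add: field_growth_def)
  have [measurable]: "B \<in> sets borel" using B by (rule bounded_borelD)
  have C: "0 \<le> C" using g by (simp add: field_growth_def)
  \<comment> \<open>The factor 2 absorbs the additional unit that the planted point contributes to
    the count, so that one estimate serves both claims.\<close>
  have one: "integrable (\<Lambda> \<Otimes>\<^sub>M Q) f" if [measurable]: "f \<in> borel_measurable (\<Lambda> \<Otimes>\<^sub>M Q)"
    and f: "\<And>x nu. nu \<in> configs \<Longrightarrow> \<bar>f (x, nu)\<bar> \<le> indicator B x * (2 * C * (1 + measure nu B))" for f
  proof (rule integrableI_bounded)
    have i: "integrable Q (\<lambda>nu. 2 * C * (1 + measure nu B))"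
      by (rule growth_integrable[OF B, of "2 * C"]) (use C in \<open>auto simp: growth_def\<close>)
    have "(\<integral>\<^sup>+p. ennreal (norm (f p)) \<partial>(\<Lambda> \<Otimes>\<^sub>M Q)) = (\<integral>\<^sup>+x. \<integral>\<^sup>+nu. ennreal (norm (f (x, nu))) \<partial>Q \<partial>\<Lambda>)"
      by (subst Q.nn_integral_fst[symmetric]) auto
    also have "... \<le> (\<integral>\<^sup>+x. \<integral>\<^sup>+nu. indicator B x * ennreal (2 * C * (1 + measure nu B)) \<partial>Q \<partial>\<Lambda>)"
    proof (intro nn_integral_mono)
      fix x nu assume "nu \<in> space Q"
      then have "\<bar>f (x, nu)\<bar> \<le> indicator B x * (2 * C * (1 + measure nu B))" using f by simp
      then have "ennreal (norm (f (x, nu))) \<le> ennreal (indicator B x * (2 * C * (1 + measure nu B)))"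
        by (intro ennreal_leI) simp
      then show "ennreal (norm (f (x, nu))) \<le> indicator B x * ennreal (2 * C * (1 + measure nu B))"
        by (cases "x \<in> B") auto
    qed
    also have "... = (\<integral>\<^sup>+nu. ennreal (2 * C * (1 + measure nu B)) \<partial>Q) * emeasure \<Lambda> B"
      by (simp add: nn_integral_cmult nn_integral_multc mult.commute)
    also have "... < \<infinity>"
      using i C \<Lambda>_finite[OF B] by (subst nn_integral_eq_integral) (auto simp: ennreal_mult_less_top)
    finally show "(\<integral>\<^sup>+p. ennreal (norm (f p)) \<partial>(\<Lambda> \<Otimes>\<^sub>M Q)) < \<infinity>" .
  qed measurable
  have le: "C * (1 + measure nu B) \<le> 2 * C * (1 + measure nu B)" "C * (1 + (measure nu B + 1)) \<le> 2 * C * (1 + measure nu B)"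
    for nu :: "(real \<times> real) measure"
    using C mult_nonneg_nonneg[OF C, of "measure nu B"] by (simp_all add: algebra_simps)
  show "integrable (\<Lambda> \<Otimes>\<^sub>M Q) (\<lambda>(x, nu). g x nu)"
  proof (rule one)
    fix x nu assume "nu \<in> (configs :: (real \<times> real) measure set)"
    then show "\<bar>case (x, nu) of (x, nu) \<Rightarrow> g x nu\<bar> \<le> indicator B x * (2 * C * (1 + measure nu B))"
      using order_trans[OF field_growthD(1)[OF g] le(1)[of nu]] field_growthD(2)[OF g] by (cases "x \<in> B") auto
  qed measurable
  show "integrable (\<Lambda> \<Otimes>\<^sub>M Q) (\<lambda>(x, nu). g x (add_point x nu))"
  proof (rule one)
    fix x nu assume nu: "nu \<in> (configs :: (real \<times> real) measure set)"
    have "\<bar>g x (add_point x nu)\<bar> \<le> C * (1 + measure (add_point x nu) B)"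
      using g add_point_in_configs[OF nu] by (simp add: field_growth_def)
    also have "... \<le> C * (1 + (measure nu B + 1))"
      using C by (intro mult_left_mono) (simp_all add: measure_add_point[OF nu B] split: split_indicator)
    finally show "\<bar>case (x, nu) of (x, nu) \<Rightarrow> g x (add_point x nu)\<bar> \<le> indicator B x * (2 * C * (1 + measure nu B))"
      using g add_point_in_configs[OF nu] le(2)[of nu] by (cases "x \<in> B") (auto simp: field_growth_def)
  qed measurable
qed

lemma field_growth_section:
  assumes B: "B \<in> bounded_borel" and g: "field_growth B C g" and nu: "nu \<in> configs"
  shows "integrable nu (\<lambda>x. g x nu)"
proof -
  have [measurable]: "(\<lambda>(x, nu). g x nu) \<in> borel_measurable (borel \<Otimes>\<^sub>M confs)"
    using g by (simp add: field_growth_def)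
  have m: "(\<lambda>x. g x nu) \<in> borel_measurable nu"
    by (rule field_section[OF _ nu]) (use nu in simp_all)
  show ?thesis
    by (rule integrableI_bounded_set[of B _ _ "C * (1 + measure nu B)"])
       (use g nu m bounded_borelD[OF B] configs_finite[OF nu bounded_borelD[OF B]] in \<open>auto simp: field_growth_def\<close>)
qed

lemma mecke_nonneg:
  assumes B: "B \<in> bounded_borel" and g: "field_growth B C g" and pos: "\<And>x nu. 0 \<le> g x nu"
  shows "integrable Q (\<lambda>nu. LINT x|nu. g x nu)"
    "(LINT nu|Q. LINT x|nu. g x nu) = (LINT x|\<Lambda>. LINT nu|Q. g x (add_point x nu))"
proof -
  have gm [measurable]: "(\<lambda>(x, nu). g x nu) \<in> borel_measurable (borel \<Otimes>\<^sub>M confs)"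
    using g by (simp add: field_growth_def)
  note I = field_growth_integrable(2)[OF B g]
  have "(\<integral>\<^sup>+nu. ennreal (LINT x|nu. g x nu) \<partial>Q) = (\<integral>\<^sup>+nu. \<integral>\<^sup>+x. ennreal (g x nu) \<partial>nu \<partial>Q)"
    using field_growth_section[OF B g] pos
    by (intro nn_integral_cong nn_integral_eq_integral[symmetric]) auto
  also have "... = (\<integral>\<^sup>+x. \<integral>\<^sup>+nu. ennreal (g x (add_point x nu)) \<partial>Q \<partial>\<Lambda>)"
    using mecke[of "\<lambda>(x, nu). ennreal (g x nu)"] by simp
  also have "... = (\<integral>\<^sup>+p. ennreal (case p of (x, nu) \<Rightarrow> g x (add_point x nu)) \<partial>(\<Lambda> \<Otimes>\<^sub>M Q))"
    by (subst Q.nn_integral_fst[symmetric]) auto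
  also have "... = ennreal (LINT p|(\<Lambda> \<Otimes>\<^sub>M Q). (case p of (x, nu) \<Rightarrow> g x (add_point x nu)))"
    using I pos by (intro nn_integral_eq_integral) auto
  finally have eq: "(\<integral>\<^sup>+nu. ennreal (LINT x|nu. g x nu) \<partial>Q) = ennreal (LINT p|(\<Lambda> \<Otimes>\<^sub>M Q). (case p of (x, nu) \<Rightarrow> g x (add_point x nu)))" .
  have nn: "0 \<le> (LINT x|nu. g x nu)" for nu using pos by (intro integral_nonneg_AE) auto
  show int: "integrable Q (\<lambda>nu. LINT x|nu. g x nu)"
    by (rule integrableI_nonneg) (use eq nn in \<open>auto simp: measurable_cong_sets[OF sets_Q refl]\<close>)
  have "ennreal (LINT nu|Q. LINT x|nu. g x nu) = ennreal (LINT p|(\<Lambda> \<Otimes>\<^sub>M Q). (case p of (x, nu) \<Rightarrow> g x (add_point x nu)))"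
    using eq nn_integral_eq_integral[OF int] nn by auto
  then have "(LINT nu|Q. LINT x|nu. g x nu) = (LINT p|(\<Lambda> \<Otimes>\<^sub>M Q). (case p of (x, nu) \<Rightarrow> g x (add_point x nu)))"
    by (subst (asm) ennreal_inj) (use nn pos in \<open>auto intro!: integral_nonneg_AE\<close>)
  also have "... = (LINT x|\<Lambda>. LINT nu|Q. g x (add_point x nu))"
    using \<Lambda>Q.integral_fst[OF I] by simp
  finally show "(LINT nu|Q. LINT x|nu. g x nu) = (LINT x|\<Lambda>. LINT nu|Q. g x (add_point x nu))" .
qed

lemma mecke_integral:
  assumes B: "B \<in> bounded_borel" and g: "field_growth B C g"
  shows "integrable Q (\<lambda>nu. LINT x|nu. g x nu)"
    "(LINT nu|Q. LINT x|nu. g x nu) = (LINT x|\<Lambda>. LINT nu|Q. g x (add_point x nu))"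
proof -
  have gm [measurable]: "(\<lambda>(x, nu). g x nu) \<in> borel_measurable (borel \<Otimes>\<^sub>M confs)"
    using g by (simp add: field_growth_def)
  let ?p = "\<lambda>x nu. max 0 (g x nu)" and ?n = "\<lambda>x nu. max 0 (- g x nu)"
  have abs: "\<bar>?p x nu\<bar> \<le> \<bar>g x nu\<bar>" "\<bar>?n x nu\<bar> \<le> \<bar>g x nu\<bar>" for x nu by auto
  have p: "field_growth B C ?p" and n: "field_growth B C ?n"
    unfolding field_growth_def
    using order_trans[OF abs(1) field_growthD(1)[OF g]] order_trans[OF abs(2) field_growthD(1)[OF g]]
      field_growthD(2)[OF g] g by (simp_all add: field_growth_def)
  have dec: "g x nu = ?p x nu - ?n x nu" for x nu by auto
  have split: "(LINT x|nu. g x nu) = (LINT x|nu. ?p x nu) - (LINT x|nu. ?n x nu)" if "nu \<in> configs" for nu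
    using field_growth_section[OF B p that] field_growth_section[OF B n that]
    by (subst dec) (rule Bochner_Integration.integral_diff)
  note P = mecke_nonneg[OF B p] and N = mecke_nonneg[OF B n]
  have "integrable Q (\<lambda>nu. (LINT x|nu. ?p x nu) - (LINT x|nu. ?n x nu))" using P(1) N(1) by auto
  then show "integrable Q (\<lambda>nu. LINT x|nu. g x nu)"
    by (rule Bochner_Integration.integrable_cong[THEN iffD1, OF refl, rotated]) (simp add: split)
  have "(LINT nu|Q. LINT x|nu. g x nu) = (LINT nu|Q. (LINT x|nu. ?p x nu) - (LINT x|nu. ?n x nu))"
    by (intro Bochner_Integration.integral_cong) (auto simp: split)
  also have "... = (LINT x|\<Lambda>. LINT nu|Q. ?p x (add_point x nu)) - (LINT x|\<Lambda>. LINT nu|Q. ?n x (add_point x nu))"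
    using P N by simp
  also have "... = (LINT q|(\<Lambda> \<Otimes>\<^sub>M Q). (case q of (x, nu) \<Rightarrow> ?p x (add_point x nu))) - (LINT q|(\<Lambda> \<Otimes>\<^sub>M Q). (case q of (x, nu) \<Rightarrow> ?n x (add_point x nu)))"
    using \<Lambda>Q.integral_fst[OF field_growth_integrable(2)[OF B p]] \<Lambda>Q.integral_fst[OF field_growth_integrable(2)[OF B n]] by simp
  also have "... = (LINT q|(\<Lambda> \<Otimes>\<^sub>M Q). (case q of (x, nu) \<Rightarrow> g x (add_point x nu)))"
    using field_growth_integrable(2)[OF B p] field_growth_integrable(2)[OF B n]
    by (subst Bochner_Integration.integral_diff[symmetric]) (auto intro!: Bochner_Integration.integral_cong)
  also have "... = (LINT x|\<Lambda>. LINT nu|Q. g x (add_point x nu))"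
    using \<Lambda>Q.integral_fst[OF field_growth_integrable(2)[OF B g]] by simp
  finally show "(LINT nu|Q. LINT x|nu. g x nu) = (LINT x|\<Lambda>. LINT nu|Q. g x (add_point x nu))" .
qed

lemma growth_field:
  assumes k: "growth B C k" and Y: "causal c B Y"
  shows "field_growth B (C * c) (\<lambda>x nu. k nu * Y x nu)"
proof -
  note [measurable] = causal_measurable[OF Y]
  have [measurable]: "k \<in> borel_measurable confs" using k by (simp add: growth_def)
  have "\<bar>k nu * Y x nu\<bar> \<le> C * c * (1 + measure nu B)" if "nu \<in> configs" for x nu
  proof -
    have "\<bar>k nu\<bar> * \<bar>Y x nu\<bar> \<le> (C * (1 + measure nu B)) * c"
      using k Y that by (intro mult_mono) (auto simp: growth_def causal_def)
    then show ?thesis by (simp add: abs_mult ac_simps)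
  qed
  then show ?thesis using k Y by (auto simp: field_growth_def growth_def causal_def)
qed

text \<open>The duality between compensated integrals and the difference operator. Mecke's formula
  turns the sum over the points into an integral of \<open>k\<close> at the augmented configuration,
  the compensator subtracts \<open>k\<close> at the original one, and causality gives both the
  common factor \<open>Y x nu\<close>.\<close>

theorem compensated_covariance:
  assumes B: "B \<in> bounded_borel" and k: "growth B C k" and Y: "causal c B Y"
  shows "(LINT nu|Q. k nu * compensated Y nu) = (LINT x|\<Lambda>. LINT nu|Q. Y x nu * (k (add_point x nu) - k nu))"
proof -
  note g = growth_field[OF k Y]
  note I1 = field_growth_integrable(1)[OF B g] and I2 = field_growth_integrable(2)[OF B g]
  have inv: "k (add_point x nu) * Y x (add_point x nu) = Y x nu * k (add_point x nu)" if "nu \<in> configs" for x nu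
    using Y that by (simp add: causal_def)
  have "(LINT nu|Q. k nu * compensated Y nu) = (LINT nu|Q. (LINT x|nu. k nu * Y x nu) - (LINT x|\<Lambda>. k nu * Y x nu))"
    by (simp add: compensated_def right_diff_distrib)
  also have "... = (LINT nu|Q. LINT x|nu. k nu * Y x nu) - (LINT nu|Q. LINT x|\<Lambda>. k nu * Y x nu)"
    using mecke_integral(1)[OF B g] \<Lambda>Q.integrable_snd[OF I1] by (intro Bochner_Integration.integral_diff) auto
  also have "... = (LINT x|\<Lambda>. LINT nu|Q. k (add_point x nu) * Y x (add_point x nu)) - (LINT x|\<Lambda>. LINT nu|Q. k nu * Y x nu)"
    using mecke_integral(2)[OF B g] \<Lambda>Q.Fubini_integral[OF I1] by simp
  also have "... = (LINT p|(\<Lambda> \<Otimes>\<^sub>M Q). (case p of (x, nu) \<Rightarrow> k (add_point x nu) * Y x (add_point x nu))) - (LINT p|(\<Lambda> \<Otimes>\<^sub>M Q). (case p of (x, nu) \<Rightarrow> k nu * Y x nu))"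
    using \<Lambda>Q.integral_fst[OF I1] \<Lambda>Q.integral_fst[OF I2] by simp
  also have "... = (LINT p|(\<Lambda> \<Otimes>\<^sub>M Q). (case p of (x, nu) \<Rightarrow> k (add_point x nu) * Y x (add_point x nu)) - (case p of (x, nu) \<Rightarrow> k nu * Y x nu))"
    by (rule Bochner_Integration.integral_diff[OF I2 I1, symmetric])
  also have "... = (LINT p|(\<Lambda> \<Otimes>\<^sub>M Q). (case p of (x, nu) \<Rightarrow> k (add_point x nu) * Y x (add_point x nu) - k nu * Y x nu))"
    by (intro Bochner_Integration.integral_cong) auto
  also have "... = (LINT x|\<Lambda>. LINT nu|Q. k (add_point x nu) * Y x (add_point x nu) - k nu * Y x nu)"
  proof -
    have "integrable (\<Lambda> \<Otimes>\<^sub>M Q) (\<lambda>(x, nu). k (add_point x nu) * Y x (add_point x nu) - k nu * Y x nu)"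
      using Bochner_Integration.integrable_diff[OF I2 I1] by (simp add: split_beta')
    from \<Lambda>Q.integral_fst[OF this] show ?thesis by simp
  qed
  also have "... = (LINT x|\<Lambda>. LINT nu|Q. Y x nu * (k (add_point x nu) - k nu))"
    by (intro Bochner_Integration.integral_cong refl) (simp add: inv algebra_simps)
  finally show ?thesis .
qed

text \<open>The added point contributes its own weight and alters the field at later points. Its own
  weight is not altered by itself, so these are all the effects.\<close>

lemma compensated_add_point:
  assumes B: "B \<in> bounded_borel" and Y: "causal c B Y" and nu: "nu \<in> configs"
  shows "compensated Y (add_point x nu) = compensated Y nu + Y x nu + compensated (point_diff x Y) nu"
proof -
  note [measurable] = causal_measurable[OF Y]
  have Jnu: "add_point x nu \<in> configs" using nu by simp
  have fin: "emeasure nu B < \<infinity>" using configs_finite[OF nu bounded_borelD[OF B]] .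
  have a: "integrable nu (\<lambda>y. Y y (add_point x nu))" "integrable \<Lambda> (\<lambda>y. Y y (add_point x nu))"
    using causal_integrable(1)[OF B Y Jnu] fin \<Lambda>_finite[OF B] nu by auto
  have b: "integrable nu (\<lambda>y. Y y nu)" "integrable \<Lambda> (\<lambda>y. Y y nu)"
    using causal_integrable(1)[OF B Y nu] fin \<Lambda>_finite[OF B] nu by auto
  have "(LINT y|add_point x nu. Y y (add_point x nu)) = (LINT y|nu. Y y (add_point x nu)) + Y x (add_point x nu)"
    by (rule integrable_add_point(2)[OF nu field_section[OF causal_measurable[OF Y] Jnu refl] a(1)])
  moreover have "Y x (add_point x nu) = Y x nu" using Y nu by (simp add: causal_def)
  ultimately show ?thesis
    using a b by (simp add: compensated_def point_diff_def)
qed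

text \<open>The covariance formula with the compensated integral itself as functional. Its increment
  at \<open>x\<close> is \<open>Y x\<close> plus a compensated difference field. The latter is
  orthogonal to \<open>Y x\<close>, as a second covariance formula produces a product with a
  vanishing factor: a point \<open>y\<close> not before \<open>x\<close> leaves \<open>Y x\<close>
  unchanged, and before \<open>x\<close> the difference field is zero.\<close>

theorem compensated_isometry:
  assumes B: "B \<in> bounded_borel" and Y: "causal c B Y"
  shows "(LINT nu|Q. (compensated Y nu)\<^sup>2) = (LINT x|\<Lambda>. LINT nu|Q. (Y x nu)\<^sup>2)"
proof -
  note [measurable] = causal_measurable[OF Y]
  note R = growth_compensated[OF B Y]
  have "(LINT nu|Q. (compensated Y nu)\<^sup>2) = (LINT x|\<Lambda>. LINT nu|Q. Y x nu * (compensated Y (add_point x nu) - compensated Y nu))"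
    using compensated_covariance[OF B R Y] by (simp add: power2_eq_square)
  also have "... = (LINT x|\<Lambda>. LINT nu|Q. (Y x nu)\<^sup>2)"
  proof (rule Bochner_Integration.integral_cong[OF refl])
    fix x
    have c: "0 \<le> c" using Y by (simp add: causal_def)
    have Yx: "growth B c (Y x)"
      using Y by (intro growth_bounded) (auto simp: causal_def)
    note D = causal_point_diff[OF Y, of x]
    have "(LINT nu|Q. Y x nu * compensated (point_diff x Y) nu)
      = (LINT y|\<Lambda>. LINT nu|Q. point_diff x Y y nu * (Y x (add_point y nu) - Y x nu))"
      by (rule compensated_covariance[OF B Yx D])
    also have "... = (LINT y|\<Lambda>. LINT nu|Q. 0)"
    proof (intro Bochner_Integration.integral_cong refl)
      fix y nu assume "nu \<in> space Q"
      then have nu: "nu \<in> configs" by simp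
      show "point_diff x Y y nu * (Y x (add_point y nu) - Y x nu) = 0"
      proof (cases "fst x \<le> fst y")
        case True then show ?thesis using Y nu by (simp add: causal_def)
      next
        case False then show ?thesis using point_diff_before[OF Y nu] by simp
      qed
    qed
    finally have zero: "(LINT nu|Q. Y x nu * compensated (point_diff x Y) nu) = 0" by simp
    have "(LINT nu|Q. Y x nu * (compensated Y (add_point x nu) - compensated Y nu))
      = (LINT nu|Q. (Y x nu)\<^sup>2 + Y x nu * compensated (point_diff x Y) nu)"
      by (intro Bochner_Integration.integral_cong refl)
         (simp add: compensated_add_point[OF B Y] power2_eq_square algebra_simps)
    also have "... = (LINT nu|Q. (Y x nu)\<^sup>2) + (LINT nu|Q. Y x nu * compensated (point_diff x Y) nu)"
      by (rule Bochner_Integration.integral_add[OF growth_square_integrable[OF B Yx]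
            growth_mult_integrable[OF B Yx growth_compensated[OF B D]]])
    finally show "(LINT nu|Q. Y x nu * (compensated Y (add_point x nu) - compensated Y nu)) = (LINT nu|Q. (Y x nu)\<^sup>2)"
      using zero by simp
  qed
  finally show ?thesis .
qed

end

section \<open>Truncated Picard iterates\<close>

lemma measurable_fst_borel [measurable (raw)]:
  fixes f :: "'z \<Rightarrow> real \<times> real"
  assumes "f \<in> borel_measurable Z" shows "(\<lambda>z. fst (f z)) \<in> borel_measurable Z"
  using measurable_compose[OF assms, of fst borel]
  by (simp add: borel_measurable_continuous_onI continuous_on_fst)

lemma measurable_snd_borel [measurable (raw)]:
  fixes f :: "'z \<Rightarrow> real \<times> real"
  assumes "f \<in> borel_measurable Z" shows "(\<lambda>z. snd (f z)) \<in> borel_measurable Z"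
  using measurable_compose[OF assms, of snd borel]
  by (simp add: borel_measurable_continuous_onI continuous_on_snd)

lemma sigma_finite_configs:
  assumes "nu \<in> (configs :: ('a::euclidean_space) measure set)"
  shows "sigma_finite_measure nu"
proof
  show "\<exists>A::'a set set. countable A \<and> A \<subseteq> sets nu \<and> \<Union>A = space nu \<and> (\<forall>a\<in>A. emeasure nu a \<noteq> \<infinity>)"
  proof (intro exI conjI ballI)
    show "countable (range (\<lambda>n. cball (0::'a) (real n)))" by simp
    show "\<Union>(range (\<lambda>n. cball (0::'a) (real n))) = space nu" using UN_cball_nat assms by simp
    show "range (\<lambda>n. cball (0::'a) (real n)) \<subseteq> sets nu" using assms by (intro image_subsetI) simp
    fix a assume "a \<in> range (\<lambda>n. cball (0::'a) (real n))"
    then have "a \<in> bounded_borel" by (auto simp: bounded_borel_def)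
    then show "emeasure nu a \<noteq> \<infinity>"
      using configs_finite[OF assms, of a] by (auto simp: bounded_borel_def)
  qed
qed

text \<open>Acceptance of a point under the level \<open>a\<close>. The lower bound makes the
  indicator vanish off the half plane and for negative levels.\<close>

definition hit :: "real \<Rightarrow> real \<times> real \<Rightarrow> real" where
  "hit a y = (if 0 \<le> snd y \<and> snd y \<le> a then 1 else 0)"

lemma hit_simps [simp]: "0 \<le> hit a y" "hit a y \<le> 1" "\<bar>hit a y\<bar> = hit a y"
  by (auto simp: hit_def)

lemma measurable_hit [measurable (raw)]:
  assumes [measurable]: "f \<in> borel_measurable Z" "g \<in> borel_measurable Z"
  shows "(\<lambda>z. hit (f z) (g z)) \<in> borel_measurable Z"
  unfolding hit_def by measurable

lemma nn_integral_hit: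
  "0 \<le> a \<Longrightarrow> (\<integral>\<^sup>+\<theta>. ennreal (hit a (s, \<theta>)) * indicator {0..} \<theta> \<partial>lborel) = ennreal a"
proof -
  assume "0 \<le> a"
  have "(\<integral>\<^sup>+\<theta>. ennreal (hit a (s, \<theta>)) * indicator {0..} \<theta> \<partial>lborel) = (\<integral>\<^sup>+\<theta>. indicator {0..a} \<theta> \<partial>lborel)"
    by (intro nn_integral_cong) (auto simp: hit_def split: split_indicator)
  then show ?thesis using \<open>0 \<le> a\<close> by simp
qed

lemma nn_integral_hit_diff:
  assumes "0 \<le> a" "0 \<le> a'"
  shows "(\<integral>\<^sup>+\<theta>. ennreal \<bar>hit a (s, \<theta>) - hit a' (s, \<theta>)\<bar> * indicator {0..} \<theta> \<partial>lborel) = ennreal \<bar>a - a'\<bar>"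
proof -
  have "(\<integral>\<^sup>+\<theta>. ennreal \<bar>hit a (s, \<theta>) - hit a' (s, \<theta>)\<bar> * indicator {0..} \<theta> \<partial>lborel)
    = (\<integral>\<^sup>+\<theta>. indicator {min a a'<..max a a'} \<theta> \<partial>lborel)"
    using assms by (intro nn_integral_cong) (auto simp: hit_def split: split_indicator)
  also have "... = ennreal \<bar>a - a'\<bar>" by (auto simp: min_def max_def)
  finally show ?thesis .
qed

lemma half_plane_borel [measurable]: "UNIV \<times> {0..} \<in> sets (borel :: (real \<times> real) measure)"
  unfolding borel_prod[symmetric] by (intro pair_measureI) auto

context poisson_plane begin

lemma nn_integral_\<Lambda>:
  assumes [measurable]: "f \<in> borel_measurable borel"
  shows "(\<integral>\<^sup>+x. f x \<partial>\<Lambda>) = (\<integral>\<^sup>+s. \<integral>\<^sup>+\<theta>. f (s, \<theta>) * indicator {0..} \<theta> \<partial>lborel \<partial>lborel)"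
proof -
  have "(\<integral>\<^sup>+x. f x \<partial>\<Lambda>) = (\<integral>\<^sup>+x. f x * indicator (UNIV \<times> {0..}) x \<partial>(lborel \<Otimes>\<^sub>M lborel))"
    unfolding \<Lambda>_eq lborel_prod by (subst nn_integral_density) (auto simp: mult.commute)
  also have "... = (\<integral>\<^sup>+s. \<integral>\<^sup>+\<theta>. f (s, \<theta>) * indicator (UNIV \<times> {0..}) (s, \<theta>) \<partial>lborel \<partial>lborel)"
  proof (subst lborel.nn_integral_fst[symmetric])
    show "(\<lambda>x. f x * indicator (UNIV \<times> {0..}) x) \<in> borel_measurable (lborel \<Otimes>\<^sub>M lborel)"
      unfolding lborel_prod by measurable
  qed simp
  finally show ?thesis by (simp add: indicator_def)
qed

lemma emeasure_\<Lambda>_box: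
  "s \<le> t \<Longrightarrow> 0 \<le> b \<Longrightarrow> emeasure \<Lambda> ({s<..t} \<times> {0..b}) = ennreal ((t - s) * b)"
proof -
  assume st: "s \<le> t" "0 \<le> b"
  have [measurable]: "{s<..t} \<times> {0..b} \<in> sets borel"
    unfolding borel_prod[symmetric] by (intro pair_measureI) auto
  have "emeasure \<Lambda> ({s<..t} \<times> {0..b}) = (\<integral>\<^sup>+x. indicator ({s<..t} \<times> {0..b}) x \<partial>\<Lambda>)" by simp
  also have "... = (\<integral>\<^sup>+u. \<integral>\<^sup>+\<theta>. indicator {s<..t} u * indicator {0..b} \<theta> \<partial>lborel \<partial>lborel)"
    by (subst nn_integral_\<Lambda>) (auto intro!: nn_integral_cong split: split_indicator)
  also have "... = (\<integral>\<^sup>+u. ennreal b * indicator {s<..t} u \<partial>lborel)"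
    using st by (simp add: nn_integral_cmult nn_integral_multc mult.commute)
  also have "... = ennreal ((t - s) * b)"
    using st by (simp add: nn_integral_cmult ennreal_mult[symmetric] mult.commute)
  finally show ?thesis .
qed

lemma nn_isometry:
  assumes B: "B \<in> bounded_borel" and Y: "causal c B Y"
  shows "(\<integral>\<^sup>+nu. ennreal ((compensated Y nu)\<^sup>2) \<partial>Q) = (\<integral>\<^sup>+x. \<integral>\<^sup>+nu. ennreal ((Y x nu)\<^sup>2) \<partial>Q \<partial>\<Lambda>)"
proof -
  note [measurable] = causal_measurable[OF Y]
  have c: "0 \<le> c" using Y by (simp add: causal_def)
  have sq: "(Y x nu)\<^sup>2 \<le> c\<^sup>2 * (1 + measure nu B)" if "nu \<in> configs" for x nu
  proof -
    have "\<bar>Y x nu\<bar>\<^sup>2 \<le> c\<^sup>2" using Y that by (intro power_mono) (auto simp: causal_def)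
    also have "c\<^sup>2 * 1 \<le> c\<^sup>2 * (1 + measure nu B)" by (intro mult_left_mono) auto
    finally show ?thesis by simp
  qed
  have "field_growth B (c\<^sup>2) (\<lambda>x nu. (Y x nu)\<^sup>2)"
    using Y sq by (simp add: field_growth_def causal_def)
  note I = field_growth_integrable(1)[OF B this]
  have "(\<integral>\<^sup>+nu. ennreal ((compensated Y nu)\<^sup>2) \<partial>Q) = ennreal (LINT nu|Q. (compensated Y nu)\<^sup>2)"
    by (intro nn_integral_eq_integral growth_square_integrable[OF B growth_compensated[OF B Y]]) simp
  also have "... = ennreal (LINT p|(\<Lambda> \<Otimes>\<^sub>M Q). (case p of (x, nu) \<Rightarrow> (Y x nu)\<^sup>2))"
    unfolding compensated_isometry[OF B Y] using \<Lambda>Q.integral_fst[OF I] by simp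
  also have "... = (\<integral>\<^sup>+p. ennreal (case p of (x, nu) \<Rightarrow> (Y x nu)\<^sup>2) \<partial>(\<Lambda> \<Otimes>\<^sub>M Q))"
    using I by (intro nn_integral_eq_integral[symmetric]) auto
  also have "... = (\<integral>\<^sup>+x. \<integral>\<^sup>+nu. ennreal ((Y x nu)\<^sup>2) \<partial>Q \<partial>\<Lambda>)"
    by (subst Q.nn_integral_fst[symmetric]) auto
  finally show ?thesis .
qed

end

section \<open>The kernel, its contraction rate and the capped iteration\<close>

locale hawkes_kernel =
  fixes \<phi> h :: "real \<Rightarrow> real" and \<mu> \<alpha> :: real
  assumes \<phi>_measurable [measurable]: "\<phi> \<in> borel_measurable borel"
    and \<phi>_integrable: "integrable lborel \<phi>"
    and \<phi>_bounded: "\<exists>K. \<forall>t\<in>{0..T}. \<bar>\<phi> t\<bar> \<le> K"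
    and h_nonneg: "0 \<le> h x"
    and h_lipschitz: "\<alpha>-lipschitz_on UNIV h"
    and contraction: "\<alpha> * (LINT t|lborel. \<bar>\<phi> t\<bar>) < 1"
begin

text \<open>The branching ratio: a bound for the total direct effect of one accepted point on the
  later intensity.\<close>

definition \<rho> :: real where "\<rho> = \<alpha> * (LINT t|lborel. \<bar>\<phi> t\<bar>)"

lemma \<alpha>_nonneg: "0 \<le> \<alpha>"
  using h_lipschitz by (rule lipschitz_on_nonneg)

lemma \<rho>_bounds: "0 \<le> \<rho>" "\<rho> < 1"
  using contraction \<alpha>_nonneg by (auto simp: \<rho>_def intro!: mult_nonneg_nonneg integral_nonneg_AE)

lemma h_measurable [measurable]: "h \<in> borel_measurable borel"
  using lipschitz_on_continuous_on[OF h_lipschitz] by (rule borel_measurable_continuous_onI)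

lemma h_diff: "\<bar>h x - h y\<bar> \<le> \<alpha> * \<bar>x - y\<bar>"
  using lipschitz_onD[OF h_lipschitz, of x y] by (simp add: dist_real_def)

lemma \<phi>_shift_mass: "(\<integral>\<^sup>+t. ennreal (\<alpha> * \<bar>\<phi> (t - s)\<bar>) \<partial>lborel) = ennreal \<rho>"
proof -
  have "(\<integral>\<^sup>+t. ennreal (\<alpha> * \<bar>\<phi> (t - s)\<bar>) \<partial>lborel) = ennreal \<alpha> * (\<integral>\<^sup>+t. ennreal \<bar>\<phi> (t - s)\<bar> \<partial>lborel)"
    using \<alpha>_nonneg by (subst nn_integral_cmult[symmetric]) (auto simp: ennreal_mult)
  also have "(\<integral>\<^sup>+t. ennreal \<bar>\<phi> (t - s)\<bar> \<partial>lborel) = (\<integral>\<^sup>+t. ennreal \<bar>\<phi> t\<bar> \<partial>lborel)"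
    using nn_integral_real_affine[of "\<lambda>t. ennreal \<bar>\<phi> t\<bar>" 1 "- s"] by simp
  also have "... = ennreal (LINT t|lborel. \<bar>\<phi> t\<bar>)"
    using \<phi>_integrable by (intro nn_integral_eq_integral) auto
  finally show ?thesis using \<alpha>_nonneg
    by (simp add: \<rho>_def ennreal_mult[symmetric] integral_nonneg_AE)
qed

text \<open>The indicator cuts off the history before time 0 and evaluates the kernel at positive
  arguments only.\<close>

definition window :: "real \<Rightarrow> real \<times> real \<Rightarrow> real" where
  "window t y = indicator {0<..<t} (fst y) * \<phi> (t - fst y)"

lemma measurable_window [measurable (raw)]:
  assumes [measurable]: "f \<in> borel_measurable Z" "g \<in> borel_measurable Z"
  shows "(\<lambda>z. window (f z) (g z)) \<in> borel_measurable Z"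
proof -
  have "window a y = (if 0 < fst y \<and> fst y < a then \<phi> (a - fst y) else 0)" for a y
    by (simp add: window_def indicator_def)
  then show ?thesis by simp
qed

lemma window_mass: "(\<integral>\<^sup>+t. ennreal (\<alpha> * \<bar>window t y\<bar>) \<partial>lborel) \<le> ennreal \<rho>"
proof -
  have "(\<integral>\<^sup>+t. ennreal (\<alpha> * \<bar>window t y\<bar>) \<partial>lborel) \<le> (\<integral>\<^sup>+t. ennreal (\<alpha> * \<bar>\<phi> (t - fst y)\<bar>) \<partial>lborel)"
    using \<alpha>_nonneg by (intro nn_integral_mono ennreal_leI mult_left_mono)
      (auto simp: window_def split: split_indicator)
  then show ?thesis using \<phi>_shift_mass by simp
qed

text \<open>
  The cap \<open>b\<close> makes the fields of accepted points bounded with bounded support.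
\<close>

fun iter :: "real \<Rightarrow> nat \<Rightarrow> real \<Rightarrow> (real \<times> real) measure \<Rightarrow> real" where
  "iter b 0 t nu = 0"
| "iter b (Suc n) t nu = min b (h (\<mu> + (LINT y|nu. window t y * hit (iter b n (fst y) nu) y)))"

lemma measurable_iter: "(\<lambda>(t, nu). iter b n t nu) \<in> borel_measurable (borel \<Otimes>\<^sub>M confs)"
proof (induction n)
  case (Suc n)
  note [measurable] = Suc
  show ?case unfolding iter.simps by measurable
qed simp

end

section \<open>The iterates on a bounded horizon and the effect of an additional point\<close>

locale hawkes_iterates = poisson_plane Q \<Lambda> + hawkes_kernel \<phi> h \<mu> \<alpha>
  for Q \<Lambda> \<phi> h \<mu> \<alpha> +
  fixes b T :: real
  assumes b_nonneg: "0 \<le> b" and T_pos: "0 < T"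
begin

abbreviation lam :: "nat \<Rightarrow> real \<Rightarrow> (real \<times> real) measure \<Rightarrow> real" where
  "lam \<equiv> iter b"

definition box :: "(real \<times> real) set" where "box = {0<..T} \<times> {0..b}"

text \<open>The accepted points form a causal field with values 0 and 1. Its compensated integral is
  the number of points accepted by the iterate minus the integrated iterate, the counterpart of the
  martingale in the theorem.\<close>

definition Z :: "nat \<Rightarrow> real \<times> real \<Rightarrow> (real \<times> real) measure \<Rightarrow> real" where
  "Z n y nu = indicator {0<..T} (fst y) * hit (lam n (fst y) nu) y"

lemmas [measurable] = measurable_iter

lemma box: "box \<in> bounded_borel"
proof -
  have "box \<in> sets borel"
    unfolding borel_prod[symmetric] box_def by (intro pair_measureI) auto
  moreover have "bounded box" unfolding box_def by (intro bounded_Times) auto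
  ultimately show ?thesis by (simp add: bounded_borel_def)
qed

lemma box_borel [measurable]: "box \<in> sets borel"
  using box by (rule bounded_borelD)

lemma lam_bounds: "0 \<le> lam n t nu" "lam n t nu \<le> b"
  using b_nonneg h_nonneg by (cases n; simp)+

lemma measurable_Z [measurable]: "(\<lambda>(y, nu). Z n y nu) \<in> borel_measurable (borel \<Otimes>\<^sub>M confs)"
  unfolding Z_def by measurable

lemma Z_bounds: "0 \<le> Z n y nu" "Z n y nu \<le> 1" "y \<notin> box \<Longrightarrow> Z n y nu = 0"
  using lam_bounds(2)[of n "fst y" nu]
  by (auto simp: Z_def box_def hit_def mem_Times_iff split: split_indicator)

text \<open>The configuration that is integrated over and the one that determines the level are kept
  apart, because the effect of an added point is computed by changing them one at a time.\<close>

lemma window_hit_integrable: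
  assumes "nu \<in> configs" "nu' \<in> configs"
  shows "integrable nu (\<lambda>y. window t y * hit (lam n (fst y) nu') y)"
proof -
  obtain K where K: "\<And>u. u \<in> {0..t} \<Longrightarrow> \<bar>\<phi> u\<bar> \<le> K" using \<phi>_bounded[of t] by blast
  let ?B = "{0..t} \<times> {0..b}"
  have B: "?B \<in> sets borel" "bounded ?B"
    unfolding borel_prod[symmetric] by (auto intro!: pair_measureI bounded_Times)
  have m: "(\<lambda>y. window t y * hit (lam n (fst y) nu') y) \<in> borel_measurable nu"
    by (rule field_section[of "\<lambda>y nu. window t y * hit (lam n (fst y) nu) y"]) (use assms in auto)
  have le: "\<bar>window t y * hit (lam n (fst y) nu') y\<bar> \<le> \<bar>K\<bar>" for y
  proof -
    have "\<bar>window t y\<bar> \<le> \<bar>K\<bar>" using K[of "t - fst y"] by (auto simp: window_def split: split_indicator)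
    then show ?thesis by (auto simp: hit_def)
  qed
  have zero: "y \<notin> ?B \<Longrightarrow> window t y * hit (lam n (fst y) nu') y = 0" for y
    using lam_bounds(2)[of n "fst y" nu']
    by (auto simp: window_def hit_def mem_Times_iff split: split_indicator)
  show ?thesis
    by (rule integrableI_bounded_set[of ?B _ _ "\<bar>K\<bar>"])
       (use B assms configs_finite[OF assms(1) B] m le zero in auto)
qed

text \<open>Induction on the iterations: the added point lies outside the window of
  \<open>t\<close>, and the points inside it have earlier times, for which the induction hypothesis
  applies.\<close>

lemma lam_add_point:
  assumes "nu \<in> configs" "t \<le> fst z" shows "lam n t (add_point z nu) = lam n t nu"
  using assms(2)
proof (induction n arbitrary: t)
  case (Suc n)
  have z: "add_point z nu \<in> configs" using assms(1) by simp
  have "(LINT y|add_point z nu. window t y * hit (lam n (fst y) (add_point z nu)) y)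
    = (LINT y|nu. window t y * hit (lam n (fst y) (add_point z nu)) y) + window t z * hit (lam n (fst z) (add_point z nu)) z"
    using z by (intro integrable_add_point window_hit_integrable assms
      field_section[of "\<lambda>y nu. window t y * hit (lam n (fst y) nu) y"]) auto
  also have "window t z = 0" using Suc.prems by (simp add: window_def)
  also have "(LINT y|nu. window t y * hit (lam n (fst y) (add_point z nu)) y) = (LINT y|nu. window t y * hit (lam n (fst y) nu) y)"
  proof (rule Bochner_Integration.integral_cong[OF refl])
    fix y
    show "window t y * hit (lam n (fst y) (add_point z nu)) y = window t y * hit (lam n (fst y) nu) y"
      using Suc.IH[of "fst y"] Suc.prems by (cases "fst y < t") (auto simp: window_def)
  qed
  finally show ?case by simp
qed simp

lemma causal_Z: "causal 1 box (Z n)"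
  unfolding causal_def
  using Z_bounds by (auto simp: abs_le_iff intro: order_trans[of _ 0]) (auto simp: Z_def lam_add_point)

text \<open>By the cap every point accepted before \<open>t\<close> lies in \<open>box\<close>. This
  provides the bounded region that the Poincare inequality asks for.\<close>

lemma lam_restr:
  assumes "nu \<in> configs" "t \<le> T" shows "lam n t (restr box nu) = lam n t nu"
  using assms(2)
proof (induction n arbitrary: t)
  case (Suc n)
  have m: "(\<lambda>y. window t y * hit (lam n (fst y) nu') y) \<in> borel_measurable nu" if "nu' \<in> configs" for nu'
    by (rule field_section[of "\<lambda>y nu. window t y * hit (lam n (fst y) nu) y"]) (use assms that in auto)
  have "(LINT y|restr box nu. window t y * hit (lam n (fst y) (restr box nu)) y)
    = (LINT y|density nu (\<lambda>y. ennreal (indicator box y)). window t y * hit (lam n (fst y) (restr box nu)) y)"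
    by (simp add: ennreal_indicator)
  also have "... = (LINT y|nu. indicator box y * (window t y * hit (lam n (fst y) (restr box nu)) y))"
    using m[of "restr box nu"] assms(1)
    by (subst integral_real_density) (auto simp: measurable_cong_sets[OF sets_configs refl])
  also have "... = (LINT y|nu. window t y * hit (lam n (fst y) nu) y)"
  proof (rule Bochner_Integration.integral_cong[OF refl])
    fix y
    show "indicator box y * (window t y * hit (lam n (fst y) (restr box nu)) y) = window t y * hit (lam n (fst y) nu) y"
    proof (cases "0 < fst y \<and> fst y < t")
      case True
      then have e: "lam n (fst y) (restr box nu) = lam n (fst y) nu" using Suc by auto
      have "y \<notin> box \<Longrightarrow> hit (lam n (fst y) nu) y = 0"
        using True Suc.prems lam_bounds(2)[of n "fst y" nu] by (auto simp: box_def hit_def mem_Times_iff)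
      then show ?thesis using e by (auto split: split_indicator)
    qed (auto simp: window_def)
  qed
  finally show ?case by simp
qed simp

text \<open>The Lipschitz property of \<open>h\<close> leaves two effects of the new point: its own
  kernel if it is accepted, and the kernels of existing points whose acceptance has changed. The cap
  only decreases differences.\<close>

lemma lam_diff_point:
  assumes nu: "nu \<in> configs" and t: "t \<le> T"
  shows "\<bar>lam (Suc n) t (add_point x nu) - lam (Suc n) t nu\<bar>
    \<le> \<alpha> * (\<bar>window t x\<bar> * Z n x nu + (LINT y|nu. \<bar>window t y\<bar> * \<bar>point_diff x (Z n) y nu\<bar>))"
proof -
  have Jnu: "add_point x nu \<in> configs" using nu by simp
  let ?g = "\<lambda>\<rho> y. window t y * hit (lam n (fst y) \<rho>) y"
  note i = window_hit_integrable[OF nu Jnu, of t n] window_hit_integrable[OF nu nu, of t n]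
  have J: "(LINT y|add_point x nu. ?g (add_point x nu) y) = (LINT y|nu. ?g (add_point x nu) y) + ?g (add_point x nu) x"
    using Jnu by (intro integrable_add_point nu i
      field_section[of "\<lambda>y nu. window t y * hit (lam n (fst y) nu) y"]) auto
  have gZ: "?g \<rho> y = window t y * Z n y \<rho>" for \<rho> y
    using t by (auto simp: window_def Z_def split: split_indicator)
  have Zx: "Z n x (add_point x nu) = Z n x nu" using nu by (simp add: Z_def lam_add_point)
  have "\<bar>lam (Suc n) t (add_point x nu) - lam (Suc n) t nu\<bar>
    \<le> \<bar>h (\<mu> + (LINT y|add_point x nu. ?g (add_point x nu) y)) - h (\<mu> + (LINT y|nu. ?g nu y))\<bar>"
    by (simp add: min_def)
  also have "... \<le> \<alpha> * \<bar>(LINT y|add_point x nu. ?g (add_point x nu) y) - (LINT y|nu. ?g nu y)\<bar>"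
    using h_diff[of "\<mu> + (LINT y|add_point x nu. ?g (add_point x nu) y)" "\<mu> + (LINT y|nu. ?g nu y)"] by simp
  also have "(LINT y|add_point x nu. ?g (add_point x nu) y) - (LINT y|nu. ?g nu y)
    = window t x * Z n x nu + (LINT y|nu. ?g (add_point x nu) y - ?g nu y)"
    unfolding J using i by (simp add: gZ Zx)
  also have "(\<lambda>y. ?g (add_point x nu) y - ?g nu y) = (\<lambda>y. window t y * point_diff x (Z n) y nu)"
    by (simp add: gZ point_diff_def right_diff_distrib fun_eq_iff)
  also have "\<alpha> * \<bar>window t x * Z n x nu + (LINT y|nu. window t y * point_diff x (Z n) y nu)\<bar>
    \<le> \<alpha> * (\<bar>window t x\<bar> * Z n x nu + (LINT y|nu. \<bar>window t y\<bar> * \<bar>point_diff x (Z n) y nu\<bar>))"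
  proof (intro mult_left_mono \<alpha>_nonneg order_trans[OF abs_triangle_ineq] add_mono)
    show "\<bar>window t x * Z n x nu\<bar> \<le> \<bar>window t x\<bar> * Z n x nu"
      using Z_bounds by (simp add: abs_mult)
    show "\<bar>LINT y|nu. window t y * point_diff x (Z n) y nu\<bar> \<le> (LINT y|nu. \<bar>window t y\<bar> * \<bar>point_diff x (Z n) y nu\<bar>)"
      unfolding abs_mult[symmetric] by (rule integral_abs_bound)
  qed
  finally show ?thesis .
qed

text \<open>
  The total influence of an additional point at \<open>x\<close> on the intensity.
\<close>

definition S :: "nat \<Rightarrow> real \<times> real \<Rightarrow> (real \<times> real) measure \<Rightarrow> ennreal" where
  "S n x nu = (\<integral>\<^sup>+t. ennreal \<bar>lam n t (add_point x nu) - lam n t nu\<bar> * indicator {0<..T} t \<partial>lborel)"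

lemma measurable_S [measurable]: "(\<lambda>(x, nu). S n x nu) \<in> borel_measurable (borel \<Otimes>\<^sub>M confs)"
  unfolding S_def by measurable

text \<open>For a fixed time the two acceptance indicators differ on a range of marks whose length
  is the difference of the two levels.\<close>

lemma S_eq:
  assumes nu: "nu \<in> configs"
  shows "(\<integral>\<^sup>+y. ennreal \<bar>point_diff x (Z n) y nu\<bar> \<partial>\<Lambda>) = S n x nu"
proof -
  have [measurable]: "(\<lambda>y. ennreal \<bar>point_diff x (Z n) y nu\<bar>) \<in> borel_measurable borel"
    using field_section[OF causal_measurable[OF causal_point_diff[OF causal_Z]] nu refl, of x n] by simp
  have "(\<integral>\<^sup>+y. ennreal \<bar>point_diff x (Z n) y nu\<bar> \<partial>\<Lambda>)
    = (\<integral>\<^sup>+s. \<integral>\<^sup>+\<theta>. ennreal \<bar>point_diff x (Z n) (s, \<theta>) nu\<bar> * indicator {0..} \<theta> \<partial>lborel \<partial>lborel)"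
    by (rule nn_integral_\<Lambda>) measurable
  also have "... = S n x nu"
    unfolding S_def
  proof (rule nn_integral_cong)
    fix s
    let ?a = "lam n s (add_point x nu)" and ?a' = "lam n s nu"
    have "(\<integral>\<^sup>+\<theta>. ennreal \<bar>point_diff x (Z n) (s, \<theta>) nu\<bar> * indicator {0..} \<theta> \<partial>lborel)
      = (\<integral>\<^sup>+\<theta>. indicator {0<..T} s * (ennreal \<bar>hit ?a (s, \<theta>) - hit ?a' (s, \<theta>)\<bar> * indicator {0..} \<theta>) \<partial>lborel)"
      by (intro nn_integral_cong) (auto simp: point_diff_def Z_def split: split_indicator)
    also have "... = indicator {0<..T} s * ennreal \<bar>?a - ?a'\<bar>"
      by (simp add: nn_integral_cmult nn_integral_hit_diff lam_bounds)
    finally show "(\<integral>\<^sup>+\<theta>. ennreal \<bar>point_diff x (Z n) (s, \<theta>) nu\<bar> * indicator {0..} \<theta> \<partial>lborel)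
      = ennreal \<bar>?a - ?a'\<bar> * indicator {0<..T} s" by (simp add: mult.commute)
  qed
  finally show ?thesis .
qed

text \<open>A renewal inequality for every single configuration. The indirect part is an integral
  against \<open>nu\<close> and not against \<Lambda>, so it turns into \<open>S n\<close> only
  after an expectation is taken.\<close>

lemma S_step:
  assumes nu: "nu \<in> configs"
  shows "S (Suc n) x nu \<le> ennreal \<rho> * (ennreal (Z n x nu) + (\<integral>\<^sup>+y. ennreal \<bar>point_diff x (Z n) y nu\<bar> \<partial>nu))"
proof -
  interpret nu: sigma_finite_measure nu by (rule sigma_finite_configs[OF nu])
  interpret P: pair_sigma_finite lborel nu ..
  have [measurable_cong]: "sets nu = sets borel" using nu by simp
  have D: "causal (2 * 1) box (point_diff x (Z n))" by (rule causal_point_diff[OF causal_Z])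
  have [measurable]: "(\<lambda>y. point_diff x (Z n) y nu) \<in> borel_measurable borel"
    by (rule field_section[OF causal_measurable[OF D] nu refl])
  have int: "integrable nu (\<lambda>y. \<bar>window t y\<bar> * \<bar>point_diff x (Z n) y nu\<bar>)" if "t \<le> T" for t
  proof -
    have Jnu: "add_point x nu \<in> configs" using nu by simp
    have "integrable nu (\<lambda>y. \<bar>window t y * hit (lam n (fst y) (add_point x nu)) y - window t y * hit (lam n (fst y) nu) y\<bar>)"
      by (intro integrable_abs Bochner_Integration.integrable_diff window_hit_integrable nu Jnu)
    moreover have "\<bar>window t y * hit (lam n (fst y) (add_point x nu)) y - window t y * hit (lam n (fst y) nu) y\<bar>
      = \<bar>window t y\<bar> * \<bar>point_diff x (Z n) y nu\<bar>" for y
      using that unfolding abs_mult[symmetric]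
      by (auto simp: window_def Z_def point_diff_def right_diff_distrib split: split_indicator)
    ultimately show ?thesis by simp
  qed
  have "S (Suc n) x nu \<le> (\<integral>\<^sup>+t. ennreal (\<alpha> * \<bar>window t x\<bar>) * ennreal (Z n x nu)
      + (\<integral>\<^sup>+y. ennreal (\<alpha> * \<bar>window t y\<bar>) * ennreal \<bar>point_diff x (Z n) y nu\<bar> \<partial>nu) \<partial>lborel)"
    unfolding S_def
  proof (rule nn_integral_mono)
    fix t
    show "ennreal \<bar>lam (Suc n) t (add_point x nu) - lam (Suc n) t nu\<bar> * indicator {0<..T} t
      \<le> ennreal (\<alpha> * \<bar>window t x\<bar>) * ennreal (Z n x nu) + (\<integral>\<^sup>+y. ennreal (\<alpha> * \<bar>window t y\<bar>) * ennreal \<bar>point_diff x (Z n) y nu\<bar> \<partial>nu)"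
    proof (cases "t \<in> {0<..T}")
      case True
      then have t: "t \<le> T" by simp
      have "ennreal \<bar>lam (Suc n) t (add_point x nu) - lam (Suc n) t nu\<bar>
        \<le> ennreal (\<alpha> * \<bar>window t x\<bar> * Z n x nu + \<alpha> * (LINT y|nu. \<bar>window t y\<bar> * \<bar>point_diff x (Z n) y nu\<bar>))"
        using lam_diff_point[OF nu t, of n x] by (intro ennreal_leI) (simp only: distrib_left mult.assoc)
      also have "... = ennreal (\<alpha> * \<bar>window t x\<bar>) * ennreal (Z n x nu) + ennreal \<alpha> * ennreal (LINT y|nu. \<bar>window t y\<bar> * \<bar>point_diff x (Z n) y nu\<bar>)"
        using \<alpha>_nonneg Z_bounds by (subst ennreal_plus) (auto simp: ennreal_mult integral_nonneg_AE)
      also have "ennreal (LINT y|nu. \<bar>window t y\<bar> * \<bar>point_diff x (Z n) y nu\<bar>) = (\<integral>\<^sup>+y. ennreal (\<bar>window t y\<bar> * \<bar>point_diff x (Z n) y nu\<bar>) \<partial>nu)"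
        using int[OF t] by (intro nn_integral_eq_integral[symmetric]) auto
      also have "ennreal \<alpha> * ... = (\<integral>\<^sup>+y. ennreal (\<alpha> * \<bar>window t y\<bar>) * ennreal \<bar>point_diff x (Z n) y nu\<bar> \<partial>nu)"
        using \<alpha>_nonneg by (subst nn_integral_cmult[symmetric]) (auto simp: ennreal_mult mult.assoc)
      finally show ?thesis using True by simp
    qed simp
  qed
  also have "... = (\<integral>\<^sup>+t. ennreal (\<alpha> * \<bar>window t x\<bar>) * ennreal (Z n x nu) \<partial>lborel)
      + (\<integral>\<^sup>+t. \<integral>\<^sup>+y. ennreal (\<alpha> * \<bar>window t y\<bar>) * ennreal \<bar>point_diff x (Z n) y nu\<bar> \<partial>nu \<partial>lborel)"
    by (intro nn_integral_add) measurable
  also have "(\<integral>\<^sup>+t. \<integral>\<^sup>+y. ennreal (\<alpha> * \<bar>window t y\<bar>) * ennreal \<bar>point_diff x (Z n) y nu\<bar> \<partial>nu \<partial>lborel)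
    = (\<integral>\<^sup>+y. \<integral>\<^sup>+t. ennreal (\<alpha> * \<bar>window t y\<bar>) * ennreal \<bar>point_diff x (Z n) y nu\<bar> \<partial>lborel \<partial>nu)"
    by (rule P.Fubini'[symmetric]) measurable
  also have "... \<le> (\<integral>\<^sup>+y. ennreal \<rho> * ennreal \<bar>point_diff x (Z n) y nu\<bar> \<partial>nu)"
    by (intro nn_integral_mono) (auto simp: nn_integral_multc intro!: mult_right_mono window_mass)
  also have "... = ennreal \<rho> * (\<integral>\<^sup>+y. ennreal \<bar>point_diff x (Z n) y nu\<bar> \<partial>nu)"
    by (intro nn_integral_cmult) measurable
  also have "(\<integral>\<^sup>+t. ennreal (\<alpha> * \<bar>window t x\<bar>) * ennreal (Z n x nu) \<partial>lborel) \<le> ennreal \<rho> * ennreal (Z n x nu)"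
    by (auto simp: nn_integral_multc intro!: mult_right_mono window_mass)
  finally show ?thesis by (simp add: distrib_left add_mono)
qed

text \<open>
  A weight \<open>W\<close> that depends on the past of \<open>x\<close> only turns these identities into conditional ones.
\<close>

lemma influence_mean:
  assumes W [measurable]: "W \<in> borel_measurable confs"
    and past: "\<And>nu y. nu \<in> configs \<Longrightarrow> fst x \<le> fst y \<Longrightarrow> W (add_point y nu) = W nu"
  shows "(\<integral>\<^sup>+nu. W nu * (\<integral>\<^sup>+y. ennreal \<bar>point_diff x (Z n) y nu\<bar> \<partial>nu) \<partial>Q) = (\<integral>\<^sup>+nu. W nu * S n x nu \<partial>Q)"
    "(\<integral>\<^sup>+y. \<integral>\<^sup>+nu. W nu * ennreal \<bar>point_diff x (Z n) y nu\<bar> \<partial>Q \<partial>\<Lambda>) = (\<integral>\<^sup>+nu. W nu * S n x nu \<partial>Q)"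
proof -
  have D: "causal (2 * 1) box (point_diff x (Z n))" by (rule causal_point_diff[OF causal_Z])
  note [measurable] = causal_measurable[OF D]
  have sec: "(\<lambda>y. ennreal \<bar>point_diff x (Z n) y nu\<bar>) \<in> borel_measurable N"
    if "nu \<in> configs" "sets N = sets borel" for nu N
    using measurable_compose[OF field_section[OF causal_measurable[OF D] that], of "\<lambda>u. ennreal \<bar>u\<bar>" borel]
    by simp
  have "(\<integral>\<^sup>+nu. W nu * (\<integral>\<^sup>+y. ennreal \<bar>point_diff x (Z n) y nu\<bar> \<partial>nu) \<partial>Q)
    = (\<integral>\<^sup>+nu. \<integral>\<^sup>+y. W nu * ennreal \<bar>point_diff x (Z n) y nu\<bar> \<partial>nu \<partial>Q)"
    by (intro nn_integral_cong nn_integral_cmult[symmetric] sec) auto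
  also have "... = (\<integral>\<^sup>+y. \<integral>\<^sup>+nu. W nu * ennreal \<bar>point_diff x (Z n) y nu\<bar> \<partial>Q \<partial>\<Lambda>)"
  proof (rule compensation)
    fix y nu assume nu: "nu \<in> (configs :: (real \<times> real) measure set)"
    show "W (add_point y nu) * ennreal \<bar>point_diff x (Z n) y (add_point y nu)\<bar> = W nu * ennreal \<bar>point_diff x (Z n) y nu\<bar>"
    proof (cases "fst x \<le> fst y")
      case True
      moreover have "point_diff x (Z n) y (add_point y nu) = point_diff x (Z n) y nu"
        using D nu by (simp add: causal_def)
      ultimately show ?thesis using past[OF nu] by simp
    next
      case False
      then show ?thesis using point_diff_before[OF causal_Z, of _ y x] nu by simp
    qed
  qed measurable
  finally have 1: "(\<integral>\<^sup>+nu. W nu * (\<integral>\<^sup>+y. ennreal \<bar>point_diff x (Z n) y nu\<bar> \<partial>nu) \<partial>Q)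
    = (\<integral>\<^sup>+y. \<integral>\<^sup>+nu. W nu * ennreal \<bar>point_diff x (Z n) y nu\<bar> \<partial>Q \<partial>\<Lambda>)" .
  have "(\<integral>\<^sup>+y. \<integral>\<^sup>+nu. W nu * ennreal \<bar>point_diff x (Z n) y nu\<bar> \<partial>Q \<partial>\<Lambda>)
    = (\<integral>\<^sup>+nu. \<integral>\<^sup>+y. W nu * ennreal \<bar>point_diff x (Z n) y nu\<bar> \<partial>\<Lambda> \<partial>Q)"
    by (rule \<Lambda>Q.Fubini'[symmetric]) measurable
  also have "... = (\<integral>\<^sup>+nu. W nu * S n x nu \<partial>Q)"
    by (intro nn_integral_cong) (subst nn_integral_cmult, auto intro!: sec simp: S_eq)
  finally show 2: "(\<integral>\<^sup>+y. \<integral>\<^sup>+nu. W nu * ennreal \<bar>point_diff x (Z n) y nu\<bar> \<partial>Q \<partial>\<Lambda>) = (\<integral>\<^sup>+nu. W nu * S n x nu \<partial>Q)" .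
  show "(\<integral>\<^sup>+nu. W nu * (\<integral>\<^sup>+y. ennreal \<bar>point_diff x (Z n) y nu\<bar> \<partial>nu) \<partial>Q) = (\<integral>\<^sup>+nu. W nu * S n x nu \<partial>Q)"
    using 1 2 by simp
qed

lemma influence_step:
  assumes W [measurable]: "W \<in> borel_measurable confs"
    and past: "\<And>nu y. nu \<in> configs \<Longrightarrow> fst x \<le> fst y \<Longrightarrow> W (add_point y nu) = W nu"
  shows "(\<integral>\<^sup>+nu. W nu * S (Suc n) x nu \<partial>Q)
    \<le> ennreal \<rho> * ((\<integral>\<^sup>+nu. W nu * ennreal (Z n x nu) \<partial>Q) + (\<integral>\<^sup>+nu. W nu * S n x nu \<partial>Q))"
proof -
  have D: "causal (2 * 1) box (point_diff x (Z n))" by (rule causal_point_diff[OF causal_Z])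
  note [measurable] = causal_measurable[OF D]
  have "(\<integral>\<^sup>+nu. W nu * S (Suc n) x nu \<partial>Q)
    \<le> (\<integral>\<^sup>+nu. ennreal \<rho> * (W nu * ennreal (Z n x nu) + W nu * (\<integral>\<^sup>+y. ennreal \<bar>point_diff x (Z n) y nu\<bar> \<partial>nu)) \<partial>Q)"
    using mult_left_mono[OF S_step] by (intro nn_integral_mono) (auto simp: distrib_left ac_simps)
  also have "... = ennreal \<rho> * ((\<integral>\<^sup>+nu. W nu * ennreal (Z n x nu) \<partial>Q) + (\<integral>\<^sup>+nu. W nu * (\<integral>\<^sup>+y. ennreal \<bar>point_diff x (Z n) y nu\<bar> \<partial>nu) \<partial>Q))"
    by (simp add: nn_integral_cmult nn_integral_add)
  finally show ?thesis using influence_mean(1)[OF W past] by simp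
qed

text \<open>The geometric sum \<rho> + \<open>\<rho>\<^sup>2\<close> + ... of a branching mechanism
  over all later generations, characterized by \<kappa> = \<rho> * (1 + \<kappa>).\<close>

definition \<kappa> :: real where "\<kappa> = \<rho> / (1 - \<rho>)"

lemma \<kappa>_nonneg: "0 \<le> \<kappa>"
  using \<rho>_bounds by (simp add: \<kappa>_def)

lemma \<kappa>_fixpoint: "ennreal \<rho> * (w + ennreal \<kappa> * w) = ennreal \<kappa> * w"
proof -
  have "ennreal \<rho> * (w + ennreal \<kappa> * w) = (ennreal \<rho> * (1 + ennreal \<kappa>)) * w"
    by (simp add: distrib_left distrib_right mult.assoc)
  also have "ennreal \<rho> * (1 + ennreal \<kappa>) = ennreal (\<rho> * (1 + \<kappa>))"
    using \<kappa>_nonneg \<rho>_bounds by (simp add: ennreal_mult ennreal_plus)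
  also have "\<rho> * (1 + \<kappa>) = \<kappa>" using \<rho>_bounds by (simp add: \<kappa>_def field_simps)
  finally show ?thesis .
qed

text \<open>As \<kappa> is a fixed point of the recursion, the constant does not accumulate along
  the induction and is uniform in \<open>n\<close>.\<close>

lemma influence_bound:
  assumes W [measurable]: "W \<in> borel_measurable confs"
    and past: "\<And>nu y. nu \<in> configs \<Longrightarrow> fst x \<le> fst y \<Longrightarrow> W (add_point y nu) = W nu"
  shows "(\<integral>\<^sup>+nu. W nu * S n x nu \<partial>Q) \<le> ennreal \<kappa> * (\<integral>\<^sup>+nu. W nu \<partial>Q)"
proof (induction n)
  case 0 then show ?case by (simp add: S_def)
next
  case (Suc n)
  have "(\<integral>\<^sup>+nu. W nu * ennreal (Z n x nu) \<partial>Q) \<le> (\<integral>\<^sup>+nu. W nu \<partial>Q)"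
    using mult_left_mono[of "ennreal (Z n x _)" 1 "W _"] Z_bounds
    by (intro nn_integral_mono) (simp add: ennreal_le_1)
  then have "(\<integral>\<^sup>+nu. W nu * S (Suc n) x nu \<partial>Q) \<le> ennreal \<rho> * ((\<integral>\<^sup>+nu. W nu \<partial>Q) + ennreal \<kappa> * (\<integral>\<^sup>+nu. W nu \<partial>Q))"
    using Suc by (intro order_trans[OF influence_step[OF W past]] mult_left_mono add_mono) auto
  then show ?case by (simp only: \<kappa>_fixpoint)
qed

end

section \<open>Moments of the iterates\<close>

text \<open>\<open>K / (1 - r)\<close> is the fixed point of the affine recursion, and the sequence
  starts below it.\<close>

lemma ennreal_recursion_bound:
  fixes x :: "nat \<Rightarrow> ennreal"
  assumes r: "0 \<le> r" "r < 1" and K: "0 \<le> K" and x: "x 0 = 0" "\<And>n. x (Suc n) \<le> ennreal r * x n + ennreal K"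
  shows "x n \<le> ennreal (K / (1 - r))"
proof (induction n)
  case (Suc n)
  have "x (Suc n) \<le> ennreal r * ennreal (K / (1 - r)) + ennreal K"
    using Suc by (intro order_trans[OF x(2)] add_mono mult_left_mono) auto
  also have "... = ennreal (r * (K / (1 - r)) + K)"
    using r K by (simp add: ennreal_mult[symmetric] ennreal_plus[symmetric] del: ennreal_plus)
  also have "r * (K / (1 - r)) + K = K / (1 - r)" using r by (simp add: field_simps)
  finally show ?case .
qed (simp add: x)

context hawkes_iterates begin

lemma Z_section:
  assumes "nu \<in> configs" "sets N = sets borel"
  shows "(\<lambda>x. Z n x nu) \<in> borel_measurable N"
  by (rule field_section[OF measurable_Z assms])

lemma Z_mass:
  assumes nu: "nu \<in> configs"
  shows "(\<integral>\<^sup>+x. ennreal (Z n x nu) \<partial>\<Lambda>) = (\<integral>\<^sup>+t. ennreal (lam n t nu) * indicator {0<..T} t \<partial>lborel)"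
proof -
  have [measurable]: "(\<lambda>x. Z n x nu) \<in> borel_measurable borel" by (rule Z_section[OF nu refl])
  have "(\<integral>\<^sup>+x. ennreal (Z n x nu) \<partial>\<Lambda>) = (\<integral>\<^sup>+t. \<integral>\<^sup>+\<theta>. ennreal (Z n (t, \<theta>) nu) * indicator {0..} \<theta> \<partial>lborel \<partial>lborel)"
    by (rule nn_integral_\<Lambda>) measurable
  also have "... = (\<integral>\<^sup>+t. ennreal (lam n t nu) * indicator {0<..T} t \<partial>lborel)"
  proof (rule nn_integral_cong)
    fix t
    have "(\<integral>\<^sup>+\<theta>. ennreal (Z n (t, \<theta>) nu) * indicator {0..} \<theta> \<partial>lborel)
      = (\<integral>\<^sup>+\<theta>. indicator {0<..T} t * (ennreal (hit (lam n t nu) (t, \<theta>)) * indicator {0..} \<theta>) \<partial>lborel)"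
      by (intro nn_integral_cong) (auto simp: Z_def split: split_indicator)
    also have "... = indicator {0<..T} t * ennreal (lam n t nu)"
      by (simp add: nn_integral_cmult nn_integral_hit lam_bounds)
    finally show "(\<integral>\<^sup>+\<theta>. ennreal (Z n (t, \<theta>) nu) * indicator {0..} \<theta> \<partial>lborel) = ennreal (lam n t nu) * indicator {0<..T} t"
      by (simp add: mult.commute)
  qed
  finally show ?thesis .
qed

text \<open>The solution of m = h \<mu> + \<rho> * m, an upper bound for the mean intensity averaged
  over the horizon.\<close>

definition rate :: real where "rate = h \<mu> / (1 - \<rho>)"

lemma rate_nonneg: "0 \<le> rate"
  using h_nonneg[of \<mu>] \<rho>_bounds by (simp add: rate_def)

text \<open>Once the mark is integrated out, this is the expected integrated intensity of the
  iterate up to \<open>T\<close>.\<close>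

definition V :: "nat \<Rightarrow> ennreal" where "V n = (\<integral>\<^sup>+x. \<integral>\<^sup>+nu. ennreal (Z n x nu) \<partial>Q \<partial>\<Lambda>)"

lemma V_eq: "V n = (\<integral>\<^sup>+nu. \<integral>\<^sup>+x. ennreal (Z n x nu) \<partial>\<Lambda> \<partial>Q)"
  unfolding V_def by (rule \<Lambda>Q.Fubini'[symmetric]) measurable

text \<open>The Lipschitz bound compares with \<open>h \<mu>\<close>, the exchange of the integrals
  produces the mass of the kernel, and compensation replaces \<open>nu\<close> by \<Lambda> in the
  resulting sum over accepted points.\<close>

lemma V_step: "V (Suc n) \<le> ennreal \<rho> * V n + ennreal (h \<mu> * T)"
proof -
  have step: "(\<integral>\<^sup>+x. ennreal (Z (Suc n) x nu) \<partial>\<Lambda>) \<le> ennreal (h \<mu> * T) + ennreal \<rho> * (\<integral>\<^sup>+y. ennreal (Z n y nu) \<partial>nu)"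
    if nu: "nu \<in> configs" for nu
  proof -
    interpret nu: sigma_finite_measure nu by (rule sigma_finite_configs[OF nu])
    interpret P: pair_sigma_finite lborel nu ..
    have [measurable_cong]: "sets nu = sets borel" using nu by simp
    have [measurable]: "(\<lambda>x. Z n x nu) \<in> borel_measurable borel" by (rule Z_section[OF nu refl])
    have "(\<integral>\<^sup>+x. ennreal (Z (Suc n) x nu) \<partial>\<Lambda>)
      \<le> (\<integral>\<^sup>+t. ennreal (h \<mu>) * indicator {0<..T} t + (\<integral>\<^sup>+y. ennreal (\<alpha> * \<bar>window t y\<bar>) * ennreal (Z n y nu) \<partial>nu) \<partial>lborel)"
      unfolding Z_mass[OF nu]
    proof (rule nn_integral_mono)
      fix t
      show "ennreal (lam (Suc n) t nu) * indicator {0<..T} t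
        \<le> ennreal (h \<mu>) * indicator {0<..T} t + (\<integral>\<^sup>+y. ennreal (\<alpha> * \<bar>window t y\<bar>) * ennreal (Z n y nu) \<partial>nu)"
      proof (cases "t \<in> {0<..T}")
        case True
        let ?g = "\<lambda>y. window t y * hit (lam n (fst y) nu) y"
        have i: "integrable nu ?g" by (rule window_hit_integrable[OF nu nu])
        have g: "\<bar>?g y\<bar> = \<bar>window t y\<bar> * Z n y nu" for y
          using True by (auto simp: window_def Z_def abs_mult split: split_indicator)
        have "lam (Suc n) t nu \<le> h (\<mu> + (LINT y|nu. ?g y))" by simp
        also have "... \<le> h \<mu> + \<alpha> * \<bar>LINT y|nu. ?g y\<bar>"
          using h_diff[of "\<mu> + (LINT y|nu. ?g y)" \<mu>] by simp
        also have "... \<le> h \<mu> + \<alpha> * (LINT y|nu. \<bar>?g y\<bar>)"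
          using \<alpha>_nonneg by (intro add_left_mono mult_left_mono integral_abs_bound)
        finally have "ennreal (lam (Suc n) t nu) \<le> ennreal (h \<mu> + \<alpha> * (LINT y|nu. \<bar>?g y\<bar>))" by (rule ennreal_leI)
        also have "... = ennreal (h \<mu>) + ennreal \<alpha> * ennreal (LINT y|nu. \<bar>?g y\<bar>)"
          using h_nonneg \<alpha>_nonneg by (subst ennreal_plus) (auto simp: ennreal_mult integral_nonneg_AE)
        also have "ennreal (LINT y|nu. \<bar>?g y\<bar>) = (\<integral>\<^sup>+y. ennreal (\<bar>window t y\<bar> * Z n y nu) \<partial>nu)"
          using i by (subst nn_integral_eq_integral[symmetric]) (auto simp: g[symmetric])
        also have "ennreal \<alpha> * ... = (\<integral>\<^sup>+y. ennreal (\<alpha> * \<bar>window t y\<bar>) * ennreal (Z n y nu) \<partial>nu)"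
          using \<alpha>_nonneg Z_bounds by (subst nn_integral_cmult[symmetric]) (auto simp: ennreal_mult mult.assoc)
        finally show ?thesis using True by simp
      qed simp
    qed
    also have "... = ennreal (h \<mu> * T) + (\<integral>\<^sup>+t. \<integral>\<^sup>+y. ennreal (\<alpha> * \<bar>window t y\<bar>) * ennreal (Z n y nu) \<partial>nu \<partial>lborel)"
      using T_pos h_nonneg by (subst nn_integral_add) (auto simp: nn_integral_cmult_indicator ennreal_mult)
    also have "(\<integral>\<^sup>+t. \<integral>\<^sup>+y. ennreal (\<alpha> * \<bar>window t y\<bar>) * ennreal (Z n y nu) \<partial>nu \<partial>lborel)
      = (\<integral>\<^sup>+y. \<integral>\<^sup>+t. ennreal (\<alpha> * \<bar>window t y\<bar>) * ennreal (Z n y nu) \<partial>lborel \<partial>nu)"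
      by (rule P.Fubini'[symmetric]) measurable
    also have "... \<le> (\<integral>\<^sup>+y. ennreal \<rho> * ennreal (Z n y nu) \<partial>nu)"
      by (intro nn_integral_mono) (auto simp: nn_integral_multc intro!: mult_right_mono window_mass)
    also have "... = ennreal \<rho> * (\<integral>\<^sup>+y. ennreal (Z n y nu) \<partial>nu)"
      by (intro nn_integral_cmult) measurable
    finally show ?thesis by (simp add: add_left_mono)
  qed
  have "V (Suc n) \<le> (\<integral>\<^sup>+nu. ennreal (h \<mu> * T) + ennreal \<rho> * (\<integral>\<^sup>+y. ennreal (Z n y nu) \<partial>nu) \<partial>Q)"
    unfolding V_eq using step by (intro nn_integral_mono) simp
  also have "... = ennreal (h \<mu> * T) + ennreal \<rho> * (\<integral>\<^sup>+nu. \<integral>\<^sup>+y. ennreal (Z n y nu) \<partial>nu \<partial>Q)"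
    by (simp add: nn_integral_add nn_integral_cmult)
  also have "(\<integral>\<^sup>+nu. \<integral>\<^sup>+y. ennreal (Z n y nu) \<partial>nu \<partial>Q) = V n"
    unfolding V_def by (rule compensation) (auto simp: Z_def lam_add_point)
  finally show ?thesis by (simp add: add.commute)
qed

lemma V_bound: "V n \<le> ennreal (rate * T)"
proof -
  have "V 0 = 0" by (simp add: V_eq Z_mass cong: nn_integral_cong_simp)
  then have "V n \<le> ennreal (h \<mu> * T / (1 - \<rho>))"
    using \<rho>_bounds h_nonneg[of \<mu>] T_pos V_step by (intro ennreal_recursion_bound) auto
  then show ?thesis by (simp add: rate_def)
qed

definition A :: "nat \<Rightarrow> ennreal" where "A n = (\<integral>\<^sup>+x. \<integral>\<^sup>+nu. S n x nu \<partial>Q \<partial>\<Lambda>)"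

text \<open>The uniform bound \<kappa> per point would give a multiple of \<open>T * b\<close> after
  integration over the box, hence a constant that grows with the cap. Keeping the acceptance
  probability of the point in the recursion gives a bound free of \<open>b\<close>.\<close>

lemma A_bound: "A n \<le> ennreal (\<kappa> * rate * T)"
proof -
  have "A (Suc n) \<le> ennreal \<rho> * A n + ennreal (\<rho> * rate * T)" for n
  proof -
    have "A (Suc n) \<le> (\<integral>\<^sup>+x. ennreal \<rho> * ((\<integral>\<^sup>+nu. ennreal (Z n x nu) \<partial>Q) + (\<integral>\<^sup>+nu. S n x nu \<partial>Q)) \<partial>\<Lambda>)"
      unfolding A_def using influence_step[of "\<lambda>_. 1"] by (intro nn_integral_mono) simp
    also have "... = ennreal \<rho> * (V n + A n)"
      by (simp add: nn_integral_cmult nn_integral_add V_def A_def)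
    also have "... \<le> ennreal \<rho> * (ennreal (rate * T) + A n)"
      using V_bound by (intro mult_left_mono add_right_mono) auto
    also have "... = ennreal \<rho> * A n + ennreal (\<rho> * rate * T)"
      using \<rho>_bounds by (simp add: distrib_left ennreal_mult' add.commute mult.assoc)
    finally show ?thesis .
  qed
  then have "A n \<le> ennreal (\<rho> * rate * T / (1 - \<rho>))"
    using \<rho>_bounds rate_nonneg T_pos
    by (intro ennreal_recursion_bound) (auto simp: A_def S_def)
  then show ?thesis by (simp add: \<kappa>_def)
qed

text \<open>
  The weights are chosen such that the second moments of the influence contract at the same rate
  \<open>r\<close> as the first ones.
\<close>

lemma convex_square_bound:
  fixes r s w :: real assumes "0 \<le> r" "r < 1"
  shows "(r * s + w)\<^sup>2 \<le> r * s\<^sup>2 + w\<^sup>2 / (1 - r)"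
proof -
  have "r * s\<^sup>2 + w\<^sup>2 / (1 - r) - (r * s + w)\<^sup>2 = r / (1 - r) * ((1 - r) * s - w)\<^sup>2"
    using assms by (simp add: field_simps power2_eq_square)
  also have "... \<ge> 0" using assms by simp
  finally show ?thesis by simp
qed

text \<open>The mass of the difference field against \<open>nu\<close> is its compensator
  \<open>s\<close>, which is \<open>S n\<close>, plus a centred part \<open>R\<close>. The weight of
  \<open>s\<close> stays at \<rho>. By isometry the second moment of \<open>R\<close> is the mass of
  the squared differences, and as these differences are at most 1 in absolute value, it is at most
  the mean of \<open>S n\<close>.\<close>

lemma S_square_step:
  "(\<integral>\<^sup>+nu. (S (Suc n) x nu)\<^sup>2 \<partial>Q) \<le> ennreal \<rho> * (\<integral>\<^sup>+nu. (S n x nu)\<^sup>2 \<partial>Q) +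
     ennreal (2 * \<rho>\<^sup>2 / (1 - \<rho>)) * ((\<integral>\<^sup>+nu. ennreal (Z n x nu) \<partial>Q) + (\<integral>\<^sup>+nu. S n x nu \<partial>Q))"
proof -
  let ?Y = "\<lambda>y nu. \<bar>point_diff x (Z n) y nu\<bar>"
  let ?c = "2 * \<rho>\<^sup>2 / (1 - \<rho>)"
  have c: "0 \<le> ?c" using \<rho>_bounds by simp
  have D: "causal (2 * 1) box (point_diff x (Z n))" by (rule causal_point_diff[OF causal_Z])
  note [measurable] = causal_measurable[OF D]
  have Y: "causal 2 box ?Y"
    using D unfolding causal_def by simp
  have Y1: "?Y y nu \<le> 1" for y nu
    using Z_bounds(1,2)[of n y nu] Z_bounds(1,2)[of n y "add_point x nu"] by (auto simp: point_diff_def)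
  note RY = growth_compensated[OF box Y]
  have [measurable]: "compensated ?Y \<in> borel_measurable confs" using RY by (simp add: growth_def)
  have sq: "(S (Suc n) x nu)\<^sup>2 \<le> ennreal \<rho> * (S n x nu)\<^sup>2 + ennreal ?c * (ennreal (Z n x nu) + ennreal ((compensated ?Y nu)\<^sup>2))"
    if nu: "nu \<in> configs" for nu
  proof -
    define s where "s = (LINT y|\<Lambda>. ?Y y nu)"
    define R where "R = compensated ?Y nu"
    define a where "a = Z n x nu"
    have a: "0 \<le> a" "a \<le> 1" using Z_bounds by (auto simp: a_def)
    have s0: "0 \<le> s" unfolding s_def by (intro integral_nonneg_AE) auto
    have i\<Lambda>: "integrable \<Lambda> (\<lambda>y. ?Y y nu)" and inu: "integrable nu (\<lambda>y. ?Y y nu)"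
      using causal_integrable(1)[OF box Y nu] \<Lambda>_finite[OF box] configs_finite[OF nu bounded_borelD[OF box]] nu by auto
    have S: "S n x nu = ennreal s"
      unfolding s_def S_eq[OF nu, symmetric] using i\<Lambda> by (intro nn_integral_eq_integral) auto
    have sR: "s + R = (LINT y|nu. ?Y y nu)" by (simp add: R_def s_def compensated_def)
    then have sR0: "0 \<le> s + R" by (simp add: integral_nonneg_AE)
    have "(\<integral>\<^sup>+y. ennreal (?Y y nu) \<partial>nu) = ennreal (s + R)"
      unfolding sR using inu by (intro nn_integral_eq_integral) auto
    then have "S (Suc n) x nu \<le> ennreal \<rho> * (ennreal a + ennreal (s + R))"
      using S_step[OF nu, of n x] by (simp add: a_def)
    also have "... = ennreal (\<rho> * (a + s + R))"
      using \<rho>_bounds a sR0 by (simp add: ennreal_mult[symmetric] ennreal_plus[symmetric] add.assoc del: ennreal_plus)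
    finally have "(S (Suc n) x nu)\<^sup>2 \<le> (ennreal (\<rho> * (a + s + R)))\<^sup>2" by (intro power_mono) auto
    also have "... = ennreal ((\<rho> * (a + s + R))\<^sup>2)"
      using \<rho>_bounds a sR0 by (intro ennreal_power) auto
    also have "... \<le> ennreal (\<rho> * s\<^sup>2 + ?c * (a + R\<^sup>2))"
    proof (rule ennreal_leI)
      have "(\<rho> * (a + s + R))\<^sup>2 = (\<rho> * s + \<rho> * (a + R))\<^sup>2" by (simp add: algebra_simps)
      also have "... \<le> \<rho> * s\<^sup>2 + (\<rho> * (a + R))\<^sup>2 / (1 - \<rho>)" by (rule convex_square_bound[OF \<rho>_bounds])
      \<comment> \<open>Acceptance \<open>a\<close> lies between 0 and 1, so its square may be
        replaced by \<open>a\<close>; this is how first moments come to control second ones.\<close>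
      also have "(\<rho> * (a + R))\<^sup>2 \<le> 2 * \<rho>\<^sup>2 * (a + R\<^sup>2)"
      proof -
        have "0 \<le> (a - R)\<^sup>2" by simp
        then have "(a + R)\<^sup>2 \<le> 2 * (a\<^sup>2 + R\<^sup>2)" by (simp add: power2_eq_square algebra_simps)
        also have "a\<^sup>2 \<le> a" using a by (simp add: power2_eq_square mult_left_le)
        finally have "(a + R)\<^sup>2 \<le> 2 * (a + R\<^sup>2)" by simp
        then have "\<rho>\<^sup>2 * (a + R)\<^sup>2 \<le> \<rho>\<^sup>2 * (2 * (a + R\<^sup>2))" by (intro mult_left_mono) auto
        then show ?thesis by (simp only: power_mult_distrib ac_simps)
      qed
      finally show "(\<rho> * (a + s + R))\<^sup>2 \<le> \<rho> * s\<^sup>2 + ?c * (a + R\<^sup>2)"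
        using \<rho>_bounds by (simp add: divide_right_mono)
    qed
    also have "... = ennreal \<rho> * (ennreal s)\<^sup>2 + ennreal ?c * (ennreal a + ennreal (R\<^sup>2))"
    proof -
      have e1: "ennreal (\<rho> * s\<^sup>2) = ennreal \<rho> * (ennreal s)\<^sup>2"
        using \<rho>_bounds s0 by (simp add: ennreal_mult ennreal_power)
      have "ennreal (?c * (a + R\<^sup>2)) = ennreal ?c * ennreal (a + R\<^sup>2)"
        using c a by (intro ennreal_mult) auto
      also have "ennreal (a + R\<^sup>2) = ennreal a + ennreal (R\<^sup>2)" using a by (intro ennreal_plus) auto
      finally have e2: "ennreal (?c * (a + R\<^sup>2)) = ennreal ?c * (ennreal a + ennreal (R\<^sup>2))" .
      have "ennreal (\<rho> * s\<^sup>2 + ?c * (a + R\<^sup>2)) = ennreal (\<rho> * s\<^sup>2) + ennreal (?c * (a + R\<^sup>2))"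
        using c a \<rho>_bounds by (intro ennreal_plus) (auto intro!: mult_nonneg_nonneg)
      then show ?thesis using e1 e2 by simp
    qed
    finally show ?thesis by (simp add: S a_def R_def)
  qed
  have "(\<integral>\<^sup>+nu. (S (Suc n) x nu)\<^sup>2 \<partial>Q)
    \<le> (\<integral>\<^sup>+nu. ennreal \<rho> * (S n x nu)\<^sup>2 + ennreal ?c * (ennreal (Z n x nu) + ennreal ((compensated ?Y nu)\<^sup>2)) \<partial>Q)"
    using sq by (intro nn_integral_mono) simp
  also have "... = ennreal \<rho> * (\<integral>\<^sup>+nu. (S n x nu)\<^sup>2 \<partial>Q) + ennreal ?c * ((\<integral>\<^sup>+nu. ennreal (Z n x nu) \<partial>Q) + (\<integral>\<^sup>+nu. ennreal ((compensated ?Y nu)\<^sup>2) \<partial>Q))"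
    by (simp add: nn_integral_add nn_integral_cmult del: ennreal_plus)
  also have "(\<integral>\<^sup>+nu. ennreal ((compensated ?Y nu)\<^sup>2) \<partial>Q) \<le> (\<integral>\<^sup>+nu. S n x nu \<partial>Q)"
  proof -
    have "(\<integral>\<^sup>+nu. ennreal ((compensated ?Y nu)\<^sup>2) \<partial>Q) = (\<integral>\<^sup>+y. \<integral>\<^sup>+nu. ennreal ((?Y y nu)\<^sup>2) \<partial>Q \<partial>\<Lambda>)"
      by (rule nn_isometry[OF box Y])
    also have "... \<le> (\<integral>\<^sup>+y. \<integral>\<^sup>+nu. ennreal (?Y y nu) \<partial>Q \<partial>\<Lambda>)"
      using Y1 by (intro nn_integral_mono ennreal_leI) (simp add: power2_eq_square abs_mult mult_left_le del: abs_mult_self_eq)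
    also have "... = (\<integral>\<^sup>+nu. \<integral>\<^sup>+y. ennreal (?Y y nu) \<partial>\<Lambda> \<partial>Q)"
      by (rule \<Lambda>Q.Fubini'[symmetric]) measurable
    also have "... = (\<integral>\<^sup>+nu. S n x nu \<partial>Q)" by (intro nn_integral_cong) (simp add: S_eq)
    finally show ?thesis .
  qed
  finally show ?thesis by (simp add: mult_left_mono add_left_mono)
qed

text \<open>The fixed point, per unit of time, of the recursion for the integrated second moment of
  the influence. Its source term is \<open>2 * \<rho>\<^sup>2 / (1 - \<rho>)\<close> times the bound
  (1 + \<kappa>) * rate for \<open>V\<close> and \<open>A\<close> together.\<close>

definition var_const :: real where
  "var_const = 2 * \<rho>\<^sup>2 / (1 - \<rho>) * (1 + \<kappa>) * rate / (1 - \<rho>)"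

lemma S_square_bound: "(\<integral>\<^sup>+x. \<integral>\<^sup>+nu. (S n x nu)\<^sup>2 \<partial>Q \<partial>\<Lambda>) \<le> ennreal (var_const * T)"
proof -
  let ?c = "2 * \<rho>\<^sup>2 / (1 - \<rho>)"
  let ?B = "\<lambda>n. \<integral>\<^sup>+x. \<integral>\<^sup>+nu. (S n x nu)\<^sup>2 \<partial>Q \<partial>\<Lambda>"
  have c: "0 \<le> ?c" using \<rho>_bounds by simp
  have "?B (Suc n) \<le> ennreal \<rho> * ?B n + ennreal (?c * (1 + \<kappa>) * rate * T)" for n
  proof -
    have "?B (Suc n) \<le> (\<integral>\<^sup>+x. ennreal \<rho> * (\<integral>\<^sup>+nu. (S n x nu)\<^sup>2 \<partial>Q) + ennreal ?c * ((\<integral>\<^sup>+nu. ennreal (Z n x nu) \<partial>Q) + (\<integral>\<^sup>+nu. S n x nu \<partial>Q)) \<partial>\<Lambda>)"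
      by (intro nn_integral_mono S_square_step)
    also have "... = ennreal \<rho> * ?B n + ennreal ?c * (V n + A n)"
      by (simp add: nn_integral_add nn_integral_cmult V_def A_def)
    also have "... \<le> ennreal \<rho> * ?B n + ennreal ?c * (ennreal (rate * T) + ennreal (\<kappa> * rate * T))"
      by (intro add_left_mono mult_left_mono add_mono V_bound A_bound) auto
    also have "ennreal ?c * (ennreal (rate * T) + ennreal (\<kappa> * rate * T)) = ennreal (?c * (rate * T + \<kappa> * rate * T))"
      using c rate_nonneg \<kappa>_nonneg T_pos
      by (subst ennreal_mult, simp, simp) (simp add: ennreal_plus)
    also have "?c * (rate * T + \<kappa> * rate * T) = ?c * (1 + \<kappa>) * rate * T"
      using distrib_left[of ?c "rate * T" "\<kappa> * rate * T"] by (simp only: distrib_left distrib_right mult_1_right mult_1_left mult.assoc)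
    finally show ?thesis .
  qed
  then have "?B n \<le> ennreal (?c * (1 + \<kappa>) * rate * T / (1 - \<rho>))"
    using \<rho>_bounds c rate_nonneg \<kappa>_nonneg T_pos
    by (intro ennreal_recursion_bound) (auto simp: S_def intro!: mult_nonneg_nonneg)
  also have "?c * (1 + \<kappa>) * rate * T / (1 - \<rho>) = var_const * T" by (simp add: var_const_def)
  finally show ?thesis .
qed

section \<open>Mean and variance of the integrated intensity\<close>

definition total :: "nat \<Rightarrow> (real \<times> real) measure \<Rightarrow> real" where
  "total n nu = (LINT x|\<Lambda>. Z n x nu)"

lemma total_measurable [measurable]: "total n \<in> borel_measurable confs"
  unfolding total_def by measurable

lemma total_bounds:
  assumes nu: "nu \<in> configs" shows "0 \<le> total n nu" "\<bar>total n nu\<bar> \<le> measure \<Lambda> box"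
  using causal_integrable(2)[OF box causal_Z nu sets_\<Lambda> \<Lambda>_finite[OF box], of n] Z_bounds
  by (auto simp: total_def intro!: integral_nonneg_AE)

lemma bfun_total: "bfun (measure \<Lambda> box) (total n)"
  using total_bounds(2) by (auto simp: bfun_def)

lemma ennreal_total:
  assumes nu: "nu \<in> configs" shows "ennreal (total n nu) = (\<integral>\<^sup>+x. ennreal (Z n x nu) \<partial>\<Lambda>)"
  unfolding total_def
  using causal_integrable(1)[OF box causal_Z nu sets_\<Lambda> \<Lambda>_finite[OF box]] Z_bounds
  by (intro nn_integral_eq_integral[symmetric]) auto

lemma total_mean: "(LINT nu|Q. total n nu) \<le> rate * T"
proof -
  have "ennreal (LINT nu|Q. total n nu) = (\<integral>\<^sup>+nu. ennreal (total n nu) \<partial>Q)"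
    using bfun_integrable[OF bfun_total] total_bounds(1)
    by (intro nn_integral_eq_integral[symmetric]) auto
  also have "... = V n" unfolding V_eq by (intro nn_integral_cong) (simp add: ennreal_total)
  also have "... \<le> ennreal (rate * T)" by (rule V_bound)
  finally show ?thesis using rate_nonneg T_pos by (subst (asm) ennreal_le_iff) auto
qed

lemma box_fine_partition:
  assumes "0 < \<epsilon>"
  shows "\<exists>\<C>. finite \<C> \<and> disjoint \<C> \<and> \<C> \<subseteq> bounded_borel \<and> \<Union>\<C> = box \<and> (\<Sum>C\<in>\<C>. (measure \<Lambda> C)\<^sup>2) \<le> \<epsilon>"
proof -
  \<comment> \<open>Vertical strips of equal width have mass \<open>T * b / m\<close> each, so the
    squares add up to at most \<open>(T * b)\<^sup>2 / m\<close>.\<close>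
  obtain m :: nat where m: "(T * b)\<^sup>2 / \<epsilon> < real m" "0 < m"
    using reals_Archimedean2[of "max ((T * b)\<^sup>2 / \<epsilon>) 0"] by (metis max_less_iff_conj of_nat_0_less_iff)
  define cell where "cell k = {T * real k / real m<..T * real (Suc k) / real m} \<times> {0..b}" for k
  let ?C = "cell ` {..<m}"
  have le: "T * real j / real m \<le> T * real k / real m" if "j \<le> k" for j k
    using that T_pos by (intro divide_right_mono mult_left_mono) auto
  have meas: "measure \<Lambda> (cell k) = T * b / real m" for k
  proof -
    have "emeasure \<Lambda> (cell k) = ennreal ((T * real (Suc k) / real m - T * real k / real m) * b)"
      unfolding cell_def using le[of k "Suc k"] b_nonneg by (intro emeasure_\<Lambda>_box) auto
    also have "(T * real (Suc k) / real m - T * real k / real m) * b = T * b / real m"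
      using m by (simp add: field_simps)
    finally show ?thesis using T_pos b_nonneg by (simp add: measure_def)
  qed
  have "disjoint ?C"
  proof (rule disjointI)
    fix a a' assume "a \<in> ?C" "a' \<in> ?C" "a \<noteq> a'"
    then obtain j k where jk: "a = cell j" "a' = cell k" "j \<noteq> k" by auto
    have *: "cell i \<inter> cell l = {}" if "i < l" for i l
      using le[of "Suc i" l] that unfolding cell_def by auto
    show "a \<inter> a' = {}" using *[of j k] *[of k j] jk by (cases j k rule: linorder_cases) auto
  qed
  moreover have "?C \<subseteq> bounded_borel"
  proof
    fix a assume "a \<in> ?C"
    then obtain k where a: "a = cell k" by auto
    have "cell k \<in> sets borel"
      unfolding cell_def borel_prod[symmetric] by (intro pair_measureI) auto
    moreover have "bounded (cell k)" unfolding cell_def by (intro bounded_Times) auto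
    ultimately show "a \<in> bounded_borel" by (simp add: bounded_borel_def a)
  qed
  moreover have "\<Union>?C = box"
  proof
    show "\<Union>?C \<subseteq> box"
    proof
      fix y assume "y \<in> \<Union>?C"
      then obtain k where k: "k < m" "y \<in> cell k" by auto
      have "0 \<le> T * real k / real m" using T_pos by auto
      moreover have "T * real (Suc k) / real m \<le> T"
        using le[of "Suc k" m] k m by simp
      ultimately show "y \<in> box" using k by (auto simp: cell_def box_def)
    qed
    show "box \<subseteq> \<Union>?C"
    proof
      fix y assume y: "y \<in> box"
      define u where "u = fst y * real m / T"
      have u: "0 < u" "u \<le> real m" using y T_pos m by (auto simp: u_def box_def field_simps)
      \<comment> \<open>The strips are open on the left and closed on the right, hence the ceiling
        minus one.\<close>
      define k where "k = nat (\<lceil>u\<rceil> - 1)"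
      have k: "real k < u" "u \<le> real (Suc k)" "k < m"
        using u by (auto simp: k_def of_nat_nat) (linarith+)
      have "T * real k / real m < fst y" "fst y \<le> T * real (Suc k) / real m"
        using k(1,2) T_pos m unfolding u_def by (simp_all add: field_simps del: of_nat_Suc)
      then have "y \<in> cell k" using y by (auto simp: cell_def box_def mem_Times_iff)
      then show "y \<in> \<Union>?C" using k(3) by blast
    qed
  qed
  moreover have "(\<Sum>C\<in>?C. (measure \<Lambda> C)\<^sup>2) \<le> \<epsilon>"
  proof -
    have "(\<Sum>C\<in>?C. (measure \<Lambda> C)\<^sup>2) = (\<Sum>C\<in>?C. (T * b / real m)\<^sup>2)"
      by (intro sum.cong) (auto simp: meas)
    also have "... \<le> real m * (T * b / real m)\<^sup>2"
      using card_image_le[of "{..<m}" cell] by (simp add: mult_right_mono)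
    also have "... = (T * b)\<^sup>2 / real m" using m by (simp add: power2_eq_square)
    also have "... \<le> \<epsilon>" using m assms by (simp add: field_simps)
    finally show ?thesis .
  qed
  ultimately show ?thesis by blast
qed

text \<open>An additional point changes the integrated intensity by at most its total influence
  \<open>S\<close>, so the Poincare inequality bounds the variance by the integrated second moment
  of \<open>S\<close>.\<close>

theorem total_variance:
  "(LINT nu|Q. (total n nu)\<^sup>2) - (LINT nu|Q. total n nu)\<^sup>2 \<le> var_const * T"
proof -
  have dep: "depends box (total n)"
    unfolding depends_def total_def
  proof (intro ballI Bochner_Integration.integral_cong refl)
    fix nu x assume "nu \<in> (configs :: (real \<times> real) measure set)"
    then show "Z n x (restr box nu) = Z n x nu" by (auto simp: Z_def lam_restr split: split_indicator)
  qed
  have D: "causal (2 * 1) box (point_diff x (Z n))" for x by (rule causal_point_diff[OF causal_Z])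
  have diff: "ennreal ((total n (add_point x nu) - total n nu)\<^sup>2) \<le> (S n x nu)\<^sup>2" if nu: "nu \<in> configs" for x nu
  proof -
    note iD = causal_integrable(1)[OF box D nu sets_\<Lambda> \<Lambda>_finite[OF box], of x]
    have "total n (add_point x nu) - total n nu = (LINT y|\<Lambda>. point_diff x (Z n) y nu)"
      unfolding total_def point_diff_def
      using causal_integrable(1)[OF box causal_Z _ sets_\<Lambda> \<Lambda>_finite[OF box], of "add_point x nu" n]
        causal_integrable(1)[OF box causal_Z nu sets_\<Lambda> \<Lambda>_finite[OF box], of n] nu
      by (simp add: Bochner_Integration.integral_diff)
    then have "\<bar>total n (add_point x nu) - total n nu\<bar> \<le> (LINT y|\<Lambda>. \<bar>point_diff x (Z n) y nu\<bar>)"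
      by (simp add: integral_abs_bound)
    then have "ennreal \<bar>total n (add_point x nu) - total n nu\<bar> \<le> ennreal (LINT y|\<Lambda>. \<bar>point_diff x (Z n) y nu\<bar>)"
      by (rule ennreal_leI)
    also have "... = S n x nu"
      unfolding S_eq[OF nu, symmetric] using iD by (intro nn_integral_eq_integral[symmetric]) auto
    finally have "(ennreal \<bar>total n (add_point x nu) - total n nu\<bar>)\<^sup>2 \<le> (S n x nu)\<^sup>2" by (intro power_mono) auto
    then show ?thesis by (simp add: ennreal_power)
  qed
  have "ennreal ((LINT nu|Q. (total n nu)\<^sup>2) - (LINT nu|Q. total n nu)\<^sup>2)
    \<le> (\<integral>\<^sup>+x. (\<integral>\<^sup>+nu. ennreal ((total n (add_point x nu) - total n nu)\<^sup>2) \<partial>Q) * indicator box x \<partial>\<Lambda>)"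
    by (rule poincare[OF bfun_total box dep box_fine_partition])
  also have "... \<le> (\<integral>\<^sup>+x. \<integral>\<^sup>+nu. (S n x nu)\<^sup>2 \<partial>Q \<partial>\<Lambda>)"
    using diff by (intro nn_integral_mono) (auto intro!: nn_integral_mono split: split_indicator)
  also have "... \<le> ennreal (var_const * T)" by (rule S_square_bound)
  finally show ?thesis
    using \<rho>_bounds rate_nonneg \<kappa>_nonneg T_pos
    by (subst (asm) ennreal_le_iff) (auto simp: var_const_def intro!: mult_nonneg_nonneg)
qed

end

section \<open>Normal approximation for the iterates\<close>

text \<open>The inequality holds without integrability, because a divergent Bochner integral has the
  value 0.\<close>

lemma ennreal_abs_integral_le:
  fixes f :: "'z \<Rightarrow> real"
  shows "ennreal \<bar>LINT x|M. f x\<bar> \<le> (\<integral>\<^sup>+x. ennreal \<bar>f x\<bar> \<partial>M)"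
proof (cases "integrable M f")
  case True
  have "ennreal \<bar>LINT x|M. f x\<bar> \<le> ennreal (LINT x|M. \<bar>f x\<bar>)" by (intro ennreal_leI integral_abs_bound)
  also have "... = (\<integral>\<^sup>+x. ennreal \<bar>f x\<bar> \<partial>M)"
    using True by (intro nn_integral_eq_integral[symmetric]) auto
  finally show ?thesis .
qed (simp add: not_integrable_integral_eq)

lemma borel_measurable_abs_lipschitz:
  fixes f :: "real \<Rightarrow> real"
  assumes "\<And>x y. \<bar>f x - f y\<bar> \<le> K * \<bar>x - y\<bar>"
  shows "f \<in> borel_measurable borel"
proof -
  have "(max K 0)-lipschitz_on UNIV f"
    by (intro lipschitz_onI) (auto simp: dist_real_def intro!: order_trans[OF assms] mult_right_mono)
  then show ?thesis
    using lipschitz_on_continuous_on by (intro borel_measurable_continuous_onI) blast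
qed

lemma taylor_lipschitz:
  fixes f f' :: "real \<Rightarrow> real"
  assumes f: "\<And>x. (f has_real_derivative f' x) (at x)" and L: "\<And>x y. \<bar>f' x - f' y\<bar> \<le> K * \<bar>x - y\<bar>"
  shows "\<bar>f y - f x - f' x * (y - x)\<bar> \<le> K * (y - x)\<^sup>2"
proof -
  have K: "0 \<le> K" using L[of 0 1] abs_ge_zero[of "f' 0 - f' 1"] by (simp del: abs_ge_zero) 
  obtain z where z: "\<bar>z - x\<bar> \<le> \<bar>y - x\<bar>" "f y - f x = (y - x) * f' z"
  proof (cases x y rule: linorder_cases)
    case less
    then obtain z where "x < z" "z < y" "f y - f x = (y - x) * f' z"
      using MVT2[of x y f f'] f by blast
    then show ?thesis using that[of z] by simp
  next
    case greater
    then obtain z where "y < z" "z < x" "f x - f y = (x - y) * f' z"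
      using MVT2[of y x f f'] f by blast
    then show ?thesis using that[of z] by (simp add: algebra_simps)
  qed (use that[of x] in simp)
  have "\<bar>f y - f x - f' x * (y - x)\<bar> = \<bar>y - x\<bar> * \<bar>f' z - f' x\<bar>"
    using z(2) by (simp add: abs_mult[symmetric] algebra_simps)
  also have "... \<le> \<bar>y - x\<bar> * (K * \<bar>y - x\<bar>)"
    using L[of z x] z(1) K by (intro mult_left_mono) (auto intro: order_trans mult_left_mono)
  finally show ?thesis
    by (simp add: power2_eq_square mult.left_commute[of "\<bar>y - x\<bar>" K])
qed

context hawkes_iterates begin

definition F :: "nat \<Rightarrow> (real \<times> real) measure \<Rightarrow> real" where
  "F n nu = compensated (Z n) nu / sqrt T"

lemma growth_Z: "growth box (1 + measure \<Lambda> box) (compensated (Z n))"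
  using growth_compensated[OF box causal_Z] by simp

lemma measurable_compensated_Z [measurable]: "compensated (Z n) \<in> borel_measurable confs"
  using growth_Z by (simp add: growth_def)

lemma measurable_F [measurable]: "F n \<in> borel_measurable confs"
  unfolding F_def by measurable

lemma F_add_point:
  "nu \<in> configs \<Longrightarrow> F n (add_point x nu) - F n nu = (Z n x nu + compensated (point_diff x (Z n)) nu) / sqrt T"
  by (simp add: F_def compensated_add_point[OF box causal_Z] diff_divide_distrib[symmetric])

lemma causal_Z_diff: "causal 2 box (point_diff x (Z n))"
  using causal_point_diff[OF causal_Z] by simp

lemma abs_compensated_diff:
  assumes nu: "nu \<in> configs"
  shows "ennreal \<bar>compensated (point_diff x (Z n)) nu\<bar> \<le> (\<integral>\<^sup>+y. ennreal \<bar>point_diff x (Z n) y nu\<bar> \<partial>nu) + S n x nu"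
proof -
  have "ennreal \<bar>compensated (point_diff x (Z n)) nu\<bar>
    \<le> ennreal (\<bar>LINT y|nu. point_diff x (Z n) y nu\<bar> + \<bar>LINT y|\<Lambda>. point_diff x (Z n) y nu\<bar>)"
    unfolding compensated_def by (intro ennreal_leI abs_triangle_ineq4)
  also have "... = ennreal \<bar>LINT y|nu. point_diff x (Z n) y nu\<bar> + ennreal \<bar>LINT y|\<Lambda>. point_diff x (Z n) y nu\<bar>"
    by (intro ennreal_plus) auto
  also have "... \<le> (\<integral>\<^sup>+y. ennreal \<bar>point_diff x (Z n) y nu\<bar> \<partial>nu) + (\<integral>\<^sup>+y. ennreal \<bar>point_diff x (Z n) y nu\<bar> \<partial>\<Lambda>)"
    by (intro add_mono ennreal_abs_integral_le)
  finally show ?thesis by (simp add: S_eq[OF nu])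
qed

lemma Z_past: "nu \<in> configs \<Longrightarrow> fst x \<le> fst y \<Longrightarrow> Z n x (add_point y nu) = Z n x nu"
  by (simp add: Z_def lam_add_point)

text \<open>The probability that a point planted at \<open>x\<close> is accepted.\<close>

definition z :: "nat \<Rightarrow> real \<times> real \<Rightarrow> real" where "z n x = (LINT nu|Q. Z n x nu)"

lemma bfun_Z: "bfun 1 (Z n x)"
proof -
  have "Z n x \<in> borel_measurable confs" by measurable
  then show ?thesis using Z_bounds by (auto simp: bfun_def abs_le_iff intro: order_trans[of _ 0])
qed

lemma z_nonneg: "0 \<le> z n x"
  unfolding z_def using Z_bounds by (intro integral_nonneg_AE) auto

lemma ennreal_z: "(\<integral>\<^sup>+nu. ennreal (Z n x nu) \<partial>Q) = ennreal (z n x)"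
  unfolding z_def using bfun_integrable[OF bfun_Z] Z_bounds by (intro nn_integral_eq_integral) auto

text \<open>The difference field vanishes up to the time of \<open>x\<close>, when acceptance of
  \<open>x\<close> is already decided, so the product is causal. Thus acceptance times the
  compensated influence of \<open>x\<close> is itself a compensated integral, accessible to duality
  and isometry.\<close>

lemma causal_Z_Z_diff: "causal 2 box (\<lambda>y nu. Z n x nu * point_diff x (Z n) y nu)"
proof (rule causal_past_mult[OF causal_Z_diff])
  show "Z n x \<in> borel_measurable confs" by measurable
  show "\<And>nu. nu \<in> configs \<Longrightarrow> \<bar>Z n x nu\<bar> \<le> 1" using bfun_Z by (simp add: bfun_def)
  show "\<And>nu y. nu \<in> configs \<Longrightarrow> fst x \<le> fst y \<Longrightarrow> Z n x (add_point y nu) = Z n x nu" by (rule Z_past)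
  show "\<And>nu y. nu \<in> configs \<Longrightarrow> fst y \<le> fst x \<Longrightarrow> point_diff x (Z n) y nu = 0"
    by (rule point_diff_before[OF causal_Z])
qed

lemma compensated_Z_Z_diff:
  "compensated (\<lambda>y nu. Z n x nu * point_diff x (Z n) y nu) nu = Z n x nu * compensated (point_diff x (Z n)) nu"
  by (simp add: compensated_def right_diff_distrib)

lemma Z_influence:
  "(\<integral>\<^sup>+y. \<integral>\<^sup>+nu. ennreal \<bar>Z n x nu * point_diff x (Z n) y nu\<bar> \<partial>Q \<partial>\<Lambda>) \<le> ennreal (\<kappa> * z n x)"
proof -
  have "(\<integral>\<^sup>+y. \<integral>\<^sup>+nu. ennreal \<bar>Z n x nu * point_diff x (Z n) y nu\<bar> \<partial>Q \<partial>\<Lambda>)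
    = (\<integral>\<^sup>+y. \<integral>\<^sup>+nu. ennreal (Z n x nu) * ennreal \<bar>point_diff x (Z n) y nu\<bar> \<partial>Q \<partial>\<Lambda>)"
    using Z_bounds by (intro nn_integral_cong) (simp add: abs_mult ennreal_mult)
  also have "... = (\<integral>\<^sup>+nu. ennreal (Z n x nu) * S n x nu \<partial>Q)"
    by (rule influence_mean(2)) (auto simp: Z_past)
  also have "... \<le> ennreal \<kappa> * (\<integral>\<^sup>+nu. ennreal (Z n x nu) \<partial>Q)"
    by (rule influence_bound) (auto simp: Z_past)
  finally show ?thesis using \<kappa>_nonneg by (simp add: ennreal_z ennreal_mult')
qed

text \<open>Acceptance is idempotent, so the integrand is the square of a compensated integral.
  Under the isometry the values -1, 0 and 1 allow squares to be replaced by absolute values, whose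
  mass is bounded by the mean influence.\<close>

lemma Z_diff_square:
  "integrable Q (\<lambda>nu. Z n x nu * (compensated (point_diff x (Z n)) nu)\<^sup>2)"
  "(LINT nu|Q. Z n x nu * (compensated (point_diff x (Z n)) nu)\<^sup>2) \<le> \<kappa> * z n x"
proof -
  let ?Y = "\<lambda>y nu. Z n x nu * point_diff x (Z n) y nu"
  have Zsq: "Z n x nu * Z n x nu = Z n x nu" for nu by (auto simp: Z_def hit_def split: split_indicator)
  have eq: "Z n x nu * (compensated (point_diff x (Z n)) nu)\<^sup>2 = (compensated ?Y nu)\<^sup>2" for nu
    unfolding compensated_Z_Z_diff power_mult_distrib using Zsq by (simp add: power2_eq_square)
  show int: "integrable Q (\<lambda>nu. Z n x nu * (compensated (point_diff x (Z n)) nu)\<^sup>2)"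
    unfolding eq by (rule growth_square_integrable[OF box growth_compensated[OF box causal_Z_Z_diff]])
  have "ennreal (LINT nu|Q. Z n x nu * (compensated (point_diff x (Z n)) nu)\<^sup>2) = (\<integral>\<^sup>+nu. ennreal ((compensated ?Y nu)\<^sup>2) \<partial>Q)"
    using int unfolding eq by (intro nn_integral_eq_integral[symmetric]) auto
  also have "... = (\<integral>\<^sup>+y. \<integral>\<^sup>+nu. ennreal ((?Y y nu)\<^sup>2) \<partial>Q \<partial>\<Lambda>)" by (rule nn_isometry[OF box causal_Z_Z_diff])
  also have "... \<le> (\<integral>\<^sup>+y. \<integral>\<^sup>+nu. ennreal \<bar>?Y y nu\<bar> \<partial>Q \<partial>\<Lambda>)"
  proof (intro nn_integral_mono ennreal_leI)
    fix y nu
    have "?Y y nu \<in> {-1, 0, 1}" by (auto simp: Z_def hit_def point_diff_def split: split_indicator)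
    then show "(?Y y nu)\<^sup>2 \<le> \<bar>?Y y nu\<bar>" by auto
  qed
  also have "... \<le> ennreal (\<kappa> * z n x)" by (rule Z_influence)
  finally show "(LINT nu|Q. Z n x nu * (compensated (point_diff x (Z n)) nu)\<^sup>2) \<le> \<kappa> * z n x"
    using \<kappa>_nonneg z_nonneg by (subst (asm) ennreal_le_iff) auto
qed

text \<open>An absolute bound has no factor 1 / sqrt T. Duality replaces \<open>k (F n nu)\<close>
  by its increment under a later point \<open>y\<close>, of size at most \<open>K2 / sqrt T\<close>
  times 1 plus the compensated influence of \<open>y\<close>. Given the past of \<open>y\<close>
  that influence costs one \<kappa> for its integral against \<open>nu\<close> and one for its
  compensator, which explains 1 + 2 * \<kappa>. The other \<kappa> is the mean influence of
  \<open>x\<close>.\<close>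

lemma cross_term:
  fixes k :: "real \<Rightarrow> real"
  assumes k: "\<And>x. \<bar>k x\<bar> \<le> K1" "\<And>x y. \<bar>k x - k y\<bar> \<le> K2 * \<bar>x - y\<bar>" "k \<in> borel_measurable borel"
  shows "\<bar>LINT nu|Q. k (F n nu) * (Z n x nu * compensated (point_diff x (Z n)) nu)\<bar>
    \<le> K2 / sqrt T * (1 + 2 * \<kappa>) * \<kappa> * z n x"
proof -
  note [measurable] = k(3)
  have K2: "0 \<le> K2" using k(2)[of 0 1] abs_ge_zero[of "k 0 - k 1"] by (simp del: abs_ge_zero)
  have K1: "0 \<le> K1" using k(1)[of 0] by simp
  let ?Y = "\<lambda>y nu. Z n x nu * point_diff x (Z n) y nu"
  let ?D = "\<lambda>y nu. \<integral>\<^sup>+y'. ennreal \<bar>point_diff y (Z n) y' nu\<bar> \<partial>nu"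
  have gk: "growth box K1 (\<lambda>nu. k (F n nu))"
    using k(1) K1 by (intro growth_bounded) auto
  have Dm [measurable]: "(\<lambda>nu. ?D y nu) \<in> borel_measurable confs" for y
    using causal_measurable[OF causal_Z_diff[of y n]] by measurable
  note [measurable] = causal_measurable[OF causal_Z_Z_diff[of n x]]
  have Kd: "0 \<le> K2 / sqrt T" using K2 T_pos by simp
  have Kd2: "0 \<le> K2 / sqrt T * (1 + 2 * \<kappa>)"
    by (intro mult_nonneg_nonneg Kd) (use \<kappa>_nonneg in simp)
  have \<kappa>z: "0 \<le> \<kappa> * z n x" by (intro mult_nonneg_nonneg \<kappa>_nonneg z_nonneg)
  have pt: "ennreal \<bar>?Y y nu * (k (F n (add_point y nu)) - k (F n nu))\<bar>
    \<le> ennreal (K2 / sqrt T) * (ennreal \<bar>?Y y nu\<bar> + (ennreal \<bar>?Y y nu\<bar> * ?D y nu + ennreal \<bar>?Y y nu\<bar> * S n y nu))"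
    if nu: "nu \<in> configs" for y nu
  proof -
    let ?M = "compensated (point_diff y (Z n)) nu"
    have "\<bar>k (F n (add_point y nu)) - k (F n nu)\<bar> \<le> K2 * \<bar>F n (add_point y nu) - F n nu\<bar>" by (rule k(2))
    also have "... = K2 / sqrt T * \<bar>Z n y nu + ?M\<bar>"
      using T_pos by (simp add: F_add_point[OF nu] abs_divide)
    also have "... \<le> K2 / sqrt T * (1 + \<bar>?M\<bar>)"
      using Z_bounds(1,2)[of n y nu] by (intro mult_left_mono Kd) auto
    finally have "\<bar>?Y y nu\<bar> * \<bar>k (F n (add_point y nu)) - k (F n nu)\<bar> \<le> \<bar>?Y y nu\<bar> * (K2 / sqrt T * (1 + \<bar>?M\<bar>))"
      by (rule mult_left_mono) simp
    then have "\<bar>?Y y nu * (k (F n (add_point y nu)) - k (F n nu))\<bar> \<le> K2 / sqrt T * (\<bar>?Y y nu\<bar> * (1 + \<bar>?M\<bar>))"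
      unfolding abs_mult[of "?Y y nu" "k (F n (add_point y nu)) - k (F n nu)"]
        mult.left_commute[of "K2 / sqrt T" "\<bar>?Y y nu\<bar>"] .
    then have "ennreal \<bar>?Y y nu * (k (F n (add_point y nu)) - k (F n nu))\<bar> \<le> ennreal (K2 / sqrt T * (\<bar>?Y y nu\<bar> * (1 + \<bar>?M\<bar>)))"
      by (rule ennreal_leI)
    also have "... = ennreal (K2 / sqrt T) * (ennreal \<bar>?Y y nu\<bar> * (1 + ennreal \<bar>?M\<bar>))"
      using Kd by (subst ennreal_mult) (auto simp: ennreal_mult ennreal_plus)
    also have "... \<le> ennreal (K2 / sqrt T) * (ennreal \<bar>?Y y nu\<bar> * (1 + (?D y nu + S n y nu)))"
      by (intro mult_left_mono add_left_mono abs_compensated_diff nu) auto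
    finally show ?thesis by (simp add: distrib_left)
  qed
  have past: "ennreal \<bar>?Y y (add_point y' nu)\<bar> = ennreal \<bar>?Y y nu\<bar>" if "nu \<in> configs" "fst y \<le> fst y'" for y y' nu
    using causal_Z_Z_diff[of n x] that by (simp add: causal_def)
  have Ym [measurable]: "(\<lambda>nu. ennreal \<bar>?Y y nu\<bar>) \<in> borel_measurable confs" for y by measurable
  have "ennreal \<bar>LINT nu|Q. k (F n nu) * (Z n x nu * compensated (point_diff x (Z n)) nu)\<bar>
    = ennreal \<bar>LINT y|\<Lambda>. LINT nu|Q. ?Y y nu * (k (F n (add_point y nu)) - k (F n nu))\<bar>"
    using compensated_covariance[OF box gk causal_Z_Z_diff] by (simp add: compensated_Z_Z_diff)
  also have "... \<le> (\<integral>\<^sup>+y. \<integral>\<^sup>+nu. ennreal \<bar>?Y y nu * (k (F n (add_point y nu)) - k (F n nu))\<bar> \<partial>Q \<partial>\<Lambda>)"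
    by (rule order_trans[OF ennreal_abs_integral_le nn_integral_mono[OF ennreal_abs_integral_le]])
  also have "... \<le> (\<integral>\<^sup>+y. ennreal (K2 / sqrt T * (1 + 2 * \<kappa>)) * (\<integral>\<^sup>+nu. ennreal \<bar>?Y y nu\<bar> \<partial>Q) \<partial>\<Lambda>)"
  proof (rule nn_integral_mono)
    fix y
    let ?e = "\<integral>\<^sup>+nu. ennreal \<bar>?Y y nu\<bar> \<partial>Q"
    have "(\<integral>\<^sup>+nu. ennreal \<bar>?Y y nu * (k (F n (add_point y nu)) - k (F n nu))\<bar> \<partial>Q)
      \<le> (\<integral>\<^sup>+nu. ennreal (K2 / sqrt T) * (ennreal \<bar>?Y y nu\<bar> + (ennreal \<bar>?Y y nu\<bar> * ?D y nu + ennreal \<bar>?Y y nu\<bar> * S n y nu)) \<partial>Q)"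
      using pt by (intro nn_integral_mono) simp
    also have "... = ennreal (K2 / sqrt T) * (?e + ((\<integral>\<^sup>+nu. ennreal \<bar>?Y y nu\<bar> * ?D y nu \<partial>Q) + (\<integral>\<^sup>+nu. ennreal \<bar>?Y y nu\<bar> * S n y nu \<partial>Q)))"
      by (simp add: nn_integral_cmult nn_integral_add)
    also have "(\<integral>\<^sup>+nu. ennreal \<bar>?Y y nu\<bar> * ?D y nu \<partial>Q) = (\<integral>\<^sup>+nu. ennreal \<bar>?Y y nu\<bar> * S n y nu \<partial>Q)"
      by (rule influence_mean(1)[OF Ym past])
    also have "ennreal (K2 / sqrt T) * (?e + ((\<integral>\<^sup>+nu. ennreal \<bar>?Y y nu\<bar> * S n y nu \<partial>Q) + (\<integral>\<^sup>+nu. ennreal \<bar>?Y y nu\<bar> * S n y nu \<partial>Q)))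
      \<le> ennreal (K2 / sqrt T) * (?e + (ennreal \<kappa> * ?e + ennreal \<kappa> * ?e))"
      by (intro mult_left_mono add_left_mono add_mono influence_bound[OF Ym past]) auto
    also have "... = ennreal (K2 / sqrt T) * ((1 + (ennreal \<kappa> + ennreal \<kappa>)) * ?e)"
      by (simp only: distrib_right mult_1_left)
    also have "1 + (ennreal \<kappa> + ennreal \<kappa>) = ennreal (1 + 2 * \<kappa>)"
    proof -
      have "ennreal (1 + 2 * \<kappa>) = ennreal 1 + ennreal (\<kappa> + \<kappa>)"
        using \<kappa>_nonneg by (subst ennreal_plus[symmetric]) auto
      also have "ennreal (\<kappa> + \<kappa>) = ennreal \<kappa> + ennreal \<kappa>" by (intro ennreal_plus \<kappa>_nonneg)
      finally show ?thesis by simp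
    qed
    also have "ennreal (K2 / sqrt T) * (ennreal (1 + 2 * \<kappa>) * ?e) = ennreal (K2 / sqrt T * (1 + 2 * \<kappa>)) * ?e"
      using ennreal_mult[OF Kd, of "1 + 2 * \<kappa>"] \<kappa>_nonneg by (simp add: mult.assoc)
    finally show "(\<integral>\<^sup>+nu. ennreal \<bar>?Y y nu * (k (F n (add_point y nu)) - k (F n nu))\<bar> \<partial>Q)
      \<le> ennreal (K2 / sqrt T * (1 + 2 * \<kappa>)) * ?e" .
  qed
  also have "... = ennreal (K2 / sqrt T * (1 + 2 * \<kappa>)) * (\<integral>\<^sup>+y. \<integral>\<^sup>+nu. ennreal \<bar>?Y y nu\<bar> \<partial>Q \<partial>\<Lambda>)"
    by (intro nn_integral_cmult) measurable
  also have "... \<le> ennreal (K2 / sqrt T * (1 + 2 * \<kappa>)) * ennreal (\<kappa> * z n x)"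
    by (intro mult_left_mono Z_influence) auto
  also have "... = ennreal (K2 / sqrt T * (1 + 2 * \<kappa>) * (\<kappa> * z n x))"
    by (rule ennreal_mult[symmetric, OF Kd2 \<kappa>z])
  finally show ?thesis
    using mult_nonneg_nonneg[OF Kd2 \<kappa>z] by (subst (asm) ennreal_le_iff) (simp_all add: mult.assoc)
qed

section \<open>Integration by parts and Stein's bound for the iterates\<close>

definition stein_const :: real where
  "stein_const = ((1 + 2 * \<kappa>) * \<kappa> + 2 * (1 + \<kappa>)) * rate"

text \<open>Duality expresses the left-hand expectation through the increments of
  \<open>f (F n nu)\<close> at accepted points. The jump of size 1 / sqrt T gives the term with
  \<open>total\<close>. In \<open>stein_const\<close> the summand (1 + 2 * \<kappa>) * \<kappa> is
  the cross term, 2 * (1 + \<kappa>) is the Taylor remainder, and \<open>rate\<close> bounds the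
  expected number of accepted points per unit of time.\<close>

lemma integration_by_parts:
  fixes f f' :: "real \<Rightarrow> real"
  assumes f: "\<And>x. (f has_real_derivative f' x) (at x)" and K0: "\<And>x. \<bar>f x\<bar> \<le> K0"
    and K1: "\<And>x. \<bar>f' x\<bar> \<le> K1" and K2: "\<And>x y. \<bar>f' x - f' y\<bar> \<le> K2 * \<bar>x - y\<bar>"
  shows "\<bar>(LINT nu|Q. F n nu * f (F n nu)) - (LINT nu|Q. f' (F n nu) * total n nu) / T\<bar> \<le> K2 * stein_const / sqrt T"
proof -
  have "f \<in> borel_measurable borel"
    using f by (intro borel_measurable_continuous_onI) (auto intro: DERIV_continuous_on DERIV_subset)
  moreover have "f' \<in> borel_measurable borel" by (rule borel_measurable_abs_lipschitz[OF K2])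
  ultimately have [measurable]: "f \<in> borel_measurable borel" "f' \<in> borel_measurable borel" by auto
  have K2n: "0 \<le> K2" using K2[of 0 1] abs_ge_zero[of "f' 0 - f' 1"] by (simp del: abs_ge_zero)
  have K0n: "0 \<le> K0" and K1n: "0 \<le> K1" using K0[of 0] K1[of 0] by auto
  have sT: "0 < sqrt T" "sqrt T * sqrt T = T" using T_pos by auto
  let ?M = "\<lambda>x nu. compensated (point_diff x (Z n)) nu"
  let ?g = "\<lambda>x nu. Z n x nu * (f (F n (add_point x nu)) - f (F n nu))"
  let ?m = "\<lambda>x nu. Z n x nu * f' (F n nu)"
  have gk: "growth box K0 (\<lambda>nu. f (F n nu))" using K0 K0n by (intro growth_bounded) auto
  have one: "1 \<le> 1 + measure nu box" for nu by simp
  have g_le: "\<bar>?g x nu\<bar> \<le> 2 * K0" for x nu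
  proof -
    have "\<bar>?g x nu\<bar> \<le> 1 * (2 * K0)" unfolding abs_mult
      using Z_bounds(1,2)[of n x nu] K0[of "F n (add_point x nu)"] K0[of "F n nu"] by (intro mult_mono) auto
    then show ?thesis by simp
  qed
  have m_le: "\<bar>?m x nu\<bar> \<le> K1" for x nu
  proof -
    have "\<bar>?m x nu\<bar> \<le> 1 * K1" unfolding abs_mult
      using Z_bounds(1,2)[of n x nu] K1[of "F n nu"] by (intro mult_mono) auto
    then show ?thesis by simp
  qed
  have bd: "a \<le> a * (1 + measure nu box)" if "0 \<le> a" for a :: real and nu :: "(real \<times> real) measure"
    using mult_left_mono[OF one that] by simp
  have g: "field_growth box (2 * K0) ?g"
    unfolding field_growth_def using K0n Z_bounds(3) order_trans[OF g_le bd] by simp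
  have m: "field_growth box K1 ?m"
    unfolding field_growth_def using K1n Z_bounds(3) order_trans[OF m_le bd] by simp
  have Zf: "field_growth box 1 (Z n)"
    unfolding field_growth_def using Z_bounds one by (auto simp: abs_le_iff intro: order_trans[OF _ one] order_trans[of _ 0])
  note Ig = field_growth_integrable(1)[OF box g] and Im = field_growth_integrable(1)[OF box m]
    and IZ = field_growth_integrable(1)[OF box Zf]
  let ?c = "K2 * ((1 + 2 * \<kappa>) * \<kappa> + 2 * (1 + \<kappa>)) / T"
  have pointwise: "\<bar>(LINT nu|Q. ?g x nu) - (LINT nu|Q. ?m x nu) / sqrt T\<bar> \<le> ?c * z n x" for x
  proof -
    have iM: "integrable Q (\<lambda>nu. f' (F n nu) * (Z n x nu * ?M x nu))"
      using growth_integrable[OF box growth_bounded_mult[OF growth_compensated[OF box causal_Z_Z_diff[of n x]], of "\<lambda>nu. f' (F n nu)" K1]]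
        K1 K1n by (simp add: compensated_Z_Z_diff mult.commute)
    have ig: "integrable Q (?g x)"
      by (rule Q.integrable_const_bound[of _ "2 * K0"])
         (use g_le in auto)
    have im: "integrable Q (?m x)"
      by (rule Q.integrable_const_bound[of _ K1])
         (use m_le in auto)
    have iZ: "integrable Q (Z n x)" by (rule bfun_integrable[OF bfun_Z])
    \<comment> \<open>All terms vanish unless the point is accepted; in that case the increment of
      \<open>F\<close> is exactly (1 + ?M x nu) / sqrt T.\<close>
    have pt: "\<bar>?g x nu - ?m x nu / sqrt T - f' (F n nu) * (Z n x nu * ?M x nu) / sqrt T\<bar>
      \<le> 2 * K2 / T * (Z n x nu + Z n x nu * (?M x nu)\<^sup>2)" if nu: "nu \<in> configs" for nu
    proof (cases "Z n x nu = 0")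
      case False
      then have Z1: "Z n x nu = 1" by (auto simp: Z_def hit_def split: split_indicator_asm if_splits)
      let ?d = "F n (add_point x nu) - F n nu"
      have d: "?d = (1 + ?M x nu) / sqrt T" using F_add_point[OF nu] Z1 by simp
      have "\<bar>f (F n (add_point x nu)) - f (F n nu) - f' (F n nu) * ?d\<bar> \<le> K2 * ?d\<^sup>2"
        by (rule taylor_lipschitz[OF f K2])
      also have "?d\<^sup>2 = (1 + ?M x nu)\<^sup>2 / T" using d T_pos by (simp add: power_divide)
      also have "(1 + ?M x nu)\<^sup>2 \<le> 2 * (1 + (?M x nu)\<^sup>2)"
        using zero_le_power2[of "1 - ?M x nu"] by (simp add: power2_eq_square algebra_simps)
      finally have "\<bar>f (F n (add_point x nu)) - f (F n nu) - f' (F n nu) * ?d\<bar> \<le> K2 * (2 * (1 + (?M x nu)\<^sup>2) / T)"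
        using K2n T_pos by (simp add: mult_left_mono divide_right_mono)
      moreover have "f' (F n nu) * ?d = f' (F n nu) / sqrt T + f' (F n nu) * ?M x nu / sqrt T"
        unfolding d by (simp add: algebra_simps add_divide_distrib)
      ultimately show ?thesis using Z1 by (simp add: algebra_simps add_divide_distrib)
    qed simp
    have "\<bar>(LINT nu|Q. ?g x nu) - (LINT nu|Q. ?m x nu) / sqrt T - (LINT nu|Q. f' (F n nu) * (Z n x nu * ?M x nu)) / sqrt T\<bar>
      = \<bar>LINT nu|Q. ?g x nu - ?m x nu / sqrt T - f' (F n nu) * (Z n x nu * ?M x nu) / sqrt T\<bar>"
      using ig im iM by simp
    also have "... \<le> (LINT nu|Q. \<bar>?g x nu - ?m x nu / sqrt T - f' (F n nu) * (Z n x nu * ?M x nu) / sqrt T\<bar>)"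
      by (rule integral_abs_bound)
    also have "... \<le> (LINT nu|Q. 2 * K2 / T * (Z n x nu + Z n x nu * (?M x nu)\<^sup>2))"
      using ig im iM iZ Z_diff_square(1)[of n x] pt by (intro integral_mono) auto
    also have "... = 2 * K2 / T * (z n x + (LINT nu|Q. Z n x nu * (?M x nu)\<^sup>2))"
      using iZ Z_diff_square(1)[of n x] by (simp add: z_def)
    also have "... \<le> 2 * K2 / T * (z n x + \<kappa> * z n x)"
      using K2n T_pos Z_diff_square(2) by (intro mult_left_mono add_left_mono) auto
    finally have 1: "\<bar>(LINT nu|Q. ?g x nu) - (LINT nu|Q. ?m x nu) / sqrt T - (LINT nu|Q. f' (F n nu) * (Z n x nu * ?M x nu)) / sqrt T\<bar>
      \<le> 2 * K2 / T * (z n x + \<kappa> * z n x)" .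
    have "\<bar>LINT nu|Q. f' (F n nu) * (Z n x nu * ?M x nu)\<bar> / sqrt T \<le> (K2 / sqrt T * (1 + 2 * \<kappa>) * \<kappa> * z n x) / sqrt T"
      using sT by (intro divide_right_mono cross_term[OF K1 K2]) auto
    also have "... = K2 * ((1 + 2 * \<kappa>) * \<kappa>) / T * z n x"
      using sT by (simp add: field_simps)
    finally have 2: "\<bar>(LINT nu|Q. f' (F n nu) * (Z n x nu * ?M x nu)) / sqrt T\<bar> \<le> K2 * ((1 + 2 * \<kappa>) * \<kappa>) / T * z n x"
      using sT by (simp add: abs_divide)
    have "\<bar>a - b\<bar> \<le> e1 + e2" if "\<bar>a - b - c\<bar> \<le> e1" "\<bar>c\<bar> \<le> e2" for a b c e1 e2 :: real
      using that by linarith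
    from this[OF 1 2] show ?thesis by (simp add: algebra_simps add_divide_distrib)
  qed
  have "(LINT nu|Q. f (F n nu) * compensated (Z n) nu) = (LINT x|\<Lambda>. LINT nu|Q. ?g x nu)"
    by (rule compensated_covariance[OF box gk causal_Z])
  then have L: "(LINT nu|Q. F n nu * f (F n nu)) = (LINT x|\<Lambda>. LINT nu|Q. ?g x nu) / sqrt T"
    by (simp add: F_def mult.commute)
  have R: "(LINT x|\<Lambda>. LINT nu|Q. ?m x nu) = (LINT nu|Q. f' (F n nu) * total n nu)"
    using \<Lambda>Q.Fubini_integral[OF Im] by (simp add: total_def mult.commute)
  have ig': "integrable \<Lambda> (\<lambda>x. LINT nu|Q. ?g x nu)" and im': "integrable \<Lambda> (\<lambda>x. LINT nu|Q. ?m x nu)"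
    and iz: "integrable \<Lambda> (z n)"
    using \<Lambda>Q.integrable_fst[OF Ig] \<Lambda>Q.integrable_fst[OF Im] \<Lambda>Q.integrable_fst[OF IZ]
    by (simp_all add: z_def[abs_def])
  have zV: "(LINT x|\<Lambda>. z n x) \<le> rate * T"
  proof -
    have "ennreal (LINT x|\<Lambda>. z n x) = (\<integral>\<^sup>+x. ennreal (z n x) \<partial>\<Lambda>)"
      using iz z_nonneg by (intro nn_integral_eq_integral[symmetric]) auto
    also have "... = V n" by (simp add: V_def ennreal_z)
    also have "... \<le> ennreal (rate * T)" by (rule V_bound)
    finally show ?thesis using rate_nonneg T_pos by (subst (asm) ennreal_le_iff) auto
  qed
  have c: "0 \<le> ?c" using K2n \<kappa>_nonneg T_pos by simp
  have "\<bar>(LINT x|\<Lambda>. LINT nu|Q. ?g x nu) - (LINT x|\<Lambda>. LINT nu|Q. ?m x nu) / sqrt T\<bar>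
    = \<bar>LINT x|\<Lambda>. (LINT nu|Q. ?g x nu) - (LINT nu|Q. ?m x nu) / sqrt T\<bar>"
    using ig' im' by simp
  also have "... \<le> (LINT x|\<Lambda>. \<bar>(LINT nu|Q. ?g x nu) - (LINT nu|Q. ?m x nu) / sqrt T\<bar>)"
    by (rule integral_abs_bound)
  also have "... \<le> (LINT x|\<Lambda>. ?c * z n x)"
    using ig' im' iz pointwise by (intro integral_mono) auto
  also have "... = ?c * (LINT x|\<Lambda>. z n x)" by simp
  also have "... \<le> ?c * (rate * T)" by (intro mult_left_mono zV c)
  also have "... = K2 * stein_const" using T_pos by (simp add: stein_const_def)
  finally have "\<bar>(LINT x|\<Lambda>. LINT nu|Q. ?g x nu) - (LINT x|\<Lambda>. LINT nu|Q. ?m x nu) / sqrt T\<bar> / sqrt T \<le> K2 * stein_const / sqrt T"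
    using sT by (intro divide_right_mono) auto
  moreover have "\<bar>(LINT x|\<Lambda>. LINT nu|Q. ?g x nu) - (LINT x|\<Lambda>. LINT nu|Q. ?m x nu) / sqrt T\<bar> / sqrt T
    = \<bar>(LINT x|\<Lambda>. LINT nu|Q. ?g x nu) / sqrt T - (LINT x|\<Lambda>. LINT nu|Q. ?m x nu) / T\<bar>"
  proof -
    have "\<bar>a - b / sqrt T\<bar> / sqrt T = \<bar>a / sqrt T - b / T\<bar>" for a b
    proof -
      have "a / sqrt T - b / T = (a - b / sqrt T) / sqrt T" using sT by (simp add: diff_divide_distrib)
      then show ?thesis using sT by (simp add: abs_divide)
    qed
    then show ?thesis .
  qed
  ultimately show ?thesis by (simp add: L R)
qed

text \<open>After integration by parts there remains the distance of \<open>total n nu / T\<close>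
  from \<open>v\<close>. It splits into the error of the mean and the fluctuation around the mean,
  which is at most the square root of the variance.\<close>

theorem stein_bound:
  fixes f f' u :: "real \<Rightarrow> real"
  assumes f: "\<And>x. (f has_real_derivative f' x) (at x)" and K0: "\<And>x. \<bar>f x\<bar> \<le> K0"
    and K1: "\<And>x. \<bar>f' x\<bar> \<le> K1" and K2: "\<And>x y. \<bar>f' x - f' y\<bar> \<le> K2 * \<bar>x - y\<bar>"
    and stein: "\<And>x. v * f' x - x * f x = u x - e"
  shows "\<bar>(LINT nu|Q. u (F n nu)) - e\<bar>
    \<le> K1 * (\<bar>v * T - (LINT nu|Q. total n nu)\<bar> / T) + (K1 * sqrt var_const + K2 * stein_const) / sqrt T"
proof -
  have fc: "f \<in> borel_measurable borel"
    using f by (intro borel_measurable_continuous_onI) (auto intro: DERIV_continuous_on DERIV_subset)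
  have f'c: "f' \<in> borel_measurable borel" by (rule borel_measurable_abs_lipschitz[OF K2])
  note [measurable] = fc f'c
  have K0n: "0 \<le> K0" and K1n: "0 \<le> K1" using K0[of 0] K1[of 0] by auto
  have iR: "integrable Q (\<lambda>nu. F n nu * f (F n nu))"
    using growth_integrable[OF box growth_bounded_mult[OF growth_cmult[OF growth_Z, of "1 / sqrt T" n], of "\<lambda>nu. f (F n nu)" K0]]
      K0 K0n by (simp add: F_def)
  have i': "integrable Q (\<lambda>nu. f' (F n nu))"
    using K1 by (intro Q.integrable_const_bound[of _ K1]) auto
  have it: "integrable Q (total n)" by (rule bfun_integrable[OF bfun_total])
  have b': "bfun K1 (\<lambda>nu. f' (F n nu))" using K1 by (simp add: bfun_def)
  have i't: "integrable Q (\<lambda>nu. f' (F n nu) * total n nu)"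
    by (rule bfun_integrable[OF bfun_mult[OF b' bfun_total]])
  let ?m = "LINT nu|Q. total n nu"
  have "(LINT nu|Q. u (F n nu)) = (LINT nu|Q. v * f' (F n nu) - F n nu * f (F n nu) + e)"
    using stein by (intro Bochner_Integration.integral_cong) auto
  also have "... = v * (LINT nu|Q. f' (F n nu)) - (LINT nu|Q. F n nu * f (F n nu)) + e"
    using iR i' by simp
  finally have 1: "(LINT nu|Q. u (F n nu)) - e = v * (LINT nu|Q. f' (F n nu)) - (LINT nu|Q. F n nu * f (F n nu))" by simp
  have ia: "integrable Q (\<lambda>nu. \<bar>v - total n nu / T\<bar>)" using it by simp
  have 2: "\<bar>v * (LINT nu|Q. f' (F n nu)) - (LINT nu|Q. f' (F n nu) * total n nu) / T\<bar> \<le> K1 * (LINT nu|Q. \<bar>v - total n nu / T\<bar>)"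
  proof -
    have eq: "v * (LINT nu|Q. f' (F n nu)) - (LINT nu|Q. f' (F n nu) * total n nu) / T
      = (LINT nu|Q. f' (F n nu) * (v - total n nu / T))"
      using i' i't by (simp add: right_diff_distrib mult.commute)
    have "\<bar>LINT nu|Q. f' (F n nu) * (v - total n nu / T)\<bar> \<le> (LINT nu|Q. \<bar>f' (F n nu) * (v - total n nu / T)\<bar>)" by (rule integral_abs_bound)
    also have "... \<le> (LINT nu|Q. K1 * \<bar>v - total n nu / T\<bar>)"
    proof (rule integral_mono)
      show "integrable Q (\<lambda>nu. \<bar>f' (F n nu) * (v - total n nu / T)\<bar>)"
        using i' i't by (intro integrable_abs) (simp add: right_diff_distrib mult.commute)
      show "integrable Q (\<lambda>nu. K1 * \<bar>v - total n nu / T\<bar>)" using ia by simp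
      show "\<bar>f' (F n nu) * (v - total n nu / T)\<bar> \<le> K1 * \<bar>v - total n nu / T\<bar>" for nu
        using K1 by (simp add: abs_mult mult_right_mono)
    qed
    finally show ?thesis unfolding eq by simp
  qed
  have var: "(LINT nu|Q. \<bar>total n nu - ?m\<bar>) \<le> sqrt (var_const * T)"
  proof -
    have sq: "integrable Q (\<lambda>nu. (total n nu - ?m)\<^sup>2)"
      using it bfun_square_integrable[OF bfun_total[of n]] by (simp add: power2_diff)
    \<comment> \<open>The Cauchy-Schwarz inequality, obtained as nonnegativity of the variance of
      the absolute deviation.\<close>
    have "(LINT nu|Q. \<bar>total n nu - ?m\<bar>)\<^sup>2 \<le> (LINT nu|Q. \<bar>total n nu - ?m\<bar>\<^sup>2)"
    proof -
      have "0 \<le> Q.variance (\<lambda>nu. \<bar>total n nu - ?m\<bar>)" by (rule Q.variance_positive)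
      also have "Q.variance (\<lambda>nu. \<bar>total n nu - ?m\<bar>)
        = (LINT nu|Q. \<bar>total n nu - ?m\<bar>\<^sup>2) - (LINT nu|Q. \<bar>total n nu - ?m\<bar>)\<^sup>2"
        using it sq by (intro Q.variance_eq) auto
      finally show ?thesis by simp
    qed
    also have "(LINT nu|Q. \<bar>total n nu - ?m\<bar>\<^sup>2) = (LINT nu|Q. (total n nu)\<^sup>2) - ?m\<^sup>2"
      using Q.variance_eq[OF it bfun_square_integrable[OF bfun_total]] by simp
    also have "... \<le> var_const * T" by (rule total_variance)
    finally show ?thesis by (rule real_le_rsqrt)
  qed
  have 3: "(LINT nu|Q. \<bar>v - total n nu / T\<bar>) \<le> \<bar>v * T - ?m\<bar> / T + sqrt var_const / sqrt T"
  proof -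
    have pt: "\<bar>v - total n nu / T\<bar> \<le> \<bar>v * T - ?m\<bar> / T + \<bar>total n nu - ?m\<bar> / T" for nu
    proof -
      have "v - total n nu / T = ((v * T - ?m) - (total n nu - ?m)) / T" using T_pos by (simp add: field_simps)
      then have "\<bar>v - total n nu / T\<bar> = \<bar>(v * T - ?m) - (total n nu - ?m)\<bar> / T" using T_pos by simp
      also have "... \<le> (\<bar>v * T - ?m\<bar> + \<bar>total n nu - ?m\<bar>) / T" using T_pos by (intro divide_right_mono) auto
      finally show ?thesis by (simp add: add_divide_distrib)
    qed
    have "(LINT nu|Q. \<bar>v - total n nu / T\<bar>) \<le> (LINT nu|Q. \<bar>v * T - ?m\<bar> / T + \<bar>total n nu - ?m\<bar> / T)"
      using it pt by (intro integral_mono) auto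
    also have "... = \<bar>v * T - ?m\<bar> / T + (LINT nu|Q. \<bar>total n nu - ?m\<bar>) / T"
      using it by simp
    also have "(LINT nu|Q. \<bar>total n nu - ?m\<bar>) / T \<le> sqrt (var_const * T) / T"
      using var T_pos by (intro divide_right_mono) auto
    also have "sqrt (var_const * T) / T = sqrt var_const / sqrt T"
      using T_pos by (simp add: real_sqrt_mult real_div_sqrt divide_divide_eq_left[symmetric] field_simps)
    finally show ?thesis by simp
  qed
  have "\<bar>(LINT nu|Q. u (F n nu)) - e\<bar> \<le> K1 * (LINT nu|Q. \<bar>v - total n nu / T\<bar>) + K2 * stein_const / sqrt T"
    unfolding 1 using 2 integration_by_parts[OF f K0 K1 K2, of n] by linarith
  also have "K1 * (LINT nu|Q. \<bar>v - total n nu / T\<bar>) \<le> K1 * (\<bar>v * T - ?m\<bar> / T + sqrt var_const / sqrt T)"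
    by (intro mult_left_mono 3 K1n)
  finally show ?thesis by (simp add: distrib_left add_divide_distrib)
qed

end

section \<open>Stein's equation for the normal law\<close>

locale normal_weight =
  fixes v :: real
  assumes v_pos: "0 < v"
begin

definition p :: "real \<Rightarrow> real" where "p = normal_density 0 (sqrt v)"

lemma p_eq: "p x = exp (- (x\<^sup>2 / (2 * v))) / sqrt (2 * pi * v)"
  using v_pos by (simp add: p_def normal_density_def)

lemma p_pos: "0 < p x"
  using v_pos by (simp add: p_eq)

lemma p_nonneg: "0 \<le> p x"
  using p_pos[of x] by simp

lemma p_measurable [measurable]: "p \<in> borel_measurable borel"
  unfolding p_def by measurable

lemma p_even: "p (- x) = p x"
  by (simp add: p_eq)

lemma p_deriv: "(p has_real_derivative - (x / v) * p x) (at x)"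
proof -
  have "((\<lambda>x. exp (- (x\<^sup>2 / (2 * v))) / k) has_real_derivative
     exp (- (x\<^sup>2 / (2 * v))) * (- (2 * x / (2 * v))) / k) (at x)" if "k \<noteq> 0" for k
    using v_pos that by (auto intro!: derivative_eq_intros simp: field_simps power2_eq_square)
  from this[of "sqrt (2 * pi * v)"] v_pos
  have "((\<lambda>x. exp (- (x\<^sup>2 / (2 * v))) / sqrt (2 * pi * v)) has_real_derivative
     exp (- (x\<^sup>2 / (2 * v))) * (- (2 * x / (2 * v))) / sqrt (2 * pi * v)) (at x)" by simp
  then show ?thesis by (simp add: p_eq[abs_def] mult.commute)
qed

lemma p_continuous: "continuous_on S p"
  using p_deriv by (intro continuous_at_imp_continuous_on) (blast intro: DERIV_isCont)

lemma p_integrable: "integrable lborel p" "(LINT x|lborel. p x) = 1"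
  using v_pos by (simp_all add: p_def)

lemma p_abs_integrable: "integrable lborel (\<lambda>x. \<bar>x\<bar> * p x)"
  using integrable_normal_moment_abs[of "sqrt v" 0 1] v_pos by (simp add: p_def mult.commute)

lemma p_decay: "((\<lambda>y. (y + d) * p y) \<longlongrightarrow> 0) at_top"
proof -
  let ?K = "2 * v / sqrt (2 * pi * v)"
  have K: "0 \<le> ?K" using v_pos by simp
  have le: "p y \<le> ?K / y\<^sup>2" if "0 < y" for y
  proof -
    \<comment> \<open>The elementary bound of the exponential by its argument already gives
      quadratic decay of the density, enough to beat a linear factor.\<close>
    have "y\<^sup>2 / (2 * v) \<le> exp (y\<^sup>2 / (2 * v))"
      using exp_ge_add_one_self[of "y\<^sup>2 / (2 * v)"] by linarith
    then have "exp (- (y\<^sup>2 / (2 * v))) \<le> 2 * v / y\<^sup>2"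
      using that v_pos by (simp add: exp_minus field_simps)
    then have "p y \<le> (2 * v / y\<^sup>2) / sqrt (2 * pi * v)"
      unfolding p_eq using v_pos by (intro divide_right_mono) auto
    then show ?thesis by (simp add: field_simps)
  qed
  have "((\<lambda>y::real. ?K / y + \<bar>d\<bar> * (?K / y\<^sup>2)) \<longlongrightarrow> 0 + \<bar>d\<bar> * 0) at_top"
    by (intro tendsto_intros tendsto_divide_0[OF tendsto_const] filterlim_at_top_imp_at_infinity
        filterlim_ident filterlim_pow_at_top) auto
  then have lim: "((\<lambda>y::real. ?K / y + \<bar>d\<bar> * (?K / y\<^sup>2)) \<longlongrightarrow> 0) at_top" by simp
  show ?thesis
  proof (rule Lim_null_comparison[OF _ lim])
    show "\<forall>\<^sub>F y in at_top. norm ((y + d) * p y) \<le> ?K / y + \<bar>d\<bar> * (?K / y\<^sup>2)"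
      using eventually_gt_at_top[of 0]
    proof eventually_elim
      case (elim y)
      have "norm ((y + d) * p y) \<le> (y + \<bar>d\<bar>) * (?K / y\<^sup>2)"
        using elim le[OF elim] p_nonneg[of y] unfolding real_norm_def abs_mult
        by (intro mult_mono) auto
      also have "... = ?K / y + \<bar>d\<bar> * (?K / y\<^sup>2)"
      proof -
        have "(y + D) * (k / y\<^sup>2) = k / y + D * (k / y\<^sup>2)" for D k
          using elim by (simp add: field_simps power2_eq_square)
        then show ?thesis .
      qed
      finally show ?case .
    qed
  qed
qed

section \<open>Gaussian tail integrals\<close>

definition tail :: "(real \<Rightarrow> real) \<Rightarrow> real \<Rightarrow> real" where
  "tail g x = (LINT y|lborel. indicator {x..} y * g y)"

lemma ennreal_indicator_mult: "ennreal (indicator A y * r) = ennreal r * indicator A y"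
  by (simp split: split_indicator)

lemma tail_integrable:
  fixes g :: "real \<Rightarrow> real"
  shows "integrable lborel g \<Longrightarrow> integrable lborel (\<lambda>y. indicator {x..} y * g y)"
  using integrable_mult_indicator[of "{x..}" lborel g] by simp

lemma tail_mono:
  assumes "integrable lborel f" "integrable lborel g" "\<And>y. x \<le> y \<Longrightarrow> f y \<le> g y"
  shows "tail f x \<le> tail g x"
  unfolding tail_def using assms
  by (intro integral_mono tail_integrable) (auto split: split_indicator)

lemma tail_abs: "integrable lborel g \<Longrightarrow> \<bar>tail g x\<bar> \<le> tail (\<lambda>y. \<bar>g y\<bar>) x"
  unfolding tail_def by (rule order_trans[OF integral_abs_bound]) (simp add: abs_mult)

lemma tail_linear:
  "integrable lborel f \<Longrightarrow> integrable lborel g \<Longrightarrow> tail (\<lambda>y. a * f y + b * g y) x = a * tail f x + b * tail g x"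
proof -
  assume i: "integrable lborel f" "integrable lborel g"
  have "tail (\<lambda>y. a * f y + b * g y) x = (LINT y|lborel. a * (indicator {x..} y * f y) + b * (indicator {x..} y * g y))"
    unfolding tail_def by (intro Bochner_Integration.integral_cong) (auto simp: algebra_simps)
  also have "... = a * tail f x + b * tail g x"
    unfolding tail_def using tail_integrable[OF i(1)] tail_integrable[OF i(2)] by simp
  finally show ?thesis .
qed

lemma y_p_integrable: "integrable lborel (\<lambda>y. y * p y)"
  by (rule Bochner_Integration.integrable_bound[OF p_abs_integrable]) (auto simp: abs_mult p_nonneg)

text \<open>The density satisfies v * p' y = - y * p y, so - v * p is a primitive of the
  integrand.\<close>

lemma tail_y_p: "0 \<le> x \<Longrightarrow> tail (\<lambda>y. y * p y) x = v * p x"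
proof -
  assume x: "0 \<le> x"
  have "(\<integral>\<^sup>+y. ennreal (y * p y) * indicator {x..} y \<partial>lborel) = 0 - (- v * p x)"
  proof (rule nn_integral_FTC_atLeast[where F="\<lambda>y. - v * p y"])
    show "((\<lambda>y. - v * p y) has_real_derivative y * p y) (at y)" for y
      using v_pos by (auto intro!: derivative_eq_intros p_deriv)
    show "0 \<le> y * p y" if "x \<le> y" for y using that x p_nonneg by simp
    have "((\<lambda>y. (y + 1) * p y - (y + 0) * p y) \<longlongrightarrow> 0 - 0) at_top" by (intro tendsto_diff p_decay)
    then have "((\<lambda>y. - v * p y) \<longlongrightarrow> - v * 0) at_top" by (intro tendsto_intros) (simp add: algebra_simps)
    then show "((\<lambda>y. - v * p y) \<longlongrightarrow> 0) at_top" by simp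
  qed measurable
  then have "(\<integral>\<^sup>+y. ennreal (indicator {x..} y * (y * p y)) \<partial>lborel) = ennreal (v * p x)"
    by (simp add: ennreal_indicator_mult)
  moreover have "(\<integral>\<^sup>+y. ennreal (indicator {x..} y * (y * p y)) \<partial>lborel) = ennreal (tail (\<lambda>y. y * p y) x)"
    unfolding tail_def using tail_integrable[OF y_p_integrable] x p_nonneg
    by (intro nn_integral_eq_integral) (auto split: split_indicator)
  moreover have "0 \<le> tail (\<lambda>y. y * p y) x"
    unfolding tail_def using x p_nonneg by (intro integral_nonneg_AE) (auto split: split_indicator)
  moreover have "0 \<le> v * p x" using v_pos p_nonneg[of x] by simp
  ultimately show ?thesis by (simp add: ennreal_inj)
qed

text \<open>For 0 \<le> x \<le> y the square of y dominates the sum of the squares of x and y - x.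
  Hence \<open>p y\<close> is at most \<open>p x * p (y - x) / p 0\<close>, and the shifted density
  has total mass 1.\<close>

lemma tail_p: "0 \<le> x \<Longrightarrow> tail p x \<le> p x / p 0"
proof -
  assume x: "0 \<le> x"
  have le: "p y \<le> p x / p 0 * p (y - x)" if "x \<le> y" for y
  proof -
    have "0 \<le> x * (y - x)" using x that by simp
    then have "x\<^sup>2 + (y - x)\<^sup>2 \<le> y\<^sup>2" by (simp add: power2_eq_square algebra_simps)
    then have "- (y\<^sup>2 / (2 * v)) \<le> - (x\<^sup>2 / (2 * v)) + - ((y - x)\<^sup>2 / (2 * v))"
      using v_pos divide_right_mono[of "x\<^sup>2 + (y - x)\<^sup>2" "y\<^sup>2" "2 * v"]
      by (simp add: add_divide_distrib)
    then have "exp (- (y\<^sup>2 / (2 * v))) \<le> exp (- (x\<^sup>2 / (2 * v))) * exp (- ((y - x)\<^sup>2 / (2 * v)))"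
      unfolding exp_add[symmetric] by simp
    then show ?thesis using v_pos by (simp add: p_eq divide_right_mono)
  qed
  have shift: "integrable lborel (\<lambda>y. p (y - x))" "(LINT y|lborel. p (y - x)) = 1"
    using lborel_integrable_real_affine[OF p_integrable(1), of 1 "- x"]
      lborel_integral_real_affine[of 1 p "- x"] p_integrable(2) by simp_all
  have "tail p x \<le> tail (\<lambda>y. p x / p 0 * p (y - x)) x"
    using le shift(1) p_integrable(1) by (intro tail_mono) auto
  also have "... \<le> (LINT y|lborel. p x / p 0 * p (y - x))"
    unfolding tail_def using shift(1) p_nonneg
    by (intro integral_mono tail_integrable) (auto split: split_indicator)
  also have "... = p x / p 0" using shift(2) by simp
  finally show ?thesis .
qed

lemma tail_gap: "0 < x \<Longrightarrow> tail (\<lambda>y. (y - x) * p y) x \<le> v\<^sup>2 / x\<^sup>2 * p x"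
proof -
  assume x: "0 < x"
  \<comment> \<open>Replacing y - x by (y - x) * y / x and adding the nonnegative correction (v * y
    / x - v) / x gives an integrand with the primitive \<open>?G\<close>. Its value at
    \<open>x\<close> is minus the claimed bound.\<close>
  let ?G = "\<lambda>y. - (v / x) * ((y + (v / x - x)) * p y)"
  let ?g = "\<lambda>y. (1 / x) * ((y - x) * y + (v * y / x - v)) * p y"
  have g0: "(y - x) * p y \<le> ?g y" if "x \<le> y" for y
  proof (rule mult_right_mono[OF _ p_nonneg])
    have "(y - x) * x \<le> (y - x) * y" using that by (intro mult_left_mono) auto
    moreover have "v * x \<le> v * y" using that v_pos by simp
    ultimately show "y - x \<le> (1 / x) * ((y - x) * y + (v * y / x - v))"
      using x by (simp add: field_simps)
        (smt (verit, best) mult_left_mono mult_nonneg_nonneg distrib_left mult.commute)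
  qed
  have "(\<integral>\<^sup>+y. ennreal (?g y) * indicator {x..} y \<partial>lborel) = 0 - ?G x"
  proof (rule nn_integral_FTC_atLeast[where F="?G"])
    show "(?G has_real_derivative ?g y) (at y)" for y
      using v_pos x by (auto intro!: derivative_eq_intros p_deriv simp: field_simps)
    show "0 \<le> ?g y" if "x \<le> y" for y
      using g0[OF that] that p_nonneg[of y] by (meson diff_ge_0_iff_ge mult_nonneg_nonneg order_trans)
    have "(?G \<longlongrightarrow> - (v / x) * 0) at_top" by (intro tendsto_mult tendsto_const p_decay)
    then show "(?G \<longlongrightarrow> 0) at_top" by simp
  qed measurable
  also have "0 - ?G x = v\<^sup>2 / x\<^sup>2 * p x" using x by (simp add: field_simps power2_eq_square)
  finally have I: "(\<integral>\<^sup>+y. ennreal (?g y) * indicator {x..} y \<partial>lborel) = ennreal (v\<^sup>2 / x\<^sup>2 * p x)" .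
  have int: "integrable lborel (\<lambda>y. (y - x) * p y)"
    using y_p_integrable p_integrable(1) by (simp add: left_diff_distrib)
  have "ennreal (tail (\<lambda>y. (y - x) * p y) x) = (\<integral>\<^sup>+y. ennreal (indicator {x..} y * ((y - x) * p y)) \<partial>lborel)"
    unfolding tail_def using tail_integrable[OF int] p_nonneg
    by (intro nn_integral_eq_integral[symmetric]) (auto split: split_indicator)
  also have "... \<le> (\<integral>\<^sup>+y. ennreal (?g y) * indicator {x..} y \<partial>lborel)"
    using g0 by (intro nn_integral_mono) (auto intro!: ennreal_leI split: split_indicator)
  finally show ?thesis unfolding I using p_nonneg[of x] by (subst (asm) ennreal_le_iff) auto
qed

text \<open>Complements \<open>tail_gap\<close>, whose bound degenerates as x approaches 0.\<close>

lemma tail_gap_small: "0 \<le> x \<Longrightarrow> tail (\<lambda>y. (y - x) * p y) x \<le> v * p x"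
proof -
  assume x: "0 \<le> x"
  have "tail (\<lambda>y. (y - x) * p y) x \<le> tail (\<lambda>y. y * p y) x"
    using x y_p_integrable p_integrable(1) p_nonneg
    by (intro tail_mono) (auto simp: left_diff_distrib mult_nonneg_nonneg)
  then show ?thesis using tail_y_p[OF x] by simp
qed

text \<open>
  For centred \<open>w\<close> this solves \<open>v * f' x - x * f x = w x\<close>. The formula is bounded well only for
  \<open>x \<ge> 0\<close>; negative arguments are reached by reflection.
\<close>

definition sol :: "(real \<Rightarrow> real) \<Rightarrow> real \<Rightarrow> real" where
  "sol w x = - tail (\<lambda>y. w y * p y) x / (v * p x)"

lemma weighted_integrable:
  assumes [measurable]: "w \<in> borel_measurable borel" and "\<And>y. \<bar>w y\<bar> \<le> \<bar>y\<bar> + c"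
  shows "integrable lborel (\<lambda>y. w y * p y)"
proof (rule Bochner_Integration.integrable_bound)
  show "integrable lborel (\<lambda>y. \<bar>y\<bar> * p y + c * p y)"
    using p_abs_integrable p_integrable(1) by simp
  show "AE y in lborel. norm (w y * p y) \<le> norm (\<bar>y\<bar> * p y + c * p y)"
  proof (intro AE_I2)
    fix y
    have "\<bar>w y\<bar> * p y \<le> (\<bar>y\<bar> + c) * p y" using assms p_nonneg by (intro mult_right_mono) auto
    also have "... \<le> \<bar>(\<bar>y\<bar> + c) * p y\<bar>" by simp
    finally show "norm (w y * p y) \<le> norm (\<bar>y\<bar> * p y + c * p y)"
      by (simp add: abs_mult p_nonneg distrib_right)
  qed
qed measurable

text \<open>The expression w x + x * sol w x is v times the derivative of the solution, and its two
  summands may each grow with x. Written as one tail integral, with v * p x expressed as the tail of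
  y * p y, they cancel up to a factor y - x, whose tail is small. The bound weighted by x is needed
  later for the derivative of x * f x.\<close>

lemma sol_bounds:
  assumes w: "\<And>x y. \<bar>w x - w y\<bar> \<le> 1 * \<bar>x - y\<bar>" "\<And>y. \<bar>w y\<bar> \<le> \<bar>y\<bar> + c" and c: "0 \<le> c" and x: "0 \<le> x"
  shows "\<bar>sol w x\<bar> \<le> 1 + c / (v * p 0)"
    "\<bar>w x + x * sol w x\<bar> \<le> (2 + c) * (1 + v)" "x * \<bar>w x + x * sol w x\<bar> \<le> (2 + c) * (1 + v)"
proof -
  have wm [measurable]: "w \<in> borel_measurable borel" by (rule borel_measurable_abs_lipschitz[OF w(1)])
  note wi = weighted_integrable[OF wm w(2)]
  have vp: "0 < v * p x" using v_pos p_pos by simp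
  have "\<bar>tail (\<lambda>y. w y * p y) x\<bar> \<le> tail (\<lambda>y. \<bar>w y * p y\<bar>) x" by (rule tail_abs[OF wi])
  also have "... \<le> tail (\<lambda>y. 1 * (y * p y) + c * p y) x"
  proof (rule tail_mono)
    show "integrable lborel (\<lambda>y. \<bar>w y * p y\<bar>)" using wi by simp
    show "integrable lborel (\<lambda>y. 1 * (y * p y) + c * p y)" using y_p_integrable p_integrable(1) by simp
    fix y assume "x \<le> y"
    then have "\<bar>w y\<bar> \<le> y + c" using w(2)[of y] x by simp
    then have "\<bar>w y\<bar> * p y \<le> (y + c) * p y" using p_nonneg by (intro mult_right_mono)
    then show "\<bar>w y * p y\<bar> \<le> 1 * (y * p y) + c * p y" by (simp add: abs_mult p_nonneg distrib_right)
  qed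
  also have "... = v * p x + c * tail p x"
    using tail_linear[OF y_p_integrable p_integrable(1), of 1 c x] tail_y_p[OF x] by simp
  also have "... \<le> v * p x + c * (p x / p 0)"
    using c tail_p[OF x] by (intro add_left_mono mult_left_mono)
  finally have "\<bar>tail (\<lambda>y. w y * p y) x\<bar> / (v * p x) \<le> (v * p x + c * (p x / p 0)) / (v * p x)"
    using vp by (intro divide_right_mono) auto
  also have "... = 1 + c / (v * p 0)"
    using v_pos p_pos[of x] p_pos[of 0] by (simp add: field_simps)
  finally show "\<bar>sol w x\<bar> \<le> 1 + c / (v * p 0)"
    using vp by (simp add: sol_def abs_divide)
  have int: "integrable lborel (\<lambda>y. (w x * y - x * w y) * p y)"
    using wi y_p_integrable by (simp add: left_diff_distrib mult.assoc)
  have gi: "integrable lborel (\<lambda>y. (y - x) * p y)"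
    using y_p_integrable p_integrable(1) by (simp add: left_diff_distrib)
  have "tail (\<lambda>y. (w x * y - x * w y) * p y) x = tail (\<lambda>y. w x * (y * p y) + (- x) * (w y * p y)) x"
    by (rule arg_cong[where f="\<lambda>g. tail g x"]) (auto simp: algebra_simps)
  also have "... = w x * (v * p x) - x * tail (\<lambda>y. w y * p y) x"
    unfolding tail_linear[OF y_p_integrable wi] tail_y_p[OF x] by simp
  finally have t: "tail (\<lambda>y. (w x * y - x * w y) * p y) x = w x * (v * p x) - x * tail (\<lambda>y. w y * p y) x" .
  have key: "w x + x * sol w x = tail (\<lambda>y. (w x * y - x * w y) * p y) x / (v * p x)"
  proof -
    have "w x + x * (- a / d) = (w x * d - x * a) / d" if "d \<noteq> 0" for a d
      using that by (simp add: field_simps)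
    from this[of "v * p x" "tail (\<lambda>y. w y * p y) x"] show ?thesis
      unfolding t sol_def using v_pos p_pos[of x] by simp
  qed
  have "\<bar>tail (\<lambda>y. (w x * y - x * w y) * p y) x\<bar> \<le> tail (\<lambda>y. \<bar>(w x * y - x * w y) * p y\<bar>) x"
    by (rule tail_abs[OF int])
  also have "... \<le> tail (\<lambda>y. (2 * x + c) * ((y - x) * p y) + 0 * p y) x"
  proof (rule tail_mono)
    show "integrable lborel (\<lambda>y. \<bar>(w x * y - x * w y) * p y\<bar>)" using int by simp
    show "integrable lborel (\<lambda>y. (2 * x + c) * ((y - x) * p y) + 0 * p y)" using gi by simp
    fix y assume y: "x \<le> y"
    have "w x * y - x * w y = w x * (y - x) + x * (w x - w y)" by (simp add: algebra_simps)
    also have "\<bar>...\<bar> \<le> \<bar>w x\<bar> * (y - x) + x * \<bar>w x - w y\<bar>"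
      using y x by (intro order_trans[OF abs_triangle_ineq]) (simp add: abs_mult)
    also have "... \<le> (x + c) * (y - x) + x * (y - x)"
      using w(2)[of x] w(1)[of x y] x y by (intro add_mono mult_right_mono mult_left_mono) auto
    also have "... = (2 * x + c) * (y - x)" by (simp add: algebra_simps)
    finally have "\<bar>w x * y - x * w y\<bar> * p y \<le> (2 * x + c) * (y - x) * p y"
      using p_nonneg by (intro mult_right_mono)
    then show "\<bar>(w x * y - x * w y) * p y\<bar> \<le> (2 * x + c) * ((y - x) * p y) + 0 * p y"
      by (simp add: abs_mult p_nonneg mult.assoc)
  qed
  also have "... = (2 * x + c) * tail (\<lambda>y. (y - x) * p y) x"
    unfolding tail_linear[OF gi p_integrable(1)] by simp
  finally have main: "\<bar>tail (\<lambda>y. (w x * y - x * w y) * p y) x\<bar> \<le> (2 * x + c) * tail (\<lambda>y. (y - x) * p y) x" .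
  have bound: "\<bar>w x + x * sol w x\<bar> \<le> (2 * x + c) * B" if "tail (\<lambda>y. (y - x) * p y) x \<le> B * (v * p x)" for B
  proof -
    have "\<bar>tail (\<lambda>y. (w x * y - x * w y) * p y) x\<bar> \<le> (2 * x + c) * (B * (v * p x))"
      using main mult_left_mono[OF that, of "2 * x + c"] x c by simp
    then have "\<bar>tail (\<lambda>y. (w x * y - x * w y) * p y) x\<bar> / (v * p x) \<le> (2 * x + c) * B"
      using vp by (simp add: pos_divide_le_eq mult.assoc)
    then show ?thesis unfolding key using vp by (simp add: abs_divide)
  qed
  \<comment> \<open>The weight \<open>max 1 x\<close> proves the plain and the weighted bound
    together. The tail estimate near 0 serves x \<le> 1, the decaying one serves larger x.\<close>
  have both: "\<bar>w x + x * sol w x\<bar> * max 1 x \<le> (2 + c) * (1 + v)"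
  proof (cases "x \<le> 1")
    case True
    have "\<bar>w x + x * sol w x\<bar> \<le> (2 * x + c) * 1" using tail_gap_small[OF x] by (intro bound) simp
    also have "... \<le> (2 + c) * 1" using True by simp
    also have "... \<le> (2 + c) * (1 + v)" using c v_pos by (intro mult_left_mono) auto
    finally show ?thesis using True by simp
  next
    case False
    then have x1: "1 \<le> x" "0 < x" by auto
    have "\<bar>w x + x * sol w x\<bar> \<le> (2 * x + c) * (v / x\<^sup>2)"
      using tail_gap[OF x1(2)] by (intro bound) (simp add: power2_eq_square)
    then have "\<bar>w x + x * sol w x\<bar> * x \<le> (2 * x + c) * (v / x\<^sup>2) * x" using x by (rule mult_right_mono)
    also have "... = (2 + c / x) * v" using x1 by (simp add: field_simps power2_eq_square)
    also have "... \<le> (2 + c) * (1 + v)"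
      using x1 c v_pos by (intro mult_mono) (auto simp: divide_le_eq mult_left_le intro: order_trans[OF _ mult_left_mono[of 1 x c]])
    finally show ?thesis using x1 by simp
  qed
  have "\<bar>w x + x * sol w x\<bar> * 1 \<le> \<bar>w x + x * sol w x\<bar> * max 1 x" by (intro mult_left_mono) auto
  then show "\<bar>w x + x * sol w x\<bar> \<le> (2 + c) * (1 + v)" using both by simp
  have "\<bar>w x + x * sol w x\<bar> * x \<le> \<bar>w x + x * sol w x\<bar> * max 1 x" by (intro mult_left_mono) auto
  then show "x * \<bar>w x + x * sol w x\<bar> \<le> (2 + c) * (1 + v)" using both by (simp add: mult.commute)
qed

lemma tail_deriv:
  assumes g: "continuous_on UNIV g" "integrable lborel g"
  shows "(tail g has_real_derivative - g x) (at x)"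
proof -
  \<comment> \<open>With a base point to the left of \<open>x\<close> the tail is a constant minus
    an integral over a compact interval, to which the fundamental theorem of calculus
    applies.\<close>
  let ?a = "x - 1" and ?b = "x + 1"
  have eq: "tail g y = tail g ?a - integral {?a..y} g" if "?a < y" for y
  proof -
    have si: "set_integrable lborel {?a..y} g" "set_integrable lborel {y..} g"
      using integrable_mult_indicator[of "{?a..y}" lborel g] integrable_mult_indicator[of "{y..}" lborel g] g(2)
      by (simp_all add: set_integrable_def)
    \<comment> \<open>The two half-open pieces are taken closed, so the point \<open>y\<close> is
      counted twice and subtracted once; it is a null set.\<close>
    have "tail g ?a = (LINT u|lborel. indicator {?a..y} u * g u + indicator {y..} u * g u - indicator {y} u * g u)"
      unfolding tail_def using that
      by (intro Bochner_Integration.integral_cong) (auto split: split_indicator)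
    also have "... = (LINT u:{?a..y}|lborel. g u) + tail g y - (LINT u:{y}|lborel. g u)"
      unfolding tail_def set_lebesgue_integral_def using si tail_integrable[OF g(2)]
        integrable_mult_indicator[OF _ g(2), of "{y}"] by (simp add: set_integrable_def)
    also have "(LINT u:{y}|lborel. g u) = 0"
      by (rule set_integral_null_delta[of _ _ _ "{}", THEN trans]) 
         (use g(2) in \<open>auto simp: set_lebesgue_integral_def\<close>)
    also have "(LINT u:{?a..y}|lborel. g u) = integral {?a..y} g"
      using si(1) by (rule set_borel_integral_eq_integral(2))
    finally show ?thesis by simp
  qed
  have "((\<lambda>y. integral {?a..y} g) has_real_derivative g x) (at x within {?a..?b})"
    using g(1) by (intro integral_has_real_derivative) (auto intro: continuous_on_subset)
  then have "((\<lambda>y. integral {?a..y} g) has_real_derivative g x) (at x)"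
    by (simp add: at_within_Icc_at)
  then have "((\<lambda>y. tail g ?a - integral {?a..y} g) has_real_derivative 0 - g x) (at x)"
    by (intro DERIV_diff DERIV_const)
  then have "((\<lambda>y. tail g ?a - integral {?a..y} g) has_real_derivative - g x) (at x)" by simp
  moreover have "\<forall>\<^sub>F y in nhds x. tail g y = tail g ?a - integral {?a..y} g"
    using eventually_nhds_in_open[of "{?a<..}" x] by (auto elim!: eventually_mono intro: eq)
  ultimately show ?thesis by (subst DERIV_cong_ev[OF refl _ refl])
qed

text \<open>Since \<open>w\<close> is centred, the integral over the lower tail is minus the
  integral over the upper one. The substitution y to -y turns it into an upper tail for the
  reflected function.\<close>

lemma sol_reflect:
  assumes wm [measurable]: "w \<in> borel_measurable borel" and w: "\<And>y. \<bar>w y\<bar> \<le> \<bar>y\<bar> + c"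
    and zero: "(LINT y|lborel. w y * p y) = 0"
  shows "sol (\<lambda>y. w (- y)) (- x) = - sol w x"
proof -
  note wi = weighted_integrable[OF wm w]
  have "tail (\<lambda>y. w (- y) * p y) (- x) = (LINT y|lborel. indicator {..x} y * (w y * p y))"
    unfolding tail_def
    using lborel_integral_real_affine[of "-1" "\<lambda>y. indicator {-x..} y * (w (- y) * p y)" 0]
    by (auto simp: p_even intro!: Bochner_Integration.integral_cong split: split_indicator)
  also have "... = (LINT y|lborel. w y * p y) - tail (\<lambda>y. w y * p y) x + (LINT y|lborel. indicator {x} y * (w y * p y))"
  proof -
    have i: "integrable lborel (\<lambda>y. indicator {x} y * (w y * p y))"
      using integrable_mult_indicator[OF _ wi, of "{x}"] by simp
    have "(LINT y|lborel. w y * p y) - tail (\<lambda>y. w y * p y) x + (LINT y|lborel. indicator {x} y * (w y * p y))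
      = (LINT y|lborel. w y * p y - indicator {x..} y * (w y * p y) + indicator {x} y * (w y * p y))"
      unfolding tail_def using wi tail_integrable[OF wi] i by simp
    also have "... = (LINT y|lborel. indicator {..x} y * (w y * p y))"
      by (intro Bochner_Integration.integral_cong) (auto split: split_indicator)
    finally show ?thesis by simp
  qed
  also have "(LINT y|lborel. indicator {x} y * (w y * p y)) = 0"
  proof -
    have "AE y in lborel. y \<noteq> x" by (rule AE_lborel_singleton)
    then have "AE y in lborel. indicator {x} y * (w y * p y) = 0" by eventually_elim simp
    then show ?thesis by (simp add: integral_eq_zero_AE)
  qed
  finally show ?thesis using zero by (simp add: sol_def p_even)
qed

text \<open>The constant depends on \<open>v\<close> alone. A centred function with Lipschitz
  constant 1 is bounded by \<bar>y\<bar> + c, where c is the absolute first moment, and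
  \<open>sol_bounds\<close> uses nothing else about it. A Lipschitz \<open>u\<close> gives no second
  derivative of \<open>f\<close>; instead v * f' x = w x + x * f x is Lipschitz because x * f x has
  the bounded derivative f x + x * f' x.\<close>

theorem stein_solution:
  "\<exists>K. \<forall>u. (\<forall>x y. \<bar>u x - u y\<bar> \<le> \<bar>x - y\<bar>) \<longrightarrow>
     (\<exists>f f'. (\<forall>x. (f has_real_derivative f' x) (at x)) \<and> (\<forall>x. \<bar>f x\<bar> \<le> K) \<and> (\<forall>x. \<bar>f' x\<bar> \<le> K) \<and>
        (\<forall>x y. \<bar>f' x - f' y\<bar> \<le> K * \<bar>x - y\<bar>) \<and>
        (\<forall>x. v * f' x - x * f x = u x - (LINT y|lborel. u y * p y)))"
proof -
  define c where "c = (LINT y|lborel. \<bar>y\<bar> * p y)"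
  have c: "0 \<le> c" unfolding c_def using p_nonneg by (intro integral_nonneg_AE) auto
  define A where "A = max (1 + c / (v * p 0)) ((2 + c) * (1 + v))"
  have A: "1 \<le> A" "1 + c / (v * p 0) \<le> A" "(2 + c) * (1 + v) \<le> A"
    using c v_pos p_pos[of 0] by (auto simp: A_def le_max_iff_disj)
  \<comment> \<open>The three entries bound \<open>f\<close>, its derivative, and the Lipschitz
    constant of the derivative.\<close>
  define K where "K = max A (max (A / v) ((1 + (A + A / v)) / v))"
  show ?thesis
  proof (intro exI[of _ K] allI impI)
    fix u :: "real \<Rightarrow> real" assume "\<forall>x y. \<bar>u x - u y\<bar> \<le> \<bar>x - y\<bar>"
    then have u: "\<And>x y. \<bar>u x - u y\<bar> \<le> 1 * \<bar>x - y\<bar>" by simp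
    have um [measurable]: "u \<in> borel_measurable borel" by (rule borel_measurable_abs_lipschitz[OF u])
    define e where "e = (LINT y|lborel. u y * p y)"
    define w where "w x = u x - e" for x
    have wm [measurable]: "w \<in> borel_measurable borel" unfolding w_def by measurable
    have wl: "\<And>x y. \<bar>w x - w y\<bar> \<le> 1 * \<bar>x - y\<bar>" using u by (simp add: w_def)
    have ui: "integrable lborel (\<lambda>y. u y * p y)"
    proof -
      have "\<bar>u y - u 0\<bar> \<le> \<bar>y\<bar> + 0" for y using u[of y 0] by simp
      then have "integrable lborel (\<lambda>y. (u y - u 0) * p y)" by (intro weighted_integrable) measurable
      moreover have "integrable lborel (\<lambda>y. u 0 * p y)" using p_integrable(1) by simp
      ultimately have "integrable lborel (\<lambda>y. (u y - u 0) * p y + u 0 * p y)" by (rule Bochner_Integration.integrable_add)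
      then show ?thesis by (simp add: left_diff_distrib)
    qed
    have wb: "\<bar>w y\<bar> \<le> \<bar>y\<bar> + c" for y
    proof -
      have "w y = (LINT s|lborel. (u y - u s) * p s)"
        using ui p_integrable by (simp add: w_def e_def left_diff_distrib)
      also have "\<bar>...\<bar> \<le> (LINT s|lborel. \<bar>(u y - u s) * p s\<bar>)" by (rule integral_abs_bound)
      also have "... \<le> (LINT s|lborel. \<bar>y\<bar> * p s + \<bar>s\<bar> * p s)"
      proof (rule integral_mono)
        show "integrable lborel (\<lambda>s. \<bar>(u y - u s) * p s\<bar>)"
          using ui p_integrable(1) by (intro integrable_abs) (simp add: left_diff_distrib)
        show "integrable lborel (\<lambda>s. \<bar>y\<bar> * p s + \<bar>s\<bar> * p s)" using p_integrable(1) p_abs_integrable by simp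
        fix s
        have "\<bar>u y - u s\<bar> * p s \<le> (\<bar>y\<bar> + \<bar>s\<bar>) * p s"
          using u[of y s] p_nonneg by (intro mult_right_mono) auto
        then show "\<bar>(u y - u s) * p s\<bar> \<le> \<bar>y\<bar> * p s + \<bar>s\<bar> * p s"
          by (simp add: abs_mult p_nonneg distrib_right)
      qed
      also have "... = \<bar>y\<bar> + c" using p_integrable p_abs_integrable by (simp add: c_def)
      finally show ?thesis .
    qed
    have w0: "(LINT y|lborel. w y * p y) = 0"
      using ui p_integrable by (simp add: w_def e_def left_diff_distrib)
    note wi = weighted_integrable[OF wm wb]
    have wc: "continuous_on UNIV w"
      using wl by (intro lipschitz_on_continuous_on[of 1] lipschitz_onI) (auto simp: dist_real_def)
    define f where "f = sol w"
    define f' where "f' x = (w x + x * f x) / v" for x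
    have deriv: "(f has_real_derivative f' x) (at x)" for x
    proof -
      have gc: "continuous_on UNIV (\<lambda>y. w y * p y)" by (intro continuous_intros wc p_continuous)
      have "((\<lambda>x. - tail (\<lambda>y. w y * p y) x / (v * p x)) has_real_derivative f' x) (at x)"
        by (rule derivative_eq_intros tail_deriv[OF gc wi] p_deriv refl)+
           (use v_pos p_pos[of x] in \<open>auto simp: f'_def f_def sol_def field_simps power2_eq_square\<close>)
      then show ?thesis by (simp add: f_def sol_def[abs_def])
    qed
    let ?w = "\<lambda>y. w (- y)"
    have wl': "\<bar>?w x - ?w y\<bar> \<le> 1 * \<bar>x - y\<bar>" for x y using wl[of "- x" "- y"] by simp
    have wb': "\<bar>?w y\<bar> \<le> \<bar>y\<bar> + c" for y using wb[of "- y"] by simp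
    have refl': "sol ?w (- x) = - f x" for x unfolding f_def by (rule sol_reflect[OF wm wb w0])
    have fb: "\<bar>f x\<bar> \<le> A" and gb: "\<bar>w x + x * f x\<bar> \<le> A" and xb: "\<bar>x\<bar> * \<bar>w x + x * f x\<bar> \<le> A" for x
    proof -
      have "\<bar>f x\<bar> \<le> A \<and> \<bar>w x + x * f x\<bar> \<le> A \<and> \<bar>x\<bar> * \<bar>w x + x * f x\<bar> \<le> A"
      proof (cases "0 \<le> x")
        case True
        then show ?thesis using sol_bounds[OF wl wb c True] A by (auto simp: f_def)
      next
        case False
        then have x: "0 \<le> - x" by simp
        show ?thesis using sol_bounds[OF wl' wb' c x] A False by (auto simp: refl')
      qed
      then show "\<bar>f x\<bar> \<le> A" "\<bar>w x + x * f x\<bar> \<le> A" "\<bar>x\<bar> * \<bar>w x + x * f x\<bar> \<le> A" by auto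
    qed
    have f'b: "\<bar>f' x\<bar> \<le> A / v" for x
      using gb[of x] v_pos by (simp add: f'_def abs_divide divide_right_mono)
    have f'l: "\<bar>f' x - f' y\<bar> \<le> (1 + (A + A / v)) / v * \<bar>x - y\<bar>" for x y
    proof -
      have "\<bar>x * f x - y * f y\<bar> \<le> (A + A / v) * \<bar>x - y\<bar>"
      proof -
        have d: "((\<lambda>x. x * f x) has_real_derivative (f z + z * f' z)) (at z within UNIV)" for z
          using deriv[of z] by (auto intro!: derivative_eq_intros)
        have "norm (f z + z * f' z) \<le> A + A / v" for z
        proof -
          have "\<bar>z * f' z\<bar> = \<bar>z\<bar> * \<bar>w z + z * f z\<bar> / v" using v_pos by (simp add: f'_def abs_mult abs_divide)
          also have "... \<le> A / v" using xb[of z] v_pos by (intro divide_right_mono) auto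
          finally show ?thesis using fb[of z] by (intro order_trans[OF norm_triangle_ineq]) auto
        qed
        then have "norm (x * f x - y * f y) \<le> (A + A / v) * norm (x - y)"
          using d by (intro field_differentiable_bound[of UNIV]) auto
        then show ?thesis by simp
      qed
      then have "\<bar>(w x + x * f x) - (w y + y * f y)\<bar> \<le> (1 + (A + A / v)) * \<bar>x - y\<bar>"
        using wl[of x y] by (simp add: distrib_right)
      then show ?thesis using v_pos by (simp add: f'_def diff_divide_distrib[symmetric] abs_divide divide_right_mono)
    qed
    have Kle: "A \<le> K" "A / v \<le> K" "(1 + (A + A / v)) / v \<le> K" by (auto simp: K_def)
    show "\<exists>f f'. (\<forall>x. (f has_real_derivative f' x) (at x)) \<and> (\<forall>x. \<bar>f x\<bar> \<le> K) \<and> (\<forall>x. \<bar>f' x\<bar> \<le> K) \<and>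
        (\<forall>x y. \<bar>f' x - f' y\<bar> \<le> K * \<bar>x - y\<bar>) \<and>
        (\<forall>x. v * f' x - x * f x = u x - (LINT y|lborel. u y * p y))"
    proof (rule exI[of _ f], rule exI[of _ f'], intro conjI allI)
      fix x y
      show "(f has_real_derivative f' x) (at x)" by (rule deriv)
      show "\<bar>f x\<bar> \<le> K" by (rule order_trans[OF fb Kle(1)])
      show "\<bar>f' x\<bar> \<le> K" by (rule order_trans[OF f'b Kle(2)])
      show "\<bar>f' x - f' y\<bar> \<le> K * \<bar>x - y\<bar>"
        using f'l[of x y] mult_right_mono[OF Kle(3), of "\<bar>x - y\<bar>"] by simp
      show "v * f' x - x * f x = u x - (LINT y|lborel. u y * p y)"
        using v_pos by (simp add: f'_def w_def e_def)
    qed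
  qed
qed

end

section \<open>The law of a Poisson random measure and predictable processes\<close>

definition half_plane :: "(real \<times> real) set" where "half_plane = UNIV \<times> {0..}"

text \<open>The intensity of the theorem lives on the half plane as its own space. Extended by zero
  to the plane, it fits configurations of a Euclidean space.\<close>

definition plane_intensity :: "(real \<times> real) measure" where
  "plane_intensity = density lborel (indicator (UNIV \<times> {0..}))"

lemma half_plane_sets [measurable]: "half_plane \<in> sets borel"
  by (simp add: half_plane_def)

lemma sets_half_plane_lebesgue: "sets half_plane_lebesgue = sets (restrict_space borel half_plane)"
  unfolding half_plane_lebesgue_def half_plane_def by (intro sets_restrict_space_cong) simp

lemma half_plane_Int: "A \<in> sets borel \<Longrightarrow> A \<inter> half_plane \<in> sets half_plane_lebesgue"
  unfolding sets_half_plane_lebesgue sets_restrict_space by auto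

lemma emeasure_half_plane_lebesgue:
  "A \<in> sets borel \<Longrightarrow> emeasure half_plane_lebesgue (A \<inter> half_plane) = emeasure plane_intensity A"
proof -
  assume A [measurable]: "A \<in> sets borel"
  have "emeasure half_plane_lebesgue (A \<inter> half_plane) = emeasure lborel (A \<inter> half_plane)"
    unfolding half_plane_lebesgue_def half_plane_def by (intro emeasure_restrict_space) auto
  also have "... = emeasure plane_intensity A"
    unfolding plane_intensity_def half_plane_def
    by (subst emeasure_density) (auto simp: indicator_inter_arith[symmetric] Int_commute)
  finally show ?thesis .
qed

locale poisson_input = M: prob_space M
  for M :: "'w measure" +
  fixes N :: "'w \<Rightarrow> (real \<times> real) measure"
  assumes N: "poisson_random_measure M half_plane_lebesgue N"
begin

text \<open>The push-forward along the inclusion of the half plane changes the carrier space and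
  leaves the points in place.\<close>

definition conf :: "'w \<Rightarrow> (real \<times> real) measure" where
  "conf \<omega> = distr (N \<omega>) borel (\<lambda>x. x)"

lemmas N_sets = N[unfolded poisson_random_measure_def, THEN conjunct1]
lemmas N_rest1 = N[unfolded poisson_random_measure_def, THEN conjunct2]
lemmas N_rest2 = N_rest1[THEN conjunct2]
lemmas N_rest3 = N_rest2[THEN conjunct2]
lemmas N_rest4 = N_rest3[THEN conjunct2]

lemma sets_N: "\<omega> \<in> space M \<Longrightarrow> sets (N \<omega>) = sets (restrict_space borel half_plane)"
  unfolding sets_half_plane_lebesgue[symmetric] by (rule bspec[OF N_sets])

lemma N_count:
  assumes A: "A \<in> sets half_plane_lebesgue"
  shows "\<omega> \<in> space M \<Longrightarrow> emeasure (N \<omega>) A \<in> range ennreal_of_enat"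
    "\<omega> \<in> space M \<Longrightarrow> bounded A \<Longrightarrow> emeasure (N \<omega>) A < \<infinity>"
    "(\<lambda>\<omega>. emeasure (N \<omega>) A) \<in> borel_measurable M"
    "emeasure half_plane_lebesgue A < \<infinity> \<Longrightarrow> measure M {\<omega>\<in>space M. emeasure (N \<omega>) A = of_nat j} =
       measure half_plane_lebesgue A ^ j / fact j * exp (- measure half_plane_lebesgue A)"
proof -
  show "\<omega> \<in> space M \<Longrightarrow> emeasure (N \<omega>) A \<in> range ennreal_of_enat"
    by (rule bspec[OF bspec[OF N_rest1[THEN conjunct1]] A])
  show "\<omega> \<in> space M \<Longrightarrow> bounded A \<Longrightarrow> emeasure (N \<omega>) A < \<infinity>"
    by (rule bspec[OF bspec[OF N_rest2[THEN conjunct1]] A, THEN mp])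
  show "(\<lambda>\<omega>. emeasure (N \<omega>) A) \<in> borel_measurable M"
    by (rule bspec[OF N_rest3[THEN conjunct1] A])
  show "emeasure half_plane_lebesgue A < \<infinity> \<Longrightarrow> measure M {\<omega>\<in>space M. emeasure (N \<omega>) A = of_nat j} =
       measure half_plane_lebesgue A ^ j / fact j * exp (- measure half_plane_lebesgue A)"
    by (rule spec[OF mp[OF bspec[OF N_rest4[THEN conjunct1] A]]])
qed

lemma N_indep:
  fixes B :: "nat \<Rightarrow> (real \<times> real) set"
  assumes "finite J" "B ` J \<subseteq> sets half_plane_lebesgue" "disjoint_family_on B J"
  shows "M.indep_vars (\<lambda>_. borel) (\<lambda>i \<omega>. emeasure (N \<omega>) (B i)) J"
  by (rule mp[OF mp[OF mp[OF N_rest4[THEN conjunct2, THEN conjunct2, THEN spec[where x=J],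
        THEN spec[where x=B]] assms(1)] assms(2)] assms(3)])

lemma space_N: "\<omega> \<in> space M \<Longrightarrow> space (N \<omega>) = half_plane"
  using sets_eq_imp_space_eq[OF sets_N] by (simp add: space_restrict_space)

lemma measurable_N: "\<omega> \<in> space M \<Longrightarrow> f \<in> measurable borel K \<Longrightarrow> f \<in> measurable (N \<omega>) K"
proof -
  assume \<omega>: "\<omega> \<in> space M" and f: "f \<in> measurable borel K"
  show "f \<in> measurable (N \<omega>) K"
    unfolding measurable_cong_sets[OF sets_N[OF \<omega>] refl] by (rule measurable_restrict_space1[OF f])
qed

lemma emeasure_conf_N:
  "\<omega> \<in> space M \<Longrightarrow> A \<in> sets borel \<Longrightarrow> emeasure (conf \<omega>) A = emeasure (N \<omega>) (A \<inter> half_plane)"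
  unfolding conf_def
  by (subst emeasure_distr) (auto intro: measurable_N simp: space_N)

lemma conf_in_configs: "\<omega> \<in> space M \<Longrightarrow> conf \<omega> \<in> configs"
proof -
  assume \<omega>: "\<omega> \<in> space M"
  have "\<exists>k::nat. emeasure (conf \<omega>) A = of_nat k" if A: "A \<in> sets borel" "bounded A" for A
  proof -
    have B: "A \<inter> half_plane \<in> sets half_plane_lebesgue" "bounded (A \<inter> half_plane)"
      using half_plane_Int[OF A(1)] A(2) by (simp_all add: bounded_Int)
    obtain e where e: "emeasure (N \<omega>) (A \<inter> half_plane) = ennreal_of_enat e"
      using N_count(1)[OF B(1) \<omega>] by (rule rangeE)
    then show ?thesis
      using N_count(2)[OF B(1) \<omega> B(2)] emeasure_conf_N[OF \<omega> A(1)] by (cases e) auto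
  qed
  moreover have "sets (conf \<omega>) = sets borel" by (simp only: conf_def sets_distr)
  ultimately show ?thesis unfolding configs_def by blast
qed

lemma measurable_conf [measurable]: "conf \<in> measurable M confs"
proof (rule measurable_confsI[OF conf_in_configs])
  fix A :: "(real \<times> real) set" assume A: "A \<in> sets borel" "bounded A"
  have "(\<lambda>\<omega>. emeasure (N \<omega>) (A \<inter> half_plane)) \<in> borel_measurable M"
    by (rule N_count(3)[OF half_plane_Int[OF A(1)]])
  then show "(\<lambda>\<omega>. emeasure (conf \<omega>) A) \<in> borel_measurable M"
    using emeasure_conf_N[OF _ A(1)] by (simp cong: measurable_cong)
qed

definition law :: "(real \<times> real) measure measure" where
  "law = distr M confs conf"

lemma cylinder_probability:
  assumes C: "finite \<C>" "disjoint \<C>" "\<C> \<subseteq> bounded_borel"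
  shows "measure law (cylinder \<C> k) =
    (\<Prod>C\<in>\<C>. measure plane_intensity C ^ k C / fact (k C) * exp (- measure plane_intensity C))"
\<comment> \<open>The product formula for independent variables asks for a nonempty index
  set.\<close>
proof (cases "\<C> = {}")
  case True
  have "prob_space law" unfolding law_def by (rule M.prob_space_distr) simp
  then have "measure law (space law) = 1" by (rule prob_space.prob_space)
  then show ?thesis using True by (simp add: cylinder_def law_def)
next
  case False
  obtain e where e: "bij_betw e {0..<card \<C>} \<C>" using ex_bij_betw_nat_finite[OF C(1)] by blast
  let ?I = "{0..<card \<C>}" and ?A = "\<lambda>i. e i \<inter> half_plane"
  have eC: "e i \<in> \<C>" "e i \<in> sets borel" "bounded (e i)" if "i \<in> ?I" for i
  proof -
    show "e i \<in> \<C>" using e that by (auto simp: bij_betw_def)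
    then have "e i \<in> bounded_borel" using C(3) by blast
    then show "e i \<in> sets borel" "bounded (e i)" by (rule bounded_borelD)+
  qed
  have I: "?I \<noteq> {}" "finite ?I" using False C(1) by auto
  have "disjoint_family_on ?A ?I"
    unfolding disjoint_family_on_def
  proof (intro ballI impI)
    fix i j assume ij: "i \<in> ?I" "j \<in> ?I" "i \<noteq> j"
    then have "e i \<noteq> e j" using e by (auto simp: bij_betw_def inj_on_def)
    then show "?A i \<inter> ?A j = {}" using C(2) eC(1) ij by (auto simp: disjoint_def)
  qed
  moreover have "?A ` ?I \<subseteq> sets half_plane_lebesgue" using eC(2) by (auto intro: half_plane_Int)
  ultimately have ind: "M.indep_vars (\<lambda>_. borel) (\<lambda>i \<omega>. emeasure (N \<omega>) (?A i)) ?I"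
    using N_indep[OF I(2)] by simp
  have fin: "emeasure half_plane_lebesgue (?A i) < \<infinity>" if "i \<in> ?I" for i
  proof -
    have "emeasure lborel (e i) < \<infinity>" by (rule emeasure_bounded_finite[OF eC(3)[OF that]])
    moreover have "emeasure half_plane_lebesgue (?A i) \<le> emeasure lborel (e i)"
      unfolding half_plane_lebesgue_def using eC(2)[OF that]
      by (subst emeasure_restrict_space) (auto simp: half_plane_def[symmetric] intro!: emeasure_mono)
    ultimately show ?thesis by simp
  qed
  have m: "measure half_plane_lebesgue (?A i) = measure plane_intensity (e i)" if "i \<in> ?I" for i
    using emeasure_half_plane_lebesgue[OF eC(2)[OF that]] by (simp add: measure_def)
  have single: "M.prob ((\<lambda>\<omega>. emeasure (N \<omega>) (?A i)) -` {of_nat (k (e i))} \<inter> space M)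
      = measure plane_intensity (e i) ^ k (e i) / fact (k (e i)) * exp (- measure plane_intensity (e i))"
    if "i \<in> ?I" for i
  proof -
    have "(\<lambda>\<omega>. emeasure (N \<omega>) (?A i)) -` {of_nat (k (e i))} \<inter> space M
      = {\<omega>\<in>space M. emeasure (N \<omega>) (?A i) = of_nat (k (e i))}" by auto
    then show ?thesis
      using N_count(4)[OF half_plane_Int[OF eC(2)[OF that]] fin[OF that]] m[OF that] by simp
  qed
  have "measure law (cylinder \<C> k) = M.prob (conf -` cylinder \<C> k \<inter> space M)"
    unfolding law_def using sets_cylinder[OF C(1,3)] by (intro measure_distr) auto
  also have "conf -` cylinder \<C> k \<inter> space M
    = (\<Inter>i\<in>?I. (\<lambda>\<omega>. emeasure (N \<omega>) (?A i)) -` {of_nat (k (e i))} \<inter> space M)"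
  proof -
    have img: "\<C> = e ` ?I" using e by (simp add: bij_betw_def)
    have "\<omega> \<in> conf -` cylinder \<C> k \<longleftrightarrow> (\<forall>i\<in>?I. emeasure (N \<omega>) (?A i) = of_nat (k (e i)))" if "\<omega> \<in> space M" for \<omega>
    proof -
      have ball: "(\<forall>C\<in>\<C>. P C) \<longleftrightarrow> (\<forall>i\<in>?I. P (e i))" for P
        by (subst img) blast
      have "\<omega> \<in> conf -` cylinder \<C> k \<longleftrightarrow> (\<forall>C\<in>\<C>. emeasure (conf \<omega>) C = of_nat (k C))"
        using conf_in_configs[OF that] by (simp add: cylinder_def)
      also have "... \<longleftrightarrow> (\<forall>i\<in>?I. emeasure (conf \<omega>) (e i) = of_nat (k (e i)))" by (rule ball)
      also have "... \<longleftrightarrow> (\<forall>i\<in>?I. emeasure (N \<omega>) (?A i) = of_nat (k (e i)))"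
        using emeasure_conf_N[OF that eC(2)] by (intro ball_cong refl) simp
      finally show ?thesis .
    qed
    then show ?thesis using I(1) by auto
  qed
  also have "M.prob ... = (\<Prod>i\<in>?I. M.prob ((\<lambda>\<omega>. emeasure (N \<omega>) (?A i)) -` {of_nat (k (e i))} \<inter> space M))"
    using M.indep_varsD[OF ind I subset_refl, of "\<lambda>i. {of_nat (k (e i))}"] by simp
  also have "... = (\<Prod>i\<in>?I. measure plane_intensity (e i) ^ k (e i) / fact (k (e i)) * exp (- measure plane_intensity (e i)))"
    using single by (intro prod.cong) auto
  also have "... = (\<Prod>C\<in>\<C>. measure plane_intensity C ^ k C / fact (k C) * exp (- measure plane_intensity C))"
    by (rule prod.reindex_bij_betw[OF e])
  finally show ?thesis .
qed

lemma poisson_plane_law: "poisson_plane law plane_intensity"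
proof (intro poisson_plane.intro poisson_law.intro poisson_law_axioms.intro poisson_plane_axioms.intro)
  show "prob_space law" unfolding law_def by (rule M.prob_space_distr) simp
  show "sets law = sets confs" by (simp add: law_def)
  show "sets plane_intensity = sets borel" by (simp add: plane_intensity_def)
  show "plane_intensity = density lborel (indicator (UNIV \<times> {0..}))" by (simp add: plane_intensity_def)
  show "emeasure plane_intensity A < \<infinity>" if "A \<in> bounded_borel" for A
  proof -
    have [measurable]: "A \<in> sets borel" using that by (rule bounded_borelD)
    have "emeasure plane_intensity A = (\<integral>\<^sup>+x. indicator (UNIV \<times> {0..}) x * indicator A x \<partial>lborel)"
      unfolding plane_intensity_def by (intro emeasure_density) auto
    also have "... \<le> (\<integral>\<^sup>+x. indicator A x \<partial>lborel)"
      by (intro nn_integral_mono) (auto split: split_indicator)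
    also have "... < \<infinity>" using emeasure_bounded_finite[OF bounded_borelD(2)[OF that]] by simp
    finally show ?thesis .
  qed
qed (rule cylinder_probability)

text \<open>
  At time \<open>t\<close> a predictable process sees the configuration strictly before \<open>t\<close>: points added at time
  \<open>t\<close> or later do not change it.
\<close>

definition invariant_set :: "(real \<times> (real \<times> real) measure) set \<Rightarrow> bool" where
  "invariant_set C \<longleftrightarrow> (\<forall>nu\<in>configs. \<forall>y t. t \<le> fst y \<longrightarrow> ((t, add_point y nu) \<in> C \<longleftrightarrow> (t, nu) \<in> C))"

text \<open>Counts of sets before \<open>s\<close> do not react to points after \<open>s\<close>,
  and this survives complements and countable unions. The inequality is strict because the
  information at \<open>s\<close> includes the points at time \<open>s\<close>.\<close>

lemma natural_filtration_factor:
  assumes "A \<in> sets (natural_filtration M N s)"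
  shows "\<exists>C\<in>sets confs. A = conf -` C \<inter> space M \<and>
    (\<forall>nu\<in>configs. \<forall>y. s < fst y \<longrightarrow> (add_point y nu \<in> C \<longleftrightarrow> nu \<in> C))"
proof -
  let ?G = "{(\<lambda>\<omega>. emeasure (N \<omega>) (S \<times> B)) -` D \<inter> space M | S B D.
        S \<in> sets borel \<and> S \<subseteq> {..s} \<and> B \<in> sets borel \<and> B \<subseteq> {0..} \<and> D \<in> sets borel}"
  have "A \<in> sigma_sets (space M) ?G"
    using assms sets_measure_of[of ?G "space M"] unfolding natural_filtration_def by blast
  then show ?thesis
  proof induction
    case (Basic a)
    then obtain S B D where a: "a = (\<lambda>\<omega>. emeasure (N \<omega>) (S \<times> B)) -` D \<inter> space M"
      and S: "S \<in> sets borel" "S \<subseteq> {..s}" and B: "B \<in> sets borel" "B \<subseteq> {0..}" and D: "D \<in> sets borel" by blast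
    have SB [measurable]: "S \<times> B \<in> sets borel"
      unfolding borel_prod[symmetric] using S B by (intro pair_measureI) auto
    let ?C = "(\<lambda>nu. emeasure nu (S \<times> B)) -` D \<inter> space confs"
    have "?C \<in> sets confs" using D by (intro measurable_sets[OF measurable_count[OF SB]])
    moreover have "(S \<times> B) \<inter> half_plane = S \<times> B" using B by (auto simp: half_plane_def)
    then have "a = conf -` ?C \<inter> space M"
      unfolding a using emeasure_conf_N[OF _ SB] conf_in_configs by auto
    moreover have "add_point y nu \<in> ?C \<longleftrightarrow> nu \<in> ?C" if "nu \<in> configs" "s < fst y" for y nu
    proof -
      have "fst y \<notin> S" using S(2) that(2) by (meson atMost_iff leD subsetD)
      then have "y \<notin> S \<times> B" by (simp add: mem_Times_iff)
      then show ?thesis using that emeasure_add_point[OF that(1) SB, of y] by simp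
    qed
    ultimately show ?case by blast
  next
    case Empty then show ?case by (intro bexI[of _ "{}"]) auto
  next
    case (Compl a)
    then obtain C where C: "C \<in> sets confs" "a = conf -` C \<inter> space M"
      "\<forall>nu\<in>configs. \<forall>y. s < fst y \<longrightarrow> (add_point y nu \<in> C \<longleftrightarrow> nu \<in> C)" by blast
    show ?case
      by (intro bexI[OF _ sets.compl_sets[OF C(1)]]) (use C(2,3) conf_in_configs in auto)
  next
    case (Union a)
    have "\<forall>i. \<exists>C. C \<in> sets confs \<and> a i = conf -` C \<inter> space M \<and>
      (\<forall>nu\<in>configs. \<forall>y. s < fst y \<longrightarrow> (add_point y nu \<in> C \<longleftrightarrow> nu \<in> C))"
    unfolding Bex_def[symmetric] by (intro allI) (rule Union.IH)
    from choice[OF this] obtain C where C: "\<forall>i::nat. C i \<in> sets confs \<and> a i = conf -` C i \<inter> space M \<and>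
      (\<forall>nu\<in>configs. \<forall>y. s < fst y \<longrightarrow> (add_point y nu \<in> C i \<longleftrightarrow> nu \<in> C i))" ..
    show ?case
    proof (intro bexI[of _ "\<Union>i. C i"] conjI)
      show "(\<Union>i. a i) = conf -` (\<Union>i. C i) \<inter> space M" using C by auto
      show "\<forall>nu\<in>configs. \<forall>y. s < fst y \<longrightarrow> (add_point y nu \<in> (\<Union>i. C i) \<longleftrightarrow> nu \<in> (\<Union>i. C i))" using C by simp
      show "(\<Union>i. C i) \<in> sets confs" using C by auto
    qed
  qed
qed

text \<open>At a least time of the interval a predictable process may see points at that very time,
  so the description by the strict past is available only at times with a predecessor.\<close>

definition after_start :: "real set \<Rightarrow> real set" where
  "after_start I = {t\<in>I. \<exists>s\<in>I. s < t}"

text \<open>A generator over the times after \<open>s\<close> carries an event known at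
  \<open>s\<close>, hence at each of its times \<open>t\<close> an event of the configuration
  strictly before \<open>t\<close>. Slices at a least time contribute nothing at the times
  considered.\<close>

lemma predictable_set_factor:
  assumes "A \<in> sets (predictable_sigma I (space M) (natural_filtration M N))"
  shows "\<exists>C\<in>sets (borel \<Otimes>\<^sub>M confs). invariant_set C \<and>
    (\<forall>t\<in>after_start I. \<forall>\<omega>\<in>space M. (t, \<omega>) \<in> A \<longleftrightarrow> (t, conf \<omega>) \<in> C)"
proof -
  let ?F = "natural_filtration M N"
  let ?G = "{({s<..t} \<inter> I) \<times> A | s t A. s \<in> I \<and> t \<in> I \<and> s \<le> t \<and> A \<in> sets (?F s)} \<union>
      {{s} \<times> A | s A. s \<in> I \<and> (\<forall>t\<in>I. s \<le> t) \<and> A \<in> sets (?F s)}"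
  have sp: "A \<subseteq> space M" if "A \<in> sets (?F s)" for A s
    using sets.sets_into_space[OF that] by (simp add: natural_filtration_def space_measure_of_conv)
  have "A \<in> sigma_sets (I \<times> space M) ?G"
    using assms unfolding predictable_sigma_def by (subst (asm) sets_measure_of) (use sp in blast)+
  then show ?thesis
  proof induction
    case (Basic a)
    then consider s t B where "a = ({s<..t} \<inter> I) \<times> B" "B \<in> sets (?F s)"
      | s B where "a = {s} \<times> B" "\<forall>t\<in>I. s \<le> t" by blast
    then show ?case
    proof cases
      case 1
      obtain C where C: "C \<in> sets confs" "B = conf -` C \<inter> space M"
        "\<forall>nu\<in>configs. \<forall>y. s < fst y \<longrightarrow> (add_point y nu \<in> C \<longleftrightarrow> nu \<in> C)"
        using natural_filtration_factor[OF 1(2)] by blast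
      show ?thesis
      proof (intro bexI[of _ "{s<..t} \<times> C"] conjI)
        show "{s<..t} \<times> C \<in> sets (borel \<Otimes>\<^sub>M confs)" using C by (intro pair_measureI) auto
        show "invariant_set ({s<..t} \<times> C)" using C(3) by (auto simp: invariant_set_def)
      qed (auto simp: 1 C after_start_def)
    next
      case 2
      show ?thesis
        by (intro bexI[of _ "{}"]) (auto simp: 2(1) invariant_set_def after_start_def dest!: bspec[OF 2(2)])
    qed
  next
    case Empty then show ?case by (intro bexI[of _ "{}"]) (auto simp: invariant_set_def)
  next
    case (Compl a)
    then obtain C where C: "C \<in> sets (borel \<Otimes>\<^sub>M confs)" "invariant_set C"
      "\<forall>t\<in>after_start I. \<forall>\<omega>\<in>space M. (t, \<omega>) \<in> a \<longleftrightarrow> (t, conf \<omega>) \<in> C" by blast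
    show ?case
      by (intro bexI[OF _ sets.compl_sets[OF C(1)]])
         (use C(2,3) conf_in_configs in \<open>auto simp: invariant_set_def space_pair_measure after_start_def\<close>)
  next
    case (Union a)
    have "\<forall>i. \<exists>C. C \<in> sets (borel \<Otimes>\<^sub>M confs) \<and> invariant_set C \<and>
      (\<forall>t\<in>after_start I. \<forall>\<omega>\<in>space M. (t, \<omega>) \<in> a i \<longleftrightarrow> (t, conf \<omega>) \<in> C)"
    unfolding Bex_def[symmetric] by (intro allI) (rule Union.IH)
    from choice[OF this] obtain C where C: "\<forall>i::nat. C i \<in> sets (borel \<Otimes>\<^sub>M confs) \<and> invariant_set (C i) \<and>
      (\<forall>t\<in>after_start I. \<forall>\<omega>\<in>space M. (t, \<omega>) \<in> a i \<longleftrightarrow> (t, conf \<omega>) \<in> C i)" ..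
    show ?case
    proof (intro bexI[of _ "\<Union>i. C i"] conjI)
      show "invariant_set (\<Union>i. C i)" using C by (simp add: invariant_set_def)
      show "\<forall>t\<in>after_start I. \<forall>\<omega>\<in>space M. (t, \<omega>) \<in> (\<Union>i. a i) \<longleftrightarrow> (t, conf \<omega>) \<in> (\<Union>i. C i)" using C by simp
      show "(\<Union>i. C i) \<in> sets (borel \<Otimes>\<^sub>M confs)" using C by auto
    qed
  qed
qed

lemma predictable_factor_ennreal:
  fixes g :: "real \<times> 'w \<Rightarrow> ennreal"
  assumes "g \<in> borel_measurable (predictable_sigma I (space M) (natural_filtration M N))"
  shows "\<exists>Y\<in>borel_measurable (borel \<Otimes>\<^sub>M confs).
    (\<forall>nu\<in>configs. \<forall>y t. t \<le> fst y \<longrightarrow> Y (t, add_point y nu) = Y (t, nu)) \<and>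
    (\<forall>t\<in>after_start I. \<forall>\<omega>\<in>space M. g (t, \<omega>) = Y (t, conf \<omega>))"
  using assms
proof (induction rule: borel_measurable_induct)
  case (cong f g)
  have "space (predictable_sigma I (space M) (natural_filtration M N)) = I \<times> space M"
    by (simp add: predictable_sigma_def space_measure_of_conv)
  then have "f (t, \<omega>) = g (t, \<omega>)" if "t \<in> after_start I" "\<omega> \<in> space M" for t \<omega>
    using cong(3)[of "(t, \<omega>)"] that by (simp add: after_start_def)
  then show ?case using cong(4) by auto
next
  case (set A)
  then obtain C where C: "C \<in> sets (borel \<Otimes>\<^sub>M confs)" "invariant_set C"
    "\<forall>t\<in>after_start I. \<forall>\<omega>\<in>space M. (t, \<omega>) \<in> A \<longleftrightarrow> (t, conf \<omega>) \<in> C"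
    using predictable_set_factor by blast
  then show ?case
    by (intro bexI[of _ "indicator C"]) (auto simp: invariant_set_def indicator_def)
next
  case (mult u c)
  then obtain Y where "Y \<in> borel_measurable (borel \<Otimes>\<^sub>M confs)"
    "\<forall>nu\<in>configs. \<forall>y t. t \<le> fst y \<longrightarrow> Y (t, add_point y nu) = Y (t, nu)"
    "\<forall>t\<in>after_start I. \<forall>\<omega>\<in>space M. u (t, \<omega>) = Y (t, conf \<omega>)" by blast
  then show ?case by (intro bexI[of _ "\<lambda>p. c * Y p"]) auto
next
  case (add u w)
  then obtain Y Y' where "Y \<in> borel_measurable (borel \<Otimes>\<^sub>M confs)" "Y' \<in> borel_measurable (borel \<Otimes>\<^sub>M confs)"
    "\<forall>nu\<in>configs. \<forall>y t. t \<le> fst y \<longrightarrow> Y (t, add_point y nu) = Y (t, nu)"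
    "\<forall>nu\<in>configs. \<forall>y t. t \<le> fst y \<longrightarrow> Y' (t, add_point y nu) = Y' (t, nu)"
    "\<forall>t\<in>after_start I. \<forall>\<omega>\<in>space M. u (t, \<omega>) = Y (t, conf \<omega>)"
    "\<forall>t\<in>after_start I. \<forall>\<omega>\<in>space M. w (t, \<omega>) = Y' (t, conf \<omega>)" by blast
  then show ?case by (intro bexI[of _ "\<lambda>p. Y' p + Y p"]) auto
next
  case (seq U)
  have "\<forall>i. \<exists>Y. Y \<in> borel_measurable (borel \<Otimes>\<^sub>M confs) \<and>
    (\<forall>nu\<in>configs. \<forall>y t. t \<le> fst y \<longrightarrow> Y (t, add_point y nu) = Y (t, nu)) \<and>
    (\<forall>t\<in>after_start I. \<forall>\<omega>\<in>space M. U i (t, \<omega>) = Y (t, conf \<omega>))"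
    unfolding Bex_def[symmetric] by (intro allI) (rule seq.IH)
  from choice[OF this] obtain Y where Y: "\<forall>i. Y i \<in> borel_measurable (borel \<Otimes>\<^sub>M confs) \<and>
    (\<forall>nu\<in>configs. \<forall>y t. t \<le> fst y \<longrightarrow> Y i (t, add_point y nu) = Y i (t, nu)) \<and>
    (\<forall>t\<in>after_start I. \<forall>\<omega>\<in>space M. U i (t, \<omega>) = Y i (t, conf \<omega>))" ..
  have "(\<lambda>p. SUP i. Y i p) \<in> borel_measurable (borel \<Otimes>\<^sub>M confs)"
    by (intro borel_measurable_SUP) (use Y in auto)
  moreover have "\<forall>nu\<in>configs. \<forall>y t. t \<le> fst y \<longrightarrow> (SUP i. Y i (t, add_point y nu)) = (SUP i. Y i (t, nu))"
    using Y by simp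
  moreover have "\<forall>t\<in>after_start I. \<forall>\<omega>\<in>space M. (SUP i. U i) (t, \<omega>) = (SUP i. Y i (t, conf \<omega>))"
    using Y by (simp add: SUP_apply image_image)
  ultimately show ?case by (intro bexI[of _ "\<lambda>p. SUP i. Y i p"]) simp_all
qed

text \<open>The version \<open>L\<close> is defined at every configuration and not only at those of
  the form \<open>conf \<omega>\<close>. This matters because an added point leads out of the range
  of \<open>conf\<close>.\<close>

lemma predictable_factor:
  assumes "predictable_on I M N X"
  obtains L where "(\<lambda>(t, nu). L t nu) \<in> borel_measurable (borel \<Otimes>\<^sub>M confs)"
    "\<And>nu y t. nu \<in> configs \<Longrightarrow> t \<le> fst y \<Longrightarrow> L t (add_point y nu) = L t nu"
    "\<And>t \<omega>. t \<in> after_start I \<Longrightarrow> \<omega> \<in> space M \<Longrightarrow> L t (conf \<omega>) = X t \<omega>"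
proof -
  have [measurable]: "(\<lambda>(t, \<omega>). X t \<omega>) \<in> borel_measurable (predictable_sigma I (space M) (natural_filtration M N))"
    using assms by (simp add: predictable_on_def)
  have "\<exists>Y\<in>borel_measurable (borel \<Otimes>\<^sub>M confs). (\<forall>nu\<in>configs. \<forall>y t. t \<le> fst y \<longrightarrow> Y (t, add_point y nu) = Y (t, nu)) \<and>
    (\<forall>t\<in>after_start I. \<forall>\<omega>\<in>space M. ennreal (c * X t \<omega>) = Y (t, conf \<omega>))" for c
    using predictable_factor_ennreal[of "\<lambda>p. ennreal (c * (case p of (t, \<omega>) \<Rightarrow> X t \<omega>))" I] by simp
  \<comment> \<open>The two signs supply the positive and the negative part.\<close>
  from this[of 1] this[of "- 1"] obtain Y Y' where
    Y: "Y \<in> borel_measurable (borel \<Otimes>\<^sub>M confs)" "\<forall>nu\<in>configs. \<forall>y t. t \<le> fst y \<longrightarrow> Y (t, add_point y nu) = Y (t, nu)"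
      "\<forall>t\<in>after_start I. \<forall>\<omega>\<in>space M. ennreal (X t \<omega>) = Y (t, conf \<omega>)" and
    Y': "Y' \<in> borel_measurable (borel \<Otimes>\<^sub>M confs)" "\<forall>nu\<in>configs. \<forall>y t. t \<le> fst y \<longrightarrow> Y' (t, add_point y nu) = Y' (t, nu)"
      "\<forall>t\<in>after_start I. \<forall>\<omega>\<in>space M. ennreal (- X t \<omega>) = Y' (t, conf \<omega>)"
    by auto
  show ?thesis
  proof
    show "(\<lambda>(t, nu). enn2real (Y (t, nu)) - enn2real (Y' (t, nu))) \<in> borel_measurable (borel \<Otimes>\<^sub>M confs)"
      using Y(1) Y'(1) by measurable
    show "enn2real (Y (t, add_point y nu)) - enn2real (Y' (t, add_point y nu)) = enn2real (Y (t, nu)) - enn2real (Y' (t, nu))"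
      if "nu \<in> configs" "t \<le> fst y" for nu y t
      using Y(2) Y'(2) that by simp
    show "enn2real (Y (t, conf \<omega>)) - enn2real (Y' (t, conf \<omega>)) = X t \<omega>" if "t \<in> after_start I" "\<omega> \<in> space M" for t \<omega>
    proof -
      have "Y (t, conf \<omega>) = ennreal (X t \<omega>)" "Y' (t, conf \<omega>) = ennreal (- X t \<omega>)" using Y(3) Y'(3) that by auto
      then show ?thesis by (cases "0 \<le> X t \<omega>") (simp_all add: ennreal_neg)
    qed
  qed
qed

text \<open>The points of \<open>N\<close> have nonnegative marks, so the lower bound in
  \<open>hit\<close> changes nothing on them.\<close>

lemma thinned_integral_eq:
  assumes \<omega>: "\<omega> \<in> space M" and S: "S \<in> sets borel" and f: "f \<in> borel_measurable borel"
    and L: "(\<lambda>(t, nu). L t nu) \<in> borel_measurable (borel \<Otimes>\<^sub>M confs)"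
    and eq: "\<And>t. t \<in> S \<Longrightarrow> L t (conf \<omega>) = X t \<omega>"
  shows "thinned_integral N X S f \<omega>
    = (LINT y|conf \<omega>. indicator S (fst y) * f (fst y) * hit (L (fst y) (conf \<omega>)) y)"
proof -
  note [measurable] = S f L
  have nu: "conf \<omega> \<in> configs" by (rule conf_in_configs[OF \<omega>])
  have m: "(\<lambda>y. indicator S (fst y) * f (fst y) * hit (L (fst y) (conf \<omega>)) y) \<in> borel_measurable borel"
  proof (rule poisson_plane.field_section[OF poisson_plane_law, of "\<lambda>y nu. indicator S (fst y) * f (fst y) * hit (L (fst y) nu) y", OF _ nu refl])
    have [measurable]: "(\<lambda>y. indicator S (fst y) :: real) \<in> borel_measurable (borel :: (real \<times> real) measure)"
      by (rule measurable_compose[of fst borel borel]) auto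
    show "(\<lambda>(y, nu). indicator S (fst y) * f (fst y) * hit (L (fst y) nu) y) \<in> borel_measurable (borel \<Otimes>\<^sub>M confs)"
      by measurable
  qed
  have "(LINT y|conf \<omega>. g y) = (LINT y|N \<omega>. g y)" if "g \<in> borel_measurable borel" for g :: "_ \<Rightarrow> real"
    using integral_distr[OF measurable_N[OF \<omega>, of "\<lambda>x. x" borel] that] by (simp add: conf_def)
  from this[OF m] have "(LINT y|conf \<omega>. indicator S (fst y) * f (fst y) * hit (L (fst y) (conf \<omega>)) y)
    = (LINT y|N \<omega>. indicator S (fst y) * f (fst y) * hit (L (fst y) (conf \<omega>)) y)" .
  also have "... = thinned_integral N X S f \<omega>"
    unfolding thinned_integral_def
  proof (rule Bochner_Integration.integral_cong[OF refl])
    fix y assume "y \<in> space (N \<omega>)"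
    then have "y \<in> half_plane" unfolding space_N[OF \<omega>] .
    then have "0 \<le> snd y" unfolding half_plane_def mem_Times_iff by simp
    then show "indicator S (fst y) * f (fst y) * hit (L (fst y) (conf \<omega>)) y
      = (case y of (s, \<theta>) \<Rightarrow> indicator S s * (f s * indicator {..X s \<omega>} \<theta>))"
      using eq[of "fst y"] by (simp add: case_prod_beta hit_def split: split_indicator)
  qed
  finally show ?thesis ..
qed

end

section \<open>Hawkes intensities and their iterates\<close>

text \<open>No sign condition on the level: a solution is known to be nonnegative only almost
  surely, and for negative levels both sides are 0.\<close>

lemma nn_integral_hit_all:
  "(\<integral>\<^sup>+\<theta>. ennreal (hit a (s, \<theta>)) * indicator {0..} \<theta> \<partial>lborel) = ennreal a"
proof (cases "0 \<le> a")
  case False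
  then have "(\<integral>\<^sup>+\<theta>. ennreal (hit a (s, \<theta>)) * indicator {0..} \<theta> \<partial>lborel) = (\<integral>\<^sup>+\<theta>. 0 \<partial>(lborel :: real measure))"
    by (intro nn_integral_cong) (auto simp: hit_def)
  then show ?thesis using False by (simp add: ennreal_neg)
qed (rule nn_integral_hit)

lemma nn_integral_hit_diff_le:
  "(\<integral>\<^sup>+\<theta>. ennreal \<bar>hit a (s, \<theta>) - hit a' (s, \<theta>)\<bar> * indicator {0..} \<theta> \<partial>lborel) \<le> ennreal \<bar>a - a'\<bar>"
proof -
  have "(\<integral>\<^sup>+\<theta>. ennreal \<bar>hit a (s, \<theta>) - hit a' (s, \<theta>)\<bar> * indicator {0..} \<theta> \<partial>lborel)
    \<le> (\<integral>\<^sup>+\<theta>. indicator {min a a'..max a a'} \<theta> \<partial>lborel)"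
    by (intro nn_integral_mono) (auto simp: hit_def split: split_indicator)
  also have "... = ennreal \<bar>a - a'\<bar>" by (auto simp: min_def max_def)
  finally show ?thesis .
qed

text \<open>
  The intensity is only known to be almost surely locally integrable. Stopping it when its integral
  reaches \<open>c\<close> yields the finiteness that the contraction argument for its mean needs.
\<close>

lemma stopped_integral_le:
  fixes f :: "real \<Rightarrow> ennreal"
  assumes [measurable]: "f \<in> borel_measurable borel"
  shows "(\<integral>\<^sup>+t. (if (\<integral>\<^sup>+u. f u * indicator {0<..<t} u \<partial>lborel) \<le> c then f t else 0) * indicator {0<..T} t \<partial>lborel) \<le> c"
proof -
  define a where "a t = (\<integral>\<^sup>+u. f u * indicator {0<..<t} u \<partial>lborel)" for t
  define D where "D = {t\<in>{0<..T}. a t \<le> c}"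
  show ?thesis
  proof (cases "D = {}")
    case True
    then have "(\<integral>\<^sup>+t. (if a t \<le> c then f t else 0) * indicator {0<..T} t \<partial>lborel) = (\<integral>\<^sup>+t. 0 \<partial>(lborel :: real measure))"
      by (intro nn_integral_cong) (auto simp: D_def split: split_indicator)
    then show ?thesis by (simp add: a_def)
  next
    case False
    \<comment> \<open>The integrand vanishes after \<open>s\<close>. As \<open>s\<close> itself need
      not belong to \<open>D\<close>, the bound at \<open>s\<close> is reached from below by
      monotone convergence.\<close>
    define s where "s = Sup D"
    have bdd: "bdd_above D" by (auto simp: D_def)
    have up: "t \<le> s" if "t \<in> D" for t unfolding s_def using that bdd by (rule cSup_upper)
    let ?f = "\<lambda>n u. f u * indicator {0<..<s - 1 / real (Suc n)} u"
    have SUP: "(SUP n. ?f n u) = f u * indicator {0<..<s} u" for u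
    proof (rule antisym)
      show "(SUP n. ?f n u) \<le> f u * indicator {0<..<s} u"
      proof (rule SUP_least)
        fix n
        define d where "d = 1 / real (Suc n)"
        have "0 < d" by (simp add: d_def)
        then show "?f n u \<le> f u * indicator {0<..<s} u"
          unfolding d_def[symmetric] by (auto split: split_indicator)
      qed
      show "f u * indicator {0<..<s} u \<le> (SUP n. ?f n u)"
      proof (cases "0 < u \<and> u < s")
        case True
        then obtain n where "inverse (real (Suc n)) < s - u" using reals_Archimedean[of "s - u"] by auto
        then have "u < s - 1 / real (Suc n)" by (simp add: inverse_eq_divide)
        then show ?thesis using True by (intro SUP_upper2[of n]) auto
      qed (auto split: split_indicator)
    qed
    have inc: "1 / real (Suc m) \<le> 1 / real (Suc n)" if "n \<le> m" for n m using that by (simp add: frac_le)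
    have "a s = (\<integral>\<^sup>+u. (SUP n. ?f n u) \<partial>lborel)" unfolding a_def SUP ..
    also have "... = (SUP n. \<integral>\<^sup>+u. ?f n u \<partial>lborel)"
    proof (intro nn_integral_monotone_convergence_SUP)
      show "incseq ?f"
      proof (intro incseq_SucI le_funI)
        fix n u
        show "?f n u \<le> ?f (Suc n) u" using inc[of n "Suc n"] by (auto split: split_indicator simp del: of_nat_Suc)
      qed
    qed measurable
    also have "... \<le> c"
    proof (rule SUP_least)
      fix n
      have "s - 1 / real (Suc n) < s" by simp
      then obtain t where t: "t \<in> D" "s - 1 / real (Suc n) < t"
        unfolding s_def using less_cSup_iff[OF False bdd] by blast
      have "(\<integral>\<^sup>+u. ?f n u \<partial>lborel) \<le> a t"
        unfolding a_def using t(2) by (intro nn_integral_mono) (auto split: split_indicator)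
      also have "a t \<le> c" using t(1) by (simp add: D_def)
      finally show "(\<integral>\<^sup>+u. ?f n u \<partial>lborel) \<le> c" .
    qed
    finally have as: "a s \<le> c" .
    have "(\<integral>\<^sup>+t. (if a t \<le> c then f t else 0) * indicator {0<..T} t \<partial>lborel) \<le> a s"
      unfolding a_def[of s]
    proof (rule nn_integral_mono_AE)
      have "AE t in lborel. t \<noteq> s" by (rule AE_lborel_singleton)
      then show "AE t in lborel. (if a t \<le> c then f t else 0) * indicator {0<..T} t \<le> f t * indicator {0<..<s} t"
      proof eventually_elim
        case (elim t)
        then show ?case using up[of t] by (auto simp: D_def split: split_indicator)
      qed
    qed
    then show ?thesis using as unfolding a_def by (rule order_trans)
  qed
qed

lemma ennreal_abs_integral_diff:
  assumes "integrable nu a" "integrable nu a'" "0 \<le> c"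
  shows "ennreal (c * \<bar>(LINT y|nu. a y) - (LINT y|nu. a' y)\<bar>) \<le> (\<integral>\<^sup>+y. ennreal (c * \<bar>a y - a' y\<bar>) \<partial>nu)"
proof -
  have "c * \<bar>(LINT y|nu. a y) - (LINT y|nu. a' y)\<bar> = \<bar>LINT y|nu. c * (a y - a' y)\<bar>"
    using assms by (simp add: abs_mult)
  then have "ennreal (c * \<bar>(LINT y|nu. a y) - (LINT y|nu. a' y)\<bar>) \<le> (\<integral>\<^sup>+y. ennreal \<bar>c * (a y - a' y)\<bar> \<partial>nu)"
    by (simp only: ennreal_abs_integral_le)
  then show ?thesis using assms(3) by (simp add: abs_mult)
qed

text \<open>The value \<infinity> satisfies the inequality as well, so finiteness has to be
  established beforehand in each application.\<close>

lemma ennreal_contraction: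
  assumes "x \<le> ennreal r * x + ennreal k" "x < \<infinity>" "0 \<le> r" "r < 1" "0 \<le> k"
  shows "x \<le> ennreal (k / (1 - r))"
proof -
  obtain y where y: "x = ennreal y" "0 \<le> y" using assms(2) by (cases x) auto
  have "ennreal y \<le> ennreal (r * y + k)"
    using assms y by (simp add: ennreal_mult)
  then have "y \<le> r * y + k" using assms y by (subst (asm) ennreal_le_iff) auto
  then have "y \<le> k / (1 - r)" using assms by (simp add: field_simps)
  then show ?thesis by (simp add: y ennreal_leI)
qed

section \<open>Mean comparison of processes determined by the strict past\<close>

definition past_process :: "(real \<Rightarrow> (real \<times> real) measure \<Rightarrow> 'b) \<Rightarrow> 'b measure \<Rightarrow> bool" where
  "past_process X K \<longleftrightarrow> (\<lambda>(t, nu). X t nu) \<in> measurable (borel \<Otimes>\<^sub>M confs) K \<and>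
     (\<forall>nu\<in>configs. \<forall>y t. t \<le> fst y \<longrightarrow> X t (add_point y nu) = X t nu)"

lemma past_processD:
  "past_process X K \<Longrightarrow> (\<lambda>(t, nu). X t nu) \<in> measurable (borel \<Otimes>\<^sub>M confs) K"
  "past_process X K \<Longrightarrow> nu \<in> configs \<Longrightarrow> t \<le> fst y \<Longrightarrow> X t (add_point y nu) = X t nu"
  by (simp_all add: past_process_def)

context poisson_plane begin

lemma compensation_time:
  assumes G: "(\<lambda>(y, nu). G y nu) \<in> borel_measurable (borel \<Otimes>\<^sub>M confs)"
    and inv: "\<And>y nu. nu \<in> configs \<Longrightarrow> G y (add_point y nu) = G y nu"
  shows "(\<integral>\<^sup>+nu. \<integral>\<^sup>+y. G y nu \<partial>nu \<partial>Q) = (\<integral>\<^sup>+s. \<integral>\<^sup>+nu. \<integral>\<^sup>+\<theta>. G (s, \<theta>) nu * indicator {0..} \<theta> \<partial>lborel \<partial>Q \<partial>lborel)"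
proof -
  interpret P: pair_sigma_finite lborel Q ..
  note [measurable] = G
  have "(\<integral>\<^sup>+nu. \<integral>\<^sup>+y. G y nu \<partial>nu \<partial>Q) = (\<integral>\<^sup>+y. \<integral>\<^sup>+nu. G y nu \<partial>Q \<partial>\<Lambda>)"
    by (rule compensation[OF G inv])
  also have "... = (\<integral>\<^sup>+nu. \<integral>\<^sup>+y. G y nu \<partial>\<Lambda> \<partial>Q)"
    by (rule \<Lambda>Q.Fubini'[symmetric]) measurable
  also have "... = (\<integral>\<^sup>+nu. \<integral>\<^sup>+s. \<integral>\<^sup>+\<theta>. G (s, \<theta>) nu * indicator {0..} \<theta> \<partial>lborel \<partial>lborel \<partial>Q)"
    by (intro nn_integral_cong nn_integral_\<Lambda> field_section[OF G]) auto
  also have "... = (\<integral>\<^sup>+s. \<integral>\<^sup>+nu. \<integral>\<^sup>+\<theta>. G (s, \<theta>) nu * indicator {0..} \<theta> \<partial>lborel \<partial>Q \<partial>lborel)"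
    by (rule P.Fubini') measurable
  finally show ?thesis .
qed

text \<open>The expected sum over accepted points becomes an integral against the level, since the
  marks below it have that length. The factor \<open>V\<close> admits a random weight, as long as it
  too is determined by the past.\<close>

lemma compensation_hit:
  assumes w [measurable]: "w \<in> borel_measurable borel"
    and V: "past_process V borel" and X: "past_process X borel"
  shows "(\<integral>\<^sup>+nu. \<integral>\<^sup>+y. w (fst y) * V (fst y) nu * ennreal (hit (X (fst y) nu) y) \<partial>nu \<partial>Q)
    = (\<integral>\<^sup>+s. w s * (\<integral>\<^sup>+nu. V s nu * ennreal (X s nu) \<partial>Q) \<partial>lborel)"
proof -
  note [measurable] = past_processD(1)[OF V] past_processD(1)[OF X]
  have "(\<integral>\<^sup>+nu. \<integral>\<^sup>+y. w (fst y) * V (fst y) nu * ennreal (hit (X (fst y) nu) y) \<partial>nu \<partial>Q)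
    = (\<integral>\<^sup>+s. \<integral>\<^sup>+nu. \<integral>\<^sup>+\<theta>. w (fst (s, \<theta>)) * V (fst (s, \<theta>)) nu * ennreal (hit (X (fst (s, \<theta>)) nu) (s, \<theta>)) * indicator {0..} \<theta> \<partial>lborel \<partial>Q \<partial>lborel)"
    by (rule compensation_time) (auto simp: past_processD(2)[OF V] past_processD(2)[OF X])
  also have "... = (\<integral>\<^sup>+s. \<integral>\<^sup>+nu. w s * (V s nu * ennreal (X s nu)) \<partial>Q \<partial>lborel)"
  proof (intro nn_integral_cong)
    fix s nu
    have "(\<integral>\<^sup>+\<theta>. w (fst (s, \<theta>)) * V (fst (s, \<theta>)) nu * ennreal (hit (X (fst (s, \<theta>)) nu) (s, \<theta>)) * indicator {0..} \<theta> \<partial>lborel)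
      = (\<integral>\<^sup>+\<theta>. (w s * V s nu) * (ennreal (hit (X s nu) (s, \<theta>)) * indicator {0..} \<theta>) \<partial>lborel)"
      by (simp add: mult.assoc)
    also have "... = w s * (V s nu * ennreal (X s nu))"
      by (simp add: nn_integral_cmult nn_integral_hit_all mult.assoc)
    finally show "(\<integral>\<^sup>+\<theta>. w (fst (s, \<theta>)) * V (fst (s, \<theta>)) nu * ennreal (hit (X (fst (s, \<theta>)) nu) (s, \<theta>)) * indicator {0..} \<theta> \<partial>lborel)
      = w s * (V s nu * ennreal (X s nu))" .
  qed
  also have "... = (\<integral>\<^sup>+s. w s * (\<integral>\<^sup>+nu. V s nu * ennreal (X s nu) \<partial>Q) \<partial>lborel)"
    by (intro nn_integral_cong nn_integral_cmult) measurable
  finally show ?thesis .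
qed

lemma compensation_hit_diff:
  assumes w [measurable]: "w \<in> borel_measurable borel"
    and X: "past_process X borel" and X': "past_process X' borel"
  shows "(\<integral>\<^sup>+nu. \<integral>\<^sup>+y. w (fst y) * ennreal \<bar>hit (X (fst y) nu) y - hit (X' (fst y) nu) y\<bar> \<partial>nu \<partial>Q)
    \<le> (\<integral>\<^sup>+s. w s * (\<integral>\<^sup>+nu. ennreal \<bar>X s nu - X' s nu\<bar> \<partial>Q) \<partial>lborel)"
proof -
  note [measurable] = past_processD(1)[OF X'] past_processD(1)[OF X]
  have "(\<integral>\<^sup>+nu. \<integral>\<^sup>+y. w (fst y) * ennreal \<bar>hit (X (fst y) nu) y - hit (X' (fst y) nu) y\<bar> \<partial>nu \<partial>Q)
    = (\<integral>\<^sup>+s. \<integral>\<^sup>+nu. \<integral>\<^sup>+\<theta>. w (fst (s, \<theta>)) * ennreal \<bar>hit (X (fst (s, \<theta>)) nu) (s, \<theta>) - hit (X' (fst (s, \<theta>)) nu) (s, \<theta>)\<bar> * indicator {0..} \<theta> \<partial>lborel \<partial>Q \<partial>lborel)"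
    by (rule compensation_time) (auto simp: past_processD(2)[OF X] past_processD(2)[OF X'])
  also have "... \<le> (\<integral>\<^sup>+s. \<integral>\<^sup>+nu. w s * ennreal \<bar>X s nu - X' s nu\<bar> \<partial>Q \<partial>lborel)"
  proof (intro nn_integral_mono)
    fix s nu
    have "(\<integral>\<^sup>+\<theta>. w (fst (s, \<theta>)) * ennreal \<bar>hit (X (fst (s, \<theta>)) nu) (s, \<theta>) - hit (X' (fst (s, \<theta>)) nu) (s, \<theta>)\<bar> * indicator {0..} \<theta> \<partial>lborel)
      = w s * (\<integral>\<^sup>+\<theta>. ennreal \<bar>hit (X s nu) (s, \<theta>) - hit (X' s nu) (s, \<theta>)\<bar> * indicator {0..} \<theta> \<partial>lborel)"
      by (simp add: nn_integral_cmult mult.assoc)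
    also have "... \<le> w s * ennreal \<bar>X s nu - X' s nu\<bar>"
      by (intro mult_left_mono nn_integral_hit_diff_le) simp
    finally show "(\<integral>\<^sup>+\<theta>. w (fst (s, \<theta>)) * ennreal \<bar>hit (X (fst (s, \<theta>)) nu) (s, \<theta>) - hit (X' (fst (s, \<theta>)) nu) (s, \<theta>)\<bar> * indicator {0..} \<theta> \<partial>lborel)
      \<le> w s * ennreal \<bar>X s nu - X' s nu\<bar>" .
  qed
  also have "... = (\<integral>\<^sup>+s. w s * (\<integral>\<^sup>+nu. ennreal \<bar>X s nu - X' s nu\<bar> \<partial>Q) \<partial>lborel)"
    by (intro nn_integral_cong nn_integral_cmult) measurable
  finally show ?thesis .
qed

definition gap :: "real \<Rightarrow> (real \<Rightarrow> (real \<times> real) measure \<Rightarrow> real) \<Rightarrow> (real \<Rightarrow> (real \<times> real) measure \<Rightarrow> real) \<Rightarrow> ennreal" where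
  "gap T X X' = (\<integral>\<^sup>+t. (\<integral>\<^sup>+nu. ennreal \<bar>X t nu - X' t nu\<bar> \<partial>Q) * indicator {0<..T} t \<partial>lborel)"

definition mass :: "real \<Rightarrow> (real \<Rightarrow> (real \<times> real) measure \<Rightarrow> real) \<Rightarrow> ennreal" where
  "mass T X = (\<integral>\<^sup>+t. (\<integral>\<^sup>+nu. ennreal (X t nu) \<partial>Q) * indicator {0<..T} t \<partial>lborel)"

lemma gap_triangle:
  assumes X: "past_process X borel" "past_process Y borel" "past_process Z borel"
  shows "gap T X Z \<le> gap T X Y + gap T Y Z"
proof -
  note [measurable] = past_processD(1)[OF X(1)] past_processD(1)[OF X(2)] past_processD(1)[OF X(3)]
  have "gap T X Z \<le> (\<integral>\<^sup>+t. ((\<integral>\<^sup>+nu. ennreal \<bar>X t nu - Y t nu\<bar> \<partial>Q) + (\<integral>\<^sup>+nu. ennreal \<bar>Y t nu - Z t nu\<bar> \<partial>Q)) * indicator {0<..T} t \<partial>lborel)"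
    unfolding gap_def
  proof (intro nn_integral_mono mult_right_mono)
    fix t
    have "(\<integral>\<^sup>+nu. ennreal \<bar>X t nu - Z t nu\<bar> \<partial>Q) \<le> (\<integral>\<^sup>+nu. ennreal \<bar>X t nu - Y t nu\<bar> + ennreal \<bar>Y t nu - Z t nu\<bar> \<partial>Q)"
      by (intro nn_integral_mono) (simp add: ennreal_plus[symmetric] ennreal_leI del: ennreal_plus)
    then show "(\<integral>\<^sup>+nu. ennreal \<bar>X t nu - Z t nu\<bar> \<partial>Q) \<le> (\<integral>\<^sup>+nu. ennreal \<bar>X t nu - Y t nu\<bar> \<partial>Q) + (\<integral>\<^sup>+nu. ennreal \<bar>Y t nu - Z t nu\<bar> \<partial>Q)"
      by (subst nn_integral_add[symmetric]) auto
  qed simp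
  also have "... = gap T X Y + gap T Y Z"
    unfolding gap_def by (simp add: distrib_right nn_integral_add)
  finally show ?thesis .
qed

lemma gap_commute: "gap T X Y = gap T Y X"
  unfolding gap_def by (simp add: abs_minus_commute)

lemma mass_le_gap:
  assumes X: "past_process X borel" "past_process Y borel"
  shows "mass T X \<le> mass T Y + gap T X Y"
proof -
  note [measurable] = past_processD(1)[OF X(1)] past_processD(1)[OF X(2)]
  have "mass T X \<le> (\<integral>\<^sup>+t. ((\<integral>\<^sup>+nu. ennreal (Y t nu) \<partial>Q) + (\<integral>\<^sup>+nu. ennreal \<bar>X t nu - Y t nu\<bar> \<partial>Q)) * indicator {0<..T} t \<partial>lborel)"
    unfolding mass_def
  proof (intro nn_integral_mono mult_right_mono)
    fix t
    have "ennreal x \<le> ennreal y + ennreal \<bar>x - y\<bar>" for x y :: real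
    proof -
      have "ennreal x \<le> ennreal (max 0 y + \<bar>x - y\<bar>)" by (intro ennreal_leI) auto
      also have "... = ennreal (max 0 y) + ennreal \<bar>x - y\<bar>" by (intro ennreal_plus) auto
      also have "ennreal (max 0 y) = ennreal y" by (simp add: max_def ennreal_neg)
      finally show ?thesis .
    qed
    then have "(\<integral>\<^sup>+nu. ennreal (X t nu) \<partial>Q) \<le> (\<integral>\<^sup>+nu. ennreal (Y t nu) + ennreal \<bar>X t nu - Y t nu\<bar> \<partial>Q)"
      by (intro nn_integral_mono)
    then show "(\<integral>\<^sup>+nu. ennreal (X t nu) \<partial>Q) \<le> (\<integral>\<^sup>+nu. ennreal (Y t nu) \<partial>Q) + (\<integral>\<^sup>+nu. ennreal \<bar>X t nu - Y t nu\<bar> \<partial>Q)"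
      by (subst nn_integral_add[symmetric]) auto
  qed simp
  also have "... = mass T Y + gap T X Y"
    unfolding gap_def mass_def by (simp add: distrib_right nn_integral_add)
  finally show ?thesis .
qed

end

locale hawkes_plane = poisson_plane Q \<Lambda> + hawkes_kernel \<phi> h \<mu> \<alpha>
  for Q \<Lambda> \<phi> h \<mu> \<alpha>
begin

lemma window_fst: "window t y = window t (fst y, 0)"
  by (simp add: window_def)

text \<open>The convolution inequality for \<open>L^1\<close> norms on a finite horizon. The
  restriction to (0, T] passes from t to s because the window requires 0 < s < t.\<close>

lemma window_conv:
  assumes [measurable]: "g \<in> borel_measurable borel"
  shows "(\<integral>\<^sup>+t. (\<integral>\<^sup>+s. ennreal (\<alpha> * \<bar>window t (s, 0)\<bar>) * g s \<partial>lborel) * indicator {0<..T} t \<partial>lborel)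
    \<le> ennreal \<rho> * (\<integral>\<^sup>+s. g s * indicator {0<..T} s \<partial>lborel)"
proof -
  have "(\<integral>\<^sup>+t. (\<integral>\<^sup>+s. ennreal (\<alpha> * \<bar>window t (s, 0)\<bar>) * g s \<partial>lborel) * indicator {0<..T} t \<partial>lborel)
    = (\<integral>\<^sup>+t. \<integral>\<^sup>+s. ennreal (\<alpha> * \<bar>window t (s, 0)\<bar>) * g s * indicator {0<..T} t \<partial>lborel \<partial>lborel)"
    by (intro nn_integral_cong nn_integral_multc[symmetric]) measurable
  also have "... = (\<integral>\<^sup>+s. \<integral>\<^sup>+t. ennreal (\<alpha> * \<bar>window t (s, 0)\<bar>) * g s * indicator {0<..T} t \<partial>lborel \<partial>lborel)"
    by (rule lborel_pair.Fubini') measurable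
  also have "... \<le> (\<integral>\<^sup>+s. ennreal \<rho> * (g s * indicator {0<..T} s) \<partial>lborel)"
  proof (rule nn_integral_mono)
    fix s
    have "(\<integral>\<^sup>+t. ennreal (\<alpha> * \<bar>window t (s, 0)\<bar>) * g s * indicator {0<..T} t \<partial>lborel)
      \<le> (\<integral>\<^sup>+t. ennreal (\<alpha> * \<bar>window t (s, 0)\<bar>) * (g s * indicator {0<..T} s) \<partial>lborel)"
      by (intro nn_integral_mono) (auto simp: window_def split: split_indicator)
    also have "... = (\<integral>\<^sup>+t. ennreal (\<alpha> * \<bar>window t (s, 0)\<bar>) \<partial>lborel) * (g s * indicator {0<..T} s)"
      by (intro nn_integral_multc) measurable
    also have "... \<le> ennreal \<rho> * (g s * indicator {0<..T} s)"
      by (intro mult_right_mono window_mass) simp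
    finally show "(\<integral>\<^sup>+t. ennreal (\<alpha> * \<bar>window t (s, 0)\<bar>) * g s * indicator {0<..T} t \<partial>lborel)
      \<le> ennreal \<rho> * (g s * indicator {0<..T} s)" .
  qed
  also have "... = ennreal \<rho> * (\<integral>\<^sup>+s. g s * indicator {0<..T} s \<partial>lborel)"
    by (intro nn_integral_cmult) measurable
  finally show ?thesis .
qed

lemma past_iter: "0 \<le> b \<Longrightarrow> past_process (iter b n) borel"
proof -
  assume b: "0 \<le> b"
  \<comment> \<open>The horizon 1 is arbitrary; the iterates do not depend on it.\<close>
  interpret I: hawkes_iterates Q \<Lambda> \<phi> h \<mu> \<alpha> b 1 by unfold_locales (use b in auto)
  show ?thesis using measurable_iter I.lam_add_point by (simp add: past_process_def)
qed

end

section \<open>Solutions of the equation with empty history\<close>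

locale hawkes_solution = hawkes_plane Q \<Lambda> \<phi> h \<mu> \<alpha>
  for Q \<Lambda> \<phi> h \<mu> \<alpha> +
  fixes L :: "real \<Rightarrow> (real \<times> real) measure \<Rightarrow> real"
  assumes L_past: "past_process L borel"
    and L_eq: "0 < t \<Longrightarrow> AE nu in Q. L t nu = h (\<mu> + (LINT y|nu. window t y * hit (L (fst y) nu) y))"
    and L_local: "AE nu in Q. (\<integral>\<^sup>+u. ennreal (L u nu) * indicator {0<..T} u \<partial>lborel) < \<infinity>"
begin

lemmas L_measurable [measurable] = past_processD(1)[OF L_past]

lemma L_nonneg: "0 < t \<Longrightarrow> AE nu in Q. 0 \<le> L t nu"
  using L_eq[of t] h_nonneg by auto

text \<open>The mean satisfies a contraction inequality that is conclusive only if it is finite. The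
  weight \<open>W k\<close> is 1 while the intensity accumulated before the present time is at most
  k, which bounds the weighted mass by k. It is determined by the past, and it decreases in time, so
  its value at t may be replaced by its value at the earlier points under the integral. Local
  integrability removes it by monotone convergence.\<close>

lemma L_mass_bound: "mass T L \<le> ennreal (h \<mu> * max 0 T / (1 - \<rho>))"
proof -
  define A where "A t nu = (\<integral>\<^sup>+u. ennreal (L u nu) * indicator {0<..<t} u \<partial>lborel)" for t nu
  define W where "W k t nu = (if A t nu \<le> of_nat k then 1 else 0 :: ennreal)" for k :: nat and t nu
  have ind: "indicator {0<..<t} u = (if 0 < u \<and> u < t then 1 else 0 :: ennreal)" for t u :: real
    by (simp add: indicator_def)
  have A_meas [measurable]: "(\<lambda>(t, nu). A t nu) \<in> borel_measurable (borel \<Otimes>\<^sub>M confs)"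
    unfolding A_def ind by measurable
  have A_past: "A t (add_point y nu) = A t nu" if "nu \<in> configs" "t \<le> fst y" for t y nu
    unfolding A_def using that past_processD(2)[OF L_past]
    by (intro nn_integral_cong) (auto split: split_indicator)
  have A_mono: "A s nu \<le> A t nu" if "s \<le> t" for s t nu
    unfolding A_def using that by (intro nn_integral_mono) (auto split: split_indicator)
  have W: "past_process (W k) borel" for k
    unfolding past_process_def W_def using A_past by auto
  have W_meas [measurable]: "(\<lambda>(t, nu). W k t nu) \<in> borel_measurable (borel \<Otimes>\<^sub>M confs)" for k
    by (rule past_processD(1)[OF W])
  interpret P: pair_sigma_finite lborel Q ..
  define G where "G k = (\<integral>\<^sup>+t. (\<integral>\<^sup>+nu. W k t nu * ennreal (L t nu) \<partial>Q) * indicator {0<..T} t \<partial>lborel)" for k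
  have G_eq: "G k = (\<integral>\<^sup>+nu. \<integral>\<^sup>+t. W k t nu * ennreal (L t nu) * indicator {0<..T} t \<partial>lborel \<partial>Q)" for k
  proof -
    have "G k = (\<integral>\<^sup>+t. \<integral>\<^sup>+nu. W k t nu * ennreal (L t nu) * indicator {0<..T} t \<partial>Q \<partial>lborel)"
      unfolding G_def by (intro nn_integral_cong nn_integral_multc[symmetric]) measurable
    also have "... = (\<integral>\<^sup>+nu. \<integral>\<^sup>+t. W k t nu * ennreal (L t nu) * indicator {0<..T} t \<partial>lborel \<partial>Q)"
      by (rule P.Fubini'[symmetric]) measurable
    finally show ?thesis .
  qed
  have G_fin: "G k < \<infinity>" for k
  proof -
    have "G k \<le> (\<integral>\<^sup>+nu. of_nat k \<partial>Q)"
      unfolding G_eq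
    proof (rule nn_integral_mono)
      fix nu assume "nu \<in> space Q"
      then have [measurable]: "(\<lambda>u. L u nu) \<in> borel_measurable borel"
        using measurable_compose[OF measurable_Pair2'[of nu confs borel] L_measurable] by simp
      show "(\<integral>\<^sup>+t. W k t nu * ennreal (L t nu) * indicator {0<..T} t \<partial>lborel) \<le> of_nat k"
        using stopped_integral_le[of "\<lambda>u. ennreal (L u nu)" "of_nat k" T]
        unfolding W_def A_def by (simp add: if_distrib[of "\<lambda>x. x * _"] cong: if_cong)
    qed
    also have "... < \<infinity>" by (simp add: of_nat_less_top)
    finally show ?thesis .
  qed
  have G_step: "G k \<le> ennreal \<rho> * G k + ennreal (h \<mu> * max 0 T)" for k
  proof -
    have pt: "(\<integral>\<^sup>+nu. W k t nu * ennreal (L t nu) \<partial>Q)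
      \<le> ennreal (h \<mu>) + (\<integral>\<^sup>+s. ennreal (\<alpha> * \<bar>window t (s, 0)\<bar>) * (\<integral>\<^sup>+nu. W k s nu * ennreal (L s nu) \<partial>Q) \<partial>lborel)"
      if t: "0 < t" for t
    proof -
      have "(\<integral>\<^sup>+nu. W k t nu * ennreal (L t nu) \<partial>Q)
        \<le> (\<integral>\<^sup>+nu. ennreal (h \<mu>) + (\<integral>\<^sup>+y. ennreal (\<alpha> * \<bar>window t (fst y, 0)\<bar>) * W k (fst y) nu * ennreal (hit (L (fst y) nu) y) \<partial>nu) \<partial>Q)"
      proof (rule nn_integral_mono_AE)
        have "AE nu in Q. nu \<in> space Q" by (rule AE_space)
        with L_eq[OF t]
        show "AE nu in Q. W k t nu * ennreal (L t nu)
          \<le> ennreal (h \<mu>) + (\<integral>\<^sup>+y. ennreal (\<alpha> * \<bar>window t (fst y, 0)\<bar>) * W k (fst y) nu * ennreal (hit (L (fst y) nu) y) \<partial>nu)"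
        proof eventually_elim
          case (elim nu)
          let ?g = "\<lambda>y. window t y * hit (L (fst y) nu) y"
          show ?case
          proof (cases "A t nu \<le> of_nat k")
            case True
            have "ennreal (L t nu) \<le> ennreal (h \<mu> + \<alpha> * \<bar>LINT y|nu. ?g y\<bar>)"
              using h_diff[of "\<mu> + (LINT y|nu. ?g y)" \<mu>] unfolding elim(1) by (intro ennreal_leI) simp
            also have "... = ennreal (h \<mu>) + ennreal (\<alpha> * \<bar>LINT y|nu. ?g y\<bar>)"
              using h_nonneg \<alpha>_nonneg by (intro ennreal_plus) auto
            also have "ennreal (\<alpha> * \<bar>LINT y|nu. ?g y\<bar>) = ennreal \<bar>LINT y|nu. \<alpha> * ?g y\<bar>"
              using \<alpha>_nonneg by (simp add: abs_mult)
            also have "... \<le> (\<integral>\<^sup>+y. ennreal \<bar>\<alpha> * ?g y\<bar> \<partial>nu)" by (rule ennreal_abs_integral_le)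
            also have "... \<le> (\<integral>\<^sup>+y. ennreal (\<alpha> * \<bar>window t (fst y, 0)\<bar>) * W k (fst y) nu * ennreal (hit (L (fst y) nu) y) \<partial>nu)"
            proof (rule nn_integral_mono)
              fix y
              show "ennreal \<bar>\<alpha> * ?g y\<bar> \<le> ennreal (\<alpha> * \<bar>window t (fst y, 0)\<bar>) * W k (fst y) nu * ennreal (hit (L (fst y) nu) y)"
              proof (cases "fst y < t")
                case inside: True
                \<comment> \<open>Less intensity has accumulated by the earlier time, so the weight
                  there is 1 as well.\<close>
                then have "W k (fst y) nu = 1" using A_mono[of "fst y" t nu] True by (simp add: W_def)
                then show ?thesis
                  using \<alpha>_nonneg by (simp add: abs_mult ennreal_mult window_fst[of t y] mult.assoc)
              qed (simp add: window_def)
            qed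
            finally show ?thesis using True by (simp add: W_def add_left_mono)
          qed (simp add: W_def)
        qed
      qed
      also have "... = ennreal (h \<mu>) + (\<integral>\<^sup>+nu. \<integral>\<^sup>+y. ennreal (\<alpha> * \<bar>window t (fst y, 0)\<bar>) * W k (fst y) nu * ennreal (hit (L (fst y) nu) y) \<partial>nu \<partial>Q)"
        by (subst nn_integral_add) auto
      also have "(\<integral>\<^sup>+nu. \<integral>\<^sup>+y. ennreal (\<alpha> * \<bar>window t (fst y, 0)\<bar>) * W k (fst y) nu * ennreal (hit (L (fst y) nu) y) \<partial>nu \<partial>Q)
        = (\<integral>\<^sup>+s. ennreal (\<alpha> * \<bar>window t (s, 0)\<bar>) * (\<integral>\<^sup>+nu. W k s nu * ennreal (L s nu) \<partial>Q) \<partial>lborel)"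
        by (rule compensation_hit[OF _ W L_past]) measurable
      finally show ?thesis .
    qed
    have "G k \<le> (\<integral>\<^sup>+t. ennreal (h \<mu>) * indicator {0<..T} t
        + (\<integral>\<^sup>+s. ennreal (\<alpha> * \<bar>window t (s, 0)\<bar>) * (\<integral>\<^sup>+nu. W k s nu * ennreal (L s nu) \<partial>Q) \<partial>lborel) * indicator {0<..T} t \<partial>lborel)"
      unfolding G_def using pt by (intro nn_integral_mono) (auto split: split_indicator)
    also have "... = (\<integral>\<^sup>+t. ennreal (h \<mu>) * indicator {0<..T} t \<partial>lborel)
        + (\<integral>\<^sup>+t. (\<integral>\<^sup>+s. ennreal (\<alpha> * \<bar>window t (s, 0)\<bar>) * (\<integral>\<^sup>+nu. W k s nu * ennreal (L s nu) \<partial>Q) \<partial>lborel) * indicator {0<..T} t \<partial>lborel)"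
      by (intro nn_integral_add) measurable
    also have "(\<integral>\<^sup>+t. ennreal (h \<mu>) * indicator {0<..T} t \<partial>lborel) = ennreal (h \<mu> * max 0 T)"
      using h_nonneg by (cases "0 \<le> T") (simp_all add: nn_integral_cmult_indicator ennreal_mult)
    also have "(\<integral>\<^sup>+t. (\<integral>\<^sup>+s. ennreal (\<alpha> * \<bar>window t (s, 0)\<bar>) * (\<integral>\<^sup>+nu. W k s nu * ennreal (L s nu) \<partial>Q) \<partial>lborel) * indicator {0<..T} t \<partial>lborel)
      \<le> ennreal \<rho> * (\<integral>\<^sup>+s. (\<integral>\<^sup>+nu. W k s nu * ennreal (L s nu) \<partial>Q) * indicator {0<..T} s \<partial>lborel)"
      by (rule window_conv) measurable
    finally show ?thesis by (simp add: G_def add.commute add_left_mono)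
  qed
  have G_bound: "G k \<le> ennreal (h \<mu> * max 0 T / (1 - \<rho>))" for k
    using G_step G_fin \<rho>_bounds h_nonneg by (intro ennreal_contraction) auto
  have "mass T L = (\<integral>\<^sup>+t. \<integral>\<^sup>+nu. ennreal (L t nu) * indicator {0<..T} t \<partial>Q \<partial>lborel)"
    unfolding mass_def by (intro nn_integral_cong nn_integral_multc[symmetric]) measurable
  also have "... = (\<integral>\<^sup>+nu. \<integral>\<^sup>+t. ennreal (L t nu) * indicator {0<..T} t \<partial>lborel \<partial>Q)"
    by (rule P.Fubini'[symmetric]) measurable
  also have "... \<le> (\<integral>\<^sup>+nu. (SUP k. \<integral>\<^sup>+t. W k t nu * ennreal (L t nu) * indicator {0<..T} t \<partial>lborel) \<partial>Q)"
  proof (rule nn_integral_mono_AE)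
    show "AE nu in Q. (\<integral>\<^sup>+t. ennreal (L t nu) * indicator {0<..T} t \<partial>lborel)
      \<le> (SUP k. \<integral>\<^sup>+t. W k t nu * ennreal (L t nu) * indicator {0<..T} t \<partial>lborel)"
      using L_local[of T]
    proof eventually_elim
      case (elim nu)
      then obtain r where r: "(\<integral>\<^sup>+u. ennreal (L u nu) * indicator {0<..T} u \<partial>lborel) = ennreal r" "0 \<le> r"
        by (cases "\<integral>\<^sup>+u. ennreal (L u nu) * indicator {0<..T} u \<partial>lborel") auto
      obtain k :: nat where k: "r \<le> real k" using real_arch_simple by blast
      have "A t nu \<le> of_nat k" if "t \<in> {0<..T}" for t
      proof -
        have "A t nu \<le> ennreal r" unfolding A_def r(1)[symmetric]
          using that by (intro nn_integral_mono) (auto split: split_indicator)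
        also have "... \<le> of_nat k" using k by (simp add: ennreal_of_nat_eq_real_of_nat ennreal_leI)
        finally show ?thesis .
      qed
      then have "(\<integral>\<^sup>+t. ennreal (L t nu) * indicator {0<..T} t \<partial>lborel) = (\<integral>\<^sup>+t. W k t nu * ennreal (L t nu) * indicator {0<..T} t \<partial>lborel)"
        by (intro nn_integral_cong) (auto simp: W_def split: split_indicator)
      then show ?case by (simp only:) (rule SUP_upper, simp)
    qed
  qed
  also have "... = (SUP k. G k)"
    unfolding G_eq
  proof (rule nn_integral_monotone_convergence_SUP)
    have "W k t nu \<le> W (Suc k) t nu" for k t nu
      using order_trans[of "A t nu" "of_nat k" "of_nat (Suc k)"] of_nat_mono[of k "Suc k", where 'a=ennreal]
      by (auto simp: W_def simp del: of_nat_Suc)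
    then show "incseq (\<lambda>k nu. \<integral>\<^sup>+t. W k t nu * ennreal (L t nu) * indicator {0<..T} t \<partial>lborel)"
      by (intro incseq_SucI le_funI nn_integral_mono mult_right_mono) auto
  qed measurable
  also have "... \<le> ennreal (h \<mu> * max 0 T / (1 - \<rho>))" by (intro SUP_least G_bound)
  finally show ?thesis .
qed

lemma L_mass_finite: "mass T L < \<infinity>"
  using L_mass_bound by (rule order_le_less_trans) simp

lemma L_abs_mass: "(\<integral>\<^sup>+t. (\<integral>\<^sup>+nu. ennreal \<bar>L t nu\<bar> \<partial>Q) * indicator {0<..T} t \<partial>lborel) = mass T L"
  unfolding mass_def
proof (rule nn_integral_cong)
  fix t
  have "0 < t \<Longrightarrow> (\<integral>\<^sup>+nu. ennreal \<bar>L t nu\<bar> \<partial>Q) = (\<integral>\<^sup>+nu. ennreal (L t nu) \<partial>Q)"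
    using L_nonneg[of t] by (intro nn_integral_cong_AE) auto
  then show "(\<integral>\<^sup>+nu. ennreal \<bar>L t nu\<bar> \<partial>Q) * indicator {0<..T} t = (\<integral>\<^sup>+nu. ennreal (L t nu) \<partial>Q) * indicator {0<..T} t"
    by (auto split: split_indicator)
qed

text \<open>Local boundedness of the kernel reduces the claim to the finite mean of the number of
  accepted points on the window.\<close>

lemma window_L_integrable: "AE nu in Q. integrable nu (\<lambda>y. window t y * hit (L (fst y) nu) y)"
proof -
  obtain K where K: "\<And>u. u \<in> {0..t} \<Longrightarrow> \<bar>\<phi> u\<bar> \<le> K" using \<phi>_bounded[of t] by blast
  let ?n = "\<lambda>nu. \<integral>\<^sup>+y. ennreal \<bar>window t (fst y, 0)\<bar> * 1 * ennreal (hit (L (fst y) nu) y) \<partial>nu"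
  have "(\<integral>\<^sup>+nu. ?n nu \<partial>Q) = (\<integral>\<^sup>+s. ennreal \<bar>window t (s, 0)\<bar> * (\<integral>\<^sup>+nu. 1 * ennreal (L s nu) \<partial>Q) \<partial>lborel)"
    by (rule compensation_hit[OF _ _ L_past]) (auto simp: past_process_def)
  also have "... \<le> (\<integral>\<^sup>+s. ennreal \<bar>K\<bar> * ((\<integral>\<^sup>+nu. ennreal (L s nu) \<partial>Q) * indicator {0<..t} s) \<partial>lborel)"
  proof (rule nn_integral_mono)
    fix s
    have "ennreal \<bar>window t (s, 0)\<bar> \<le> ennreal \<bar>K\<bar> * indicator {0<..t} s"
      using K[of "t - s"] by (auto simp: window_def intro!: ennreal_leI split: split_indicator)
    then have "ennreal \<bar>window t (s, 0)\<bar> * (\<integral>\<^sup>+nu. ennreal (L s nu) \<partial>Q) \<le> ennreal \<bar>K\<bar> * indicator {0<..t} s * (\<integral>\<^sup>+nu. ennreal (L s nu) \<partial>Q)"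
      by (rule mult_right_mono) simp
    then show "ennreal \<bar>window t (s, 0)\<bar> * (\<integral>\<^sup>+nu. 1 * ennreal (L s nu) \<partial>Q) \<le> ennreal \<bar>K\<bar> * ((\<integral>\<^sup>+nu. ennreal (L s nu) \<partial>Q) * indicator {0<..t} s)"
      by (simp add: mult.assoc mult.commute[of "indicator {0<..t} s"])
  qed
  also have "... = ennreal \<bar>K\<bar> * mass t L" unfolding mass_def by (intro nn_integral_cmult) measurable
  also have "... < \<infinity>" using L_mass_finite by (simp add: ennreal_mult_less_top)
  finally have "(\<integral>\<^sup>+nu. ?n nu \<partial>Q) \<noteq> \<infinity>" by simp
  then have "AE nu in Q. ?n nu \<noteq> \<infinity>" by (intro nn_integral_PInf_AE) measurable
  moreover have "AE nu in Q. nu \<in> space Q" by (rule AE_space)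
  ultimately show ?thesis
  proof eventually_elim
    case (elim nu)
    then have nu: "nu \<in> configs" by simp
    have m: "(\<lambda>y. window t y * hit (L (fst y) nu) y) \<in> borel_measurable nu"
      by (rule field_section[of "\<lambda>y nu. window t y * hit (L (fst y) nu) y", OF _ nu]) (use nu in auto)
    have n: "(\<integral>\<^sup>+y. ennreal (norm (window t y * hit (L (fst y) nu) y)) \<partial>nu) = ?n nu"
      by (intro nn_integral_cong) (simp add: abs_mult ennreal_mult window_fst[of t, symmetric])
    show ?case
    proof (rule integrableI_bounded[OF m])
      show "(\<integral>\<^sup>+y. ennreal (norm (window t y * hit (L (fst y) nu) y)) \<partial>nu) < \<infinity>"
        unfolding n using elim(1) by (simp add: less_top)
    qed
  qed
qed

definition mart :: "real \<Rightarrow> (real \<times> real) measure \<Rightarrow> real" where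
  "mart T nu = (LINT y|nu. indicator {0<..T} (fst y) * hit (L (fst y) nu) y) - (LINT u|lborel. indicator {0<..T} u * L u nu)"

end

section \<open>Approximation of a solution by capped iterates\<close>

context hawkes_solution begin

text \<open>The cap costs the expected excess of \<open>L\<close> over \<open>b\<close>. Apart from
  this the iteration map is a contraction in the mean with factor \<rho>.\<close>

lemma gap_step:
  assumes b: "0 \<le> b"
  shows "gap T L (iter b (Suc n)) \<le> mass T (\<lambda>t nu. L t nu - b) + ennreal \<rho> * gap T L (iter b n)"
proof -
  interpret I: hawkes_iterates Q \<Lambda> \<phi> h \<mu> \<alpha> b 1 by unfold_locales (use b in auto)
  have pt: "(\<integral>\<^sup>+nu. ennreal \<bar>L t nu - iter b (Suc n) t nu\<bar> \<partial>Q)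
    \<le> (\<integral>\<^sup>+nu. ennreal (L t nu - b) \<partial>Q) + (\<integral>\<^sup>+s. ennreal (\<alpha> * \<bar>window t (s, 0)\<bar>) * (\<integral>\<^sup>+nu. ennreal \<bar>L s nu - iter b n s nu\<bar> \<partial>Q) \<partial>lborel)"
    if t: "0 < t" for t
  proof -
    let ?d = "\<lambda>nu. \<integral>\<^sup>+y. ennreal (\<alpha> * \<bar>window t (fst y, 0)\<bar>) * ennreal \<bar>hit (L (fst y) nu) y - hit (iter b n (fst y) nu) y\<bar> \<partial>nu"
    have "(\<integral>\<^sup>+nu. ennreal \<bar>L t nu - iter b (Suc n) t nu\<bar> \<partial>Q) \<le> (\<integral>\<^sup>+nu. ennreal (L t nu - b) + ?d nu \<partial>Q)"
    proof (rule nn_integral_mono_AE)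
      have "AE nu in Q. nu \<in> space Q" by (rule AE_space)
      with L_eq[OF t] window_L_integrable[of t]
      show "AE nu in Q. ennreal \<bar>L t nu - iter b (Suc n) t nu\<bar> \<le> ennreal (L t nu - b) + ?d nu"
      proof eventually_elim
        case (elim nu)
        then have nu: "nu \<in> configs" by simp
        let ?a = "\<lambda>y. window t y * hit (L (fst y) nu) y" and ?a' = "\<lambda>y. window t y * hit (iter b n (fst y) nu) y"
        have "\<bar>r - min b q\<bar> \<le> max 0 (r - b) + \<bar>r - q\<bar>" for r q :: real by (auto simp: min_def max_def)
        then have "\<bar>L t nu - iter b (Suc n) t nu\<bar> \<le> max 0 (L t nu - b) + \<bar>h (\<mu> + (LINT y|nu. ?a y)) - h (\<mu> + (LINT y|nu. ?a' y))\<bar>"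
          by (simp only: elim(1) iter.simps)
        also have "... \<le> max 0 (L t nu - b) + \<alpha> * \<bar>(LINT y|nu. ?a y) - (LINT y|nu. ?a' y)\<bar>"
          using h_diff[of "\<mu> + (LINT y|nu. ?a y)" "\<mu> + (LINT y|nu. ?a' y)"] by simp
        finally have "ennreal \<bar>L t nu - iter b (Suc n) t nu\<bar> \<le> ennreal (max 0 (L t nu - b) + \<alpha> * \<bar>(LINT y|nu. ?a y) - (LINT y|nu. ?a' y)\<bar>)"
          by (rule ennreal_leI)
        also have "... = ennreal (max 0 (L t nu - b)) + ennreal (\<alpha> * \<bar>(LINT y|nu. ?a y) - (LINT y|nu. ?a' y)\<bar>)"
          using \<alpha>_nonneg by (intro ennreal_plus) auto
        also have "ennreal (max 0 (L t nu - b)) = ennreal (L t nu - b)" by (simp add: max_def ennreal_neg)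
        also have "ennreal (\<alpha> * \<bar>(LINT y|nu. ?a y) - (LINT y|nu. ?a' y)\<bar>) \<le> (\<integral>\<^sup>+y. ennreal (\<alpha> * \<bar>?a y - ?a' y\<bar>) \<partial>nu)"
          by (rule ennreal_abs_integral_diff[OF elim(2) I.window_hit_integrable[OF nu nu] \<alpha>_nonneg])
        also have "... = ?d nu"
        proof (intro nn_integral_cong)
          fix y
          have "?a y - ?a' y = window t (fst y, 0) * (hit (L (fst y) nu) y - hit (iter b n (fst y) nu) y)"
            by (simp add: window_def right_diff_distrib)
          then show "ennreal (\<alpha> * \<bar>?a y - ?a' y\<bar>) = ennreal (\<alpha> * \<bar>window t (fst y, 0)\<bar>) * ennreal \<bar>hit (L (fst y) nu) y - hit (iter b n (fst y) nu) y\<bar>"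
            using \<alpha>_nonneg by (simp add: abs_mult ennreal_mult mult.assoc)
        qed
        finally show ?case by (simp add: add_left_mono)
      qed
    qed
    also have "... = (\<integral>\<^sup>+nu. ennreal (L t nu - b) \<partial>Q) + (\<integral>\<^sup>+nu. ?d nu \<partial>Q)" by (intro nn_integral_add) measurable
    also have "(\<integral>\<^sup>+nu. ?d nu \<partial>Q) \<le> (\<integral>\<^sup>+s. ennreal (\<alpha> * \<bar>window t (s, 0)\<bar>) * (\<integral>\<^sup>+nu. ennreal \<bar>L s nu - iter b n s nu\<bar> \<partial>Q) \<partial>lborel)"
      by (rule compensation_hit_diff[OF _ L_past past_iter[OF b]]) measurable
    finally show ?thesis by (simp add: add_left_mono)
  qed
  have "gap T L (iter b (Suc n)) \<le> (\<integral>\<^sup>+t. (\<integral>\<^sup>+nu. ennreal (L t nu - b) \<partial>Q) * indicator {0<..T} t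
      + (\<integral>\<^sup>+s. ennreal (\<alpha> * \<bar>window t (s, 0)\<bar>) * (\<integral>\<^sup>+nu. ennreal \<bar>L s nu - iter b n s nu\<bar> \<partial>Q) \<partial>lborel) * indicator {0<..T} t \<partial>lborel)"
    unfolding gap_def using pt by (intro nn_integral_mono) (auto simp del: iter.simps split: split_indicator)
  also have "... = mass T (\<lambda>t nu. L t nu - b)
      + (\<integral>\<^sup>+t. (\<integral>\<^sup>+s. ennreal (\<alpha> * \<bar>window t (s, 0)\<bar>) * (\<integral>\<^sup>+nu. ennreal \<bar>L s nu - iter b n s nu\<bar> \<partial>Q) \<partial>lborel) * indicator {0<..T} t \<partial>lborel)"
    unfolding mass_def by (intro nn_integral_add) measurable
  also have "... \<le> mass T (\<lambda>t nu. L t nu - b) + ennreal \<rho> * gap T L (iter b n)"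
    unfolding gap_def by (intro add_left_mono window_conv) measurable
  finally show ?thesis .
qed

lemma gap_iter_zero: "gap T L (iter b 0) = mass T L"
  unfolding L_abs_mass[symmetric] gap_def by simp

lemma gap_iter:
  assumes b: "0 \<le> b"
  shows "gap T L (iter b n) \<le> ennreal (1 / (1 - \<rho>)) * mass T (\<lambda>t nu. L t nu - b) + ennreal (\<rho> ^ n) * mass T L"
proof (induction n)
  case 0 show ?case unfolding gap_iter_zero by simp
next
  case (Suc n)
  let ?e = "mass T (\<lambda>t nu. L t nu - b)"
  have "gap T L (iter b (Suc n)) \<le> ?e + ennreal \<rho> * (ennreal (1 / (1 - \<rho>)) * ?e + ennreal (\<rho> ^ n) * mass T L)"
    by (intro order_trans[OF gap_step[OF b]] add_left_mono mult_left_mono Suc) simp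
  also have "... = (1 + ennreal (\<rho> * (1 / (1 - \<rho>)))) * ?e + ennreal (\<rho> ^ Suc n) * mass T L"
  proof -
    have "ennreal (\<rho> * (1 / (1 - \<rho>))) = ennreal \<rho> * ennreal (1 / (1 - \<rho>))" "ennreal (\<rho> ^ Suc n) = ennreal \<rho> * ennreal (\<rho> ^ n)"
      unfolding power_Suc using \<rho>_bounds by (intro ennreal_mult; simp)+
    then show ?thesis by (simp only: distrib_left distrib_right mult_1_left mult.assoc add.assoc)
  qed
  also have "1 + ennreal (\<rho> * (1 / (1 - \<rho>))) = ennreal (1 + \<rho> * (1 / (1 - \<rho>)))"
    using \<rho>_bounds by (subst ennreal_plus) auto
  also have "1 + \<rho> * (1 / (1 - \<rho>)) = 1 / (1 - \<rho>)" using \<rho>_bounds by (simp add: field_simps)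
  finally show ?case .
qed

text \<open>Dominated convergence with the intensity itself as majorant: the excess over the cap is
  eventually 0 at each time and configuration.\<close>

lemma excess_tendsto: "(\<lambda>k. mass T (\<lambda>t nu. L t nu - real k)) \<longlonglongrightarrow> 0"
proof -
  let ?P = "(lborel :: real measure) \<Otimes>\<^sub>M Q"
  have eq: "mass T X = (\<integral>\<^sup>+p. ennreal (X (fst p) (snd p)) * indicator {0<..T} (fst p) \<partial>?P)"
    if [measurable]: "(\<lambda>(t, nu). X t nu) \<in> borel_measurable (borel \<Otimes>\<^sub>M confs)" for X
    unfolding mass_def
    by (subst Q.nn_integral_fst[symmetric]) (auto intro!: nn_integral_cong nn_integral_multc[symmetric])
  define u where "u k p = ennreal (L (fst p) (snd p) - real k) * indicator {0<..T} (fst p)" for k p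
  have [measurable]: "u k \<in> borel_measurable ?P" for k unfolding u_def by measurable
  have "(\<lambda>k. integral\<^sup>N ?P (u k)) \<longlonglongrightarrow> integral\<^sup>N ?P (\<lambda>_. 0)"
  proof (rule nn_integral_dominated_convergence[where w="\<lambda>p. ennreal (L (fst p) (snd p)) * indicator {0<..T} (fst p)"])
    show "(\<integral>\<^sup>+p. ennreal (L (fst p) (snd p)) * indicator {0<..T} (fst p) \<partial>?P) < \<infinity>"
      using L_mass_finite[of T] eq[OF L_measurable] by simp
    show "AE p in ?P. u k p
        \<le> ennreal (L (fst p) (snd p)) * indicator {0<..T} (fst p)" for k
      unfolding u_def by (intro AE_I2 mult_right_mono ennreal_leI) auto
    show "AE p in ?P. (\<lambda>k. u k p) \<longlonglongrightarrow> 0"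
    proof (intro AE_I2 tendsto_eventually)
      fix p
      obtain N :: nat where "L (fst p) (snd p) \<le> real N" using real_arch_simple by blast
      then show "\<forall>\<^sub>F k in sequentially. u k p = 0"
        by (intro eventually_sequentiallyI[of N]) (simp add: u_def ennreal_neg)
    qed
  qed measurable
  moreover have "mass T (\<lambda>t nu. L t nu - real k) = integral\<^sup>N ?P (u k)" for k
    unfolding u_def by (rule eq) measurable
  ultimately show ?thesis by simp
qed

lemma iter_approx:
  assumes "0 < \<epsilon>"
  shows "\<exists>k n. gap T L (iter (real k) n) \<le> ennreal \<epsilon>"
proof -
  \<comment> \<open>The error of the cap is amplified by 1 / (1 - \<rho>), so this choice turns it
    into half of \<epsilon>. The number of iterations, which takes care of the other half, does not
    depend on the cap.\<close>
  define \<delta> where "\<delta> = \<epsilon> * (1 - \<rho>) / 2"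
  have \<delta>: "0 < \<delta>" using assms \<rho>_bounds by (simp add: \<delta>_def)
  have "\<forall>\<^sub>F k in sequentially. mass T (\<lambda>t nu. L t nu - real k) < ennreal \<delta>"
    using order_tendstoD(2)[OF excess_tendsto, of "ennreal \<delta>"] \<delta> by simp
  then obtain k where k: "mass T (\<lambda>t nu. L t nu - real k) < ennreal \<delta>"
    by (auto simp: eventually_sequentially)
  obtain m where m: "mass T L = ennreal m" "0 \<le> m" using L_mass_finite[of T] by (cases "mass T L") auto
  have "(\<lambda>n. \<rho> ^ n * m) \<longlonglongrightarrow> 0 * m"
    using \<rho>_bounds by (intro tendsto_mult LIMSEQ_realpow_zero tendsto_const) auto
  then have "\<forall>\<^sub>F n in sequentially. \<rho> ^ n * m < \<epsilon> / 2"
    using assms order_tendstoD(2)[of "\<lambda>n. \<rho> ^ n * m" 0 sequentially "\<epsilon> / 2"] by simp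
  then obtain n where n: "\<rho> ^ n * m < \<epsilon> / 2" by (auto simp: eventually_sequentially)
  have "gap T L (iter (real k) n) \<le> ennreal (1 / (1 - \<rho>)) * ennreal \<delta> + ennreal (\<rho> ^ n) * ennreal m"
    unfolding m(1)[symmetric] using k
    by (intro order_trans[OF gap_iter] add_mono mult_left_mono) auto
  also have "... = ennreal (1 / (1 - \<rho>) * \<delta> + \<rho> ^ n * m)"
    using \<rho>_bounds \<delta> m(2) by (simp add: ennreal_mult'[symmetric] ennreal_plus[symmetric] del: ennreal_plus)
  also have "1 / (1 - \<rho>) * \<delta> = \<epsilon> / 2" using \<rho>_bounds by (simp add: \<delta>_def)
  also have "ennreal (\<epsilon> / 2 + \<rho> ^ n * m) \<le> ennreal \<epsilon>" using n by (intro ennreal_leI) simp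
  finally show ?thesis by blast
qed

lemma hit_L_integrable: "AE nu in Q. integrable nu (\<lambda>y. indicator {0<..T} (fst y) * hit (L (fst y) nu) y)"
proof -
  let ?w = "\<lambda>s. indicator {0<..T} s :: ennreal"
  let ?n = "\<lambda>nu. \<integral>\<^sup>+y. ?w (fst y) * 1 * ennreal (hit (L (fst y) nu) y) \<partial>nu"
  have [measurable]: "(\<lambda>y. ?w (fst y)) \<in> borel_measurable (borel :: (real \<times> real) measure)"
    "(\<lambda>y. indicator {0<..T} (fst y) :: real) \<in> borel_measurable (borel :: (real \<times> real) measure)"
    by (auto intro: measurable_compose[of fst borel borel])
  have "(\<integral>\<^sup>+nu. ?n nu \<partial>Q) = (\<integral>\<^sup>+s. ?w s * (\<integral>\<^sup>+nu. 1 * ennreal (L s nu) \<partial>Q) \<partial>lborel)"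
    by (rule compensation_hit[OF _ _ L_past]) (auto simp: past_process_def)
  also have "... = mass T L" by (simp add: mass_def mult.commute)
  finally have "(\<integral>\<^sup>+nu. ?n nu \<partial>Q) \<noteq> \<infinity>" using L_mass_finite[of T] by simp
  then have "AE nu in Q. ?n nu \<noteq> \<infinity>" by (intro nn_integral_PInf_AE) measurable
  moreover have "AE nu in Q. nu \<in> space Q" by (rule AE_space)
  ultimately show ?thesis
  proof eventually_elim
    case (elim nu)
    then have nu: "nu \<in> configs" by simp
    have m: "(\<lambda>y. indicator {0<..T} (fst y) * hit (L (fst y) nu) y) \<in> borel_measurable nu"
      by (rule field_section[of "\<lambda>y nu. indicator {0<..T} (fst y) * hit (L (fst y) nu) y", OF _ nu]) (use nu in auto)
    have n: "(\<integral>\<^sup>+y. ennreal (norm (indicator {0<..T} (fst y) * hit (L (fst y) nu) y)) \<partial>nu) = ?n nu"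
      by (intro nn_integral_cong) (simp split: split_indicator)
    show ?case
    proof (rule integrableI_bounded[OF m])
      show "(\<integral>\<^sup>+y. ennreal (norm (indicator {0<..T} (fst y) * hit (L (fst y) nu) y)) \<partial>nu) < \<infinity>"
        unfolding n using elim(1) by (simp add: less_top)
    qed
  qed
qed

lemma L_time_integrable: "AE nu in Q. integrable lborel (\<lambda>u. indicator {0<..T} u * L u nu)"
proof -
  interpret P: pair_sigma_finite lborel Q ..
  let ?n = "\<lambda>nu. \<integral>\<^sup>+u. ennreal \<bar>L u nu\<bar> * indicator {0<..T} u \<partial>lborel"
  have "(\<integral>\<^sup>+nu. ?n nu \<partial>Q) = (\<integral>\<^sup>+u. \<integral>\<^sup>+nu. ennreal \<bar>L u nu\<bar> * indicator {0<..T} u \<partial>Q \<partial>lborel)"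
    by (rule P.Fubini') measurable
  also have "... = mass T L"
    unfolding L_abs_mass[symmetric] by (intro nn_integral_cong nn_integral_multc) measurable
  finally have "(\<integral>\<^sup>+nu. ?n nu \<partial>Q) \<noteq> \<infinity>" using L_mass_finite[of T] by simp
  then have "AE nu in Q. ?n nu \<noteq> \<infinity>" by (intro nn_integral_PInf_AE) measurable
  moreover have "AE nu in Q. nu \<in> space Q" by (rule AE_space)
  ultimately show ?thesis
  proof eventually_elim
    case (elim nu)
    then have [measurable]: "(\<lambda>u. L u nu) \<in> borel_measurable borel"
      using measurable_compose[OF measurable_Pair2'[of nu confs borel] L_measurable] by simp
    have "(\<integral>\<^sup>+u. ennreal (norm (indicator {0<..T} u * L u nu)) \<partial>lborel) = ?n nu"
      by (intro nn_integral_cong) (simp split: split_indicator)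
    then show ?case using elim(1) by (intro integrableI_bounded) (simp_all add: less_top)
  qed
qed

end

lemma (in hawkes_iterates) total_time_integral:
  assumes nu: "nu \<in> configs"
  shows "integrable lborel (\<lambda>u. indicator {0<..T} u * lam n u nu)"
    "total n nu = (LINT u|lborel. indicator {0<..T} u * lam n u nu)"
proof -
  have [measurable]: "(\<lambda>u. lam n u nu) \<in> borel_measurable borel"
    using measurable_compose[OF measurable_Pair2'[of nu confs borel] measurable_iter[of b n]] nu by simp
  have e: "(\<integral>\<^sup>+u. ennreal (indicator {0<..T} u * lam n u nu) \<partial>lborel) = ennreal (total n nu)"
    unfolding ennreal_total[OF nu] Z_mass[OF nu] by (intro nn_integral_cong) (simp split: split_indicator)
  show "integrable lborel (\<lambda>u. indicator {0<..T} u * lam n u nu)"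
    using lam_bounds e by (intro integrableI_nonneg) auto
  show "total n nu = (LINT u|lborel. indicator {0<..T} u * lam n u nu)"
    using lam_bounds e total_bounds(1)[OF nu] by (subst integral_eq_nn_integral) auto
qed

lemma (in hawkes_iterates) mass_iter: "mass T (lam n) = ennreal (LINT nu|Q. total n nu)"
proof -
  interpret P: pair_sigma_finite lborel Q ..
  have "mass T (lam n) = (\<integral>\<^sup>+t. \<integral>\<^sup>+nu. ennreal (lam n t nu) * indicator {0<..T} t \<partial>Q \<partial>lborel)"
    unfolding mass_def by (intro nn_integral_cong nn_integral_multc[symmetric]) measurable
  also have "... = (\<integral>\<^sup>+nu. \<integral>\<^sup>+t. ennreal (lam n t nu) * indicator {0<..T} t \<partial>lborel \<partial>Q)"
    by (rule P.Fubini'[symmetric]) measurable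
  also have "... = (\<integral>\<^sup>+nu. ennreal (total n nu) \<partial>Q)"
    by (intro nn_integral_cong) (simp add: ennreal_total Z_mass)
  also have "... = ennreal (LINT nu|Q. total n nu)"
    using total_bounds(1) by (intro nn_integral_eq_integral bfun_integrable[OF bfun_total]) auto
  finally show ?thesis .
qed

context hawkes_solution begin

lemma mart_measurable [measurable]: "mart T \<in> borel_measurable confs"
proof -
  have [measurable]: "(\<lambda>y. indicator {0<..T} (fst y) :: real) \<in> borel_measurable (borel :: (real \<times> real) measure)"
    by (auto intro: measurable_compose[of fst borel borel])
  show ?thesis unfolding mart_def by measurable
qed

text \<open>The points accepted by exactly one of the two intensities contribute one gap, the
  difference of the compensators another.\<close>

lemma mart_approx:
  assumes b: "0 \<le> b" and T: "0 < T"
  shows "(\<integral>\<^sup>+nu. ennreal \<bar>mart T nu - compensated (hawkes_iterates.Z \<phi> h \<mu> b T n) nu\<bar> \<partial>Q) \<le> 2 * gap T L (iter b n)"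
proof -
  interpret I: hawkes_iterates Q \<Lambda> \<phi> h \<mu> \<alpha> b T by unfold_locales (use b T in auto)
  interpret P: pair_sigma_finite lborel Q ..
  let ?w = "\<lambda>s. indicator {0<..T} s :: ennreal"
  have [measurable]: "(\<lambda>y. ?w (fst y)) \<in> borel_measurable (borel :: (real \<times> real) measure)"
    by (auto intro: measurable_compose[of fst borel borel])
  let ?d = "\<lambda>nu. \<integral>\<^sup>+y. ?w (fst y) * ennreal \<bar>hit (L (fst y) nu) y - hit (iter b n (fst y) nu) y\<bar> \<partial>nu"
  let ?g = "\<lambda>nu. \<integral>\<^sup>+u. ennreal \<bar>L u nu - iter b n u nu\<bar> * indicator {0<..T} u \<partial>lborel"
  have "(\<integral>\<^sup>+nu. ennreal \<bar>mart T nu - compensated (I.Z n) nu\<bar> \<partial>Q) \<le> (\<integral>\<^sup>+nu. ?d nu + ?g nu \<partial>Q)"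
  proof (rule nn_integral_mono_AE)
    have "AE nu in Q. nu \<in> space Q" by (rule AE_space)
    with hit_L_integrable[of T] L_time_integrable[of T]
    show "AE nu in Q. ennreal \<bar>mart T nu - compensated (I.Z n) nu\<bar> \<le> ?d nu + ?g nu"
    proof eventually_elim
      case (elim nu)
      then have nu: "nu \<in> configs" by simp
      let ?a = "\<lambda>y. indicator {0<..T} (fst y) * hit (L (fst y) nu) y" and ?l = "\<lambda>u. indicator {0<..T} u * L u nu"
      let ?l' = "\<lambda>u. indicator {0<..T} u * iter b n u nu"
      have iZ: "integrable nu (\<lambda>y. I.Z n y nu)"
        using causal_integrable(1)[OF I.box I.causal_Z nu, of nu n] configs_finite[OF nu bounded_borelD[OF I.box]] nu by auto
      have "mart T nu - compensated (I.Z n) nu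
        = ((LINT y|nu. ?a y) - (LINT y|nu. I.Z n y nu)) - ((LINT u|lborel. ?l u) - (LINT u|lborel. ?l' u))"
        using I.total_time_integral(2)[OF nu, of n] by (simp add: mart_def compensated_def I.total_def)
      then have "\<bar>mart T nu - compensated (I.Z n) nu\<bar>
        \<le> \<bar>(LINT y|nu. ?a y) - (LINT y|nu. I.Z n y nu)\<bar> + \<bar>(LINT u|lborel. ?l u) - (LINT u|lborel. ?l' u)\<bar>"
        by linarith
      then have "ennreal \<bar>mart T nu - compensated (I.Z n) nu\<bar>
        \<le> ennreal (\<bar>(LINT y|nu. ?a y) - (LINT y|nu. I.Z n y nu)\<bar> + \<bar>(LINT u|lborel. ?l u) - (LINT u|lborel. ?l' u)\<bar>)"
        by (rule ennreal_leI)
      also have "... = ennreal \<bar>(LINT y|nu. ?a y) - (LINT y|nu. I.Z n y nu)\<bar> + ennreal \<bar>(LINT u|lborel. ?l u) - (LINT u|lborel. ?l' u)\<bar>"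
        by (intro ennreal_plus) auto
      also have "... \<le> (\<integral>\<^sup>+y. ennreal \<bar>?a y - I.Z n y nu\<bar> \<partial>nu) + (\<integral>\<^sup>+u. ennreal \<bar>?l u - ?l' u\<bar> \<partial>lborel)"
        using ennreal_abs_integral_diff[OF elim(1) iZ, of 1] ennreal_abs_integral_diff[OF elim(2) I.total_time_integral(1)[OF nu], of 1 n]
        by (intro add_mono) auto
      also have "(\<integral>\<^sup>+y. ennreal \<bar>?a y - I.Z n y nu\<bar> \<partial>nu) = ?d nu"
        by (intro nn_integral_cong) (simp add: I.Z_def split: split_indicator)
      also have "(\<integral>\<^sup>+u. ennreal \<bar>?l u - ?l' u\<bar> \<partial>lborel) = ?g nu"
        by (intro nn_integral_cong) (simp split: split_indicator)
      finally show ?case .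
    qed
  qed
  also have "... = (\<integral>\<^sup>+nu. ?d nu \<partial>Q) + (\<integral>\<^sup>+nu. ?g nu \<partial>Q)" by (intro nn_integral_add) measurable
  also have "(\<integral>\<^sup>+nu. ?d nu \<partial>Q) \<le> (\<integral>\<^sup>+s. ?w s * (\<integral>\<^sup>+nu. ennreal \<bar>L s nu - iter b n s nu\<bar> \<partial>Q) \<partial>lborel)"
    by (rule compensation_hit_diff[OF _ L_past past_iter[OF b]]) measurable
  also have "... = gap T L (iter b n)" by (simp add: gap_def mult.commute)
  also have "(\<integral>\<^sup>+nu. ?g nu \<partial>Q) = (\<integral>\<^sup>+u. \<integral>\<^sup>+nu. ennreal \<bar>L u nu - iter b n u nu\<bar> * indicator {0<..T} u \<partial>Q \<partial>lborel)"
    by (rule P.Fubini') measurable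
  also have "... = gap T L (iter b n)"
    unfolding gap_def by (intro nn_integral_cong nn_integral_multc) measurable
  finally show ?thesis by (simp add: mult_2 add_right_mono)
qed

end

section \<open>Comparison with the stationary intensity\<close>

locale stationary_solution = hawkes_plane Q \<Lambda> \<phi> h \<mu> \<alpha>
  for Q \<Lambda> \<phi> h \<mu> \<alpha> +
  fixes K :: "real \<Rightarrow> (real \<times> real) measure \<Rightarrow> real" and v :: real
  assumes K_past: "past_process K borel"
    and K_mean: "(\<integral>\<^sup>+nu. ennreal (K t nu) \<partial>Q) = ennreal v" and v_nonneg: "0 \<le> v"
    and K_eq: "AE nu in Q. K t nu = h (\<mu> + (LINT y|nu. indicator {..<t} (fst y) * \<phi> (t - fst y) * hit (K (fst y) nu) y))"
    and \<phi>_moment: "integrable lborel (\<lambda>t. indicator {0..} t * (t * \<bar>\<phi> t\<bar>))"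
begin

lemmas K_measurable [measurable] = past_processD(1)[OF K_past]

definition moment :: real where "moment = (LINT t|lborel. indicator {0..} t * (t * \<bar>\<phi> t\<bar>))"

lemma moment_nonneg: "0 \<le> moment"
  unfolding moment_def by (intro integral_nonneg_AE) (auto split: split_indicator)

lemma indicator_fst_measurable [measurable]:
  fixes S :: "real set"
  assumes "S \<in> sets borel"
  shows "(\<lambda>y. indicator S (fst y) :: real) \<in> borel_measurable (borel :: (real \<times> real) measure)"
    "(\<lambda>y. indicator S (fst y) :: ennreal) \<in> borel_measurable (borel :: (real \<times> real) measure)"
  using assms by (auto intro: measurable_compose[of fst borel borel])

text \<open>The substitution u = t - s turns the inner integral into a tail of \<bar>\<phi>\<bar>.
  Integrated over t > 0, the tails count each u with weight u, which is the origin of the first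
  moment.\<close>

lemma history_mass:
  "(\<integral>\<^sup>+t. (\<integral>\<^sup>+s. indicator {..0} s * ennreal \<bar>\<phi> (t - s)\<bar> \<partial>lborel) * indicator {0<..} t \<partial>lborel) \<le> ennreal moment"
proof -
  have "(\<integral>\<^sup>+t. (\<integral>\<^sup>+s. indicator {..0} s * ennreal \<bar>\<phi> (t - s)\<bar> \<partial>lborel) * indicator {0<..} t \<partial>lborel)
    = (\<integral>\<^sup>+t. \<integral>\<^sup>+u. (if 0 < t \<and> t \<le> u then ennreal \<bar>\<phi> u\<bar> else 0) \<partial>lborel \<partial>lborel)"
  proof (rule nn_integral_cong)
    fix t :: real
    have "(\<integral>\<^sup>+s. indicator {..0} s * ennreal \<bar>\<phi> (t - s)\<bar> \<partial>lborel) = (\<integral>\<^sup>+u. indicator {..0} (t - u) * ennreal \<bar>\<phi> u\<bar> \<partial>lborel)"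
      using nn_integral_real_affine[of "\<lambda>u. indicator {..0} (t - u) * ennreal \<bar>\<phi> u\<bar>" "- 1" t] by simp
    then show "(\<integral>\<^sup>+s. indicator {..0} s * ennreal \<bar>\<phi> (t - s)\<bar> \<partial>lborel) * indicator {0<..} t
      = (\<integral>\<^sup>+u. (if 0 < t \<and> t \<le> u then ennreal \<bar>\<phi> u\<bar> else 0) \<partial>lborel)"
      by (auto intro!: nn_integral_cong split: split_indicator)
  qed
  also have "... = (\<integral>\<^sup>+u. \<integral>\<^sup>+t. (if 0 < t \<and> t \<le> u then ennreal \<bar>\<phi> u\<bar> else 0) \<partial>lborel \<partial>lborel)"
    by (rule lborel_pair.Fubini') measurable
  also have "... \<le> (\<integral>\<^sup>+u. ennreal (indicator {0..} u * (u * \<bar>\<phi> u\<bar>)) \<partial>lborel)"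
  proof (rule nn_integral_mono)
    fix u :: real
    have "(\<integral>\<^sup>+t. (if 0 < t \<and> t \<le> u then ennreal \<bar>\<phi> u\<bar> else 0) \<partial>lborel) = (\<integral>\<^sup>+t. ennreal \<bar>\<phi> u\<bar> * indicator {0<..u} t \<partial>lborel)"
      by (intro nn_integral_cong) (auto split: split_indicator)
    also have "... \<le> ennreal (indicator {0..} u * (u * \<bar>\<phi> u\<bar>))"
      by (cases "0 \<le> u") (simp_all add: nn_integral_cmult_indicator ennreal_mult' mult.commute)
    finally show "(\<integral>\<^sup>+t. (if 0 < t \<and> t \<le> u then ennreal \<bar>\<phi> u\<bar> else 0) \<partial>lborel) \<le> ennreal (indicator {0..} u * (u * \<bar>\<phi> u\<bar>))" .
  qed
  also have "... = ennreal moment"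
    unfolding moment_def using \<phi>_moment by (intro nn_integral_eq_integral) (auto split: split_indicator)
  finally show ?thesis .
qed

text \<open>The history is infinite, so boundedness of the kernel on compact sets does not help. The
  constant mean \<open>v\<close> and integrability of \<phi> give a finite expectation.\<close>

lemma K_integrable: "AE nu in Q. integrable nu (\<lambda>y. indicator {..<t} (fst y) * \<phi> (t - fst y) * hit (K (fst y) nu) y)"
proof -
  let ?w = "\<lambda>s. indicator {..<t} s * ennreal \<bar>\<phi> (t - s)\<bar> :: ennreal"
  let ?n = "\<lambda>nu. \<integral>\<^sup>+y. ?w (fst y) * 1 * ennreal (hit (K (fst y) nu) y) \<partial>nu"
  have "(\<integral>\<^sup>+nu. ?n nu \<partial>Q) = (\<integral>\<^sup>+s. ?w s * (\<integral>\<^sup>+nu. 1 * ennreal (K s nu) \<partial>Q) \<partial>lborel)"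
    by (rule compensation_hit[OF _ _ K_past]) (auto simp: past_process_def)
  also have "... \<le> (\<integral>\<^sup>+s. ennreal \<bar>\<phi> (t - s)\<bar> * ennreal v \<partial>lborel)"
    by (intro nn_integral_mono) (auto simp: K_mean split: split_indicator)
  also have "... = (\<integral>\<^sup>+s. ennreal \<bar>\<phi> (t - s)\<bar> \<partial>lborel) * ennreal v" by (intro nn_integral_multc) measurable
  also have "(\<integral>\<^sup>+s. ennreal \<bar>\<phi> (t - s)\<bar> \<partial>lborel) = (\<integral>\<^sup>+s. ennreal \<bar>\<phi> s\<bar> \<partial>lborel)"
    using nn_integral_real_affine[of "\<lambda>s. ennreal \<bar>\<phi> s\<bar>" "- 1" t] by simp
  also have "... * ennreal v < \<infinity>"
    using \<phi>_integrable by (simp add: integrable_iff_bounded ennreal_mult_less_top)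
  finally have "(\<integral>\<^sup>+nu. ?n nu \<partial>Q) \<noteq> \<infinity>" by simp
  then have "AE nu in Q. ?n nu \<noteq> \<infinity>" by (intro nn_integral_PInf_AE) measurable
  moreover have "AE nu in Q. nu \<in> space Q" by (rule AE_space)
  ultimately show ?thesis
  proof eventually_elim
    case (elim nu)
    then have nu: "nu \<in> configs" by simp
    have m: "(\<lambda>y. indicator {..<t} (fst y) * \<phi> (t - fst y) * hit (K (fst y) nu) y) \<in> borel_measurable nu"
      by (rule field_section[of "\<lambda>y nu. indicator {..<t} (fst y) * \<phi> (t - fst y) * hit (K (fst y) nu) y", OF _ nu]) (use nu in auto)
    have n: "(\<integral>\<^sup>+y. ennreal (norm (indicator {..<t} (fst y) * \<phi> (t - fst y) * hit (K (fst y) nu) y)) \<partial>nu) = ?n nu"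
      by (intro nn_integral_cong) (simp add: abs_mult ennreal_mult split: split_indicator)
    show ?case
    proof (rule integrableI_bounded[OF m])
      show "(\<integral>\<^sup>+y. ennreal (norm (indicator {..<t} (fst y) * \<phi> (t - fst y) * hit (K (fst y) nu) y)) \<partial>nu) < \<infinity>"
        unfolding n using elim(1) by (simp add: less_top)
    qed
  qed
qed

lemma mass_K: "0 \<le> T \<Longrightarrow> mass T K = ennreal (v * T)"
  unfolding mass_def K_mean using v_nonneg by (simp add: nn_integral_cmult_indicator ennreal_mult)

text \<open>
  The two intensities differ through the points before time 0, whose kernels have total mass
  \<open>\<integral>\<^sup>+t. t * \<bar>\<phi> t\<bar>\<close> on the positive half line.
\<close>

lemma stationary_gap:
  assumes "hawkes_solution Q \<Lambda> \<phi> h \<mu> \<alpha> L"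
  shows "gap T L K \<le> ennreal (\<alpha> * moment * v / (1 - \<rho>))"
proof -
  interpret S: hawkes_solution Q \<Lambda> \<phi> h \<mu> \<alpha> L by fact
  let ?hist = "\<lambda>t s. indicator {..0} s * ennreal \<bar>\<phi> (t - s)\<bar> :: ennreal"
  have pt: "(\<integral>\<^sup>+nu. ennreal \<bar>L t nu - K t nu\<bar> \<partial>Q)
    \<le> (\<integral>\<^sup>+s. ennreal (\<alpha> * \<bar>window t (s, 0)\<bar>) * (\<integral>\<^sup>+nu. ennreal \<bar>L s nu - K s nu\<bar> \<partial>Q) \<partial>lborel)
      + ennreal (\<alpha> * v) * (\<integral>\<^sup>+s. ?hist t s \<partial>lborel)" if t: "0 < t" for t
  proof -
    let ?d = "\<lambda>nu. \<integral>\<^sup>+y. ennreal (\<alpha> * \<bar>window t (fst y, 0)\<bar>) * ennreal \<bar>hit (L (fst y) nu) y - hit (K (fst y) nu) y\<bar> \<partial>nu"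
    let ?e = "\<lambda>nu. \<integral>\<^sup>+y. (ennreal \<alpha> * ?hist t (fst y)) * 1 * ennreal (hit (K (fst y) nu) y) \<partial>nu"
    have "(\<integral>\<^sup>+nu. ennreal \<bar>L t nu - K t nu\<bar> \<partial>Q) \<le> (\<integral>\<^sup>+nu. ?d nu + ?e nu \<partial>Q)"
    proof (rule nn_integral_mono_AE)
      have "AE nu in Q. nu \<in> space Q" by (rule AE_space)
      with S.L_eq[OF t] S.window_L_integrable[of t] K_eq[of t] K_integrable[of t]
      show "AE nu in Q. ennreal \<bar>L t nu - K t nu\<bar> \<le> ?d nu + ?e nu"
      proof eventually_elim
        case (elim nu)
        then have nu: "nu \<in> configs" by simp
        let ?a = "\<lambda>y. window t y * hit (L (fst y) nu) y"
        let ?a' = "\<lambda>y. indicator {..<t} (fst y) * \<phi> (t - fst y) * hit (K (fst y) nu) y"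
        have "\<bar>L t nu - K t nu\<bar> \<le> \<alpha> * \<bar>(LINT y|nu. ?a y) - (LINT y|nu. ?a' y)\<bar>"
          using h_diff[of "\<mu> + (LINT y|nu. ?a y)" "\<mu> + (LINT y|nu. ?a' y)"] by (simp only: elim(1,3)) simp
        then have "ennreal \<bar>L t nu - K t nu\<bar> \<le> ennreal (\<alpha> * \<bar>(LINT y|nu. ?a y) - (LINT y|nu. ?a' y)\<bar>)"
          by (rule ennreal_leI)
        also have "... \<le> (\<integral>\<^sup>+y. ennreal (\<alpha> * \<bar>?a y - ?a' y\<bar>) \<partial>nu)"
          by (rule ennreal_abs_integral_diff[OF elim(2,4) \<alpha>_nonneg])
        also have "... \<le> (\<integral>\<^sup>+y. ennreal (\<alpha> * \<bar>window t (fst y, 0)\<bar>) * ennreal \<bar>hit (L (fst y) nu) y - hit (K (fst y) nu) y\<bar>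
            + (ennreal \<alpha> * ?hist t (fst y)) * 1 * ennreal (hit (K (fst y) nu) y) \<partial>nu)"
        proof (rule nn_integral_mono)
          fix y :: "real \<times> real"
          \<comment> \<open>Before time 0 only the stationary process has points, which gives the
            history term. Within the window the two differ by their levels alone, and later points
            have no effect on either.\<close>
          consider "fst y \<le> 0" | "0 < fst y" "fst y < t" | "t \<le> fst y" by linarith
          then show "ennreal (\<alpha> * \<bar>?a y - ?a' y\<bar>) \<le> ennreal (\<alpha> * \<bar>window t (fst y, 0)\<bar>) * ennreal \<bar>hit (L (fst y) nu) y - hit (K (fst y) nu) y\<bar>
            + (ennreal \<alpha> * ?hist t (fst y)) * 1 * ennreal (hit (K (fst y) nu) y)"
          proof cases
            case 1
            then show ?thesis using t \<alpha>_nonneg by (simp add: window_def abs_mult ennreal_mult mult.assoc)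
          next
            case 2
            then have "?a y - ?a' y = window t (fst y, 0) * (hit (L (fst y) nu) y - hit (K (fst y) nu) y)"
              by (simp add: window_def right_diff_distrib)
            then show ?thesis using 2 \<alpha>_nonneg by (simp add: abs_mult ennreal_mult mult.assoc)
          next
            case 3 then show ?thesis using t by (simp add: window_def)
          qed
        qed
        also have "... = ?d nu + ?e nu"
        proof (rule nn_integral_add)
          have m: "(\<lambda>y. G y nu) \<in> borel_measurable nu" if "(\<lambda>(y, nu). G y nu) \<in> borel_measurable (borel \<Otimes>\<^sub>M confs)" for G :: "real \<times> real \<Rightarrow> _ \<Rightarrow> ennreal"
            using measurable_compose[OF measurable_Pair2'[of nu confs borel] that] nu
            unfolding measurable_cong_sets[OF sets_configs[OF nu] refl] by simp
          show "(\<lambda>y. ennreal (\<alpha> * \<bar>window t (fst y, 0)\<bar>) * ennreal \<bar>hit (L (fst y) nu) y - hit (K (fst y) nu) y\<bar>) \<in> borel_measurable nu"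
            by (rule m) measurable
          show "(\<lambda>y. (ennreal \<alpha> * ?hist t (fst y)) * 1 * ennreal (hit (K (fst y) nu) y)) \<in> borel_measurable nu"
            by (rule m) measurable
        qed
        finally show ?case .
      qed
    qed
    also have "... = (\<integral>\<^sup>+nu. ?d nu \<partial>Q) + (\<integral>\<^sup>+nu. ?e nu \<partial>Q)" by (intro nn_integral_add) measurable
    also have "(\<integral>\<^sup>+nu. ?e nu \<partial>Q) = (\<integral>\<^sup>+s. (ennreal \<alpha> * ?hist t s) * (\<integral>\<^sup>+nu. 1 * ennreal (K s nu) \<partial>Q) \<partial>lborel)"
      by (rule compensation_hit[OF _ _ K_past]) (auto simp: past_process_def)
    also have "... = (\<integral>\<^sup>+s. ennreal (\<alpha> * v) * ?hist t s \<partial>lborel)"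
      using \<alpha>_nonneg v_nonneg by (intro nn_integral_cong) (simp add: K_mean ennreal_mult ac_simps)
    also have "... = ennreal (\<alpha> * v) * (\<integral>\<^sup>+s. ?hist t s \<partial>lborel)" by (intro nn_integral_cmult) measurable
    also have "(\<integral>\<^sup>+nu. ?d nu \<partial>Q) \<le> (\<integral>\<^sup>+s. ennreal (\<alpha> * \<bar>window t (s, 0)\<bar>) * (\<integral>\<^sup>+nu. ennreal \<bar>L s nu - K s nu\<bar> \<partial>Q) \<partial>lborel)"
      by (rule compensation_hit_diff[OF _ S.L_past K_past]) measurable
    finally show ?thesis by (simp add: add_right_mono)
  qed
  have "gap T L K \<le> (\<integral>\<^sup>+t. (\<integral>\<^sup>+s. ennreal (\<alpha> * \<bar>window t (s, 0)\<bar>) * (\<integral>\<^sup>+nu. ennreal \<bar>L s nu - K s nu\<bar> \<partial>Q) \<partial>lborel) * indicator {0<..T} t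
      + ennreal (\<alpha> * v) * ((\<integral>\<^sup>+s. ?hist t s \<partial>lborel) * indicator {0<..} t) \<partial>lborel)"
    unfolding gap_def using pt by (intro nn_integral_mono) (auto split: split_indicator)
  also have "... = (\<integral>\<^sup>+t. (\<integral>\<^sup>+s. ennreal (\<alpha> * \<bar>window t (s, 0)\<bar>) * (\<integral>\<^sup>+nu. ennreal \<bar>L s nu - K s nu\<bar> \<partial>Q) \<partial>lborel) * indicator {0<..T} t \<partial>lborel)
      + ennreal (\<alpha> * v) * (\<integral>\<^sup>+t. (\<integral>\<^sup>+s. ?hist t s \<partial>lborel) * indicator {0<..} t \<partial>lborel)"
    by (subst nn_integral_add) (auto simp: nn_integral_cmult)
  also have "... \<le> ennreal \<rho> * gap T L K + ennreal (\<alpha> * v) * ennreal moment"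
    unfolding gap_def by (intro add_mono window_conv mult_left_mono history_mass) auto
  also have "ennreal (\<alpha> * v) * ennreal moment = ennreal (\<alpha> * moment * v)"
    using \<alpha>_nonneg v_nonneg moment_nonneg by (simp add: ennreal_mult[symmetric] ac_simps)
  finally have step: "gap T L K \<le> ennreal \<rho> * gap T L K + ennreal (\<alpha> * moment * v)" .
  \<comment> \<open>Comparison with the zero process provides the finiteness without which the
    contraction inequality says nothing.\<close>
  have "gap T L K \<le> gap T L (\<lambda>t nu. 0) + gap T (\<lambda>t nu. 0) K"
    by (intro gap_triangle S.L_past K_past) (simp add: past_process_def)
  also have "gap T L (\<lambda>t nu. 0) = mass T L" unfolding S.L_abs_mass[symmetric] gap_def by simp
  also have "gap T (\<lambda>t nu. 0) K = mass T K"
  proof -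
    have "(\<integral>\<^sup>+nu. ennreal \<bar>0 - K t nu\<bar> \<partial>Q) = (\<integral>\<^sup>+nu. ennreal (K t nu) \<partial>Q)" for t
      using K_eq[of t] h_nonneg by (intro nn_integral_cong_AE) auto
    then show ?thesis by (simp add: gap_def mass_def)
  qed
  also have "mass T L + mass T K < \<infinity>"
    using S.L_mass_finite[of T] v_nonneg mass_K[of T]
    by (cases "0 \<le> T") (auto simp: mass_def[of T K] ennreal_mult_less_top)
  finally show ?thesis
    using step \<rho>_bounds \<alpha>_nonneg v_nonneg moment_nonneg by (intro ennreal_contraction) auto
qed

end

lemma (in hawkes_solution) mart_abs: "(\<integral>\<^sup>+nu. ennreal \<bar>mart T nu\<bar> \<partial>Q) \<le> 2 * mass T L"
proof -
  interpret P: pair_sigma_finite lborel Q ..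
  let ?w = "\<lambda>s. indicator {0<..T} s :: ennreal"
  have [measurable]: "(\<lambda>y. ?w (fst y)) \<in> borel_measurable (borel :: (real \<times> real) measure)"
    by (auto intro: measurable_compose[of fst borel borel])
  let ?d = "\<lambda>nu. \<integral>\<^sup>+y. ?w (fst y) * 1 * ennreal (hit (L (fst y) nu) y) \<partial>nu"
  let ?g = "\<lambda>nu. \<integral>\<^sup>+u. ennreal \<bar>L u nu\<bar> * indicator {0<..T} u \<partial>lborel"
  have "(\<integral>\<^sup>+nu. ennreal \<bar>mart T nu\<bar> \<partial>Q) \<le> (\<integral>\<^sup>+nu. ?d nu + ?g nu \<partial>Q)"
  proof (rule nn_integral_mono)
    fix nu
    let ?a = "LINT y|nu. indicator {0<..T} (fst y) * hit (L (fst y) nu) y" and ?b = "LINT u|lborel. indicator {0<..T} u * L u nu"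
    have "ennreal \<bar>mart T nu\<bar> \<le> ennreal (\<bar>?a\<bar> + \<bar>?b\<bar>)" unfolding mart_def by (intro ennreal_leI) linarith
    also have "... = ennreal \<bar>?a\<bar> + ennreal \<bar>?b\<bar>" by (intro ennreal_plus) auto
    also have "... \<le> (\<integral>\<^sup>+y. ennreal \<bar>indicator {0<..T} (fst y) * hit (L (fst y) nu) y\<bar> \<partial>nu) + (\<integral>\<^sup>+u. ennreal \<bar>indicator {0<..T} u * L u nu\<bar> \<partial>lborel)"
      by (intro add_mono ennreal_abs_integral_le)
    also have "(\<integral>\<^sup>+y. ennreal \<bar>indicator {0<..T} (fst y) * hit (L (fst y) nu) y\<bar> \<partial>nu) = ?d nu"
      by (intro nn_integral_cong) (simp split: split_indicator)
    also have "(\<integral>\<^sup>+u. ennreal \<bar>indicator {0<..T} u * L u nu\<bar> \<partial>lborel) = ?g nu"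
      by (intro nn_integral_cong) (simp split: split_indicator)
    finally show "ennreal \<bar>mart T nu\<bar> \<le> ?d nu + ?g nu" .
  qed
  also have "... = (\<integral>\<^sup>+nu. ?d nu \<partial>Q) + (\<integral>\<^sup>+nu. ?g nu \<partial>Q)" by (intro nn_integral_add) measurable
  also have "(\<integral>\<^sup>+nu. ?d nu \<partial>Q) = (\<integral>\<^sup>+s. ?w s * (\<integral>\<^sup>+nu. 1 * ennreal (L s nu) \<partial>Q) \<partial>lborel)"
    by (rule compensation_hit[OF _ _ L_past]) (auto simp: past_process_def)
  also have "... = mass T L" by (simp add: mass_def mult.commute)
  also have "(\<integral>\<^sup>+nu. ?g nu \<partial>Q) = (\<integral>\<^sup>+u. \<integral>\<^sup>+nu. ennreal \<bar>L u nu\<bar> * indicator {0<..T} u \<partial>Q \<partial>lborel)"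
    by (rule P.Fubini') measurable
  also have "... = mass T L"
    unfolding L_abs_mass[symmetric] by (intro nn_integral_cong nn_integral_multc) measurable
  finally show ?thesis by (simp add: mult_2)
qed

lemma lipschitz_integrable:
  fixes u :: "real \<Rightarrow> real"
  assumes u: "\<And>x y. \<bar>u x - u y\<bar> \<le> 1 * \<bar>x - y\<bar>" and f: "integrable M f" and fin: "finite_measure M"
  shows "integrable M (\<lambda>x. u (f x))"
proof (rule Bochner_Integration.integrable_bound)
  interpret finite_measure M by fact
  show "integrable M (\<lambda>x. \<bar>u 0\<bar> + \<bar>f x\<bar>)" using f by simp
  have [measurable]: "u \<in> borel_measurable borel" by (rule borel_measurable_abs_lipschitz[OF u])
  show "(\<lambda>x. u (f x)) \<in> borel_measurable M" using f by measurable
  have "\<bar>u y\<bar> \<le> \<bar>u 0\<bar> + \<bar>y\<bar>" for y using u[of y 0] by simp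
  then show "AE x in M. norm (u (f x)) \<le> norm (\<bar>u 0\<bar> + \<bar>f x\<bar>)" by simp
qed

lemma integral_normal_law:
  fixes u :: "real \<Rightarrow> real"
  assumes "0 < v" "u \<in> borel_measurable borel"
  shows "(LINT x|normal_law 0 v. u x) = (LINT y|lborel. u y * normal_weight.p v y)"
proof -
  interpret normal_weight v by unfold_locales fact
  have "(LINT x|normal_law 0 v. u x) = (LINT x|density lborel (\<lambda>x. ennreal (p x)). u x)"
    using assms(1) by (simp add: normal_law_def p_def)
  also have "... = (LINT y|lborel. p y * u y)"
    using assms(2) p_nonneg by (subst integral_density) auto
  finally show ?thesis by (simp add: mult.commute)
qed

section \<open>The normal bound for the true intensity\<close>

locale hawkes_clt = hawkes_solution Q \<Lambda> \<phi> h \<mu> \<alpha> L + stationary_solution Q \<Lambda> \<phi> h \<mu> \<alpha> K v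
  for Q \<Lambda> \<phi> h \<mu> \<alpha> L K v
begin

lemma mart_integrable: "integrable Q (mart T)"
proof (rule integrableI_bounded)
  have "2 * mass T L < \<infinity>" using L_mass_finite[of T] by (simp add: ennreal_mult_less_top)
  then show "(\<integral>\<^sup>+nu. ennreal (norm (mart T nu)) \<partial>Q) < \<infinity>" using mart_abs[of T] by (simp add: order_le_less_trans)
qed measurable

theorem normal_bound:
  "\<exists>C>0. \<forall>T>0. \<forall>u. (\<forall>x y. \<bar>u x - u y\<bar> \<le> \<bar>x - y\<bar>) \<longrightarrow>
    \<bar>(LINT nu|Q. u (mart T nu / sqrt T)) - (LINT x|normal_law 0 v. u x)\<bar> \<le> C / sqrt T"
proof (cases "v = 0")
  \<comment> \<open>If \<open>v\<close> is 0, then the gap bound vanishes and \<open>L\<close> has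
    mass 0, so the martingale is almost surely 0 and both expectations equal
    \<open>u 0\<close>.\<close>
  case True
  show ?thesis
  proof (intro exI[of _ 1] conjI allI impI)
    fix T :: real and u :: "real \<Rightarrow> real"
    assume T: "0 < T" and "\<forall>x y. \<bar>u x - u y\<bar> \<le> \<bar>x - y\<bar>"
    then have u: "\<And>x y. \<bar>u x - u y\<bar> \<le> 1 * \<bar>x - y\<bar>" by simp
    have [measurable]: "u \<in> borel_measurable borel" by (rule borel_measurable_abs_lipschitz[OF u])
    have "mass T L \<le> mass T K + gap T L K" by (rule mass_le_gap[OF L_past K_past])
    also have "... \<le> 0"
      using stationary_gap[OF hawkes_solution_axioms, of T] mass_K[of T] T by (simp add: True)
    finally have "(\<integral>\<^sup>+nu. ennreal \<bar>mart T nu\<bar> \<partial>Q) = 0" using mart_abs[of T] by simp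
    then have "AE nu in Q. ennreal \<bar>mart T nu\<bar> = 0" by (subst (asm) nn_integral_0_iff_AE) auto
    then have "AE nu in Q. u (mart T nu / sqrt T) = u 0" by eventually_elim simp
    then have "(LINT nu|Q. u (mart T nu / sqrt T)) = (LINT nu|Q. u 0)" by (intro integral_cong_AE) auto
    moreover have "(LINT x|normal_law 0 v. u x) = u 0"
      by (simp add: True normal_law_def integral_return)
    ultimately show "\<bar>(LINT nu|Q. u (mart T nu / sqrt T)) - (LINT x|normal_law 0 v. u x)\<bar> \<le> 1 / sqrt T"
      using T by (simp add: Q.prob_space)
  qed simp
next
  case False
  then have v: "0 < v" using v_nonneg by simp
  interpret w: normal_weight v by unfold_locales (rule v)
  obtain k where k: "\<And>u. (\<forall>x y. \<bar>u x - u y\<bar> \<le> \<bar>x - y\<bar>) \<Longrightarrow>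
     \<exists>f f'. (\<forall>x. (f has_real_derivative f' x) (at x)) \<and> (\<forall>x. \<bar>f x\<bar> \<le> k) \<and> (\<forall>x. \<bar>f' x\<bar> \<le> k) \<and>
        (\<forall>x y. \<bar>f' x - f' y\<bar> \<le> k * \<bar>x - y\<bar>) \<and> (\<forall>x. v * f' x - x * f x = u x - (LINT y|lborel. u y * w.p y))"
    using w.stein_solution by blast
  have k0: "0 \<le> k"
  proof -
    obtain f where "\<forall>x::real. \<bar>f x :: real\<bar> \<le> k" using k[of "\<lambda>x. 0"] by auto
    then show ?thesis using abs_ge_zero order_trans by blast
  qed
  define c where "c = \<alpha> * moment * v / (1 - \<rho>)"
  define rate where "rate = hawkes_iterates.rate \<phi> h \<mu> \<alpha>"
  define s where "s = hawkes_iterates.var_const \<phi> h \<mu> \<alpha>"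
  define s' where "s' = hawkes_iterates.stein_const \<phi> h \<mu> \<alpha>"
  have c0: "0 \<le> c" using \<alpha>_nonneg moment_nonneg v_nonneg \<rho>_bounds by (simp add: c_def)
  have rate0: "0 \<le> rate" and s'0: "0 \<le> s'" and s0: "0 \<le> s"
  proof -
    \<comment> \<open>The three constants involve neither the cap nor the horizon; cap 0 and horizon
      1 are placeholders that make their signs available.\<close>
    interpret I: hawkes_iterates Q \<Lambda> \<phi> h \<mu> \<alpha> 0 1 by unfold_locales auto
    show "0 \<le> rate" "0 \<le> s'" "0 \<le> s"
      using I.rate_nonneg I.\<kappa>_nonneg \<rho>_bounds
      by (auto simp: rate_def s'_def s_def I.stein_const_def I.var_const_def)
  qed
  \<comment> \<open>The first summand comes from the mean of the integrated intensity, the second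
    from its fluctuation, the third from integration by parts; \<open>k\<close> bounds the Stein
    solutions and their derivatives.\<close>
  define C where "C = k * (c + v + rate) + k * sqrt s + k * s'"
  have C: "0 \<le> C" unfolding C_def using k0 c0 v rate0 s0 s'0 by (intro add_nonneg_nonneg mult_nonneg_nonneg) auto
  have main: "\<bar>(LINT nu|Q. u (mart T nu / sqrt T)) - (LINT x|normal_law 0 v. u x)\<bar> \<le> C / sqrt T"
    if T: "0 < T" and u': "\<forall>x y. \<bar>u x - u y\<bar> \<le> \<bar>x - y\<bar>" for T and u :: "real \<Rightarrow> real"
  proof (rule field_le_epsilon)
    fix e :: real assume e: "0 < e"
    have u: "\<And>x y. \<bar>u x - u y\<bar> \<le> 1 * \<bar>x - y\<bar>" using u' by simp
    have um [measurable]: "u \<in> borel_measurable borel" by (rule borel_measurable_abs_lipschitz[OF u])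
    have sT: "0 < sqrt T" using T by simp
    \<comment> \<open>The approximation enters with weight \<open>k\<close> through the mean and
      with weight 2 through \<open>mart_approx\<close>, each divided by sqrt T, and these add up to
      \<open>e\<close>.\<close>
    define \<epsilon> where "\<epsilon> = e * sqrt T / (k + 2)"
    have \<epsilon>: "0 < \<epsilon>" "(k + 2) * \<epsilon> / sqrt T = e" using e sT k0 by (simp_all add: \<epsilon>_def)
    obtain b n where gap: "gap T L (iter (real b) n) \<le> ennreal \<epsilon>" using iter_approx[OF \<epsilon>(1)] by blast
    interpret I: hawkes_iterates Q \<Lambda> \<phi> h \<mu> \<alpha> "real b" T by unfold_locales (use T in auto)
    let ?E = "LINT nu|Q. I.total n nu"
    have mean: "\<bar>v * T - ?E\<bar> \<le> c + \<epsilon>"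
    proof -
      have p: "past_process (iter (real b) n) borel" by (rule past_iter) simp
      have "gap T K (iter (real b) n) \<le> gap T K L + gap T L (iter (real b) n)"
        by (rule gap_triangle[OF K_past L_past p])
      also have "... \<le> ennreal c + ennreal \<epsilon>"
        using stationary_gap[OF hawkes_solution_axioms, of T] gap by (intro add_mono) (auto simp: gap_commute[of T K] c_def)
      finally have g: "gap T K (iter (real b) n) \<le> ennreal (c + \<epsilon>)" using c0 \<epsilon> by simp
      have E0: "0 \<le> ?E" using I.total_bounds(1) by (intro integral_nonneg_AE) auto
      have "ennreal (v * T) \<le> ennreal ?E + ennreal (c + \<epsilon>)"
        using mass_le_gap[OF K_past p, of T] mass_K[of T] I.mass_iter[of n] g T
        by (auto intro: order_trans add_left_mono)
      also have "... = ennreal (?E + (c + \<epsilon>))" by (rule ennreal_plus[symmetric]) (use E0 c0 \<epsilon> in auto)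
      finally have 1: "v * T \<le> ?E + (c + \<epsilon>)" by (subst (asm) ennreal_le_iff) (use E0 c0 \<epsilon> in auto)
      have "ennreal ?E \<le> ennreal (v * T) + ennreal (c + \<epsilon>)"
        using mass_le_gap[OF p K_past, of T] mass_K[of T] I.mass_iter[of n] g T
        by (auto simp: gap_commute[of T _ K] intro: order_trans add_left_mono)
      also have "... = ennreal (v * T + (c + \<epsilon>))" by (rule ennreal_plus[symmetric]) (use v T c0 \<epsilon> in auto)
      finally have "?E \<le> v * T + (c + \<epsilon>)" by (subst (asm) ennreal_le_iff) (use v T c0 \<epsilon> in auto)
      with 1 show ?thesis by (simp add: abs_le_iff)
    qed
    \<comment> \<open>A uniform bound divided by T suffices for T \<ge> 1. For shorter horizons it
      would be too large, and the linear bound (v + rate) * T is used in its place.\<close>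
    have mean': "\<bar>v * T - ?E\<bar> / T \<le> (c + v + rate) / sqrt T + \<epsilon> / sqrt T"
    proof (cases "1 \<le> T")
      case True
      then have sq: "sqrt T \<le> T" using real_sqrt_le_mono[of T "T * T"] T by (simp add: mult_le_cancel_left1)
      have "\<bar>v * T - ?E\<bar> / T \<le> (c + \<epsilon>) / T" using mean T by (intro divide_right_mono) auto
      also have "... \<le> (c + \<epsilon>) / sqrt T" using sq sT c0 \<epsilon> by (intro divide_left_mono) auto
      also have "... \<le> (c + v + rate + \<epsilon>) / sqrt T" using v rate0 sT by (intro divide_right_mono) auto
      finally show ?thesis by (simp add: add_divide_distrib)
    next
      case False
      then have sq: "sqrt T \<le> 1" by simp
      have "0 \<le> ?E" using I.total_bounds(1) by (intro integral_nonneg_AE) auto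
      then have "\<bar>v * T - ?E\<bar> \<le> (v + rate) * T"
        using I.total_mean[of n] v T rate0 by (auto simp: rate_def abs_le_iff distrib_right intro: order_trans)
      then have "\<bar>v * T - ?E\<bar> / T \<le> v + rate" using T by (simp add: pos_divide_le_eq)
      also have "... \<le> (v + rate) / sqrt T"
        using sq sT v rate0 mult_left_mono[OF sq, of "v + rate"] by (simp add: pos_le_divide_eq)
      also have "... \<le> (c + v + rate + \<epsilon>) / sqrt T" using c0 \<epsilon> sT by (intro divide_right_mono) auto
      finally show ?thesis by (simp add: add_divide_distrib)
    qed
    obtain f f' where f: "\<And>x. (f has_real_derivative f' x) (at x)" "\<And>x. \<bar>f x\<bar> \<le> k" "\<And>x. \<bar>f' x\<bar> \<le> k"
      "\<And>x y. \<bar>f' x - f' y\<bar> \<le> k * \<bar>x - y\<bar>" "\<And>x. v * f' x - x * f x = u x - (LINT y|lborel. u y * w.p y)"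
      using k[OF u'] by auto
    have "\<bar>(LINT nu|Q. u (I.F n nu)) - (LINT y|lborel. u y * w.p y)\<bar>
      \<le> k * (\<bar>v * T - ?E\<bar> / T) + (k * sqrt s + k * s') / sqrt T"
      using I.stein_bound[OF f] by (simp add: s_def s'_def)
    also have "... \<le> k * ((c + v + rate) / sqrt T + \<epsilon> / sqrt T) + (k * sqrt s + k * s') / sqrt T"
      by (intro add_right_mono mult_left_mono mean' k0)
    also have "... = C / sqrt T + k * \<epsilon> / sqrt T"
      by (simp add: C_def distrib_left add_divide_distrib)
    finally have 1: "\<bar>(LINT nu|Q. u (I.F n nu)) - (LINT x|normal_law 0 v. u x)\<bar> \<le> C / sqrt T + k * \<epsilon> / sqrt T"
      using integral_normal_law[OF v um] by simp
    have 2: "\<bar>(LINT nu|Q. u (mart T nu / sqrt T)) - (LINT nu|Q. u (I.F n nu))\<bar> \<le> 2 * \<epsilon> / sqrt T"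
    proof -
      have iF: "integrable Q (I.F n)" unfolding I.F_def using growth_integrable[OF I.box I.growth_Z] by simp
      have iu: "integrable Q (\<lambda>nu. u (mart T nu / sqrt T))" "integrable Q (\<lambda>nu. u (I.F n nu))"
        using mart_integrable[of T] iF by (auto intro!: lipschitz_integrable[OF u] Q.finite_measure_axioms)
      have "ennreal \<bar>(LINT nu|Q. u (mart T nu / sqrt T)) - (LINT nu|Q. u (I.F n nu))\<bar>
        \<le> (\<integral>\<^sup>+nu. ennreal \<bar>u (mart T nu / sqrt T) - u (I.F n nu)\<bar> \<partial>Q)"
        using ennreal_abs_integral_diff[OF iu, of 1] by simp
      also have "... \<le> (\<integral>\<^sup>+nu. ennreal (1 / sqrt T) * ennreal \<bar>mart T nu - compensated (I.Z n) nu\<bar> \<partial>Q)"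
      proof (rule nn_integral_mono)
        fix nu
        have "\<bar>u (mart T nu / sqrt T) - u (I.F n nu)\<bar> \<le> \<bar>(mart T nu - compensated (I.Z n) nu) / sqrt T\<bar>"
          using u[of "mart T nu / sqrt T" "I.F n nu"] by (simp add: I.F_def diff_divide_distrib)
        also have "... = 1 / sqrt T * \<bar>mart T nu - compensated (I.Z n) nu\<bar>" using sT by (simp add: abs_divide)
        finally show "ennreal \<bar>u (mart T nu / sqrt T) - u (I.F n nu)\<bar> \<le> ennreal (1 / sqrt T) * ennreal \<bar>mart T nu - compensated (I.Z n) nu\<bar>"
          using sT by (simp add: ennreal_mult'[symmetric] ennreal_leI)
      qed
      also have "... = ennreal (1 / sqrt T) * (\<integral>\<^sup>+nu. ennreal \<bar>mart T nu - compensated (I.Z n) nu\<bar> \<partial>Q)"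
        by (intro nn_integral_cmult) measurable
      also have "... \<le> ennreal (1 / sqrt T) * (2 * ennreal \<epsilon>)"
        using mart_approx[of "real b" T n] T by (intro mult_left_mono order_trans[OF _ mult_left_mono[OF gap]]) auto
      also have "... = ennreal (2 * \<epsilon> / sqrt T)"
      proof -
        have "2 * ennreal \<epsilon> = ennreal (2 * \<epsilon>)" using \<epsilon> by (simp add: ennreal_mult)
        then show ?thesis using sT \<epsilon> by (simp add: ennreal_mult'[symmetric])
      qed
      finally show ?thesis using sT \<epsilon> by (subst (asm) ennreal_le_iff) auto
    qed
    have "k * \<epsilon> / sqrt T + 2 * \<epsilon> / sqrt T = e" using \<epsilon>(2) by (simp add: distrib_right add_divide_distrib)
    then show "\<bar>(LINT nu|Q. u (mart T nu / sqrt T)) - (LINT x|normal_law 0 v. u x)\<bar> \<le> C / sqrt T + e"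
      using 1 2 by linarith
  qed
  show ?thesis
  \<comment> \<open>The summand 1 makes the constant strictly positive, as \<open>C\<close> may be
    0.\<close>
  proof (intro exI[of _ "C + 1"] conjI allI impI)
    show "0 < C + 1" using C by simp
    fix T :: real and u :: "real \<Rightarrow> real" assume T: "0 < T" and u: "\<forall>x y. \<bar>u x - u y\<bar> \<le> \<bar>x - y\<bar>"
    have "C / sqrt T \<le> (C + 1) / sqrt T" using T by (intro divide_right_mono) auto
    with main[OF T u] show "\<bar>(LINT nu|Q. u (mart T nu / sqrt T)) - (LINT x|normal_law 0 v. u x)\<bar> \<le> (C + 1) / sqrt T"
      by linarith
  qed
qed

end

text \<open>The marginal at the index set {0}, shifted by t, already determines the mean at time
  t.\<close>

lemma stationary_mean:
  assumes X: "strictly_stationary M X" "\<And>t. integrable M (X t)"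
  shows "(LINT \<omega>|M. X t \<omega>) = (LINT \<omega>|M. X 0 \<omega> :: real)"
proof -
  let ?P = "Pi\<^sub>M {0::real} (\<lambda>_. borel :: real measure)"
  have [measurable]: "X s \<in> borel_measurable M" for s using X(2)[of s] by simp
  have m: "(\<lambda>\<omega>. \<lambda>s\<in>{0}. X (s + r) \<omega>) \<in> measurable M ?P" for r by (rule measurable_restrict) measurable
  have c: "(\<lambda>f. f 0) \<in> borel_measurable ?P" by (rule measurable_component_singleton) simp
  have "(LINT \<omega>|M. X r \<omega>) = (LINT f|distr M ?P (\<lambda>\<omega>. \<lambda>s\<in>{0}. X (s + r) \<omega>). f 0)" for r
    by (subst integral_distr[OF m c]) simp
  from this[of t] this[of 0] show ?thesis
    using X(1)[unfolded strictly_stationary_def, rule_format, of "{0}" t] by simp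
qed

section \<open>Transfer to the given probability space\<close>

context poisson_input begin

lemma AE_law:
  assumes "{nu\<in>space confs. R nu} \<in> sets confs" "AE \<omega> in M. R (conf \<omega>)"
  shows "AE nu in law. R nu"
  unfolding law_def using assms by (subst AE_distr_iff) auto

lemma thinned_integral_cut:
  assumes "\<And>s. s \<in> S \<Longrightarrow> f s = g s"
  shows "thinned_integral N X S f \<omega> = thinned_integral N X S g \<omega>"
  unfolding thinned_integral_def using assms
  by (intro Bochner_Integration.integral_cong) (auto split: split_indicator)

end

theorem theorem4p3p18:
  fixes M :: "'w measure" and N :: "'w \<Rightarrow> (real \<times> real) measure"
    and P :: "'v measure" and G :: "'v \<Rightarrow> real"
    and \<mu> \<alpha> :: real and \<phi> h :: "real \<Rightarrow> real"
    and lam lam_inf :: "real \<Rightarrow> 'w \<Rightarrow> real"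
  assumes "prob_space M"
    and "poisson_random_measure M half_plane_lebesgue N"
    and "\<And>b. bounded (\<phi> ` {0..b})"
    and "set_integrable lborel {0..} \<phi>"
    and "set_integrable lborel {0..} (\<lambda>t. t * \<bar>\<phi> t\<bar>)"
    and "\<And>x. 0 \<le> h x"
    and "\<alpha>-lipschitz_on UNIV h"
    and "\<alpha> * (LINT t:{0..}|lborel. \<bar>\<phi> t\<bar>) < 1"
    and "empty_history_hawkes_intensity M N \<mu> h \<phi> lam"
    and "stationary_hawkes_intensity M N \<mu> h \<phi> lam_inf"
    and "prob_space P" and "G \<in> borel_measurable P"
    and "distr P borel G = normal_law 0 (LINT \<omega>|M. lam_inf 0 \<omega>)"
  shows "\<exists>C>0. \<forall>T>0.
    wasserstein_dist M (normalized_martingale N lam T) P G \<le> ennreal (C / sqrt T)"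
proof -
  interpret poisson_input M N
    using assms(1,2) by (intro poisson_input.intro poisson_input_axioms.intro)
  interpret plane: poisson_plane law plane_intensity by (rule poisson_plane_law)
  \<comment> \<open>The values of \<phi> at negative arguments are arbitrary; the extension by zero
    satisfies the requirements on the whole line and gives the same equations.\<close>
  define \<psi> where "\<psi> t = indicator {0..} t * \<phi> t" for t
  have \<psi>: "integrable lborel \<psi>" using assms(4) by (simp add: \<psi>_def[abs_def] set_integrable_def)
  interpret hawkes_kernel \<psi> h \<mu> \<alpha>
  proof
    show "\<psi> \<in> borel_measurable borel" using \<psi> by auto
    show "\<exists>K. \<forall>t\<in>{0..T}. \<bar>\<psi> t\<bar> \<le> K" for T
      using assms(3)[of T] by (auto simp: bounded_iff \<psi>_def)
    have "(LINT t|lborel. \<bar>\<psi> t\<bar>) = (LINT t:{0..}|lborel. \<bar>\<phi> t\<bar>)"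
      unfolding set_lebesgue_integral_def \<psi>_def by (intro Bochner_Integration.integral_cong) (auto simp: abs_mult)
    then show "\<alpha> * (LINT t|lborel. \<bar>\<psi> t\<bar>) < 1" using assms(8) by simp
  qed (use \<psi> assms in auto)
  interpret hawkes_plane law plane_intensity \<psi> h \<mu> \<alpha> ..
  note empty = assms(9)[unfolded empty_history_hawkes_intensity_def]
  note stat = assms(10)[unfolded stationary_hawkes_intensity_def]
  have start: "after_start {0..} = {0<..}" "after_start UNIV = UNIV"
    by (auto simp: after_start_def intro: lt_ex)
  obtain L where L: "(\<lambda>(t, nu). L t nu) \<in> borel_measurable (borel \<Otimes>\<^sub>M confs)"
    "\<And>nu y t. nu \<in> configs \<Longrightarrow> t \<le> fst y \<Longrightarrow> L t (add_point y nu) = L t nu"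
    "\<And>t \<omega>. 0 < t \<Longrightarrow> \<omega> \<in> space M \<Longrightarrow> L t (conf \<omega>) = lam t \<omega>"
    using predictable_factor[of "{0..}" lam] empty unfolding start by auto
  obtain K where K: "(\<lambda>(t, nu). K t nu) \<in> borel_measurable (borel \<Otimes>\<^sub>M confs)"
    "\<And>nu y t. nu \<in> configs \<Longrightarrow> t \<le> fst y \<Longrightarrow> K t (add_point y nu) = K t nu"
    "\<And>t \<omega>. \<omega> \<in> space M \<Longrightarrow> K t (conf \<omega>) = lam_inf t \<omega>"
    using predictable_factor[of UNIV lam_inf] stat unfolding start by auto
  note [measurable] = L(1) K(1)
  define v where "v = (LINT \<omega>|M. lam_inf 0 \<omega>)"
  have thin: "thinned_integral N X S (\<lambda>s. \<phi> (t - s)) \<omega> = (LINT y|conf \<omega>. indicator S (fst y) * \<psi> (t - fst y) * hit (Y (fst y) (conf \<omega>)) y)"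
    if "\<omega> \<in> space M" "S \<in> sets borel" "S \<subseteq> {..t}" "(\<lambda>(t, nu). Y t nu) \<in> borel_measurable (borel \<Otimes>\<^sub>M confs)"
      "\<And>t. t \<in> S \<Longrightarrow> Y t (conf \<omega>) = X t \<omega>" for X Y S t \<omega>
  proof -
    have "thinned_integral N X S (\<lambda>s. \<phi> (t - s)) \<omega> = thinned_integral N X S (\<lambda>s. \<psi> (t - s)) \<omega>"
      using that(3) by (intro thinned_integral_cut) (auto simp: \<psi>_def)
    also have "... = (LINT y|conf \<omega>. indicator S (fst y) * \<psi> (t - fst y) * hit (Y (fst y) (conf \<omega>)) y)"
    proof (rule thinned_integral_eq[OF that(1,2) _ that(4)])
      show "(\<lambda>s. \<psi> (t - s)) \<in> borel_measurable borel" by measurable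
    qed (rule that(5))
    finally show ?thesis .
  qed
  have ind [measurable]: "(\<lambda>y. indicator S (fst y) :: real) \<in> borel_measurable (borel :: (real \<times> real) measure)"
    if "S \<in> sets borel" for S :: "real set"
    using that by (auto intro: measurable_compose[of fst borel borel])
  interpret sol: hawkes_solution law plane_intensity \<psi> h \<mu> \<alpha> L
  proof
    show "past_process L borel" using L(1,2) by (simp add: past_process_def)
    show "AE nu in law. L t nu = h (\<mu> + (LINT y|nu. window t y * hit (L (fst y) nu) y))" if t: "0 < t" for t
    proof (rule AE_law)
      have "AE \<omega> in M. lam t \<omega> = h (\<mu> + thinned_integral N lam {0<..<t} (\<lambda>s. \<phi> (t - s)) \<omega>)" using empty t by auto
      moreover have "AE \<omega> in M. \<omega> \<in> space M" by (rule AE_space)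
      ultimately show "AE \<omega> in M. L t (conf \<omega>) = h (\<mu> + (LINT y|conf \<omega>. window t y * hit (L (fst y) (conf \<omega>)) y))"
      proof eventually_elim
        case (elim \<omega>)
        have "{0<..<t} \<subseteq> {..t}" by auto
        with elim show ?case
          using thin[OF elim(2), of "{0<..<t}" t L lam] L(1) L(3)[OF _ elim(2)] t by (simp add: window_def)
      qed
    qed measurable
    show "AE nu in law. (\<integral>\<^sup>+u. ennreal (L u nu) * indicator {0<..T} u \<partial>lborel) < \<infinity>" for T
    proof (rule AE_law)
      \<comment> \<open>Local integrability is given for nonnegative horizons, while
        \<open>T\<close> is arbitrary here.\<close>
      have "AE \<omega> in M. set_integrable lborel {0..max 0 T} (\<lambda>u. lam u \<omega>)" using empty by simp
      moreover have "AE \<omega> in M. \<omega> \<in> space M" by (rule AE_space)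
      ultimately show "AE \<omega> in M. (\<integral>\<^sup>+u. ennreal (L u (conf \<omega>)) * indicator {0<..T} u \<partial>lborel) < \<infinity>"
      proof eventually_elim
        case (elim \<omega>)
        have "(\<integral>\<^sup>+u. ennreal (L u (conf \<omega>)) * indicator {0<..T} u \<partial>lborel)
          \<le> (\<integral>\<^sup>+u. ennreal (norm (indicator {0..max 0 T} u *\<^sub>R lam u \<omega>)) \<partial>lborel)"
          using L(3)[OF _ elim(2)] by (intro nn_integral_mono) (auto intro!: ennreal_leI split: split_indicator)
        also have "... < \<infinity>" using elim(1) by (simp add: set_integrable_def integrable_iff_bounded)
        finally show ?case .
      qed
    qed measurable
  qed
  have K_nonneg: "AE \<omega> in M. 0 \<le> lam_inf t \<omega>" for t
    using stat assms(6) by (auto elim!: allE[of _ t] eventually_mono)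
  interpret st: stationary_solution law plane_intensity \<psi> h \<mu> \<alpha> K v
  proof
    show "past_process K borel" using K(1,2) by (simp add: past_process_def)
    show "(\<integral>\<^sup>+nu. ennreal (K t nu) \<partial>law) = ennreal v" for t
    proof -
      have "(\<integral>\<^sup>+nu. ennreal (K t nu) \<partial>law) = (\<integral>\<^sup>+\<omega>. ennreal (K t (conf \<omega>)) \<partial>M)"
        unfolding law_def by (intro nn_integral_distr) measurable
      also have "... = (\<integral>\<^sup>+\<omega>. ennreal (lam_inf t \<omega>) \<partial>M)" by (intro nn_integral_cong) (simp add: K(3))
      also have "... = ennreal (LINT \<omega>|M. lam_inf t \<omega>)" using stat K_nonneg by (intro nn_integral_eq_integral) auto
      also have "(LINT \<omega>|M. lam_inf t \<omega>) = v" unfolding v_def using stat by (intro stationary_mean) auto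
      finally show ?thesis .
    qed
    show "0 \<le> v" unfolding v_def using K_nonneg by (intro integral_nonneg_AE)
    show "AE nu in law. K t nu = h (\<mu> + (LINT y|nu. indicator {..<t} (fst y) * \<psi> (t - fst y) * hit (K (fst y) nu) y))" for t
    proof (rule AE_law)
      have "AE \<omega> in M. lam_inf t \<omega> = h (\<mu> + thinned_integral N lam_inf {..<t} (\<lambda>s. \<phi> (t - s)) \<omega>)" using stat by auto
      moreover have "AE \<omega> in M. \<omega> \<in> space M" by (rule AE_space)
      ultimately show "AE \<omega> in M. K t (conf \<omega>) = h (\<mu> + (LINT y|conf \<omega>. indicator {..<t} (fst y) * \<psi> (t - fst y) * hit (K (fst y) (conf \<omega>)) y))"
      proof eventually_elim
        case (elim \<omega>)
        have "{..<t} \<subseteq> {..t}" by auto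
        with elim show ?case
          using thin[OF elim(2), of "{..<t}" t K lam_inf] K(1) K(3)[OF elim(2)] by simp
      qed
    qed measurable
    have "(\<lambda>t. indicator {0..} t * (t * \<bar>\<psi> t\<bar>)) = (\<lambda>t. indicator {0..} t *\<^sub>R (t * \<bar>\<phi> t\<bar>))"
      by (auto simp: \<psi>_def fun_eq_iff split: split_indicator)
    then show "integrable lborel (\<lambda>t. indicator {0..} t * (t * \<bar>\<psi> t\<bar>))"
      using assms(5) by (simp add: set_integrable_def)
  qed
  interpret clt: hawkes_clt law plane_intensity \<psi> h \<mu> \<alpha> L K v ..
  obtain C where C: "0 < C" "\<And>T u. 0 < T \<Longrightarrow> (\<forall>x y. \<bar>u x - u y\<bar> \<le> \<bar>x - y\<bar>) \<Longrightarrow>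
      \<bar>(LINT nu|law. u (sol.mart T nu / sqrt T)) - (LINT x|normal_law 0 v. u x)\<bar> \<le> C / sqrt T"
    using clt.normal_bound by blast
  have nm: "normalized_martingale N lam T \<omega> = sol.mart T (conf \<omega>) / sqrt T" if \<omega>: "\<omega> \<in> space M" for T \<omega>
  proof -
    have [measurable]: "(\<lambda>u. L u (conf \<omega>)) \<in> borel_measurable borel"
      using measurable_compose[OF measurable_Pair2'[of "conf \<omega>" confs borel] L(1)] conf_in_configs[OF \<omega>] by simp
    have "hawkes_process N lam T \<omega> = (LINT y|conf \<omega>. indicator {0<..T} (fst y) * 1 * hit (L (fst y) (conf \<omega>)) y)"
      unfolding hawkes_process_def by (rule thinned_integral_eq[OF \<omega> _ _ L(1)]) (auto simp: L(3)[OF _ \<omega>])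
    moreover have "(LINT u:{0..T}|lborel. lam u \<omega>) = (LINT u|lborel. indicator {0<..T} u * L u (conf \<omega>))"
      unfolding set_lebesgue_integral_def
    proof (rule integral_cong_AE)
      \<comment> \<open>At time 0 the version \<open>L\<close> need not agree with
        \<open>lam\<close>. That time is split off as a null set, which also yields measurability of
        the integrand.\<close>
      have eq: "indicator {0..T} u *\<^sub>R lam u \<omega> = indicator {0<..T} u * L u (conf \<omega>) + indicator ({0} \<inter> {0..T}) u * lam 0 \<omega>" for u
        using L(3)[OF _ \<omega>, of u] by (auto split: split_indicator)
      show "(\<lambda>u. indicator {0..T} u *\<^sub>R lam u \<omega>) \<in> borel_measurable lborel" unfolding eq by measurable
      have "AE u in lborel. u \<noteq> (0::real)" by (rule AE_lborel_singleton)
      then show "AE u in lborel. indicator {0..T} u *\<^sub>R lam u \<omega> = indicator {0<..T} u * L u (conf \<omega>)"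
        by eventually_elim (unfold eq, simp)
    qed measurable
    ultimately show ?thesis by (simp add: normalized_martingale_def sol.mart_def)
  qed
  show ?thesis
  proof (intro exI[of _ C] conjI allI impI C(1))
    fix T :: real assume T: "0 < T"
    show "wasserstein_dist M (normalized_martingale N lam T) P G \<le> ennreal (C / sqrt T)"
      unfolding wasserstein_dist_def
    proof (rule SUP_least)
      fix u :: "real \<Rightarrow> real" assume "u \<in> {u. 1-lipschitz_on UNIV u}"
      then have u: "\<forall>x y. \<bar>u x - u y\<bar> \<le> \<bar>x - y\<bar>" by (auto simp: lipschitz_on_def dist_real_def)
      then have [measurable]: "u \<in> borel_measurable borel" by (intro borel_measurable_abs_lipschitz[of u 1]) simp
      have "(LINT \<omega>|M. u (normalized_martingale N lam T \<omega>)) = (LINT \<omega>|M. u (sol.mart T (conf \<omega>) / sqrt T))"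
        by (intro Bochner_Integration.integral_cong) (simp_all add: nm)
      also have "... = (LINT nu|law. u (sol.mart T nu / sqrt T))"
        unfolding law_def by (intro integral_distr[symmetric]) measurable
      finally have 1: "(LINT \<omega>|M. u (normalized_martingale N lam T \<omega>)) = (LINT nu|law. u (sol.mart T nu / sqrt T))" .
      have "(LINT \<omega>|P. u (G \<omega>)) = (LINT x|distr P borel G. u x)"
        using assms(12) by (intro integral_distr[symmetric]) auto
      then have 2: "(LINT \<omega>|P. u (G \<omega>)) = (LINT x|normal_law 0 v. u x)"
        using assms(13) by (simp add: v_def)
      show "ennreal \<bar>(LINT \<omega>|M. u (normalized_martingale N lam T \<omega>)) - (LINT \<omega>|P. u (G \<omega>))\<bar> \<le> ennreal (C / sqrt T)"
        unfolding 1 2 using C(2)[OF T u] by (rule ennreal_leI)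
    qed
  qed
qed

end
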